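(* Let $m>1$ be real, let $N\ge m$ be an integer, and put $\phi_m(x)=|x|^{m-2}x$ for $x\neq 0$, $\phi_m(0)=0$. Let $f:\mathbb R\to\mathbb R$ be continuous, $F(s)=\int_0^s f(t)\,dt$ and $Q(s)=mNF(s)-(N-m)sf(s)$. Assume the following. (1) There exist $\beta^-<0<\beta^+$ such that $F(s)<0$ for all $s\in(\beta^-,\beta^+)\setminus\{0\}$, $F(\beta^{\pm})=0$, $f(s)>0$ for all $s\in(\beta^+,\gamma^+)$ and $f(s)<0$ for all $s\in(\gamma^-,\beta^-)$, where $\gamma^+=\min\{s>\beta^+ : f(s)=0\}$ (with $\gamma^+=\infty$ if $f(s)>0$ for all $s>\beta^+$) and $\gamma^-=\max\{s<\beta^- : f(s)=0\}$ (with $\gamma^-=-\infty$ if $f(s)<0$ for all $s<\beta^-$). (2) $\lim_{s\to\gamma^-}F(s)=L=\lim_{s\to\gamma^+}F(s)$, where the common value $L$ may be finite or infinite. (3) $f$ is locally Lipschitz in $(\gamma^-,0)\cup(0,\gamma^+)$. (4) If $\gamma^+=\infty$: there exists $\bar\beta>\beta^+$ such that $Q(s)\ge 0$ for all $s\ge\bar\beta$, and there exists $\theta\in(0,1)$ such that $$\lim_{s\to\infty}\Bigl(\inf_{s_1,s_2\in[\theta s,s]}Q(s_2)\Bigl(\frac{|s|^{m-2}s}{f(s_1)}\Bigr)^{N/m}\Bigr)=\infty .$$ (5) If $\gamma^-=-\infty$: there exists $\bar\beta$ with $-\bar\beta<\beta^-$ such that $Q(s)\ge 0$ for all $s\le-\bar\beta$,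 and there exists $\theta\in(0,1)$ such that $$\lim_{s\to-\infty}\Bigl(\inf_{s_1,s_2\in[s,\theta s]}Q(s_2)\Bigl(\frac{|s|^{m-2}s}{f(s_1)}\Bigr)^{N/m}\Bigr)=\infty .$$ (6) If $\gamma^+$ is finite: there exist $L_0>0$ and $\bar\beta>\beta^+$ such that $f(s)\le L_0(\gamma^+-s)^{m-1}$ for all $s\in[\bar\beta,\gamma^+)$. (7) If $\gamma^-$ is finite: there exist $L_0>0$ and $\bar\beta>-\beta^-$ such that $-f(s)\le L_0(s-\gamma^-)^{m-1}$ for all $s\in(\gamma^-,-\bar\beta]$. Then for every $k\in\mathbb N$ there exists a radially symmetric bound state solution $u=u(r)$, $r=|x|$, of $$\nabla\cdot(|\nabla u|^{m-2}\nabla u)+f(u)=0,\qquad x\in\mathbb R^N,$$ that is, a nonconstant solution of $$(\phi_m(u'))'+\frac{N-1}{r}\phi_m(u')+f(u)=0\quad (r>0),\qquad u'(0)=0,\qquad \lim_{r\to\infty}u(r)=0,$$ which changes sign exactly $k$ times in $(0,\infty)$, i.e. has exactly $k$ zeros $r\in(0,\infty)$ with $u'(r)\ne0$.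
   Context: $\mathbb N=\{1,2,3,\dots\}$. A solution of the radial equation is a $C^1$ function $u$ on $[0,\infty)$ such that $\phi_m(u')$ is also $C^1$ and the equation holds for $r>0$. A bound state solution is a nonconstant solution of the radial problem displayed in the claim. Such a solution may have compact support, i.e. it may vanish identically for all large $r$. *)

theory Defs
  imports "HOL-Analysis.Analysis"
begin

definition phi :: "real \<Rightarrow> real \<Rightarrow> real" where
  "phi m x = (if x = 0 then 0 else \<bar>x\<bar> powr (m - 2) * x)"

text \<open>The interval integral is signed, so this is minus the integral over $[s,0]$ for $s<0$.\<close>

definition primitive :: "(real \<Rightarrow> real) \<Rightarrow> real \<Rightarrow> real" where
  "primitive f s = (LBINT t=ereal 0..ereal s. f t)"

definition Qfun :: "real \<Rightarrow> nat \<Rightarrow> (real \<Rightarrow> real) \<Rightarrow> real \<Rightarrow> real" where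
  "Qfun m N f s = m * real N * primitive f s - (real N - m) * s * f s"

text \<open>The endpoints \<open>\<gamma>\<^sup>+\<close> and \<open>\<gamma>\<^sup>-\<close> are characterised by predicates rather than by an infimum and
  a supremum: the finite endpoint has to be an attained minimum (maximum) of the set of zeros, so
  zeros accumulating at \<open>\<beta>\<close> are excluded instead of giving \<open>\<gamma> = \<beta>\<close>.\<close>

definition is_gamma_plus :: "(real \<Rightarrow> real) \<Rightarrow> real \<Rightarrow> ereal \<Rightarrow> bool" where
  "is_gamma_plus f \<beta> \<gamma> \<longleftrightarrow>
     (\<exists>g. \<gamma> = ereal g \<and> \<beta> < g \<and> f g = 0 \<and> (\<forall>s. \<beta> < s \<and> f s = 0 \<longrightarrow> g \<le> s)) \<or>
     (\<gamma> = \<infinity> \<and> (\<forall>s>\<beta>. 0 < f s))"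

definition is_gamma_minus :: "(real \<Rightarrow> real) \<Rightarrow> real \<Rightarrow> ereal \<Rightarrow> bool" where
  "is_gamma_minus f \<beta> \<gamma> \<longleftrightarrow>
     (\<exists>g. \<gamma> = ereal g \<and> g < \<beta> \<and> f g = 0 \<and> (\<forall>s. s < \<beta> \<and> f s = 0 \<longrightarrow> s \<le> g)) \<or>
     (\<gamma> = -\<infinity> \<and> (\<forall>s<\<beta>. f s < 0))"

text \<open>The infimum is taken in the extended reals, where it always exists.\<close>

definition Q_inf :: "real \<Rightarrow> nat \<Rightarrow> (real \<Rightarrow> real) \<Rightarrow> real set \<Rightarrow> real \<Rightarrow> ereal" where
  "Q_inf m N f I s =
     (INF s1\<in>I. INF s2\<in>I. ereal (Qfun m N f s2 * (phi m s / f s1) powr (real N / m)))"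

text \<open>Continuously differentiable on the closed half-line, with one-sided derivative at 0.\<close>

definition C1_halfline :: "(real \<Rightarrow> real) \<Rightarrow> (real \<Rightarrow> real) \<Rightarrow> bool" where
  "C1_halfline u u' \<longleftrightarrow>
     (\<forall>r\<ge>0. (u has_real_derivative u' r) (at r within {0..})) \<and> continuous_on {0..} u'"

definition radial_solution ::
  "real \<Rightarrow> nat \<Rightarrow> (real \<Rightarrow> real) \<Rightarrow> (real \<Rightarrow> real) \<Rightarrow> (real \<Rightarrow> real) \<Rightarrow> bool" where
  "radial_solution m N f u u' \<longleftrightarrow>
     C1_halfline u u' \<and>
     (\<exists>w'. C1_halfline (\<lambda>r. phi m (u' r)) w' \<and>
       (\<forall>r>0. w' r + (real N - 1) / r * phi m (u' r) + f (u r) = 0))"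

definition bound_state ::
  "real \<Rightarrow> nat \<Rightarrow> (real \<Rightarrow> real) \<Rightarrow> (real \<Rightarrow> real) \<Rightarrow> (real \<Rightarrow> real) \<Rightarrow> bool" where
  "bound_state m N f u u' \<longleftrightarrow>
     radial_solution m N f u u' \<and> u' 0 = 0 \<and> (u \<longlongrightarrow> 0) at_top \<and>
     \<not> (\<exists>c. \<forall>r\<ge>0. u r = c)"

text \<open>A sign change is a zero at which the derivative does not vanish.\<close>

definition sign_changes :: "(real \<Rightarrow> real) \<Rightarrow> (real \<Rightarrow> real) \<Rightarrow> real set" where
  "sign_changes u u' = {r. 0 < r \<and> u r = 0 \<and> u' r \<noteq> 0}"

end

theory Submission imports Defs "HOL-Complex_Analysis.Great_Picard"
begin
text \<open>
  With \<open>w = phi m u'\<close> the radial equation becomes the first-order system \<open>u' = psi m w\<close>,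
  \<open>w' = - (N - 1)/r w - f u\<close>, where \<open>psi m\<close> inverts \<open>phi m\<close>. The energy \<open>en = kin m w + F u\<close>, with \<open>F\<close> the
  primitive of \<open>f\<close> and \<open>kin m\<close> that of \<open>psi m\<close>, is nonincreasing in \<open>r\<close>. It is positive at every sign
  change, and as long as it is positive all critical points of \<open>u\<close> lie outside the well
  \<open>[bm, bp]\<close> in which \<open>F\<close> is nonpositive. Two consequences are used everywhere: between two sign changes the solution
  leaves the well, and initial value problems are uniquely solvable while the energy is positive
  (\<open>uniq\<close>), even where \<open>f\<close> or \<open>psi m\<close> fails to be Lipschitz.

  The bound state is found by shooting. Choose a starting value \<open>A > bp\<close> and, since \<open>F\<close> has the same limit at both ends,
  a \<open>B < bm\<close> with \<open>F B = F A\<close>. By the energy, solutions that start in \<open>[bp, A]\<close> never leave \<open>[B, A]\<close>, so \<open>f\<close>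
  may be frozen outside this interval, which makes it bounded. Suppose that the solution from \<open>A\<close> has at
  least \<open>k\<close> sign changes, and let \<open>a\<close> be the supremum of the starting values in \<open>[bp, A]\<close> for which this fails. Having
  at least \<open>k\<close> sign changes is an open condition (\<open>crosses_at_least_open\<close>), so the solution from \<open>a\<close> has fewer of them,
  while it is a limit of solutions that have \<open>k\<close>. There are three possibilities.

  \<^item> The \<open>k\<close>-th sign changes of the approximating solutions stay bounded. Then the limit has \<open>k - 1\<close> sign changes followed by a
    zero with \<open>u' = 0\<close>; extended by \<open>0\<close> it is a bound state with compact support (\<open>bounded_crossings_limit\<close>).

  \<^item> Zeros escape to infinity and the limit tends to \<open>0\<close>. A traversal of a definite part of the well at radius \<open>r\<close> costs energy
    of order \<open>1/r\<close> (\<open>zone\<close>), whereas \<open>r * en\<close> tends to \<open>0\<close> along the limit (\<open>tail_limit\<close>). Hence only one sign change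
    can escape, and the limit is a bound state with \<open>k - 1\<close> sign changes (\<open>decaying_limit\<close>).

  \<^item> Zeros escape and the limit tends to \<open>bp\<close> or \<open>bm\<close>. This is impossible (\<open>no_lingering\<close>): the approximating solutions would have to
    raise \<open>r * en\<close> from almost \<open>0\<close> to a fixed value close to the level \<open>bp\<close>, where they cannot stay long enough.

  It remains to find an \<open>A\<close> whose solution has \<open>K + 1\<close> sign changes. The weighted energy \<open>r ^ N * en\<close> is large when \<open>u\<close> has
  come down from \<open>A\<close> to a fixed level: if the upper end of the positivity interval of \<open>f\<close> is finite, because \<open>A\<close> can be taken so close to it
  that \<open>u\<close> stays nearby for a long time (\<open>start_finite\<close>); if it is infinite, because of the Pohozaev identity and the growth condition
  (\<open>start_infinite\<close>). In one swing from a zero to the next, at most half of \<open>en\<close> and half of \<open>r ^ N * en\<close> are lost,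
  provided that the latter is large (\<open>swing\<close>): in a bounded range of \<open>u\<close> the relative loss is small, and at larger values the Pohozaev quantity
  grows. So sufficiently large values at the start permit any number of swings (\<open>many_swings\<close>).
\<close>

section \<open>The inverse of phi and its primitive\<close>

text \<open>The inverse function of \<open>phi m\<close>.\<close>

definition psi :: "real \<Rightarrow> real \<Rightarrow> real" where
  "psi m x = sgn x * \<bar>x\<bar> powr (1 / (m - 1))"

text \<open>The primitive of \<open>psi m\<close>. As a function of \<open>u'\<close> it is \<open>(m - 1) / m * |u'| ^ m\<close>, the kinetic
  energy.\<close>

definition kin :: "real \<Rightarrow> real \<Rightarrow> real" where
  "kin m x = (m - 1) / m * \<bar>x\<bar> powr (m / (m - 1))"

lemma psi_0 [simp]: "psi m 0 = 0" by (simp add: psi_def)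
lemma psi_minus [simp]: "psi m (- x) = - psi m x" by (simp add: psi_def)
lemma kin_0 [simp]: "kin m 0 = 0" by (simp add: kin_def)
lemma kin_minus [simp]: "kin m (- x) = kin m x" by (simp add: kin_def)

lemma phi_psi:
  assumes "1 < m" shows "phi m (psi m x) = x"
proof (cases "x = 0")
  case True then show ?thesis by (simp add: phi_def)
next
  case False
  have "\<bar>psi m x\<bar> = \<bar>x\<bar> powr (1 / (m - 1))"
    using False by (simp add: psi_def abs_mult abs_sgn_eq)
  then have "phi m (psi m x) = sgn x * (\<bar>x\<bar> powr ((1 / (m - 1)) * (m - 2)) * \<bar>x\<bar> powr (1 / (m - 1)))"
    using False by (simp add: phi_def powr_powr psi_def)
  also have "\<dots> = sgn x * \<bar>x\<bar> powr (1 / (m - 1) * (m - 2) + 1 / (m - 1))"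
    by (simp add: powr_add)
  also have "1 / (m - 1) * (m - 2) + 1 / (m - 1) = 1"
    using assms by (simp add: field_simps)
  finally show ?thesis using False by (simp add: sgn_mult_abs)
qed

lemma psi_pos: "0 < x \<Longrightarrow> 0 < psi m x" by (simp add: psi_def)
lemma psi_neg: "x < 0 \<Longrightarrow> psi m x < 0" by (simp add: psi_def)
lemma psi_eq_0 [simp]: "psi m x = 0 \<longleftrightarrow> x = 0" by (auto simp: psi_def sgn_zero_iff)
lemma psi_nonneg: "0 \<le> x \<Longrightarrow> 0 \<le> psi m x" by (simp add: psi_def)
lemma psi_nonpos: "x \<le> 0 \<Longrightarrow> psi m x \<le> 0" using psi_nonneg[of "-x" m] by simp
lemma psi_of_pos: "0 \<le> x \<Longrightarrow> psi m x = x powr (1 / (m - 1))"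
  by (cases "x = 0") (auto simp: psi_def)
lemma abs_psi: "\<bar>psi m x\<bar> = psi m \<bar>x\<bar>" by (cases "x = 0") (auto simp: psi_def abs_mult abs_sgn_eq)

lemma psi_mono: assumes "1 < m" "x \<le> y" shows "psi m x \<le> psi m y"
proof -
  have *: "psi m a \<le> psi m b" if "0 \<le> a" "a \<le> b" for a b
    using that assms(1) by (simp add: psi_of_pos powr_mono2)
  show ?thesis
  proof (cases "0 \<le> x")
    case True then show ?thesis using * assms by simp
  next
    case False
    show ?thesis
    proof (cases "0 \<le> y")
      case True then show ?thesis using psi_nonneg[of y m] psi_nonpos[of x m] False by linarith
    next
      case False
      then show ?thesis using *[of "-y" "-x"] assms by simp
    qed
  qed
qed

lemma kin_nonneg: "1 < m \<Longrightarrow> 0 \<le> kin m x" by (simp add: kin_def)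
lemma kin_pos: "1 < m \<Longrightarrow> x \<noteq> 0 \<Longrightarrow> 0 < kin m x" by (simp add: kin_def)
lemma kin_mono: assumes "1 < m" "\<bar>x\<bar> \<le> \<bar>y\<bar>" shows "kin m x \<le> kin m y"
  using assms by (simp add: kin_def mult_left_mono powr_mono2 divide_right_mono)

lemma kin_strict_mono: assumes "1 < m" "\<bar>x\<bar> < \<bar>y\<bar>" shows "kin m x < kin m y"
  using assms by (simp add: kin_def powr_less_mono2 divide_strict_right_mono)

lemma mult_psi: assumes "1 < m" shows "x * psi m x = m / (m - 1) * kin m x"
proof (cases "x = 0")
  case False
  have "x * psi m x = \<bar>x\<bar> powr 1 * \<bar>x\<bar> powr (1 / (m - 1))"
    using False by (simp add: psi_def) (metis abs_sgn mult.assoc mult.commute)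
  also have "\<dots> = \<bar>x\<bar> powr (m / (m - 1))"
    using assms by (subst powr_add[symmetric]) (simp add: field_simps)
  finally show ?thesis using assms by (simp add: kin_def)
qed simp

lemma mult_psi_nonneg: "1 < m \<Longrightarrow> 0 \<le> x * psi m x"
  by (simp add: mult_psi kin_nonneg)

lemma kin_deriv: assumes m: "1 < m" shows "(kin m has_real_derivative psi m x) (at x)"
proof -
  let ?p = "m / (m - 1)"
  have p1: "?p - 1 = 1 / (m - 1)" using m by (simp add: field_simps)
  have pos: "(kin m has_real_derivative psi m x) (at x)" if "0 < x" for x
  proof -
    have "((\<lambda>x. (m - 1) / m * x powr ?p) has_real_derivative (m - 1) / m * (?p * x powr (?p - 1))) (at x)"
      using that by (auto intro!: derivative_eq_intros)
    then have "((\<lambda>x. (m - 1) / m * x powr ?p) has_real_derivative psi m x) (at x)"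
      using m that by (simp add: p1 psi_of_pos)
    then show ?thesis
    proof (rule has_field_derivative_transform_within_open)
      show "open {0::real<..}" by simp
      show "x \<in> {0<..}" using that by simp
      fix y :: real assume "y \<in> {0<..}"
      then show "(m - 1) / m * y powr ?p = kin m y" by (simp add: kin_def)
    qed
  qed
  consider "0 < x" | "x < 0" | "x = 0" by linarith
  then show ?thesis
  proof cases
    case 1 then show ?thesis by (rule pos)
  next
    case 2
    then have "(kin m has_real_derivative psi m (-x)) (at (-x))" by (intro pos) simp
    then have "((\<lambda>x. kin m (- x)) has_real_derivative psi m (-x) * (-1)) (at x)"
      by (intro DERIV_chain2[of "kin m"]) (auto intro!: derivative_eq_intros)
    then show ?thesis by simp
  next
    case 3
    have lim: "((\<lambda>h. (m - 1) / m * \<bar>h\<bar> powr (1 / (m - 1))) \<longlongrightarrow> 0) (at (0::real))"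
    proof -
      have "continuous_on UNIV (\<lambda>h::real. (m - 1) / m * \<bar>h\<bar> powr (1 / (m - 1)))"
        using m by (intro continuous_intros continuous_on_powr') auto
      then have "((\<lambda>h. (m - 1) / m * \<bar>h\<bar> powr (1 / (m - 1))) \<longlongrightarrow> (m - 1) / m * \<bar>0\<bar> powr (1 / (m - 1))) (at (0::real))"
        unfolding continuous_on_def by blast
      then show ?thesis using m by simp
    qed
    have "((\<lambda>h. kin m h / h) \<longlongrightarrow> 0) (at 0)"
    proof (rule Lim_null_comparison[OF _ lim])
      have "norm (kin m h / h) \<le> (m - 1) / m * \<bar>h\<bar> powr (1 / (m - 1))" if "h \<noteq> 0" for h
      proof -
        have "\<bar>h\<bar> powr ?p = \<bar>h\<bar> powr (1 / (m - 1)) * \<bar>h\<bar>"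
          using that m by (metis p1 powr_mult_base abs_ge_zero mult.commute diff_add_cancel add.commute)
        then have "kin m h / h = (m - 1) / m * \<bar>h\<bar> powr (1 / (m - 1)) * (\<bar>h\<bar> / h)"
          by (simp add: kin_def)
        then show ?thesis using m that by (simp add: abs_mult abs_divide)
      qed
      then show "\<forall>\<^sub>F h in at 0. norm (kin m h / h) \<le> (m - 1) / m * \<bar>h\<bar> powr (1 / (m - 1))"
        by (simp add: eventually_at_filter)
    qed
    then show ?thesis using 3 by (simp add: has_field_derivative_iff)
  qed
qed

lemma psi_cont: assumes m: "1 < m" shows "isCont (psi m) x"
proof -
  consider "0 < x" | "x < 0" | "x = 0" by linarith
  then show ?thesis
  proof cases
    case 3
    have lim: "((\<lambda>h. \<bar>h\<bar> powr (1 / (m - 1))) \<longlongrightarrow> 0) (at (0::real))"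
    proof -
      have "continuous_on UNIV (\<lambda>h::real. \<bar>h\<bar> powr (1 / (m - 1)))"
        using m by (intro continuous_intros continuous_on_powr') auto
      then have "((\<lambda>h. \<bar>h\<bar> powr (1 / (m - 1))) \<longlongrightarrow> \<bar>0\<bar> powr (1 / (m - 1))) (at (0::real))"
        unfolding continuous_on_def by blast
      then show ?thesis using m by simp
    qed
    have "(psi m \<longlongrightarrow> 0) (at 0)"
      by (rule Lim_null_comparison[OF _ lim]) (auto simp: psi_def abs_mult abs_sgn_eq)
    then show ?thesis using 3 by (simp add: isCont_def)
  next
    case 1
    have "isCont (\<lambda>x. x powr (1 / (m - 1))) x" using 1 by (intro continuous_intros) auto
    moreover have "\<forall>\<^sub>F y in nhds x. psi m y = y powr (1 / (m - 1))"
      using 1 eventually_nhds_in_open[of "{0<..}" x] by (auto elim!: eventually_mono simp: psi_of_pos)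
    ultimately show ?thesis using isCont_cong by metis
  next
    case 2
    have "isCont (\<lambda>x. - ((-x) powr (1 / (m - 1)))) x" using 2 by (intro continuous_intros) auto
    moreover have "\<forall>\<^sub>F y in nhds x. psi m y = - ((-y) powr (1 / (m - 1)))"
      using 2 eventually_nhds_in_open[of "{..<0}" x] by (auto elim!: eventually_mono simp: psi_def)
    ultimately show ?thesis using isCont_cong by metis
  qed
qed

lemma psi_cont_on: "1 < m \<Longrightarrow> continuous_on S (psi m)"
  by (simp add: continuous_at_imp_continuous_on psi_cont)

lemma kin_cont: "1 < m \<Longrightarrow> isCont (kin m) x"
  using kin_deriv DERIV_isCont by blast

lemma kin_cont_on: "1 < m \<Longrightarrow> continuous_on S (kin m)"
  by (simp add: continuous_at_imp_continuous_on kin_cont)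

text \<open>Derivatives are only required in the open interval, since the equation is singular at its left
  end \<open>0\<close>.\<close>

lemma deriv_le_imp_le:
  fixes g h :: "real \<Rightarrow> real"
  assumes "a \<le> b" "continuous_on {a..b} g" "continuous_on {a..b} h"
    and "\<And>x. a < x \<Longrightarrow> x < b \<Longrightarrow> (g has_real_derivative g' x) (at x)"
    and "\<And>x. a < x \<Longrightarrow> x < b \<Longrightarrow> (h has_real_derivative h' x) (at x)"
    and "\<And>x. a < x \<Longrightarrow> x < b \<Longrightarrow> g' x \<le> h' x"
  shows "g b - g a \<le> h b - h a"
proof (cases "a < b")
  case True
  have "(h a - g a) \<le> (h b - g b)"
  proof (rule DERIV_nonneg_imp_increasing_open[where f = "\<lambda>x. h x - g x"])
    show "a \<le> b" by fact
    show "continuous_on {a..b} (\<lambda>x. h x - g x)" using assms by (intro continuous_intros)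
    fix x assume "a < x" "x < b"
    then show "\<exists>y. ((\<lambda>x. h x - g x) has_real_derivative y) (at x) \<and> 0 \<le> y"
      using assms(4-6)[of x] by (intro exI[of _ "h' x - g' x"]) (auto intro!: derivative_eq_intros)
  qed
  then show ?thesis by simp
qed (use assms(1) in auto)

lemma deriv_bound_imp_le:
  fixes g :: "real \<Rightarrow> real"
  assumes "a \<le> b" "continuous_on {a..b} g"
    and "\<And>x. a < x \<Longrightarrow> x < b \<Longrightarrow> (g has_real_derivative g' x) (at x)"
    and "\<And>x. a < x \<Longrightarrow> x < b \<Longrightarrow> \<bar>g' x\<bar> \<le> C"
  shows "\<bar>g b - g a\<bar> \<le> C * (b - a)"
proof -
  have "g b - g a \<le> C * b - C * a"
    by (rule deriv_le_imp_le[where g' = g' and h' = "\<lambda>_. C"])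
      (use assms in \<open>auto intro!: continuous_intros derivative_eq_intros simp: abs_le_iff\<close>)
  moreover have "- g b - - g a \<le> C * b - C * a"
    by (rule deriv_le_imp_le[where g' = "\<lambda>x. - g' x" and h' = "\<lambda>_. C"])
      (use assms in \<open>auto intro!: continuous_intros derivative_eq_intros simp: abs_le_iff\<close>)
  ultimately show ?thesis by (simp add: algebra_simps abs_le_iff)
qed

section \<open>Solutions of the first-order system and their compactness\<close>

text \<open>Locally uniform convergence on the closed half-line.\<close>

definition luconv :: "(nat \<Rightarrow> real \<Rightarrow> real) \<Rightarrow> (real \<Rightarrow> real) \<Rightarrow> bool" where
  "luconv un u \<longleftrightarrow> (\<forall>R. \<forall>e>0. \<exists>n0. \<forall>n\<ge>n0. \<forall>r\<in>{0..R}. \<bar>un n r - u r\<bar> < e)"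

lemma luconv_subseq:
  assumes "luconv un u" "strict_mono k" shows "luconv (\<lambda>n. un (k n)) u"
  unfolding luconv_def
proof (intro allI impI)
  fix R e :: real assume "e > 0"
  then obtain n0 where "\<forall>n\<ge>n0. \<forall>r\<in>{0..R}. \<bar>un n r - u r\<bar> < e" using assms(1) unfolding luconv_def by blast
  then show "\<exists>n0. \<forall>n\<ge>n0. \<forall>r\<in>{0..R}. \<bar>un (k n) r - u r\<bar> < e"
    using seq_suble[OF assms(2)] by (meson le_trans)
qed

text \<open>Continuous convergence: the argument may move with the index.\<close>

lemma luconv_seq:
  assumes "luconv un u" "continuous_on {0..} u" "\<And>n. 0 \<le> X n" "X \<longlonglongrightarrow> r"
  shows "(\<lambda>n. un n (X n)) \<longlonglongrightarrow> u r"
proof -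
  have r0: "0 \<le> r" using assms(3,4) by (meson LIMSEQ_le_const)
  have 1: "(\<lambda>n. u (X n)) \<longlonglongrightarrow> u r"
    using assms r0 by (auto intro: continuous_on_tendsto_compose)
  obtain R where R: "\<And>n. X n \<le> R"
    using convergent_imp_Bseq[OF convergentI[OF assms(4)]] unfolding Bseq_def
    by (metis abs_le_D1 real_norm_def)
  have 2: "(\<lambda>n. un n (X n) - u (X n)) \<longlonglongrightarrow> 0"
    unfolding LIMSEQ_iff
  proof (intro allI impI)
    fix e :: real assume "e > 0"
    then obtain n0 where "\<forall>n\<ge>n0. \<forall>r\<in>{0..R}. \<bar>un n r - u r\<bar> < e" using assms(1) unfolding luconv_def by blast
    then show "\<exists>no. \<forall>n\<ge>no. norm (un n (X n) - u (X n) - 0) < e" using R assms(3) by (intro exI[of _ n0]) auto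
  qed
  from tendsto_add[OF 2 1] show ?thesis by simp
qed

lemma luconv_pt:
  assumes "luconv un u" "continuous_on {0..} u" "0 \<le> r"
  shows "(\<lambda>n. un n r) \<longlonglongrightarrow> u r"
  using luconv_seq[OF assms(1,2), of "\<lambda>_. r" r] assms(3) by simp

text \<open>Arzela-Ascoli: by equicontinuity, pointwise convergence of a subsequence on the rationals is
  locally uniform.\<close>

lemma locally_lipschitz_subsequence:
  fixes un :: "nat \<Rightarrow> real \<Rightarrow> real"
  assumes lip: "\<And>R n r s. 0 \<le> r \<Longrightarrow> r \<le> s \<Longrightarrow> s \<le> R \<Longrightarrow> \<bar>un n s - un n r\<bar> \<le> Lip R * (s - r)"
    and bd: "\<And>n. \<bar>un n 0\<bar> \<le> B"
  obtains k u where "strict_mono (k :: nat \<Rightarrow> nat)" "luconv (\<lambda>n. un (k n)) u" "continuous_on {0..} u"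
proof -
  define L where "L R = \<bar>Lip R\<bar> + 1" for R
  have L0: "0 < L R" for R by (simp add: L_def add_nonneg_pos)
  have lip2: "\<bar>un n s - un n r\<bar> \<le> L R * \<bar>s - r\<bar>" if "r \<in> {0..R}" "s \<in> {0..R}" for n r s R
  proof -
    have *: "Lip R * x \<le> L R * x" if "0 \<le> x" for x using that by (intro mult_right_mono) (auto simp: L_def)
    show ?thesis
    proof (cases "r \<le> s")
      case True then show ?thesis using lip[of r s R n] *[of "s - r"] that by auto
    next
      case False then show ?thesis using order_trans[OF lip[of s r R n] *[of "r - s"]] that by (auto simp: abs_minus_commute)
    qed
  qed
  define bn where "bn x = B + L x * x + 1" for x
  have bnd: "\<bar>un n x\<bar> < bn x" if "0 \<le> x" for n x
    using lip2[of 0 x x n] bd[of n] that by (auto simp: bn_def)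
  let ?S = "\<rat> \<inter> {0::real..}"
  have cS: "countable ?S" by (meson countable_Int1 countable_rat)
  have bS: "norm (un n x / bn x) \<le> 1" if "x \<in> ?S" for n x
    using bnd[of x n] that by (auto simp: abs_divide divide_le_eq)
  have "\<exists>k. strict_mono (k :: nat \<Rightarrow> nat) \<and> (\<forall>x\<in>?S. \<exists>l. (\<lambda>n. un (k n) x / bn x) \<longlonglongrightarrow> l)"
    by (rule function_convergent_subsequence[where f = "\<lambda>n x. un n x / bn x" and M = 1, OF cS bS]) blast+
  then obtain k where k: "strict_mono (k :: nat \<Rightarrow> nat)"
    and kl: "\<And>x. x \<in> ?S \<Longrightarrow> \<exists>l. (\<lambda>n. un (k n) x / bn x) \<longlonglongrightarrow> l" by blast
  have convQ: "convergent (\<lambda>n. un (k n) x)" if x: "x \<in> ?S" for x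
  proof -
    obtain l where "(\<lambda>n. un (k n) x / bn x) \<longlonglongrightarrow> l" using kl[OF x] by blast
    then have "(\<lambda>n. un (k n) x / bn x * bn x) \<longlonglongrightarrow> l * bn x" by (intro tendsto_intros)
    moreover have "bn x \<noteq> 0" using bnd[of x 0] x by auto
    ultimately show ?thesis by (auto simp: convergent_def)
  qed
  have uC: "\<exists>n0. \<forall>n\<ge>n0. \<forall>p\<ge>n0. \<forall>r\<in>{0..R}. \<bar>un (k n) r - un (k p) r\<bar> < e" if "e > 0" for R e :: real
  proof -
    obtain q :: nat where q: "q > 0" "L (R + 1) / real q < e / 4"
    proof -
      obtain q :: nat where "L (R + 1) / (e / 4) < real q" using reals_Archimedean2 by blast
      then show ?thesis using that[of "Suc q"] \<open>e > 0\<close> L0[of "R+1"] by (auto simp: field_simps)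
    qed
    define G where "G = (\<lambda>j. real j / real q) ` {0..nat \<lceil>R * q\<rceil>}"
    have GS: "G \<subseteq> ?S" by (auto simp: G_def)
    have "finite G" by (simp add: G_def)
    have "\<forall>x\<in>G. \<exists>n0. \<forall>n\<ge>n0. \<forall>p\<ge>n0. \<bar>un (k n) x - un (k p) x\<bar> < e / 4"
    proof
      fix x assume "x \<in> G"
      then have "Cauchy (\<lambda>n. un (k n) x)" using convQ GS convergent_Cauchy by blast
      from CauchyD[OF this, of "e/4"] show "\<exists>n0. \<forall>n\<ge>n0. \<forall>p\<ge>n0. \<bar>un (k n) x - un (k p) x\<bar> < e / 4"
        using \<open>e > 0\<close> by auto
    qed
    then obtain n0 where n0: "\<forall>x\<in>G. \<forall>n\<ge>n0 x. \<forall>p\<ge>n0 x. \<bar>un (k n) x - un (k p) x\<bar> < e / 4" by metis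
    define M where "M = Max (insert 0 (n0 ` G))"
    have M: "n0 x \<le> M" if "x \<in> G" for x using \<open>finite G\<close> that by (auto simp: M_def)
    have "\<bar>un (k n) r - un (k p) r\<bar> < e" if np: "n \<ge> M" "p \<ge> M" and r: "r \<in> {0..R}" for n p r
    proof -
      define j where "j = nat \<lfloor>r * q\<rfloor>"
      define x where "x = real j / real q"
      have rq: "0 \<le> r * q" using r by auto
      have j1: "real j \<le> r * q" "r * q < real j + 1" using rq unfolding j_def by linarith+
      have "r * q \<le> R * q" using r by (simp add: mult_right_mono)
      then have "j \<le> nat \<lceil>R * q\<rceil>" unfolding j_def by (meson floor_mono le_of_int_ceiling nat_mono order_trans floor_le_ceiling)
      then have xG: "x \<in> G" unfolding x_def G_def by auto
      have "r - x = (r * q - j) / q" using q by (simp add: x_def diff_divide_distrib)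
      also have "\<dots> \<le> 1 / q" using j1 q by (intro divide_right_mono) auto
      finally have "r - x \<le> 1 / q" .
      moreover have "x \<le> r" "0 \<le> x" using j1 q by (auto simp: x_def pos_divide_le_eq)
      ultimately have xr: "x \<le> r" "r - x \<le> 1 / q" "0 \<le> x" by auto
      have d: "\<bar>un i r - un i x\<bar> < e / 4" for i
      proof -
        have "\<bar>un i r - un i x\<bar> \<le> L (R + 1) * \<bar>r - x\<bar>" using lip2[of x "R+1" r i] xr r by auto
        also have "\<dots> \<le> L (R + 1) * (1 / q)" using xr L0[of "R+1"] by (intro mult_left_mono) auto
        also have "\<dots> = L (R + 1) / real q" by simp
        finally show ?thesis using q by linarith
      qed
      have "\<bar>un (k n) x - un (k p) x\<bar> < e / 4" using n0 xG np M[OF xG] by (meson le_trans)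
      then show ?thesis using d[of "k n"] d[of "k p"] \<open>e > 0\<close> unfolding abs_less_iff by linarith
    qed
    then show ?thesis by blast
  qed
  have conv: "convergent (\<lambda>n. un (k n) r)" if "0 \<le> r" for r
  proof -
    have "Cauchy (\<lambda>n. un (k n) r)"
      unfolding Cauchy_iff
    proof (intro allI impI)
      fix e :: real assume "e > 0"
      from uC[OF this, of r] show "\<exists>M. \<forall>m\<ge>M. \<forall>n\<ge>M. norm (un (k m) r - un (k n) r) < e"
        using that by fastforce
    qed
    then show ?thesis by (rule Cauchy_convergent)
  qed
  define u where "u r = lim (\<lambda>n. un (k n) r)" for r
  have lim: "(\<lambda>n. un (k n) r) \<longlonglongrightarrow> u r" if "0 \<le> r" for r
    using conv[OF that] unfolding u_def by (simp add: convergent_LIMSEQ_iff)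
  have lu: "luconv (\<lambda>n. un (k n)) u"
    unfolding luconv_def
  proof (intro allI impI)
    fix R e :: real assume "e > 0"
    then obtain n0 where n0: "\<forall>n\<ge>n0. \<forall>p\<ge>n0. \<forall>r\<in>{0..R}. \<bar>un (k n) r - un (k p) r\<bar> < e / 2"
      using uC[of "e/2" R] by auto
    have "\<bar>un (k n) r - u r\<bar> \<le> e / 2" if "n \<ge> n0" "r \<in> {0..R}" for n r
    proof -
      have l: "(\<lambda>p. \<bar>un (k n) r - un (k p) r\<bar>) \<longlonglongrightarrow> \<bar>un (k n) r - u r\<bar>"
        using lim[of r] that by (intro tendsto_intros) auto
      show ?thesis
        by (rule tendsto_upperbound[OF l]) (use n0 that in \<open>auto simp: eventually_sequentially intro!: exI[of _ n0] less_imp_le\<close>)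
    qed
    then show "\<exists>n0. \<forall>n\<ge>n0. \<forall>r\<in>{0..R}. \<bar>un (k n) r - u r\<bar> < e" using \<open>e > 0\<close> by (intro exI[of _ n0]) force
  qed
  have lipu: "\<bar>u s - u r\<bar> \<le> L R * \<bar>s - r\<bar>" if "r \<in> {0..R}" "s \<in> {0..R}" for r s R
  proof -
    have l: "(\<lambda>n. \<bar>un (k n) s - un (k n) r\<bar>) \<longlonglongrightarrow> \<bar>u s - u r\<bar>"
      using lim that by (intro tendsto_intros) auto
    show ?thesis by (rule tendsto_upperbound[OF l]) (use lip2[OF that] in auto)
  qed
  have "continuous_on {0..} u"
    unfolding continuous_on_iff
  proof (intro ballI allI impI)
    fix x e :: real assume x: "x \<in> {0..}" and e: "0 < e"
    let ?d = "min 1 (e / L (x + 1))"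
    show "\<exists>d>0. \<forall>x'\<in>{0..}. dist x' x < d \<longrightarrow> dist (u x') (u x) < e"
    proof (intro exI conjI ballI impI)
      show "?d > 0" using e L0 by simp
      fix y assume y: "y \<in> {0..}" "dist y x < ?d"
      then have "\<bar>u y - u x\<bar> \<le> L (x + 1) * \<bar>y - x\<bar>" using x by (intro lipu) (auto simp: dist_real_def)
      also have "\<dots> < L (x + 1) * (e / L (x + 1))" using y L0[of "x+1"] by (intro mult_strict_left_mono) (auto simp: dist_real_def)
      also have "\<dots> = e" using L0[of "x+1"] by simp
      finally show "dist (u y) (u x) < e" by (simp add: dist_real_def)
    qed
  qed
  then show ?thesis using that k lu by blast
qed

text \<open>Bounded right-hand sides suffice, because \<open>f\<close> will be frozen outside an interval that the
  relevant solutions cannot leave.\<close>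

locale radial =
  fixes m :: real and N :: nat and f F :: "real \<Rightarrow> real" and Mf :: real
  assumes m1: "1 < m" and mN: "m \<le> real N"
    and f_cont: "continuous_on UNIV f" and f_bd: "\<And>s. \<bar>f s\<bar> \<le> Mf"
    and F_deriv: "\<And>s. (F has_real_derivative f s) (at s)" and F_0: "F 0 = 0"
begin

lemma N2: "2 \<le> N" using m1 mN by linarith

lemma Mf0: "0 \<le> Mf" using f_bd[of 0] by linarith

lemma F_cont: "continuous_on S F"
  using F_deriv by (meson DERIV_isCont continuous_at_imp_continuous_on)

text \<open>The forcing \<open>g\<close> stands for \<open>f (u r)\<close> or, in the construction of solutions, for a delayed version
  of it. All a priori bounds depend on \<open>Mf\<close> alone and hold for both.\<close>

definition fsol :: "(real \<Rightarrow> real) \<Rightarrow> (real \<Rightarrow> real) \<Rightarrow> (real \<Rightarrow> real) \<Rightarrow> bool" where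
  "fsol g u w \<longleftrightarrow> continuous_on {0..} u \<and> continuous_on {0..} w \<and> continuous_on {0..} g \<and> w 0 = 0 \<and>
     (\<forall>r\<ge>0. \<bar>g r\<bar> \<le> Mf) \<and>
     (\<forall>r>0. (u has_real_derivative psi m (w r)) (at r) \<and>
            (w has_real_derivative (- ((real N - 1) / r * w r) - g r)) (at r))"

definition sol :: "(real \<Rightarrow> real) \<Rightarrow> (real \<Rightarrow> real) \<Rightarrow> bool" where
  "sol u w \<longleftrightarrow> continuous_on {0..} u \<and> continuous_on {0..} w \<and> w 0 = 0 \<and>
     (\<forall>r>0. (u has_real_derivative psi m (w r)) (at r) \<and>
            (w has_real_derivative (- ((real N - 1) / r * w r) - f (u r))) (at r))"

lemma sol_fsol: "sol u w \<longleftrightarrow> fsol (\<lambda>r. f (u r)) u w"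
proof -
  have "continuous_on {0..} (\<lambda>r. f (u r))" if "continuous_on {0..} u"
    using that f_cont by (intro continuous_on_compose2[OF f_cont]) auto
  then show ?thesis unfolding sol_def fsol_def using f_bd by blast
qed

text \<open>The integrating factor \<open>r ^ (N - 1)\<close> removes the singular friction term.\<close>

lemma power_deriv:
  assumes "0 < r" "(w has_real_derivative (- ((real N - 1) / r * w r) - g)) (at r)"
  shows "((\<lambda>r. r ^ (N - 1) * w r) has_real_derivative - (r ^ (N - 1) * g)) (at r)"
proof -
  obtain n where n: "N = Suc (Suc n)" using N2 by (metis Suc_le_D numeral_2_eq_2 Suc_le_mono)
  have "((\<lambda>r. r ^ (N - 1) * w r) has_real_derivative
     (real (N - 1) * r ^ (N - 1 - 1)) * w r + r ^ (N - 1) * (- ((real N - 1) / r * w r) - g)) (at r)"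
    using assms(2) by (auto intro!: derivative_eq_intros)
  moreover have "(real (N - 1) * r ^ (N - 1 - 1)) * w r + r ^ (N - 1) * (- ((real N - 1) / r * w r) - g) = - (r ^ (N - 1) * g)"
    using assms(1) by (simp add: n field_simps)
  ultimately show ?thesis by simp
qed

lemma fsol_z_deriv:
  assumes "fsol g u w" "0 < r"
  shows "((\<lambda>r. r ^ (N - 1) * w r) has_real_derivative - (r ^ (N - 1) * g r)) (at r)"
  using assms by (intro power_deriv) (auto simp: fsol_def)

lemma fsol_z_cont: "fsol g u w \<Longrightarrow> 0 \<le> a \<Longrightarrow> continuous_on {a..b} (\<lambda>r. r ^ (N - 1) * w r)"
  unfolding fsol_def by (intro continuous_intros) (auto elim: continuous_on_subset)

lemma fsol_w_bound: assumes s: "fsol g u w" and r: "0 \<le> r" shows "\<bar>w r\<bar> \<le> Mf * r"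
proof (cases "r = 0")
  case True then show ?thesis using s by (simp add: fsol_def)
next
  case False
  have "\<bar>r ^ (N - 1) * w r - 0 ^ (N - 1) * w 0\<bar> \<le> (r ^ (N - 1) * Mf) * (r - 0)"
  proof (rule deriv_bound_imp_le[where g' = "\<lambda>r. - (r ^ (N - 1) * g r)"])
    show "0 \<le> r" by fact
    show "continuous_on {0..r} (\<lambda>r. r ^ (N - 1) * w r)" using fsol_z_cont[OF s] by simp
    fix x assume x: "0 < x" "x < r"
    show "((\<lambda>r. r ^ (N - 1) * w r) has_real_derivative - (x ^ (N - 1) * g x)) (at x)"
      using fsol_z_deriv[OF s] x by simp
    have "\<bar>- (x ^ (N - 1) * g x)\<bar> = x ^ (N - 1) * \<bar>g x\<bar>" using x by (simp add: abs_mult)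
    also have "\<dots> \<le> r ^ (N - 1) * Mf" using x s Mf0 by (intro mult_mono power_mono) (auto simp: fsol_def)
    finally show "\<bar>- (x ^ (N - 1) * g x)\<bar> \<le> r ^ (N - 1) * Mf" .
  qed
  then have "r ^ (N - 1) * \<bar>w r\<bar> \<le> r ^ (N - 1) * (Mf * r)"
    using s r by (simp add: fsol_def abs_mult mult.assoc)
  then show ?thesis using False r by simp
qed

lemma fsol_w_lip: assumes s: "fsol g u w" and "0 \<le> r" "r \<le> t"
  shows "\<bar>w t - w r\<bar> \<le> real N * Mf * (t - r)"
proof (rule deriv_bound_imp_le[where g' = "\<lambda>r. - ((real N - 1) / r * w r) - g r"])
  show "r \<le> t" by fact
  show "continuous_on {r..t} w" using s assms unfolding fsol_def by (auto elim: continuous_on_subset)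
  fix x assume x: "r < x" "x < t"
  show "(w has_real_derivative - ((real N - 1) / x * w x) - g x) (at x)" using s assms x unfolding fsol_def by auto
  have "\<bar>- ((real N - 1) / x * w x) - g x\<bar> \<le> (real N - 1) / x * \<bar>w x\<bar> + \<bar>g x\<bar>"
    using x assms N2 by (auto simp: abs_mult intro!: order_trans[OF abs_triangle_ineq4])
  also have "\<dots> \<le> (real N - 1) / x * (Mf * x) + Mf"
    using x assms N2 fsol_w_bound[OF s, of x] by (intro add_mono mult_left_mono) (auto simp: fsol_def)
  also have "\<dots> = real N * Mf" using x assms by (simp add: field_simps)
  finally show "\<bar>- ((real N - 1) / x * w x) - g x\<bar> \<le> real N * Mf" .
qed

lemma fsol_u_lip: assumes s: "fsol g u w" and "0 \<le> r" "r \<le> t" "t \<le> R"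
  shows "\<bar>u t - u r\<bar> \<le> psi m (Mf * R) * (t - r)"
proof (rule deriv_bound_imp_le[where g' = "\<lambda>r. psi m (w r)"])
  show "r \<le> t" by fact
  show "continuous_on {r..t} u" using s assms unfolding fsol_def by (auto elim: continuous_on_subset)
  fix x assume x: "r < x" "x < t"
  show "(u has_real_derivative psi m (w x)) (at x)" using s assms x unfolding fsol_def by auto
  have "\<bar>w x\<bar> \<le> Mf * x" using fsol_w_bound[OF s, of x] x assms by simp
  also have "\<dots> \<le> Mf * R" using x assms Mf0 by (intro mult_left_mono) auto
  finally show "\<bar>psi m (w x)\<bar> \<le> psi m (Mf * R)" unfolding abs_psi by (intro psi_mono m1)
qed

lemma integral_eq_imp_deriv:
  fixes h q :: "real \<Rightarrow> real"
  assumes "\<And>r. 0 \<le> r \<Longrightarrow> q r = c + integral {0..r} h" "continuous_on {0..} h" "0 < r"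
  shows "(q has_real_derivative h r) (at r)"
proof -
  have "((\<lambda>x. integral {0..x} h) has_real_derivative h r) (at r within {0..r+1})"
    using assms by (intro integral_has_real_derivative) (auto elim: continuous_on_subset)
  then have "((\<lambda>x. c + integral {0..x} h) has_real_derivative h r) (at r)"
    using assms(3) by (auto simp: at_within_Icc_at intro!: derivative_eq_intros)
  then show ?thesis
    by (rule has_field_derivative_transform_within_open[where S = "{0<..}"]) (use assms in auto)
qed

lemma integral_of_deriv:
  fixes h q :: "real \<Rightarrow> real"
  assumes "continuous_on {0..} q" "\<And>r. 0 < r \<Longrightarrow> (q has_real_derivative h r) (at r)" "0 \<le> r"
  shows "(h has_integral (q r - q 0)) {0..r}"
  using assms by (intro fundamental_theorem_of_calculus_interior)
    (auto elim: continuous_on_subset simp: has_real_derivative_iff_has_vector_derivative)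

lemma integral_limit_eq:
  fixes hn qn :: "nat \<Rightarrow> real \<Rightarrow> real"
  assumes "\<And>n. continuous_on {0..} (qn n)" "\<And>n r. 0 < r \<Longrightarrow> (qn n has_real_derivative hn n r) (at r)"
    and "\<And>n x. 0 \<le> x \<Longrightarrow> x \<le> r \<Longrightarrow> \<bar>hn n x\<bar> \<le> B" "\<And>x. 0 \<le> x \<Longrightarrow> (\<lambda>n. hn n x) \<longlonglongrightarrow> h x"
    and "\<And>x. 0 \<le> x \<Longrightarrow> (\<lambda>n. qn n x) \<longlonglongrightarrow> q x" "0 \<le> r"
  shows "q r = q 0 + integral {0..r} h"
proof -
  have i: "(hn n has_integral (qn n r - qn n 0)) {0..r}" for n
    using assms by (intro integral_of_deriv) auto
  have "(\<lambda>n. integral {0..r} (hn n)) \<longlonglongrightarrow> integral {0..r} h"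
    by (rule dominated_convergence[where h = "\<lambda>_. B"]) (use i assms in \<open>auto simp: integrable_on_def\<close>)
  moreover have "integral {0..r} (hn n) = qn n r - qn n 0" for n using i by (rule integral_unique)
  ultimately have "(\<lambda>n. qn n r - qn n 0) \<longlonglongrightarrow> integral {0..r} h" by simp
  moreover have "(\<lambda>n. qn n r - qn n 0) \<longlonglongrightarrow> q r - q 0" using assms(5,6) by (intro tendsto_intros) auto
  ultimately have "q r - q 0 = integral {0..r} h" by (rule LIMSEQ_unique[rotated])
  then show ?thesis by simp
qed

text \<open>The limit is taken in the integrated equations, by dominated convergence, and these are
  differentiated again. Only pointwise convergence of the forcing is assumed, so that vanishing
  delays are covered.\<close>

lemma fsol_limit:
  assumes s: "\<And>n. fsol (gn n) (un n) (wn n)"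
    and cu: "luconv un u" "continuous_on {0..} u" and cw: "luconv wn w" "continuous_on {0..} w"
    and cg: "\<And>t. 0 \<le> t \<Longrightarrow> (\<lambda>n. gn n t) \<longlonglongrightarrow> f (u t)"
  shows "sol u w"
proof -
  have lw: "(\<lambda>n. wn n x) \<longlonglongrightarrow> w x" if "0 \<le> x" for x using luconv_pt[OF cw that] .
  have lu: "(\<lambda>n. un n x) \<longlonglongrightarrow> u x" if "0 \<le> x" for x using luconv_pt[OF cu that] .
  have w0: "w 0 = 0" using lw[of 0] s by (simp add: fsol_def LIMSEQ_const_iff)
  have U: "u r = u 0 + integral {0..r} (\<lambda>x. psi m (w x))" if "0 \<le> r" for r
  proof (rule integral_limit_eq[where qn = un and hn = "\<lambda>n x. psi m (wn n x)" and B = "psi m (Mf * r)"])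
    fix n show "continuous_on {0..} (un n)" using s by (auto simp: fsol_def)
  next
    fix n r assume "(0::real) < r" then show "(un n has_real_derivative psi m (wn n r)) (at r)" using s by (auto simp: fsol_def)
  next
    fix n x assume x: "0 \<le> x" "x \<le> r"
    have "\<bar>wn n x\<bar> \<le> Mf * x" using fsol_w_bound[OF s] x by simp
    also have "\<dots> \<le> Mf * r" using x Mf0 by (intro mult_left_mono) auto
    finally show "\<bar>psi m (wn n x)\<bar> \<le> psi m (Mf * r)" unfolding abs_psi by (intro psi_mono m1)
  next
    fix x :: real assume "0 \<le> x"
    then show "(\<lambda>n. psi m (wn n x)) \<longlonglongrightarrow> psi m (w x)" using isCont_tendsto_compose[OF psi_cont[OF m1] lw[of x]] by simp
  qed (use lu that in auto)
  have Z: "r ^ (N - 1) * w r = 0 ^ (N - 1) * w 0 + integral {0..r} (\<lambda>x. - (x ^ (N - 1) * f (u x)))" if "0 \<le> r" for r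
  proof (rule integral_limit_eq[where qn = "\<lambda>n r. r ^ (N - 1) * wn n r" and hn = "\<lambda>n x. - (x ^ (N - 1) * gn n x)" and q = "\<lambda>r. r ^ (N - 1) * w r" and B = "r ^ (N - 1) * Mf"])
    fix n show "continuous_on {0..} (\<lambda>r. r ^ (N - 1) * wn n r)" using s by (auto simp: fsol_def intro!: continuous_intros)
  next
    fix n r assume "(0::real) < r" then show "((\<lambda>r. r ^ (N - 1) * wn n r) has_real_derivative - (r ^ (N - 1) * gn n r)) (at r)"
      using fsol_z_deriv[OF s] by simp
  next
    fix n x assume x: "0 \<le> x" "x \<le> r"
    have "\<bar>- (x ^ (N - 1) * gn n x)\<bar> = x ^ (N - 1) * \<bar>gn n x\<bar>" using x by (simp add: abs_mult)
    also have "\<dots> \<le> r ^ (N - 1) * Mf" using x s Mf0 by (intro mult_mono power_mono) (auto simp: fsol_def)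
    finally show "\<bar>- (x ^ (N - 1) * gn n x)\<bar> \<le> r ^ (N - 1) * Mf" .
  next
    fix x :: real assume "0 \<le> x"
    then show "(\<lambda>n. - (x ^ (N - 1) * gn n x)) \<longlonglongrightarrow> - (x ^ (N - 1) * f (u x))" using cg by (intro tendsto_intros) auto
  next
    fix x :: real assume "0 \<le> x"
    then show "(\<lambda>n. x ^ (N - 1) * wn n x) \<longlonglongrightarrow> x ^ (N - 1) * w x" using lw by (intro tendsto_intros) auto
  qed (use that in auto)
  have cfu: "continuous_on {0..} (\<lambda>x. f (u x))" by (rule continuous_on_compose2[OF f_cont cu(2)]) auto
  have du: "(u has_real_derivative psi m (w r)) (at r)" if "0 < r" for r
    by (rule integral_eq_imp_deriv[OF U _ that])
      (auto intro!: continuous_on_compose2[OF psi_cont_on[OF m1] cw(2)])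
  have dw: "(w has_real_derivative - ((real N - 1) / r * w r) - f (u r)) (at r)" if r: "0 < r" for r
  proof -
    let ?z = "\<lambda>r. r ^ (N - 1) * w r"
    obtain n where n: "N = Suc (Suc n)" using N2 by (metis Suc_le_D numeral_2_eq_2 Suc_le_mono)
    have dz: "(?z has_real_derivative - (r ^ (N - 1) * f (u r))) (at r)"
      by (rule integral_eq_imp_deriv[OF Z _ r]) (auto intro!: continuous_intros cfu)
    then have "((\<lambda>r. ?z r / r ^ (N - 1)) has_real_derivative
        (- (r ^ (N - 1) * f (u r)) * r ^ (N - 1) - ?z r * (real (N - 1) * r ^ (N - 1 - 1))) / (r ^ (N - 1) * r ^ (N - 1))) (at r)"
      using DERIV_divide[OF dz DERIV_pow[of "N - 1" r]] r by simp
    moreover have "(- (r ^ (N - 1) * f (u r)) * r ^ (N - 1) - ?z r * (real (N - 1) * r ^ (N - 1 - 1))) / (r ^ (N - 1) * r ^ (N - 1))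
       = - ((real N - 1) / r * w r) - f (u r)"
      using r by (simp add: n field_simps)
    ultimately have "((\<lambda>r. ?z r / r ^ (N - 1)) has_real_derivative - ((real N - 1) / r * w r) - f (u r)) (at r)" by simp
    then show ?thesis
      by (rule has_field_derivative_transform_within_open[where S = "{0<..}"]) (use r in auto)
  qed
  show ?thesis unfolding sol_def using cu cw w0 du dw by auto
qed

lemma fsol_subsequence:
  assumes s: "\<And>n. fsol (gn n) (un n) (wn n)" and b: "\<And>n. \<bar>un n 0\<bar> \<le> B"
  obtains k u w where "strict_mono (k :: nat \<Rightarrow> nat)" "luconv (\<lambda>n. un (k n)) u" "continuous_on {0..} u"
     "luconv (\<lambda>n. wn (k n)) w" "continuous_on {0..} w"
proof -
  obtain k1 u where k1: "strict_mono (k1 :: nat \<Rightarrow> nat)" "luconv (\<lambda>n. un (k1 n)) u" "continuous_on {0..} u"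
    by (rule locally_lipschitz_subsequence[where un = un and Lip = "\<lambda>R. psi m (Mf * R)"])
      (use fsol_u_lip[OF s] b in auto)
  obtain k2 w where k2: "strict_mono (k2 :: nat \<Rightarrow> nat)" "luconv (\<lambda>n. wn (k1 (k2 n))) w" "continuous_on {0..} w"
    by (rule locally_lipschitz_subsequence[where un = "\<lambda>n. wn (k1 n)" and Lip = "\<lambda>R. real N * Mf" and B = 0])
      (use fsol_w_lip[OF s] s in \<open>auto simp: fsol_def\<close>)
  have "strict_mono (k1 \<circ> k2)" using k1(1) k2(1) by (rule strict_mono_o)
  then show ?thesis using that[of "k1 \<circ> k2" u w] luconv_subseq[OF k1(2) k2(1)] k1 k2 by (simp add: o_def)
qed

text \<open>The Lipschitz bounds for \<open>u\<close> and \<open>w\<close> on bounded intervals are the same for all solutions.\<close>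

theorem sol_compact:
  assumes s: "\<And>n. sol (un n) (wn n)" and a: "(\<lambda>n. un n 0) \<longlonglongrightarrow> \<alpha>"
  obtains k u w where "strict_mono (k :: nat \<Rightarrow> nat)" "luconv (\<lambda>n. un (k n)) u"
     "luconv (\<lambda>n. wn (k n)) w" "sol u w" "u 0 = \<alpha>"
proof -
  obtain B where B: "\<And>n. \<bar>un n 0\<bar> \<le> B"
    using convergent_imp_Bseq[OF convergentI[OF a]] unfolding Bseq_def by auto
  have s': "fsol (\<lambda>r. f (un n r)) (un n) (wn n)" for n using s sol_fsol by simp
  obtain k u w where k: "strict_mono (k :: nat \<Rightarrow> nat)" "luconv (\<lambda>n. un (k n)) u" "continuous_on {0..} u"
     "luconv (\<lambda>n. wn (k n)) w" "continuous_on {0..} w"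
    by (rule fsol_subsequence[OF s' B])
  have "sol u w"
  proof (rule fsol_limit[where gn = "\<lambda>n r. f (un (k n) r)"])
    fix t :: real assume "0 \<le> t"
    then have "(\<lambda>n. un (k n) t) \<longlonglongrightarrow> u t" using luconv_pt[OF k(2,3)] by simp
    then show "(\<lambda>n. f (un (k n) t)) \<longlonglongrightarrow> f (u t)"
      using f_cont by (auto intro: continuous_on_tendsto_compose)
  qed (use s' k in auto)
  moreover have "u 0 = \<alpha>"
    using luconv_pt[OF k(2,3), of 0] LIMSEQ_subseq_LIMSEQ[OF a k(1)] by (auto simp: o_def intro: LIMSEQ_unique)
  ultimately show ?thesis using that k by blast
qed

end
section \<open>Existence for every initial value\<close>

context radial begin

text \<open>Tonelli's method: if \<open>f\<close> is evaluated at the delayed argument \<open>t - d\<close>, then the solution on \<open>[0,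
  (j + 1) d]\<close> is an integral expression in its values on \<open>[0, j d]\<close>. The two operators below give
  \<open>w\<close> and \<open>u\<close> in terms of a candidate \<open>v\<close>, extended to the left of \<open>0\<close> by the initial value.\<close>

definition delayw :: "real \<Rightarrow> (real \<Rightarrow> real) \<Rightarrow> real \<Rightarrow> real" where
  "delayw d v s = - (integral {0..s} (\<lambda>t. t ^ (N - 1) * f (v (t - d)))) / s ^ (N - 1)"

definition delayu :: "real \<Rightarrow> real \<Rightarrow> (real \<Rightarrow> real) \<Rightarrow> real \<Rightarrow> real" where
  "delayu a d v r = a + integral {0..max 0 r} (\<lambda>s. psi m (delayw d v s))"

lemma delay_fsol:
  assumes v: "continuous_on UNIV v"
  shows "fsol (\<lambda>t. f (v (t - d))) (delayu a d v) (delayw d v)"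
    and "continuous_on UNIV (delayu a d v)" and "\<And>r. r \<le> 0 \<Longrightarrow> delayu a d v r = a"
proof -
  let ?h = "\<lambda>t. t ^ (N - 1) * f (v (t - d))"
  let ?z = "\<lambda>s. - integral {0..s} ?h"
  have cg: "continuous_on S (\<lambda>t. f (v (t - d)))" for S
    by (rule continuous_on_compose2[OF f_cont]) (auto intro!: continuous_on_compose2[OF v] continuous_intros)
  have ch: "continuous_on S (\<lambda>t. t ^ (N - 1) * f (v (t - d)))" for S by (intro continuous_intros cg)
  have dw: "(delayw d v has_real_derivative (- ((real N - 1) / r * delayw d v r) - f (v (r - d)))) (at r)" if r: "0 < r" for r
  proof -
    obtain n where n: "N = Suc (Suc n)" using N2 by (metis Suc_le_D numeral_2_eq_2 Suc_le_mono)
    have "((\<lambda>s. integral {0..s} ?h) has_real_derivative ?h r) (at r)"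
      by (rule integral_eq_imp_deriv[where c = 0 and h = ?h]) (use ch r in auto)
    then have dz: "(?z has_real_derivative - ?h r) (at r)" by (intro derivative_intros)
    have "((\<lambda>r. ?z r / r ^ (N - 1)) has_real_derivative
        (- ?h r * r ^ (N - 1) - ?z r * (real (N - 1) * r ^ (N - 1 - 1))) / (r ^ (N - 1) * r ^ (N - 1))) (at r)"
      using DERIV_divide[OF dz DERIV_pow[of "N - 1" r]] r by simp
    moreover have "(- ?h r * r ^ (N - 1) - ?z r * (real (N - 1) * r ^ (N - 1 - 1))) / (r ^ (N - 1) * r ^ (N - 1))
       = - ((real N - 1) / r * delayw d v r) - f (v (r - d))"
      using r unfolding delayw_def by (simp add: n field_simps)
    ultimately show ?thesis unfolding delayw_def by simp
  qed
  have w0: "delayw d v 0 = 0" by (simp add: delayw_def)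
  have wb: "\<bar>delayw d v s\<bar> \<le> Mf * s" if "0 \<le> s" for s
  proof (cases "s = 0")
    case False
    then have s: "0 < s" using that by simp
    have "norm (integral {0..s} ?h) \<le> integral {0..s} (\<lambda>t. s ^ (N - 1) * Mf)"
    proof (rule integral_norm_bound_integral)
      fix x assume x: "x \<in> {0..s}"
      have "norm (?h x) = x ^ (N - 1) * \<bar>f (v (x - d))\<bar>" using x by (simp add: abs_mult)
      also have "\<dots> \<le> s ^ (N - 1) * Mf" using x Mf0 f_bd by (intro mult_mono power_mono) auto
      finally show "norm (?h x) \<le> s ^ (N - 1) * Mf" .
    qed (use ch in \<open>auto intro!: integrable_continuous_real\<close>)
    then have "\<bar>integral {0..s} ?h\<bar> \<le> (Mf * s) * s ^ (N - 1)" using s by (simp add: algebra_simps)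
    then show ?thesis using s by (simp add: delayw_def abs_divide pos_divide_le_eq)
  qed (simp add: w0)
  have cw: "continuous_on {0..} (delayw d v)"
    unfolding continuous_on_eq_continuous_within
  proof
    fix x :: real assume "x \<in> {0..}"
    then consider "x = 0" | "0 < x" by force
    then show "continuous (at x within {0..}) (delayw d v)"
    proof cases
      case 2 then show ?thesis using dw[of x] DERIV_isCont continuous_at_imp_continuous_at_within by blast
    next
      case 1
      have "(delayw d v \<longlongrightarrow> 0) (at 0 within {0..})"
      proof (rule Lim_null_comparison)
        show "\<forall>\<^sub>F x in at 0 within {0..}. norm (delayw d v x) \<le> Mf * x"
          using wb by (auto simp: eventually_at_filter)
        have "((\<lambda>x. Mf * x) \<longlongrightarrow> Mf * 0) (at 0 within {0..})" by (intro tendsto_intros)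
        then show "((\<lambda>x. Mf * x) \<longlongrightarrow> 0) (at 0 within {0..})" by simp
      qed
      then show ?thesis using 1 w0 by (simp add: continuous_within)
    qed
  qed
  have cpw: "continuous_on {0..} (\<lambda>s. psi m (delayw d v s))"
    by (rule continuous_on_compose2[OF psi_cont_on[OF m1] cw]) auto
  have du: "(delayu a d v has_real_derivative psi m (delayw d v r)) (at r)" if "0 < r" for r
    by (rule integral_eq_imp_deriv[OF _ cpw that]) (simp add: delayu_def max_def)
  show cu: "continuous_on UNIV (delayu a d v)"
    unfolding continuous_on_eq_continuous_within
  proof
    fix x :: real
    define h where "h s = psi m (delayw d v (max 0 s))" for s
    have chh: "continuous_on S h" for S unfolding h_def
      by (rule continuous_on_compose2[OF cpw]) (auto intro!: continuous_intros)
    have e: "delayu a d v r = a + integral {0..max 0 r} h" for r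
    proof -
      have "integral {0..max 0 r} (\<lambda>s. psi m (delayw d v s)) = integral {0..max 0 r} h"
        by (rule integral_cong) (auto simp: h_def)
      then show ?thesis by (simp add: delayu_def)
    qed
    have "continuous_on {0..\<bar>x\<bar> + 1} (\<lambda>r. integral {0..r} h)"
      by (intro indefinite_integral_continuous_1 integrable_continuous_real chh)
    then have "continuous_on {-\<bar>x\<bar>-1..\<bar>x\<bar> + 1} (\<lambda>r. integral {0..max 0 r} h)"
      by (rule continuous_on_compose2) (auto intro!: continuous_intros)
    then have "continuous_on {-\<bar>x\<bar>-1..\<bar>x\<bar> + 1} (delayu a d v)" unfolding e by (intro continuous_intros)
    moreover have "x \<in> interior {-\<bar>x\<bar>-1..\<bar>x\<bar> + 1}" by auto
    ultimately show "continuous (at x within UNIV) (delayu a d v)"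
      by (simp add: continuous_on_interior)
  qed
  show "\<And>r. r \<le> 0 \<Longrightarrow> delayu a d v r = a" by (simp add: delayu_def max_def)
  show "fsol (\<lambda>t. f (v (t - d))) (delayu a d v) (delayw d v)"
    unfolding fsol_def using cu cw cg w0 f_bd du dw by (auto elim: continuous_on_subset)
qed

lemma delayw_cong:
  assumes "\<And>t. t \<le> s - d \<Longrightarrow> v t = v' t" shows "delayw d v s = delayw d v' s"
proof -
  have "integral {0..s} (\<lambda>t. t ^ (N - 1) * f (v (t - d))) = integral {0..s} (\<lambda>t. t ^ (N - 1) * f (v' (t - d)))"
    by (rule integral_cong) (use assms in auto)
  then show ?thesis by (simp add: delayw_def)
qed

lemma delayu_cong:
  assumes "0 < d" "\<And>t. t \<le> r - d \<Longrightarrow> v t = v' t" shows "delayu a d v r = delayu a d v' r"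
proof (cases "r \<le> 0")
  case True then show ?thesis by (simp add: delayu_def max_def)
next
  case False
  have "integral {0..r} (\<lambda>s. psi m (delayw d v s)) = integral {0..r} (\<lambda>s. psi m (delayw d v' s))"
    by (rule integral_cong) (use assms in \<open>auto intro!: arg_cong[of _ _ "psi m"] delayw_cong\<close>)
  then show ?thesis using False by (simp add: delayu_def max_def)
qed

text \<open>The \<open>j\<close>-th iterate is correct up to \<open>j d\<close>, so the iterates are eventually constant at each point.\<close>

lemma delay_solution:
  assumes d: "0 < d"
  obtains u w where "fsol (\<lambda>t. f (u (max 0 (t - d)))) u w" "u 0 = a"
proof -
  define U where "U j = (delayu a d ^^ j) (\<lambda>_. a)" for j
  have U0: "U 0 = (\<lambda>_. a)" and US: "U (Suc j) = delayu a d (U j)" for j by (auto simp: U_def)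
  have UC: "continuous_on UNIV (U j)" for j
    by (induction j) (auto simp: U0 US delay_fsol(2))
  have st: "U (Suc j) r = U j r" if "r \<le> real j * d" for j r
    using that
  proof (induction j arbitrary: r)
    case 0 then show ?case using delay_fsol(3) by (simp add: US U0)
  next
    case (Suc j)
    have "delayu a d (U (Suc j)) r = delayu a d (U j) r"
      using Suc by (intro delayu_cong d) (auto simp: algebra_simps)
    then show ?case by (simp add: US)
  qed
  have st2: "U (j + i) r = U j r" if "r \<le> real j * d" for j i r
  proof (induction i)
    case (Suc i)
    have "real j * d \<le> real (j + i) * d" using d by (intro mult_right_mono) auto
    then show ?case using st[of r "j + i"] Suc that by simp
  qed simp
  define u where "u r = U (nat \<lceil>r / d\<rceil>) r" for r
  have uU: "u r = U j r" if "r \<le> real j * d" for j r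
  proof -
    have 1: "r \<le> real (nat \<lceil>r / d\<rceil>) * d"
    proof -
      have "r / d \<le> real (nat \<lceil>r / d\<rceil>)" by linarith
      then show ?thesis using d by (simp add: field_simps)
    qed
    have 2: "r / d \<le> real j" using that d by (simp add: field_simps)
    then have "nat \<lceil>r / d\<rceil> \<le> j" by linarith
    then show ?thesis using st2[OF 1, of "j - nat \<lceil>r / d\<rceil>"] by (simp add: u_def)
  qed
  have cu: "continuous_on UNIV u"
    unfolding continuous_on_eq_continuous_within
  proof
    fix x :: real
    obtain j :: nat where "x / d < real j" using reals_Archimedean2 by blast
    then have j: "x < real j * d" using d by (simp add: field_simps)
    have "isCont (U j) x" using UC by (simp add: continuous_on_eq_continuous_at)
    moreover have "\<forall>\<^sub>F y in nhds x. u y = U j y"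
      using j eventually_nhds_in_open[of "{..<real j * d}" x] uU by (auto elim!: eventually_mono)
    ultimately show "continuous (at x within UNIV) u" using isCont_cong by metis
  qed
  have fix': "delayu a d u = u"
  proof
    fix r :: real
    obtain j :: nat where "r / d < real j" using reals_Archimedean2 by blast
    then have j: "r \<le> real (Suc j) * d" "r \<le> real j * d" using d by (auto simp: field_simps)
    have "delayu a d u r = delayu a d (U j) r"
      using j d by (intro delayu_cong d uU) auto
    also have "\<dots> = U (Suc j) r" by (simp add: US)
    also have "\<dots> = u r" using uU[OF j(1)] by simp
    finally show "delayu a d u r = u r" .
  qed
  have const: "u r = a" if "r \<le> 0" for r using delay_fsol(3)[OF cu that, of a d] fix' by simp
  have "fsol (\<lambda>t. f (u (t - d))) u (delayw d u)" using delay_fsol(1)[OF cu, of d a] fix' by simp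
  moreover have "u (t - d) = u (max 0 (t - d))" for t using const by (simp add: max_def)
  ultimately show ?thesis using that[of u "delayw d u"] const[of 0] by simp
qed

text \<open>Delayed solutions obey uniform bounds; a subsequence converges as the delay tends to \<open>0\<close>.\<close>

theorem sol_exists:
  obtains u w where "sol u w" "u 0 = a"
proof -
  define d where "d n = 1 / real (Suc n)" for n
  have d0: "0 < d n" for n by (simp add: d_def)
  have "\<exists>p. fsol (\<lambda>t. f (fst p (max 0 (t - d n)))) (fst p) (snd p) \<and> fst p 0 = a" for n
    using delay_solution[OF d0[of n], of a] by (metis fst_conv snd_conv)
  then obtain p where p: "\<And>n. fsol (\<lambda>t. f (fst (p n) (max 0 (t - d n)))) (fst (p n)) (snd (p n))" "\<And>n. fst (p n) 0 = a"
    by metis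
  define un where "un n = fst (p n)" for n
  define wn where "wn n = snd (p n)" for n
  have s: "fsol (\<lambda>t. f (un n (max 0 (t - d n)))) (un n) (wn n)" and a: "un n 0 = a" for n
    using p by (simp_all add: un_def wn_def)
  obtain k u w where k: "strict_mono (k :: nat \<Rightarrow> nat)" "luconv (\<lambda>n. un (k n)) u" "continuous_on {0..} u"
     "luconv (\<lambda>n. wn (k n)) w" "continuous_on {0..} w"
    by (rule fsol_subsequence[OF s, where B = "\<bar>a\<bar>"]) (use a in auto)
  have "sol u w"
  proof (rule fsol_limit[where gn = "\<lambda>n t. f (un (k n) (max 0 (t - d (k n))))"])
    fix t :: real assume t: "0 \<le> t"
    have "(\<lambda>n. d n) \<longlonglongrightarrow> 0" unfolding d_def by (rule LIMSEQ_Suc[OF lim_1_over_n])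
    then have "(\<lambda>n. d (k n)) \<longlonglongrightarrow> 0" using LIMSEQ_subseq_LIMSEQ[OF _ k(1)] by (auto simp: o_def)
    then have "(\<lambda>n. max 0 (t - d (k n))) \<longlonglongrightarrow> max 0 (t - 0)" by (intro tendsto_intros)
    then have "(\<lambda>n. max 0 (t - d (k n))) \<longlonglongrightarrow> t" using t by simp
    then have "(\<lambda>n. un (k n) (max 0 (t - d (k n)))) \<longlonglongrightarrow> u t"
      by (intro luconv_seq[OF k(2,3)]) auto
    then show "(\<lambda>n. f (un (k n) (max 0 (t - d (k n))))) \<longlonglongrightarrow> f (u t)"
      using f_cont by (auto intro: continuous_on_tendsto_compose)
  qed (use s k in auto)
  moreover have "u 0 = a"
    using luconv_pt[OF k(2,3), of 0] a by (simp add: LIMSEQ_const_iff)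
  ultimately show ?thesis using that by blast
qed

section \<open>Energy\<close>

definition en :: "(real \<Rightarrow> real) \<Rightarrow> (real \<Rightarrow> real) \<Rightarrow> real \<Rightarrow> real" where
  "en u w r = kin m (w r) + F (u r)"

lemma sol_cont: "sol u w \<Longrightarrow> 0 \<le> a \<Longrightarrow> continuous_on {a..b} u"
    "sol u w \<Longrightarrow> 0 \<le> a \<Longrightarrow> continuous_on {a..b} w"
  unfolding sol_def by (auto elim: continuous_on_subset)

lemma sol_cont0: "sol u w \<Longrightarrow> continuous_on {0..} u" "sol u w \<Longrightarrow> continuous_on {0..} w" "sol u w \<Longrightarrow> w 0 = 0"
  unfolding sol_def by auto

lemma sol_du: "sol u w \<Longrightarrow> 0 < r \<Longrightarrow> (u has_real_derivative psi m (w r)) (at r)"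
  unfolding sol_def by auto

lemma sol_dw: "sol u w \<Longrightarrow> 0 < r \<Longrightarrow> (w has_real_derivative (- ((real N - 1) / r * w r) - f (u r))) (at r)"
  unfolding sol_def by auto

lemma sol_dz: "sol u w \<Longrightarrow> 0 < r \<Longrightarrow> ((\<lambda>r. r ^ (N - 1) * w r) has_real_derivative - (r ^ (N - 1) * f (u r))) (at r)"
  using sol_dw power_deriv by blast

lemma en_cont0: "sol u w \<Longrightarrow> continuous_on {0..} (en u w)"
  unfolding en_def using sol_cont0[of u w]
  by (auto intro!: continuous_on_add continuous_on_compose2[OF kin_cont_on[OF m1]] continuous_on_compose2[OF F_cont])

lemma en_cont: "sol u w \<Longrightarrow> 0 \<le> a \<Longrightarrow> continuous_on {a..b} (en u w)"
  by (rule continuous_on_subset[OF en_cont0]) auto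

text \<open>The friction term is the only source of energy loss.\<close>

lemma en_deriv:
  assumes "sol u w" "0 < r"
  shows "(en u w has_real_derivative - ((real N - 1) / r * (w r * psi m (w r)))) (at r)"
proof -
  have "(en u w has_real_derivative psi m (w r) * (- ((real N - 1) / r * w r) - f (u r)) + f (u r) * psi m (w r)) (at r)"
    unfolding en_def
    by (intro DERIV_add DERIV_chain2[OF kin_deriv[OF m1]] DERIV_chain2[OF F_deriv] sol_du sol_dw assms)
  then show ?thesis by (simp add: algebra_simps)
qed

lemma en_antimono:
  assumes "sol u w" "0 \<le> r" "r \<le> t" shows "en u w t \<le> en u w r"
proof -
  have "en u w t - en u w r \<le> 0 - 0"
  proof (rule deriv_le_imp_le[where h = "\<lambda>_. 0" and g = "en u w" and g' = "\<lambda>r. - ((real N - 1) / r * (w r * psi m (w r)))" and h' = "\<lambda>_. 0"])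
    fix x assume "r < x" "x < t"
    then show "(en u w has_real_derivative - ((real N - 1) / x * (w x * psi m (w x)))) (at x)"
      using assms by (intro en_deriv) auto
    show "- ((real N - 1) / x * (w x * psi m (w x))) \<le> 0"
      using \<open>r < x\<close> assms N2 mult_psi_nonneg[OF m1, of "w x"] by simp
  qed (use assms en_cont in auto)
  then show ?thesis by simp
qed

lemma en_0: "sol u w \<Longrightarrow> en u w 0 = F (u 0)" by (simp add: en_def sol_cont0)

lemma F_le_en: "F (u r) \<le> en u w r" by (simp add: en_def kin_nonneg m1)

text \<open>The rate of energy loss vanishes only where \<open>w\<close> does.\<close>

lemma en_const_imp:
  assumes s: "sol u w" and r: "0 \<le> r" "r \<le> t" and e: "en u w r = en u w t"
  shows "\<And>x. r \<le> x \<Longrightarrow> x \<le> t \<Longrightarrow> u x = u r" "\<And>x. r < x \<Longrightarrow> x < t \<Longrightarrow> w x = 0"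
proof -
  have ec: "en u w x = en u w r" if "r \<le> x" "x \<le> t" for x
    using en_antimono[OF s, of r x] en_antimono[OF s, of x t] that r e by simp
  show w0: "w x = 0" if x: "r < x" "x < t" for x
  proof -
    have "((\<lambda>_. en u w r) has_real_derivative - ((real N - 1) / x * (w x * psi m (w x)))) (at x)"
      by (rule has_field_derivative_transform_within_open[OF en_deriv[OF s], of x "{r<..<t}"]) (use x r in \<open>auto intro: ec\<close>)
    then have "- ((real N - 1) / x * (w x * psi m (w x))) = 0" by (rule DERIV_unique) simp
    then show ?thesis using x r N2 by auto
  qed
  show "u x = u r" if x: "r \<le> x" "x \<le> t" for x
  proof -
    have "\<bar>u x - u r\<bar> \<le> 0 * (x - r)"
    proof (rule deriv_bound_imp_le[where g' = "\<lambda>x. psi m (w x)"])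
      fix y assume y: "r < y" "y < x"
      show "(u has_real_derivative psi m (w y)) (at y)" using y r by (intro sol_du[OF s]) auto
      show "\<bar>psi m (w y)\<bar> \<le> 0" using w0[of y] y x by simp
    qed (use x r sol_cont(1)[OF s] in auto)
    then show ?thesis by simp
  qed
qed

end
section \<open>Local uniqueness\<close>

text \<open>If \<open>m > 2\<close>, then \<open>psi m\<close> is not Lipschitz near \<open>0\<close>. On \<open>[c1 h, c2 h]\<close> its Lipschitz constant has
  the order \<open>h powr (1 / (m - 1) - 1)\<close>, which is compensated by the linear growth of \<open>w\<close> next to
  a critical point.\<close>

lemma psi_diff:
  assumes m: "1 < m" and c: "0 < c1" "c1 \<le> c2" "0 < h"
    and x: "c1 * h \<le> x" "x \<le> c2 * h" and y: "c1 * h \<le> y" "y \<le> c2 * h"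
  shows "\<bar>psi m x - psi m y\<bar> \<le> max (c1 powr (1 / (m - 1) - 1)) (c2 powr (1 / (m - 1) - 1)) / (m - 1)
    * h powr (1 / (m - 1) - 1) * \<bar>x - y\<bar>"
proof -
  define e where "e = 1 / (m - 1) - 1"
  define C where "C = max (c1 powr e) (c2 powr e) / (m - 1) * h powr e"
  have ch: "0 < c1 * h" using c by simp
  have main: "\<bar>psi m b - psi m a\<bar> \<le> C * (b - a)" if ab: "c1 * h \<le> a" "a \<le> b" "b \<le> c2 * h" for a b
  proof -
    have "\<bar>b powr (1 / (m - 1)) - a powr (1 / (m - 1))\<bar> \<le> C * (b - a)"
    proof (rule deriv_bound_imp_le[where g' = "\<lambda>x. 1 / (m - 1) * x powr e"])
      show "continuous_on {a..b} (\<lambda>b. b powr (1 / (m - 1)))"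
        using ab ch by (intro continuous_intros) auto
      fix t assume t: "a < t" "t < b"
      then have t0: "0 < t" using ab ch by linarith
      then show "((\<lambda>b. b powr (1 / (m - 1))) has_real_derivative 1 / (m - 1) * t powr e) (at t)"
        unfolding e_def by (auto intro!: derivative_eq_intros)
      define s where "s = t / h"
      have s: "c1 \<le> s" "s \<le> c2" "t = s * h" "0 < s" using t ab c t0 by (auto simp: s_def field_simps)
      have "s powr e \<le> max (c1 powr e) (c2 powr e)"
      proof (cases "0 \<le> e")
        case True then show ?thesis using powr_mono2[of e s c2] s by auto
      next
        case False then show ?thesis using powr_mono2'[of e c1 s] s c by auto
      qed
      then have "t powr e \<le> max (c1 powr e) (c2 powr e) * h powr e"
        using s c by (auto simp: powr_mult intro!: mult_right_mono)
      then show "\<bar>1 / (m - 1) * t powr e\<bar> \<le> C"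
        using m unfolding C_def by (simp add: divide_right_mono)
    qed (use ab in auto)
    moreover have "0 \<le> a" "0 \<le> b" using ab ch by linarith+
    ultimately show ?thesis by (simp add: psi_of_pos)
  qed
  show ?thesis
    using main[of x y] main[of y x] x y unfolding C_def[symmetric] e_def[symmetric]
    by (cases "x \<le> y") (auto simp: abs_minus_commute)
qed

lemma kin_diff_le:
  assumes m: "1 < m" and "\<bar>x\<bar> \<le> b" "\<bar>y\<bar> \<le> b"
  shows "\<bar>kin m x - kin m y\<bar> \<le> psi m b * \<bar>x - y\<bar>"
proof -
  have main: "\<bar>kin m d - kin m c\<bar> \<le> psi m b * (d - c)" if "c \<le> d" "\<bar>c\<bar> \<le> b" "\<bar>d\<bar> \<le> b" for c d
  proof (rule deriv_bound_imp_le[where g' = "psi m"])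
    fix t assume "c < t" "t < d"
    then have "\<bar>t\<bar> \<le> b" using that by auto
    then show "\<bar>psi m t\<bar> \<le> psi m b" unfolding abs_psi by (intro psi_mono m)
  qed (use that kin_cont_on[OF m] kin_deriv[OF m] in auto)
  show ?thesis using main[of x y] main[of y x] assms by (cases "x \<le> y") (auto simp: abs_minus_commute)
qed

lemma kin_diff_ge:
  assumes m: "1 < m" and "0 < a" "a \<le> x" "a \<le> y"
  shows "psi m a * \<bar>x - y\<bar> \<le> \<bar>kin m x - kin m y\<bar>"
proof -
  have main: "psi m a * (d - c) \<le> kin m d - kin m c" if "c \<le> d" "a \<le> c" for c d
  proof -
    have "psi m a * d - psi m a * c \<le> kin m d - kin m c"
      by (rule deriv_le_imp_le[where g = "\<lambda>x. psi m a * x" and h = "kin m" and g' = "\<lambda>_. psi m a" and h' = "psi m"])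
        (use that assms kin_cont_on[OF m] kin_deriv[OF m] in \<open>auto intro!: psi_mono continuous_intros derivative_eq_intros\<close>)
    then show ?thesis by (simp add: algebra_simps)
  qed
  show ?thesis using main[of x y] main[of y x] assms abs_ge_self[of "kin m x - kin m y"] abs_ge_minus_self[of "kin m x - kin m y"]
    by (cases "x \<le> y") auto
qed

context radial begin

lemma F_lip: "\<bar>F x - F y\<bar> \<le> Mf * \<bar>x - y\<bar>"
proof -
  have main: "\<bar>F d - F c\<bar> \<le> Mf * (d - c)" if "c \<le> d" for c d
    by (rule deriv_bound_imp_le[where g' = f]) (use that F_cont F_deriv f_bd in auto)
  show ?thesis using main[of x y] main[of y x] by (cases "x \<le> y") (auto simp: abs_minus_commute)
qed

lemma near_right:
  fixes g :: "real \<Rightarrow> real"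
  assumes "continuous_on {0..} g" "0 \<le> r0" "0 < e"
  shows "\<exists>d>0. \<forall>r. r0 \<le> r \<and> r \<le> r0 + d \<longrightarrow> \<bar>g r - g r0\<bar> < e"
proof -
  obtain d where d: "d > 0" "\<forall>x'\<in>{0..}. dist x' r0 < d \<longrightarrow> dist (g x') (g r0) < e"
    using assms unfolding continuous_on_iff by (metis atLeast_iff)
  show ?thesis
  proof (intro exI conjI allI impI)
    show "d / 2 > 0" using d by simp
    fix r assume "r0 \<le> r \<and> r \<le> r0 + d / 2"
    then show "\<bar>g r - g r0\<bar> < e" using d(1) d(2)[rule_format, of r] assms(2) by (auto simp: dist_real_def)
  qed
qed

lemma max_diff:
  fixes g h :: "real \<Rightarrow> real"
  assumes "continuous_on {0..} g" "continuous_on {0..} h" "0 \<le> a" "a \<le> b"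
  obtains s where "a \<le> s" "s \<le> b" "\<And>r. a \<le> r \<Longrightarrow> r \<le> b \<Longrightarrow> \<bar>g r - h r\<bar> \<le> \<bar>g s - h s\<bar>"
proof -
  have "continuous_on {a..b} (\<lambda>r. \<bar>g r - h r\<bar>)"
    using assms by (intro continuous_intros) (auto elim!: continuous_on_subset)
  from continuous_attains_sup[OF compact_Icc _ this] obtain s where
    "s \<in> {a..b}" "\<forall>y\<in>{a..b}. \<bar>g y - h y\<bar> \<le> \<bar>g s - h s\<bar>" using assms by auto
  then show ?thesis using that[of s] by auto
qed

text \<open>Compare \<open>- r ^ (N - 1) * w\<close> with the integrals of \<open>c r ^ (N - 1)\<close> and \<open>d r ^ (N - 1)\<close>.\<close>

lemma w_linear:
  assumes s: "sol u w" and r0: "0 \<le> r0" "r0 \<le> r" and w0: "w r0 = 0"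
    and f: "\<And>t. r0 \<le> t \<Longrightarrow> t \<le> r \<Longrightarrow> c \<le> f (u t) \<and> f (u t) \<le> d" and c: "0 \<le> c"
  shows "c / N * (r - r0) \<le> - w r" "- w r \<le> d * (r - r0)"
proof -
  have N0: "N > 0" using N2 by simp
  have dz: "((\<lambda>r. - (r ^ (N - 1) * w r)) has_real_derivative t ^ (N - 1) * f (u t)) (at t)" if "0 < t" for t
    using DERIV_minus[OF sol_dz[OF s that]] by simp
  have cz: "continuous_on {r0..r} (\<lambda>r. - (r ^ (N - 1) * w r))"
    by (intro continuous_intros sol_cont[OF s] r0)
  have "c / N * r ^ N - c / N * r0 ^ N \<le> - (r ^ (N - 1) * w r) - - (r0 ^ (N - 1) * w r0)"
  proof (rule deriv_le_imp_le[where g = "\<lambda>r. c / N * r ^ N" and h = "\<lambda>r. - (r ^ (N - 1) * w r)"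
      and g' = "\<lambda>r. c * r ^ (N - 1)" and h' = "\<lambda>t. t ^ (N - 1) * f (u t)"])
    fix x assume x: "r0 < x" "x < r"
    show "((\<lambda>r. c / real N * r ^ N) has_real_derivative c * x ^ (N - 1)) (at x)"
      using N0 by (auto intro!: derivative_eq_intros)
    show "((\<lambda>r. - (r ^ (N - 1) * w r)) has_real_derivative x ^ (N - 1) * f (u x)) (at x)" using x r0 by (intro dz) auto
    show "c * x ^ (N - 1) \<le> x ^ (N - 1) * f (u x)"
      using f[of x] x r0 by (simp add: mult.commute mult_left_mono)
  qed (use r0 cz N0 in \<open>auto intro!: continuous_intros\<close>)
  then have 1: "c / N * (r ^ N - r0 ^ N) \<le> - (r ^ (N - 1) * w r)" using w0 by (simp add: algebra_simps)
  have "r0 ^ N = r0 * r0 ^ (N - 1)" using N0 by (metis power_eq_if neq0_conv)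
  also have "\<dots> \<le> r0 * r ^ (N - 1)" using r0 by (intro mult_left_mono power_mono) auto
  finally have 2: "(r - r0) * r ^ (N - 1) \<le> r ^ N - r0 ^ N"
    using N0 by (simp add: algebra_simps power_eq_if[of r N])
  have "c / N * ((r - r0) * r ^ (N - 1)) \<le> c / N * (r ^ N - r0 ^ N)"
    using 2 c by (intro mult_left_mono) auto
  then have 3: "c / N * (r - r0) * r ^ (N - 1) \<le> - w r * r ^ (N - 1)"
    using 1 by (simp only: mult.assoc mult_minus_left mult.commute[of "w r"])
  show "c / N * (r - r0) \<le> - w r"
  proof (cases "r = r0")
    case True then show ?thesis using w0 by simp
  next
    case False then have "0 < r ^ (N - 1)" using r0 by simp
    then show ?thesis using 3 by (rule mult_right_le_imp_le[rotated])
  qed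
  have "- (r ^ (N - 1) * w r) - - (r0 ^ (N - 1) * w r0) \<le> r ^ (N - 1) * d * r - r ^ (N - 1) * d * r0"
  proof (rule deriv_le_imp_le[where h = "\<lambda>t. r ^ (N - 1) * d * t" and g = "\<lambda>r. - (r ^ (N - 1) * w r)"
      and h' = "\<lambda>_. r ^ (N - 1) * d" and g' = "\<lambda>t. t ^ (N - 1) * f (u t)"])
    fix x assume x: "r0 < x" "x < r"
    show "((\<lambda>r. - (r ^ (N - 1) * w r)) has_real_derivative x ^ (N - 1) * f (u x)) (at x)" using x r0 by (intro dz) auto
    show "x ^ (N - 1) * f (u x) \<le> r ^ (N - 1) * d"
      using f[of x] x r0 c by (intro mult_mono power_mono) auto
  qed (use r0 cz in \<open>auto intro!: continuous_intros derivative_eq_intros\<close>)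
  then have 4: "- w r * r ^ (N - 1) \<le> d * (r - r0) * r ^ (N - 1)" using w0 by (simp add: algebra_simps)
  show "- w r \<le> d * (r - r0)"
  proof (cases "r = r0")
    case True then show ?thesis using w0 by simp
  next
    case False then have "0 < r ^ (N - 1)" using r0 by simp
    then show ?thesis using 4 by (rule mult_right_le_imp_le[rotated])
  qed
qed

text \<open>Let \<open>D\<close> be the largest distance of \<open>u\<close> and \<open>v\<close> on a short interval. By the Lipschitz condition
  \<open>w\<close> and \<open>z\<close> differ by at most \<open>L D (r - r0)\<close>, and both are of exact order \<open>r - r0\<close>. So
  \<open>psi_diff\<close> bounds the difference of the derivatives of \<open>u\<close> and \<open>v\<close> by a multiple of \<open>D\<close>, and
  integration over a short interval gives \<open>D \<le> D / 2\<close>.\<close>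

lemma uniq_critical:
  assumes s1: "sol u w" and s2: "sol v z" and r0: "0 \<le> r0" and e: "u r0 = v r0" "w r0 = 0" "z r0 = 0"
    and fp: "0 < f (u r0)" and lip: "0 < e0" "\<And>x y. \<bar>x - u r0\<bar> < e0 \<Longrightarrow> \<bar>y - u r0\<bar> < e0 \<Longrightarrow> \<bar>f x - f y\<bar> \<le> \<Lambda> * \<bar>x - y\<bar>"
  shows "\<exists>d>0. \<forall>r. r0 \<le> r \<and> r \<le> r0 + d \<longrightarrow> u r = v r \<and> w r = z r"
proof -
  define c where "c = f (u r0)"
  define L where "L = \<bar>\<Lambda>\<bar>"
  have N0: "N > 0" using N2 by simp
  have lip': "\<bar>f x - f y\<bar> \<le> L * \<bar>x - y\<bar>" if "\<bar>x - u r0\<bar> < e0" "\<bar>y - u r0\<bar> < e0" for x y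
  proof -
    have "\<Lambda> * \<bar>x - y\<bar> \<le> L * \<bar>x - y\<bar>" unfolding L_def by (intro mult_right_mono) auto
    then show ?thesis using lip(2)[OF that] by linarith
  qed
  define c1 where "c1 = c / 2 / N"
  define c2 where "c2 = 2 * c"
  have c0: "0 < c" using fp by (simp add: c_def)
  have c12: "0 < c1" "c1 \<le> c2" using c0 N0 by (auto simp: c1_def c2_def field_simps)
  define q where "q = 1 / (m - 1) - 1"
  define C where "C = max (c1 powr q) (c2 powr q) / (m - 1)"
  have C0: "0 \<le> C" using m1 by (simp add: C_def le_max_iff_disj)
  have L0: "0 \<le> L" by (simp add: L_def)
  have cu: "continuous_on {0..} u" "continuous_on {0..} v" using s1 s2 sol_cont0 by auto
  have cf: "continuous_on {0..} (\<lambda>r. f (u r))" "continuous_on {0..} (\<lambda>r. f (v r))"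
    by (auto intro!: continuous_on_compose2[OF f_cont] cu)
  obtain d1 where d1: "d1 > 0" "\<And>r. r0 \<le> r \<Longrightarrow> r \<le> r0 + d1 \<Longrightarrow> \<bar>u r - u r0\<bar> < e0"
    using near_right[OF cu(1) r0 lip(1)] by blast
  obtain d2 where d2: "d2 > 0" "\<And>r. r0 \<le> r \<Longrightarrow> r \<le> r0 + d2 \<Longrightarrow> \<bar>v r - v r0\<bar> < e0" using near_right[OF cu(2) r0 lip(1)] by blast
  obtain d3 where d3: "d3 > 0" "\<And>r. r0 \<le> r \<Longrightarrow> r \<le> r0 + d3 \<Longrightarrow> \<bar>f (u r) - f (u r0)\<bar> < c / 2"
    using near_right[OF cf(1) r0 half_gt_zero[OF c0]] by blast
  obtain d4 where d4: "d4 > 0" "\<And>r. r0 \<le> r \<Longrightarrow> r \<le> r0 + d4 \<Longrightarrow> \<bar>f (v r) - f (v r0)\<bar> < c / 2"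
    using near_right[OF cf(2) r0 half_gt_zero[OF c0]] by blast
  define q0 where "q0 = 1 / (2 * (C * L + 1))"
  define d where "d = min (min (min d1 d2) (min d3 d4)) (min 1 q0)"
  have CL: "0 < 2 * (C * L + 1)" using C0 L0 by (simp add: add_nonneg_pos)
  have d: "d > 0" "d \<le> d1" "d \<le> d2" "d \<le> d3" "d \<le> d4" "d \<le> 1" "d \<le> 1 / (2 * (C * L + 1))"
  proof -
    have "0 < q0" using CL by (simp add: q0_def)
    then show "d > 0" using d1(1) d2(1) d3(1) d4(1) by (simp add: d_def)
    show "d \<le> d1" "d \<le> d2" "d \<le> d3" "d \<le> d4" "d \<le> 1" "d \<le> 1 / (2 * (C * L + 1))"
      unfolding q0_def[symmetric] d_def by (simp_all add: min_le_iff_disj)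
  qed
  have fu: "c / 2 \<le> f (u t) \<and> f (u t) \<le> c2" if "r0 \<le> t" "t \<le> r0 + d" for t
    using d3(2)[of t] that d c0 unfolding c_def c2_def abs_less_iff by (simp add: field_simps)
  have fv: "c / 2 \<le> f (v t) \<and> f (v t) \<le> c2" if "r0 \<le> t" "t \<le> r0 + d" for t
    using d4(2)[of t] that d c0 e unfolding c_def c2_def abs_less_iff by (simp add: field_simps)
  obtain t where t: "r0 \<le> t" "t \<le> r0 + d" and tm: "\<And>r. r0 \<le> r \<Longrightarrow> r \<le> r0 + d \<Longrightarrow> \<bar>u r - v r\<bar> \<le> \<bar>u t - v t\<bar>"
    using max_diff[OF cu r0, of "r0 + d"] d by auto
  define D where "D = \<bar>u t - v t\<bar>"
  have D0: "0 \<le> D" by (simp add: D_def)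
  have wz: "\<bar>w r - z r\<bar> \<le> L * D * (r - r0)" if r: "r0 < r" "r \<le> r0 + d" for r
  proof -
    have "\<bar>(r ^ (N - 1) * w r - r ^ (N - 1) * z r) - (r0 ^ (N - 1) * w r0 - r0 ^ (N - 1) * z r0)\<bar> \<le> r ^ (N - 1) * (L * D) * (r - r0)"
    proof (rule deriv_bound_imp_le[where g' = "\<lambda>t. - (t ^ (N - 1) * f (u t)) - - (t ^ (N - 1) * f (v t))"])
      show "continuous_on {r0..r} (\<lambda>r. r ^ (N - 1) * w r - r ^ (N - 1) * z r)"
        by (intro continuous_intros sol_cont[OF s1] sol_cont[OF s2] r0)
      fix x assume x: "r0 < x" "x < r"
      then have "0 < x" using r0 by simp
      then show "((\<lambda>r. r ^ (N - 1) * w r - r ^ (N - 1) * z r) has_real_derivative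
              - (x ^ (N - 1) * f (u x)) - - (x ^ (N - 1) * f (v x))) (at x)"
        by (intro DERIV_diff sol_dz[OF s1] sol_dz[OF s2])
      have "\<bar>f (u x) - f (v x)\<bar> \<le> L * \<bar>u x - v x\<bar>"
        using d1(2)[of x] d2(2)[of x] x r d e by (intro lip') auto
      also have "\<dots> \<le> L * D" using tm[of x] x r L0 by (intro mult_left_mono) (auto simp: D_def)
      finally have 1: "\<bar>f (u x) - f (v x)\<bar> \<le> L * D" .
      have "\<bar>- (x ^ (N - 1) * f (u x)) - - (x ^ (N - 1) * f (v x))\<bar> = x ^ (N - 1) * \<bar>f (u x) - f (v x)\<bar>"
      proof -
        have "- (x ^ (N - 1) * f (u x)) - - (x ^ (N - 1) * f (v x)) = x ^ (N - 1) * (f (v x) - f (u x))" by (simp add: algebra_simps)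
        then show ?thesis using \<open>0 < x\<close> by (simp add: abs_mult abs_minus_commute)
      qed
      also have "\<dots> \<le> r ^ (N - 1) * (L * D)" using 1 x \<open>0 < x\<close> L0 D0 by (intro mult_mono power_mono) auto
      finally show "\<bar>- (x ^ (N - 1) * f (u x)) - - (x ^ (N - 1) * f (v x))\<bar> \<le> r ^ (N - 1) * (L * D)" .
    qed (use r in auto)
    then have "\<bar>r ^ (N - 1) * (w r - z r)\<bar> \<le> r ^ (N - 1) * (L * D * (r - r0))" using e by (simp add: algebra_simps)
    then have "r ^ (N - 1) * \<bar>w r - z r\<bar> \<le> r ^ (N - 1) * (L * D * (r - r0))" using r r0 by (simp add: abs_mult)
    then show ?thesis using r r0 by simp
  qed
  have pd: "\<bar>psi m (w r) - psi m (z r)\<bar> \<le> C * L * D" if r: "r0 < r" "r \<le> r0 + d" for r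
  proof -
    define h where "h = r - r0"
    have h: "0 < h" "h \<le> 1" using r d by (auto simp: h_def)
    have wl: "c / 2 / N * (r - r0) \<le> - w r" "- w r \<le> c2 * (r - r0)"
      using w_linear[OF s1 r0 _ e(2), of r "c/2" c2] fu r c0 by auto
    have zl: "c / 2 / N * (r - r0) \<le> - z r" "- z r \<le> c2 * (r - r0)"
      using w_linear[OF s2 r0 _ e(3), of r "c/2" c2] fv r c0 by auto
    have "\<bar>psi m (w r) - psi m (z r)\<bar> = \<bar>psi m (- w r) - psi m (- z r)\<bar>" by simp
    also have "\<dots> \<le> C * h powr q * \<bar>- w r - - z r\<bar>"
      unfolding C_def q_def by (rule psi_diff[OF m1 c12 h(1)]) (use wl zl in \<open>auto simp: c1_def h_def\<close>)
    also have "\<dots> \<le> C * h powr q * (L * D * h)"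
      using wz[OF r] C0 by (intro mult_left_mono) (auto simp: h_def abs_minus_commute)
    also have "\<dots> = C * L * D * (h powr q * h powr 1)" using h by simp
    also have "h powr q * h powr 1 = h powr (1 / (m - 1))" 
      unfolding powr_add[symmetric] by (simp add: q_def)
    also have "h powr (1 / (m - 1)) \<le> 1" using h m1 by (intro powr_le1) auto
    then have "C * L * D * h powr (1 / (m - 1)) \<le> C * L * D * 1" using C0 L0 D0 by (intro mult_left_mono) auto
    finally show ?thesis by simp
  qed
  have "\<bar>(u t - v t) - (u r0 - v r0)\<bar> \<le> C * L * D * (t - r0)"
    by (rule deriv_bound_imp_le[where g' = "\<lambda>r. psi m (w r) - psi m (z r)"])
      (use t r0 pd sol_cont[OF s1] sol_cont[OF s2] in \<open>auto intro!: continuous_intros DERIV_diff sol_du[OF s1] sol_du[OF s2]\<close>)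
  then have "D \<le> C * L * D * (t - r0)" using e by (simp add: D_def)
  also have "\<dots> \<le> C * L * D * d" using t C0 L0 D0 by (intro mult_left_mono) auto
  also have "\<dots> \<le> C * L * D * (1 / (2 * (C * L + 1)))" using d C0 L0 D0 by (intro mult_left_mono) auto
  finally have "D * (2 * (C * L + 1)) \<le> C * L * D" using CL by (simp add: field_simps)
  then have "D * (C * L) + 2 * D \<le> 0" by (simp add: algebra_simps)
  moreover have "0 \<le> D * (C * L)" using D0 C0 L0 by simp
  ultimately have "D = 0" using D0 by linarith
  then have "u r = v r \<and> w r = z r" if "r0 \<le> r" "r \<le> r0 + d" for r
    using tm[of r] wz[of r] that e by (cases "r = r0") (auto simp: D_def)
  then show ?thesis using d(1) by blast
qed

text \<open>Here the energies are compared, which involves \<open>f\<close> only through the Lipschitz function \<open>F\<close>: this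
  is how uniqueness holds inside the well, where \<open>f\<close> is merely continuous. As \<open>w\<close> stays away from
  \<open>0\<close>, the function \<open>kin m\<close> has a Lipschitz inverse there, and the difference of the kinetic
  energies controls that of \<open>w\<close> and \<open>z\<close>.\<close>

lemma uniq_rising:
  assumes s1: "sol u w" and s2: "sol v z" and r0: "0 < r0" and e: "u r0 = v r0" "w r0 = z r0"
    and wp: "0 < w r0"
  shows "\<exists>d>0. \<forall>r. r0 \<le> r \<and> r \<le> r0 + d \<longrightarrow> u r = v r \<and> w r = z r"
proof -
  define a where "a = w r0 / 2"
  define b where "b = 2 * w r0"
  have ab: "0 < a" "a \<le> b" using wp by (auto simp: a_def b_def)
  have cu: "continuous_on {0..} u" "continuous_on {0..} v" "continuous_on {0..} w" "continuous_on {0..} z"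
    using s1 s2 sol_cont0 by auto
  obtain d1 where d1: "d1 > 0" "\<And>r. r0 \<le> r \<Longrightarrow> r \<le> r0 + d1 \<Longrightarrow> \<bar>w r - w r0\<bar> < a"
    using near_right[OF cu(3) less_imp_le[OF r0] ab(1)] by blast
  obtain d2 where d2: "d2 > 0" "\<And>r. r0 \<le> r \<Longrightarrow> r \<le> r0 + d2 \<Longrightarrow> \<bar>z r - z r0\<bar> < a"
    using near_right[OF cu(4) less_imp_le[OF r0] ab(1)] by blast
  define P where "P = max (a powr (1 / (m - 1) - 1)) (b powr (1 / (m - 1) - 1)) / (m - 1)"
  have P0: "0 \<le> P" using m1 by (simp add: P_def le_max_iff_disj)
  define K where "K = (real N - 1) / r0 * (m / (m - 1) * psi m b)"
  have K0: "0 \<le> K" unfolding K_def using r0 N2 m1 ab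
    by (intro mult_nonneg_nonneg psi_nonneg divide_nonneg_pos) auto
  have pa: "0 < psi m a" using ab by (simp add: psi_pos)
  define G where "G = K + Mf * P"
  have G0: "0 \<le> G" using K0 Mf0 P0 by (simp add: G_def)
  define q0 where "q0 = psi m a / (2 * (G + 1))"
  define d where "d = min (min d1 d2) q0"
  have d: "d > 0" "d \<le> d1" "d \<le> d2" "d \<le> psi m a / (2 * (G + 1))"
  proof -
    have "0 < q0" using pa G0 by (simp add: q0_def)
    then show "d > 0" using d1(1) d2(1) by (simp add: d_def)
    show "d \<le> d1" "d \<le> d2" "d \<le> psi m a / (2 * (G + 1))"
      unfolding q0_def[symmetric] d_def by (simp_all add: min_le_iff_disj)
  qed
  have wab: "a \<le> w r" "w r \<le> b" if "r0 \<le> r" "r \<le> r0 + d" for r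
    using d1(2)[of r] that d wp unfolding a_def b_def abs_less_iff by auto
  have zab: "a \<le> z r" "z r \<le> b" if "r0 \<le> r" "r \<le> r0 + d" for r
    using d2(2)[of r] that d wp e unfolding a_def b_def abs_less_iff by auto
  obtain t where t: "r0 \<le> t" "t \<le> r0 + d" and tm: "\<And>r. r0 \<le> r \<Longrightarrow> r \<le> r0 + d \<Longrightarrow> \<bar>w r - z r\<bar> \<le> \<bar>w t - z t\<bar>"
    using max_diff[OF cu(3,4), of r0 "r0 + d"] r0 d by auto
  define S where "S = \<bar>w t - z t\<bar>"
  have S0: "0 \<le> S" by (simp add: S_def)
  have uv: "\<bar>u r - v r\<bar> \<le> P * S * (r - r0)" if r: "r0 \<le> r" "r \<le> r0 + d" for r
  proof -
    have "\<bar>(u r - v r) - (u r0 - v r0)\<bar> \<le> P * S * (r - r0)"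
    proof (rule deriv_bound_imp_le[where g' = "\<lambda>r. psi m (w r) - psi m (z r)"])
      fix x assume x: "r0 < x" "x < r"
      show "((\<lambda>r. u r - v r) has_real_derivative psi m (w x) - psi m (z x)) (at x)"
        using x r0 by (intro DERIV_diff sol_du[OF s1] sol_du[OF s2]) auto
      have "\<bar>psi m (w x) - psi m (z x)\<bar> \<le> P * \<bar>w x - z x\<bar>"
        using psi_diff[OF m1 ab, of 1 "w x" "z x"] wab[of x] zab[of x] x r by (simp add: P_def)
      also have "\<dots> \<le> P * S" using tm[of x] x r P0 by (intro mult_left_mono) (auto simp: S_def)
      finally show "\<bar>psi m (w x) - psi m (z x)\<bar> \<le> P * S" .
    qed (use r r0 sol_cont[OF s1] sol_cont[OF s2] in \<open>auto intro!: continuous_intros\<close>)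
    then show ?thesis using e by simp
  qed
  have "\<bar>(en u w t - en v z t) - (en u w r0 - en v z r0)\<bar> \<le> K * S * (t - r0)"
  proof (rule deriv_bound_imp_le[where g' = "\<lambda>r. - ((real N - 1) / r * (w r * psi m (w r))) - - ((real N - 1) / r * (z r * psi m (z r)))"])
    fix x assume x: "r0 < x" "x < t"
    show "((\<lambda>r. en u w r - en v z r) has_real_derivative - ((real N - 1) / x * (w x * psi m (w x))) - - ((real N - 1) / x * (z x * psi m (z x)))) (at x)"
      using x r0 by (intro DERIV_diff en_deriv[OF s1] en_deriv[OF s2]) auto
    have "\<bar>kin m (w x) - kin m (z x)\<bar> \<le> psi m b * \<bar>w x - z x\<bar>"
      using wab[of x] zab[of x] x t ab by (intro kin_diff_le m1) auto
    also have "\<dots> \<le> psi m b * S" using tm[of x] x t ab by (intro mult_left_mono psi_nonneg) (auto simp: S_def)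
    finally have 1: "\<bar>kin m (w x) - kin m (z x)\<bar> \<le> psi m b * S" .
    have "- ((real N - 1) / x * (w x * psi m (w x))) - - ((real N - 1) / x * (z x * psi m (z x)))
       = (real N - 1) / x * (m / (m - 1)) * (kin m (z x) - kin m (w x))"
    proof -
      have alg: "- (A * (B * k1)) - - (A * (B * k2)) = A * B * (k2 - k1)" for A B k1 k2 :: real by (simp add: algebra_simps)
      show ?thesis unfolding mult_psi[OF m1] by (rule alg)
    qed
    then have "\<bar>- ((real N - 1) / x * (w x * psi m (w x))) - - ((real N - 1) / x * (z x * psi m (z x)))\<bar>
       = (real N - 1) / x * (m / (m - 1)) * \<bar>kin m (w x) - kin m (z x)\<bar>"
      using x r0 N2 m1 by (simp add: abs_mult abs_minus_commute)
    also have "\<dots> \<le> (real N - 1) / r0 * (m / (m - 1)) * (psi m b * S)"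
    proof -
      have "(real N - 1) / x \<le> (real N - 1) / r0" using x r0 N2 by (intro divide_left_mono) auto
      then show ?thesis using 1 m1 N2 x r0 ab by (intro mult_mono) (auto intro!: mult_nonneg_nonneg psi_nonneg)
    qed
    also have "\<dots> = K * S" by (simp add: K_def)
    finally show "\<bar>- ((real N - 1) / x * (w x * psi m (w x))) - - ((real N - 1) / x * (z x * psi m (z x)))\<bar> \<le> K * S" .
  qed (use t r0 en_cont[OF s1] en_cont[OF s2] in \<open>auto intro!: continuous_intros\<close>)
  then have 1: "\<bar>en u w t - en v z t\<bar> \<le> K * S * (t - r0)" using e by (simp add: en_def)
  have "\<bar>F (u t) - F (v t)\<bar> \<le> Mf * (P * S * (t - r0))"
    using F_lip[of "u t" "v t"] uv[OF t] Mf0 by (meson mult_left_mono order_trans)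
  then have "\<bar>kin m (w t) - kin m (z t)\<bar> \<le> G * S * (t - r0)"
    using 1 unfolding en_def G_def by (simp add: algebra_simps abs_le_iff)
  then have "psi m a * S \<le> G * S * (t - r0)"
    using kin_diff_ge[OF m1 ab(1) wab(1)[OF t] zab(1)[OF t]] by (simp add: S_def)
  also have "\<dots> \<le> G * S * (psi m a / (2 * (G + 1)))" using t d G0 S0 by (intro mult_left_mono) auto
  finally have "psi m a * S * (2 * (G + 1)) \<le> G * S * psi m a" using G0 by (simp add: field_simps)
  then have "psi m a * (S * (G + 2)) \<le> 0" by (simp add: algebra_simps)
  then have "S * (G + 2) \<le> 0" using pa by (simp add: mult_le_0_iff)
  then have "S = 0" using S0 G0 by (auto simp: mult_le_0_iff)
  then have "u r = v r \<and> w r = z r" if "r0 \<le> r" "r \<le> r0 + d" for r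
    using tm[of r] uv[of r] that by (auto simp: S_def)
  then show ?thesis using d(1) by blast
qed

end
section \<open>Passing levels, reflection and energy loss\<close>

lemma first_down:
  fixes g :: "real \<Rightarrow> real"
  assumes c: "continuous_on {a..b} g" and "a \<le> b" "c < g a" "g b \<le> c"
  obtains z where "a < z" "z \<le> b" "g z = c" "\<And>r. a \<le> r \<Longrightarrow> r < z \<Longrightarrow> c < g r"
proof -
  let ?S = "{a..b} \<inter> g -` {..c}"
  have "closed ?S" using c by (intro continuous_closed_preimage) auto
  then have "compact ?S" using compact_Int_closed[OF compact_Icc[of a b], of ?S] by (simp add: Int_assoc[symmetric])
  moreover have "?S \<noteq> {}" using assms by auto
  ultimately obtain z where z: "z \<in> ?S" "\<And>r. r \<in> ?S \<Longrightarrow> z \<le> r" using compact_attains_inf by metis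
  have "\<exists>x\<ge>a. x \<le> z \<and> g x = c"
    using z assms by (intro IVT2' continuous_on_subset[OF c]) auto
  then have "g z = c" using z by fastforce
  moreover have "z \<noteq> a" using \<open>g z = c\<close> assms by auto
  ultimately show ?thesis using that[of z] z by fastforce
qed

lemma last_up:
  fixes g :: "real \<Rightarrow> real"
  assumes c: "continuous_on {a..b} g" and "a \<le> b" "g a \<le> c" "c < g b"
  obtains z where "a \<le> z" "z < b" "g z = c" "\<And>r. z < r \<Longrightarrow> r \<le> b \<Longrightarrow> c < g r"
proof -
  have c': "continuous_on {-b..-a} (\<lambda>t. g (- t))"
    by (intro continuous_on_compose2[OF c] continuous_intros) auto
  obtain z where z: "-b < z" "z \<le> -a" "g (- z) = c" "\<And>r. -b \<le> r \<Longrightarrow> r < z \<Longrightarrow> c < g (- r)"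
    using first_down[OF c', of c] assms by auto
  have "c < g r" if "- z < r" "r \<le> b" for r using z(4)[of "-r"] that by auto
  then show ?thesis using that[of "-z"] z by auto
qed

lemma first_up:
  fixes g :: "real \<Rightarrow> real"
  assumes c: "continuous_on {a..b} g" and "a \<le> b" "g a < c" "c \<le> g b"
  obtains z where "a < z" "z \<le> b" "g z = c" "\<And>r. a \<le> r \<Longrightarrow> r < z \<Longrightarrow> g r < c"
proof -
  have "continuous_on {a..b} (\<lambda>t. - g t)" using c by (intro continuous_intros)
  from first_down[OF this, of "-c"] show ?thesis using that assms by auto
qed

lemma last_down:
  fixes g :: "real \<Rightarrow> real"
  assumes c: "continuous_on {a..b} g" and "a \<le> b" "c \<le> g a" "g b < c"
  obtains z where "a \<le> z" "z < b" "g z = c" "\<And>r. z < r \<Longrightarrow> r \<le> b \<Longrightarrow> g r < c"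
proof -
  have "continuous_on {a..b} (\<lambda>t. - g t)" using c by (intro continuous_intros)
  from last_up[OF this, of "-c"] show ?thesis using that assms by auto
qed

lemma decreasing_converges:
  fixes g :: "real \<Rightarrow> real"
  assumes mono: "\<And>r s. R \<le> r \<Longrightarrow> r \<le> s \<Longrightarrow> g s \<le> g r" and bd: "\<And>r. R \<le> r \<Longrightarrow> b \<le> g r"
  shows "\<exists>l. (g \<longlongrightarrow> l) at_top \<and> (\<forall>r\<ge>R. l \<le> g r)"
proof -
  define l where "l = Inf (g ` {R..})"
  have bb: "bdd_below (g ` {R..})" using bd by (auto intro!: bdd_belowI[of _ b])
  have le: "l \<le> g r" if "R \<le> r" for r unfolding l_def using that by (intro cInf_lower bb) auto
  have "(g \<longlongrightarrow> l) at_top"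
  proof (rule order_tendstoI)
    fix a assume "a < l"
    then show "\<forall>\<^sub>F x in at_top. a < g x"
      using le by (auto simp: eventually_at_top_linorder intro!: exI[of _ R] intro: less_le_trans)
  next
    fix a assume "l < a"
    then obtain r where r: "R \<le> r" "g r < a" unfolding l_def using cInf_lessD[of "g ` {R..}" a] by auto
    then show "\<forall>\<^sub>F x in at_top. g x < a"
      using mono by (auto simp: eventually_at_top_linorder intro!: exI[of _ r] intro: le_less_trans)
  qed
  then show ?thesis using le by blast
qed

lemma kin_small:
  assumes m: "1 < m" and "0 < k" obtains c where "0 < c" "kin m c < k"
proof -
  have "(kin m \<longlongrightarrow> kin m 0) (at 0)" using kin_cont[OF m, of 0] by (simp add: isCont_def)
  then have "\<forall>\<^sub>F x in at 0. kin m x < k" using assms(2) by (intro order_tendstoD(2)[of _ "kin m 0"]) auto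
  then obtain d where d: "d > 0" "\<And>x. x \<noteq> 0 \<Longrightarrow> \<bar>x\<bar> < d \<Longrightarrow> kin m x < k"
    by (auto simp: eventually_at dist_real_def)
  show ?thesis using that[of "d/2"] d by auto
qed

lemma kin_less_imp: "1 < m \<Longrightarrow> kin m x < kin m y \<Longrightarrow> \<bar>x\<bar> < \<bar>y\<bar>"
  using kin_mono[of m y x] by (meson not_le)
lemma kin_le_imp: "1 < m \<Longrightarrow> kin m x \<le> kin m y \<Longrightarrow> \<bar>x\<bar> \<le> \<bar>y\<bar>"
  using kin_strict_mono[of m y x] by (meson not_le)

context radial begin

text \<open>The reflection \<open>u \<mapsto> - u\<close> maps solutions to solutions and preserves the energy. Statements on
  positive arcs carry over to negative arcs in this way.\<close>

lemma refl_radial: "radial m N (\<lambda>s. - f (- s)) (\<lambda>s. F (- s)) Mf"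
proof
  show "continuous_on UNIV (\<lambda>s. - f (- s))"
    by (intro continuous_intros continuous_on_compose2[OF f_cont]) auto
  fix s
  show "((\<lambda>s. F (- s)) has_real_derivative - f (- s)) (at s)"
    using DERIV_chain2[OF F_deriv, of uminus "-1" s UNIV] DERIV_minus[OF DERIV_ident, of s UNIV] by simp
qed (use m1 mN f_bd F_0 in auto)

lemma refl_sol: "radial.sol m N (\<lambda>s. - f (- s)) u w \<longleftrightarrow> sol (\<lambda>r. - u r) (\<lambda>r. - w r)"
proof -
  interpret R: radial m N "\<lambda>s. - f (- s)" "\<lambda>s. F (- s)" Mf by (rule refl_radial)
  have c: "continuous_on {0..} (\<lambda>r. - g r) \<longleftrightarrow> continuous_on {0..} g" for g :: "real \<Rightarrow> real"
    using continuous_on_minus[of "{0..}" g] continuous_on_minus[of "{0..}" "\<lambda>r. - g r"] by auto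
  have d: "((\<lambda>r. - g r) has_real_derivative D) (at r) \<longleftrightarrow> (g has_real_derivative - D) (at r)" for g D and r :: real
    using DERIV_minus[of g "- D" r UNIV] DERIV_minus[of "\<lambda>r. - g r" D r UNIV] by auto
  show ?thesis unfolding R.sol_def sol_def c d by simp
qed

lemma refl_sol': "sol u w \<Longrightarrow> radial.sol m N (\<lambda>s. - f (- s)) (\<lambda>r. - u r) (\<lambda>r. - w r)"
  unfolding refl_sol by simp

lemma refl_en: "radial.en m (\<lambda>s. F (- s)) u w r = en (\<lambda>r. - u r) (\<lambda>r. - w r) r"
proof -
  interpret R: radial m N "\<lambda>s. - f (- s)" "\<lambda>s. F (- s)" Mf by (rule refl_radial)
  show ?thesis unfolding R.en_def en_def by simp
qed

lemma u_dec:
  assumes s: "sol u w" and "0 \<le> a" "a < b" and w: "\<And>x. a < x \<Longrightarrow> x < b \<Longrightarrow> w x < 0"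
  shows "u b < u a"
proof (rule DERIV_neg_imp_decreasing_open[of a b u])
  fix x assume "a < x" "x < b"
  then show "\<exists>y. (u has_real_derivative y) (at x) \<and> y < 0"
    using sol_du[OF s, of x] w[of x] assms psi_neg by (intro exI[of _ "psi m (w x)"]) auto
qed (use assms sol_cont in auto)

lemma u_inc:
  assumes s: "sol u w" and "0 \<le> a" "a < b" and w: "\<And>x. a < x \<Longrightarrow> x < b \<Longrightarrow> 0 < w x"
  shows "u a < u b"
proof (rule DERIV_pos_imp_increasing_open[of a b u])
  fix x assume "a < x" "x < b"
  then show "\<exists>y. (u has_real_derivative y) (at x) \<and> y > 0"
    using sol_du[OF s, of x] w[of x] assms psi_pos by (intro exI[of _ "psi m (w x)"]) auto
qed (use assms sol_cont in auto)

lemma u_dec_le: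
  assumes s: "sol u w" and "0 \<le> a" "a \<le> b" and w: "\<And>x. a < x \<Longrightarrow> x < b \<Longrightarrow> w x \<le> 0"
  shows "u b \<le> u a"
proof -
  have "u b - u a \<le> 0 - 0"
    by (rule deriv_le_imp_le[where g = u and h = "\<lambda>_. 0" and g' = "\<lambda>x. psi m (w x)" and h' = "\<lambda>_. 0"])
      (use assms sol_cont[OF s] sol_du[OF s] psi_nonpos in auto)
  then show ?thesis by simp
qed

text \<open>The energy loss is the integral of \<open>(N - 1) / r * |w| * |u'|\<close>, and on a monotone arc \<open>|u'|\<close>
  integrates to the height of the arc.\<close>

lemma loss_upper:
  assumes s: "sol u w" and st: "0 < a" "a \<le> b" and sg: "\<sigma> = 1 \<or> \<sigma> = -1"
    and w: "\<And>x. a < x \<Longrightarrow> x < b \<Longrightarrow> 0 \<le> \<sigma> * w x \<and> \<bar>w x\<bar> \<le> W"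
  shows "en u w a - en u w b \<le> (real N - 1) * W / a * (\<sigma> * (u b - u a))"
proof -
  have "(- en u w b) - (- en u w a) \<le> (real N - 1) * W / a * \<sigma> * u b - (real N - 1) * W / a * \<sigma> * u a"
  proof (rule deriv_le_imp_le[where g = "\<lambda>x. - en u w x" and h = "\<lambda>x. (real N - 1) * W / a * \<sigma> * u x"
     and g' = "\<lambda>x. (real N - 1) / x * (w x * psi m (w x))" and h' = "\<lambda>x. (real N - 1) * W / a * \<sigma> * psi m (w x)"])
    fix x assume x: "a < x" "x < b"
    then have x0: "0 < x" using st by simp
    show "((\<lambda>x. - en u w x) has_real_derivative (real N - 1) / x * (w x * psi m (w x))) (at x)"
      using DERIV_minus[OF en_deriv[OF s x0]] by simp
    show "((\<lambda>x. (real N - 1) * W / a * \<sigma> * u x) has_real_derivative (real N - 1) * W / a * \<sigma> * psi m (w x)) (at x)"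
      using sol_du[OF s x0] by (rule DERIV_cmult)
    have 1: "w x * psi m (w x) = \<bar>w x\<bar> * psi m \<bar>w x\<bar>" by (cases "0 \<le> w x") auto
    have 2: "\<sigma> * psi m (w x) = psi m \<bar>w x\<bar>" using w[OF x] sg by (cases "0 \<le> w x") auto
    have "(real N - 1) / x * (w x * psi m (w x)) \<le> (real N - 1) / a * (W * psi m \<bar>w x\<bar>)"
      unfolding 1 using x st w[OF x] N2
      by (intro mult_mono divide_left_mono mult_right_mono) (auto intro!: mult_nonneg_nonneg psi_nonneg)
    then show "(real N - 1) / x * (w x * psi m (w x)) \<le> (real N - 1) * W / a * \<sigma> * psi m (w x)"
      unfolding mult.assoc 2 by simp
  qed (use st sol_cont[OF s] en_cont[OF s] in \<open>auto intro!: continuous_intros\<close>)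
  then show ?thesis by (simp add: algebra_simps)
qed

lemma loss_lower:
  assumes s: "sol u w" and st: "0 \<le> a" "a < b" and sg: "\<sigma> = 1 \<or> \<sigma> = -1"
    and w: "\<And>x. a < x \<Longrightarrow> x < b \<Longrightarrow> 0 \<le> \<sigma> * w x \<and> k \<le> \<bar>w x\<bar>" and k: "0 \<le> k"
  shows "(real N - 1) * k / b * (\<sigma> * (u b - u a)) \<le> en u w a - en u w b"
proof -
  have "(real N - 1) * k / b * \<sigma> * u b - (real N - 1) * k / b * \<sigma> * u a \<le> (- en u w b) - (- en u w a)"
  proof (rule deriv_le_imp_le[where h = "\<lambda>x. - en u w x" and g = "\<lambda>x. (real N - 1) * k / b * \<sigma> * u x"
     and h' = "\<lambda>x. (real N - 1) / x * (w x * psi m (w x))" and g' = "\<lambda>x. (real N - 1) * k / b * \<sigma> * psi m (w x)"])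
    fix x assume x: "a < x" "x < b"
    then have x0: "0 < x" using st by simp
    show "((\<lambda>x. - en u w x) has_real_derivative (real N - 1) / x * (w x * psi m (w x))) (at x)"
      using DERIV_minus[OF en_deriv[OF s x0]] by simp
    show "((\<lambda>x. (real N - 1) * k / b * \<sigma> * u x) has_real_derivative (real N - 1) * k / b * \<sigma> * psi m (w x)) (at x)"
      using sol_du[OF s x0] by (rule DERIV_cmult)
    have 1: "w x * psi m (w x) = \<bar>w x\<bar> * psi m \<bar>w x\<bar>" by (cases "0 \<le> w x") auto
    have 2: "\<sigma> * psi m (w x) = psi m \<bar>w x\<bar>" using w[OF x] sg by (cases "0 \<le> w x") auto
    have "(real N - 1) / b * (k * psi m \<bar>w x\<bar>) \<le> (real N - 1) / x * (w x * psi m (w x))"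
      unfolding 1 using x x0 w[OF x] N2 k
      by (intro mult_mono divide_left_mono mult_right_mono) (auto intro!: mult_nonneg_nonneg psi_nonneg divide_nonneg_pos)
    then show "(real N - 1) * k / b * \<sigma> * psi m (w x) \<le> (real N - 1) / x * (w x * psi m (w x))"
      unfolding mult.assoc 2 by simp
  qed (use st sol_cont[OF s] en_cont[OF s] in \<open>auto intro!: continuous_intros\<close>)
  then show ?thesis by (simp add: algebra_simps)
qed

text \<open>Where \<open>F\<close> is nonpositive, the energy is at most the kinetic energy, and by \<open>m \<le> N\<close> friction
  consumes at least the fraction \<open>1 / r\<close> of the latter per unit of length.\<close>

lemma en_weighted:
  assumes s: "sol u w" and st: "0 \<le> a" "a \<le> b" and T: "0 \<le> T"
    and F: "\<And>x. a < x \<Longrightarrow> x < b \<Longrightarrow> F (u x) \<le> 0"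
  shows "(b + T) * en u w b \<le> (a + T) * en u w a"
proof -
  have "(b + T) * en u w b - (a + T) * en u w a \<le> 0 - 0"
  proof (rule deriv_le_imp_le[where g = "\<lambda>x. (x + T) * en u w x" and h = "\<lambda>_. 0" and h' = "\<lambda>_. 0"
     and g' = "\<lambda>x. 1 * en u w x + - ((real N - 1) / x * (w x * psi m (w x))) * (x + T)"])
    fix x assume x: "a < x" "x < b"
    then have x0: "0 < x" using st by simp
    show "((\<lambda>x. (x + T) * en u w x) has_real_derivative 1 * en u w x + - ((real N - 1) / x * (w x * psi m (w x))) * (x + T)) (at x)"
      by (rule DERIV_mult[OF _ en_deriv[OF s x0]]) (auto intro!: derivative_eq_intros)
    have "1 \<le> (x + T) / x" using x0 T by simp
    moreover have "1 \<le> (real N - 1) * (m / (m - 1))"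
    proof -
      have "m - 1 \<le> (real N - 1) * m" using mN m1 mult_mono[of "m - 1" "real N - 1" 1 m] by simp
      then show ?thesis using m1 by (simp add: field_simps)
    qed
    ultimately have "1 * 1 \<le> (x + T) / x * ((real N - 1) * (m / (m - 1)))" by (intro mult_mono) auto
    then have "1 * kin m (w x) \<le> (x + T) / x * ((real N - 1) * (m / (m - 1))) * kin m (w x)"
      by (intro mult_right_mono kin_nonneg m1) simp
    also have "\<dots> = (real N - 1) / x * (w x * psi m (w x)) * (x + T)"
      unfolding mult_psi[OF m1] by simp
    finally show "1 * en u w x + - ((real N - 1) / x * (w x * psi m (w x))) * (x + T) \<le> 0"
      using F[OF x] unfolding en_def by simp
  qed (use st en_cont[OF s] in \<open>auto intro!: continuous_intros\<close>)
  then show ?thesis by simp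
qed

lemma crit_right:
  assumes s: "sol u w" and x: "0 \<le> x" "w x = 0" "0 < f (u x)"
  shows "\<exists>d>0. \<forall>r. x < r \<and> r \<le> x + d \<longrightarrow> w r < 0 \<and> u r < u x"
proof -
  have N0: "N > 0" using N2 by simp
  have cf: "continuous_on {0..} (\<lambda>r. f (u r))"
    by (rule continuous_on_compose2[OF f_cont]) (use sol_cont0[OF s] in auto)
  obtain d where d: "d > 0" "\<And>r. x \<le> r \<Longrightarrow> r \<le> x + d \<Longrightarrow> \<bar>f (u r) - f (u x)\<bar> < f (u x) / 2"
    using near_right[OF cf x(1) half_gt_zero[OF x(3)]] by blast
  have wn: "w r < 0" if r: "x < r" "r \<le> x + d" for r
  proof -
    have "f (u x) / 2 / N * (r - x) \<le> - w r"
    proof (rule w_linear(1)[OF s x(1) _ x(2), of r _ "2 * f (u x)"])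
      fix t assume t: "x \<le> t" "t \<le> r"
      then have "\<bar>f (u t) - f (u x)\<bar> < f (u x) / 2" using r by (intro d(2)) auto
      then show "f (u x) / 2 \<le> f (u t) \<and> f (u t) \<le> 2 * f (u x)" using x(3) unfolding abs_less_iff by (simp add: field_simps)
    qed (use r x in auto)
    moreover have "0 < f (u x) / 2 / N * (r - x)" using r x N0 by simp
    ultimately show ?thesis by linarith
  qed
  have "u r < u x" if "x < r" "r \<le> x + d" for r
    by (rule u_dec[OF s x(1)]) (use that wn in auto)
  then show ?thesis using wn d(1) by blast
qed

lemma crit_left:
  assumes s: "sol u w" and x: "0 < x" "w x = 0" "0 < f (u x)"
  shows "\<exists>d>0. \<forall>r. x - d < r \<and> r < x \<longrightarrow> 0 < w r"
proof -
  have "(w has_real_derivative - f (u x)) (at x)" using sol_dw[OF s x(1)] x(2) by simp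
  from DERIV_neg_dec_left[OF this] obtain d where "d > 0" "\<forall>h>0. h < d \<longrightarrow> w x < w (x - h)"
    using x by auto
  then show ?thesis using x(2) by (intro exI[of _ d]) (auto, metis add_diff_cancel_left' diff_add_cancel diff_gt_0_iff_gt diff_less_eq add.commute)
qed

end
section \<open>Arcs and tails of solutions\<close>

text \<open>The potential \<open>F\<close> is a double well: negative on \<open>(bm, bp)\<close> except for its local maximum at \<open>0\<close>,
  and increasing away from the well on both sides. Coercivity bounds \<open>u\<close> in terms of the energy.\<close>

locale shooting = radial +
  fixes bm bp :: real
  assumes bm_neg: "bm < 0" and bp_pos: "0 < bp"
    and F_neg: "\<And>s. bm < s \<Longrightarrow> s < bp \<Longrightarrow> s \<noteq> 0 \<Longrightarrow> F s < 0"
    and F_bm: "F bm = 0" and F_bp: "F bp = 0"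
    and f_pos: "\<And>s. bp < s \<Longrightarrow> 0 < f s" and f_neg: "\<And>s. s < bm \<Longrightarrow> f s < 0"
    and f_lip: "\<And>s. s < bm \<or> bp < s \<Longrightarrow>
      \<exists>e>0. \<exists>\<Lambda>. \<forall>x y. \<bar>x - s\<bar> < e \<longrightarrow> \<bar>y - s\<bar> < e \<longrightarrow> \<bar>f x - f y\<bar> \<le> \<Lambda> * \<bar>x - y\<bar>"
    and F_coercive: "\<And>c. \<exists>A>bp. c < F A" "\<And>c. \<exists>B<bm. c < F B"
begin

lemma refl_shooting: "shooting m N (\<lambda>s. - f (- s)) (\<lambda>s. F (- s)) Mf (- bp) (- bm)"
proof -
  interpret R: radial m N "\<lambda>s. - f (- s)" "\<lambda>s. F (- s)" Mf by (rule refl_radial)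
  show ?thesis
  proof
    fix s :: real assume "s < - bp \<or> - bm < s"
    then have "- s < bm \<or> bp < - s" by auto
    from f_lip[OF this] obtain e \<Lambda> where e: "e > 0" "\<And>x y. \<bar>x - - s\<bar> < e \<Longrightarrow> \<bar>y - - s\<bar> < e \<Longrightarrow> \<bar>f x - f y\<bar> \<le> \<Lambda> * \<bar>x - y\<bar>" by blast
    have "\<bar>- f (- x) - - f (- y)\<bar> \<le> \<Lambda> * \<bar>x - y\<bar>" if "\<bar>x - s\<bar> < e" "\<bar>y - s\<bar> < e" for x y
    proof -
      have "\<bar>f (- x) - f (- y)\<bar> \<le> \<Lambda> * \<bar>- x - - y\<bar>" by (rule e(2)) (use that in \<open>auto simp: abs_minus_commute\<close>)
      then show ?thesis by (simp add: abs_minus_commute)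
    qed
    then show "\<exists>e>0. \<exists>\<Lambda>. \<forall>x y. \<bar>x - s\<bar> < e \<longrightarrow> \<bar>y - s\<bar> < e \<longrightarrow> \<bar>- f (- x) - - f (- y)\<bar> \<le> \<Lambda> * \<bar>x - y\<bar>" using e(1) by blast
  next
    fix c show "\<exists>A>- bm. c < F (- A)" using F_coercive(2)[of c] by (metis neg_less_iff_less minus_minus)
  next
    fix c show "\<exists>B < - bp. c < F (- B)" using F_coercive(1)[of c] by (metis neg_less_iff_less minus_minus)
  qed (use bm_neg bp_pos F_neg F_bm F_bp f_pos f_neg in auto)
qed

lemma F_strict_mono: assumes "bp \<le> s" "s < t" shows "F s < F t"
  by (rule DERIV_pos_imp_increasing_open[of s t F]) (use assms F_deriv f_pos F_cont in \<open>auto intro!: exI conjI\<close>)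

lemma F_strict_anti: assumes "s < t" "t \<le> bm" shows "F t < F s"
  by (rule DERIV_neg_imp_decreasing_open[of s t F]) (use assms F_deriv f_neg F_cont in \<open>auto intro!: exI conjI\<close>)

lemma F_pos: "bp < s \<Longrightarrow> 0 < F s" using F_strict_mono[of bp s] F_bp by simp
lemma F_pos': "s < bm \<Longrightarrow> 0 < F s" using F_strict_anti[of s bm] F_bm by simp
lemma F_nonpos: "bm \<le> s \<Longrightarrow> s \<le> bp \<Longrightarrow> F s \<le> 0"
  using F_neg[of s] F_0 F_bm F_bp by (cases "s = bm"; cases "s = bp"; cases "s = 0") auto
lemma F_pos_imp: "0 < F s \<Longrightarrow> s < bm \<or> bp < s" using F_nonpos[of s] by linarith

lemma f_0: "f 0 = 0"
proof (rule DERIV_local_max[OF F_deriv])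
  show "0 < min (- bm) bp" using bm_neg bp_pos by simp
  show "\<forall>y. \<bar>0 - y\<bar> < min (- bm) bp \<longrightarrow> F y \<le> F 0" using F_nonpos F_0 by auto
qed

text \<open>At a critical point the whole energy is potential.\<close>

lemma crit_outside:
  assumes "w r = 0" "0 < en u w r" shows "u r < bm \<or> bp < u r"
  using assms F_pos_imp by (simp add: en_def)

text \<open>At a point of positive energy, either \<open>w\<close> does not vanish or \<open>u\<close> lies outside the well, where \<open>f\<close>
  is Lipschitz and has no zero.\<close>

lemma uniq_step:
  assumes s1: "sol u w" and s2: "sol v z" and r0: "0 \<le> r0" and e: "u r0 = v r0" "w r0 = z r0"
    and en: "0 < en u w r0"
  shows "\<exists>d>0. \<forall>r. r0 \<le> r \<and> r \<le> r0 + d \<longrightarrow> u r = v r \<and> w r = z r"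
proof -
  interpret R: shooting m N "\<lambda>s. - f (- s)" "\<lambda>s. F (- s)" Mf "- bp" "- bm" by (rule refl_shooting)
  consider "0 < w r0" | "w r0 < 0" | "w r0 = 0" by linarith
  then show ?thesis
  proof cases
    case 1
    then have "0 < r0" using r0 sol_cont0[OF s1] by (cases "r0 = 0") auto
    then show ?thesis using uniq_rising[OF s1 s2 _ e 1] by simp
  next
    case 2
    then have "0 < r0" using r0 sol_cont0[OF s1] by (cases "r0 = 0") auto
    then show ?thesis using R.uniq_rising[OF refl_sol'[OF s1] refl_sol'[OF s2], of r0] e 2 by simp
  next
    case 3
    then have o: "u r0 < bm \<or> bp < u r0" using crit_outside en by blast
    obtain e0 \<Lambda> where lip: "e0 > 0" "\<And>x y. \<bar>x - u r0\<bar> < e0 \<Longrightarrow> \<bar>y - u r0\<bar> < e0 \<Longrightarrow> \<bar>f x - f y\<bar> \<le> \<Lambda> * \<bar>x - y\<bar>"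
      using f_lip[OF o] by blast
    show ?thesis
    proof (cases "bp < u r0")
      case True
      then show ?thesis using uniq_critical[OF s1 s2 r0 e(1) 3 _ _ lip] 3 e f_pos by auto
    next
      case False
      then have lt: "u r0 < bm" using o by simp
      have "\<exists>d>0. \<forall>r. r0 \<le> r \<and> r \<le> r0 + d \<longrightarrow> - u r = - v r \<and> - w r = - z r"
      proof (rule R.uniq_critical[OF refl_sol'[OF s1] refl_sol'[OF s2] r0 _ _ _ _ lip(1)])
        show "0 < - f (- (- u r0))" using lt f_neg by simp
        fix x y assume "\<bar>x - - u r0\<bar> < e0" "\<bar>y - - u r0\<bar> < e0"
        then have "\<bar>f (- x) - f (- y)\<bar> \<le> \<Lambda> * \<bar>- x - - y\<bar>" by (intro lip(2)) auto
        then show "\<bar>- f (- x) - - f (- y)\<bar> \<le> \<Lambda> * \<bar>x - y\<bar>" by (simp add: abs_minus_commute)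
      qed (use e 3 in auto)
      then show ?thesis by simp
    qed
  qed
qed

lemma const_to_end:
  fixes g :: "real \<Rightarrow> real"
  assumes "continuous_on {0..} g" "0 < s" "\<And>r. 0 \<le> r \<Longrightarrow> r < s \<Longrightarrow> g r = 0"
  shows "g s = 0"
proof (rule continuous_constant_on_closure[of "{0..<s}" g])
  show "continuous_on (closure {0..<s}) g" using assms by (auto elim: continuous_on_subset)
qed (use assms in auto)

lemma uniq:
  assumes s1: "sol u w" and s2: "sol v z" and e: "u 0 = v 0" and R: "0 \<le> R"
    and en: "\<And>r. 0 \<le> r \<Longrightarrow> r < R \<Longrightarrow> 0 < en u w r"
  shows "\<And>r. 0 \<le> r \<Longrightarrow> r \<le> R \<Longrightarrow> u r = v r \<and> w r = z r"
proof -
  define S where "S = {t \<in> {0..R}. \<forall>r\<in>{0..t}. u r = v r \<and> w r = z r}"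
  have "0 \<in> S" using R e sol_cont0[OF s1] sol_cont0[OF s2] by (auto simp: S_def)
  have bdd: "bdd_above S" by (auto simp: S_def intro!: bdd_aboveI[of _ R])
  define s where "s = Sup S"
  have sR: "0 \<le> s" "s \<le> R" using \<open>0 \<in> S\<close> bdd unfolding s_def
    by (auto intro!: cSup_upper cSup_least simp: S_def)
  have lt: "u r = v r \<and> w r = z r" if "0 \<le> r" "r < s" for r
  proof -
    have "\<exists>t\<in>S. r < t" using that(2) \<open>0 \<in> S\<close> unfolding s_def by (intro less_cSupD) auto
    then obtain t where "t \<in> S" "r < t" by blast
    then show ?thesis using that by (auto simp: S_def)
  qed
  have at: "u s = v s \<and> w s = z s"
  proof (cases "s = 0")
    case True then show ?thesis using \<open>0 \<in> S\<close> by (auto simp: S_def)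
  next
    case False
    then have "0 < s" using sR by simp
    have "u s - v s = 0" "w s - z s = 0"
      using const_to_end[of "\<lambda>r. u r - v r", OF _ \<open>0 < s\<close>] const_to_end[of "\<lambda>r. w r - z r", OF _ \<open>0 < s\<close>]
        lt sol_cont0[OF s1] sol_cont0[OF s2] by (auto intro!: continuous_intros)
    then show ?thesis by simp
  qed
  have "s = R"
  proof (rule ccontr)
    assume "s \<noteq> R"
    then have sl: "s < R" using sR by simp
    obtain d where d: "d > 0" "\<And>r. s \<le> r \<Longrightarrow> r \<le> s + d \<Longrightarrow> u r = v r \<and> w r = z r"
      using uniq_step[OF s1 s2 sR(1)] at en[OF sR(1) sl] by blast
    have "min R (s + d) \<in> S" 
    proof -
      have "u r = v r \<and> w r = z r" if "0 \<le> r" "r \<le> s + d" for r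
        using lt[of r] d(2)[of r] that by (cases "r < s") auto
      moreover have "0 \<le> min R (s + d)" using sR R d(1) by simp
      ultimately show ?thesis unfolding S_def by simp
    qed
    then have "min R (s + d) \<le> s" unfolding s_def using bdd by (rule cSup_upper)
    then show False using sl d by auto
  qed
  then show "\<And>r. 0 \<le> r \<Longrightarrow> r \<le> R \<Longrightarrow> u r = v r \<and> w r = z r" using lt at by fastforce
qed

lemma first_en_zero:
  assumes s: "sol u w" and "0 \<le> a" "a \<le> r" "en u w r \<le> 0" "0 < en u w a"
  obtains Z where "a < Z" "Z \<le> r" "en u w Z = 0" "\<And>x. a \<le> x \<Longrightarrow> x < Z \<Longrightarrow> 0 < en u w x"
  using first_down[OF en_cont[OF s, of a r], of 0] assms by auto

text \<open>When the energy reaches \<open>0\<close> and does not become negative, it is constant from then on, and the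
  solution is at rest.\<close>

lemma uniq_nonneg:
  assumes s1: "sol u w" and s2: "sol v z" and e: "u 0 = v 0"
    and n1: "\<And>r. 0 \<le> r \<Longrightarrow> 0 \<le> en u w r" and n2: "\<And>r. 0 \<le> r \<Longrightarrow> 0 \<le> en v z r" and r: "0 \<le> r"
  shows "u r = v r \<and> w r = z r"
proof (cases "0 < en u w r")
  case True
  then have "0 < en u w x" if "0 \<le> x" "x < r" for x using en_antimono[OF s1, of x r] that by simp
  then show ?thesis using uniq[OF s1 s2 e r] r by simp
next
  case False
  obtain Z where Z: "0 \<le> Z" "Z \<le> r" "en u w Z \<le> 0" "\<And>x. 0 \<le> x \<Longrightarrow> x < Z \<Longrightarrow> 0 < en u w x"
  proof (cases "0 < en u w 0")
    case True then show ?thesis using first_en_zero[OF s1 _ r] False that by (metis linorder_not_less order_refl less_imp_le)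
  next
    case False then show ?thesis using that[of 0] r by auto
  qed
  have Ze: "u Z = v Z" "w Z = z Z" using uniq[OF s1 s2 e Z(1,4)] Z(1) by auto
  then have eZ: "en v z Z \<le> 0" using Z(3) by (simp add: en_def)
  have c: "u x = u Z \<and> (Z < x \<longrightarrow> w x = 0)" if "Z \<le> x" "sol u w" "\<And>r. 0 \<le> r \<Longrightarrow> 0 \<le> en u w r" "en u w Z \<le> 0" for x u w
  proof -
    have "en u w (x + 1) \<le> en u w Z" using that(1) by (intro en_antimono[OF that(2) Z(1)]) simp
    moreover have "0 \<le> en u w (x + 1)" using that(1) Z(1) by (intro that(3)) simp
    ultimately have e: "en u w Z = en u w (x + 1)" using that(4) by linarith
    have "u x = u Z" by (rule en_const_imp(1)[OF that(2) Z(1) _ e]) (use that(1) in auto)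
    moreover have "w x = 0" if "Z < x" by (rule en_const_imp(2)[OF \<open>sol u w\<close> Z(1) _ e]) (use that in auto)
    ultimately show ?thesis by blast
  qed
  show ?thesis
  proof (cases "r = Z")
    case True then show ?thesis using Ze by simp
  next
    case False
    then show ?thesis using c[OF Z(2) s1 n1 Z(3)] c[OF Z(2) s2 n2 eZ] Ze Z(2) by auto
  qed
qed

text \<open>Critical points with positive energy on a nonnegative arc lie above \<open>bp\<close>, where \<open>f > 0\<close> makes
  them strict maxima. So a solution that moves down cannot turn upwards before it becomes
  negative.\<close>

lemma descent:
  assumes s: "sol u w" and st: "0 \<le> s" "s < t" and u: "\<And>x. s \<le> x \<Longrightarrow> x \<le> t \<Longrightarrow> 0 \<le> u x"
    and en: "0 < en u w t" and w: "w s \<le> 0"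
  shows "w t < 0"
proof (rule ccontr)
  assume "\<not> w t < 0"
  then have wt: "0 \<le> w t" by simp
  obtain x where x: "s \<le> x" "x \<le> t" "\<And>y. s \<le> y \<Longrightarrow> y \<le> t \<Longrightarrow> u x \<le> u y"
    using continuous_attains_inf[OF compact_Icc _ sol_cont(1)[OF s st(1)], of t] st by auto
  have wx: "w x = 0"
  proof -
    consider "x = s" | "x = t" | "s < x" "x < t" using x by linarith
    then show ?thesis
    proof cases
      case 1
      show ?thesis
      proof (rule ccontr)
        assume "w x \<noteq> 0"
        then have wn: "w s < 0" using w 1 by simp
        then have s0: "0 < s" using st sol_cont0[OF s] by (cases "s = 0") auto
        from DERIV_neg_dec_right[OF sol_du[OF s s0] psi_neg[OF wn]]
        obtain d where d: "d > 0" "\<And>h. 0 < h \<Longrightarrow> h < d \<Longrightarrow> u (s + h) < u s" by blast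
        define h where "h = min (d / 2) (t - s)"
        have "0 < h" "h < d" "s + h \<le> t" using d st by (auto simp: h_def)
        then show False using d(2)[of h] x(3)[of "s + h"] 1 by auto
      qed
    next
      case 2
      have t0: "0 < t" using st by simp
      show ?thesis
      proof (rule ccontr)
        assume "w x \<noteq> 0"
        then have wp: "0 < w t" using wt 2 by simp
        from DERIV_pos_inc_left[OF sol_du[OF s t0] psi_pos[OF wp]]
        obtain d where d: "d > 0" "\<And>h. 0 < h \<Longrightarrow> h < d \<Longrightarrow> u (t - h) < u t" by blast
        define h where "h = min (d / 2) (t - s)"
        have "0 < h" "h < d" "s \<le> t - h" using d st by (auto simp: h_def)
        then show False using d(2)[of h] x(3)[of "t - h"] 2 by auto
      qed
    next
      case 3
      have x0: "0 < x" using 3 st by simp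
      have "psi m (w x) = 0"
      proof (rule DERIV_local_min[OF sol_du[OF s x0]])
        show "0 < min (x - s) (t - x)" using 3 by simp
        show "\<forall>y. \<bar>x - y\<bar> < min (x - s) (t - x) \<longrightarrow> u x \<le> u y" using x(3) by (auto simp: abs_less_iff)
      qed
      then show ?thesis by simp
    qed
  qed
  have ex: "0 < en u w x" using en_antimono[OF s, of x t] x st en by simp
  then have "bp < u x" using crit_outside[where w = w and u = u, OF wx] u[of x] x bm_neg by fastforce
  then have fx: "0 < f (u x)" by (rule f_pos)
  show False
  proof (cases "x < t")
    case True
    obtain d where d: "d > 0" "\<And>r. x < r \<Longrightarrow> r \<le> x + d \<Longrightarrow> u r < u x"
      using crit_right[OF s _ wx fx] x st by auto
    define r where "r = min (x + d) t"
    have "x < r" "r \<le> x + d" "r \<le> t" using d True by (auto simp: r_def)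
    then show False using d(2)[of r] x(1) x(3)[of r] by auto
  next
    case False
    then have xt: "x = t" using x by simp
    obtain d where d: "d > 0" "\<And>r. t - d < r \<Longrightarrow> r < t \<Longrightarrow> 0 < w r"
      using crit_left[OF s _ wx fx] xt st by auto
    define r where "r = max (t - d / 2) s"
    have r: "s \<le> r" "t - d < r" "r < t" using d st by (auto simp: r_def)
    have "u r < u t" by (rule u_inc[OF s]) (use r st d in auto)
    then show False using x(3)[of r] r xt by auto
  qed
qed

lemma u_bounded:
  assumes s: "sol u w" obtains B where "\<And>r. 0 \<le> r \<Longrightarrow> \<bar>u r\<bar> \<le> B"
proof -
  obtain A where A: "A > bp" "F (u 0) < F A" using F_coercive(1) by blast
  obtain C where C: "C < bm" "F (u 0) < F C" using F_coercive(2) by blast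
  have le: "F (u r) \<le> F (u 0)" if "0 \<le> r" for r
    using F_le_en[of u r w] en_antimono[OF s, of 0 r] en_0[OF s] that by simp
  have "u r \<le> A" if "0 \<le> r" for r
    using le[OF that] A F_strict_mono[of A "u r"] by (meson less_imp_le not_le order.strict_trans1 order.asym less_le_trans)
  moreover have "C \<le> u r" if "0 \<le> r" for r
    using le[OF that] C F_strict_anti[of "u r" C] by (meson less_imp_le not_le order.strict_trans1 order.asym less_le_trans)
  ultimately have "\<bar>u r\<bar> \<le> max \<bar>A\<bar> \<bar>C\<bar>" if "0 \<le> r" for r using that by (smt (verit))
  then show ?thesis using that by blast
qed

text \<open>A bounded monotone \<open>u\<close> converges to some \<open>l\<close>, and then \<open>w\<close> tends to \<open>0\<close> and \<open>f l = 0\<close>. The energy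
  at \<open>r\<close> is what is lost after \<open>r\<close>; as \<open>|w| \<le> 1\<close> there, this is at most \<open>(N - 1) / r * (u r -
  l)\<close>, which shows that even \<open>r * en\<close> tends to \<open>0\<close>.\<close>

lemma tail_limit_dec:
  assumes s: "sol u w" and n: "\<And>r. 0 \<le> r \<Longrightarrow> 0 \<le> en u w r"
    and R0: "0 < R0" and w: "\<And>r. R0 \<le> r \<Longrightarrow> w r \<le> 0"
  shows "\<exists>l. (u \<longlongrightarrow> l) at_top \<and> (en u w \<longlongrightarrow> 0) at_top \<and> ((\<lambda>r. r * en u w r) \<longlongrightarrow> 0) at_top \<and> f l = 0 \<and> F l = 0"
proof -
  obtain B where B: "\<And>r. 0 \<le> r \<Longrightarrow> \<bar>u r\<bar> \<le> B" using u_bounded[OF s] by blast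
  have "\<exists>l. (u \<longlongrightarrow> l) at_top \<and> (\<forall>r\<ge>R0. l \<le> u r)"
  proof (rule decreasing_converges[where b = "- B"])
    show "u b \<le> u a" if "R0 \<le> a" "a \<le> b" for a b by (rule u_dec_le[OF s]) (use that R0 w in auto)
    show "- B \<le> u r" if "R0 \<le> r" for r using B[of r] that R0 by auto
  qed
  then obtain l where l: "(u \<longlongrightarrow> l) at_top" "\<And>r. R0 \<le> r \<Longrightarrow> l \<le> u r" by blast
  have "\<exists>E. (en u w \<longlongrightarrow> E) at_top \<and> (\<forall>r\<ge>0. E \<le> en u w r)"
    by (rule decreasing_converges[where b = 0]) (use n en_antimono[OF s] in auto)
  then obtain E where E: "(en u w \<longlongrightarrow> E) at_top" "\<And>r. 0 \<le> r \<Longrightarrow> E \<le> en u w r" by blast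
  have sh: "((\<lambda>r. g (r + 1)) \<longlongrightarrow> c) at_top" if "(g \<longlongrightarrow> c) at_top" for g :: "real \<Rightarrow> real" and c
    using filterlim_compose[OF that filterlim_tendsto_add_at_top[OF tendsto_const filterlim_ident], of 1] by (simp add: add.commute)
  have Fl: "((\<lambda>r. F (u r)) \<longlongrightarrow> F l) at_top"
    using F_deriv DERIV_isCont l(1) isCont_tendsto_compose by blast
  have fl: "((\<lambda>r. f (u r)) \<longlongrightarrow> f l) at_top"
    using f_cont l(1) by (metis continuous_on_eq_continuous_at isCont_tendsto_compose open_UNIV UNIV_I)
  define k where "k = E - F l"
  have kl: "((\<lambda>r. kin m (w r)) \<longlongrightarrow> k) at_top"
  proof -
    have "((\<lambda>r. en u w r - F (u r)) \<longlongrightarrow> k) at_top" unfolding k_def by (intro tendsto_intros E Fl)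
    then show ?thesis by (simp add: en_def)
  qed
  \<comment> \<open>otherwise \<open>u\<close> would drop by a fixed amount on every interval of length one\<close>
  have k0: "k = 0"
  proof (rule ccontr)
    assume "k \<noteq> 0"
    moreover have "0 \<le> k" by (rule tendsto_lowerbound[OF kl]) (auto simp: kin_nonneg[OF m1])
    ultimately have "0 < k" by simp
    then obtain c where c: "0 < c" "kin m c < k" using kin_small[OF m1] by blast
    have "\<forall>\<^sub>F r in at_top. kin m c < kin m (w r)" using order_tendstoD(1)[OF kl c(2)] .
    then obtain R1 where R1: "\<And>r. R1 \<le> r \<Longrightarrow> kin m c < kin m (w r)" by (auto simp: eventually_at_top_linorder)
    have "\<forall>\<^sub>F r in at_top. u (r + 1) - u r \<le> - psi m c"
      unfolding eventually_at_top_linorder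
    proof (intro exI allI impI)
      fix r assume r: "max R0 R1 \<le> r"
      have "u (r + 1) - u r \<le> - psi m c * (r + 1) - - psi m c * r"
      proof (rule deriv_le_imp_le[where g = u and h = "\<lambda>x. - psi m c * x" and g' = "\<lambda>x. psi m (w x)" and h' = "\<lambda>_. - psi m c"])
        fix x assume x: "r < x" "x < r + 1"
        show "(u has_real_derivative psi m (w x)) (at x)" using x r R0 by (intro sol_du[OF s]) auto
        have "\<bar>c\<bar> < \<bar>w x\<bar>" by (rule kin_less_imp[OF m1]) (use R1 x r in auto)
        then have "w x < - c" using w[of x] x r c by auto
        then have "psi m (w x) \<le> psi m (- c)" by (intro psi_mono m1) simp
        then show "psi m (w x) \<le> - psi m c" by simp
      qed (use r R0 sol_cont[OF s] in \<open>auto intro!: continuous_intros derivative_eq_intros\<close>)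
      then show "u (r + 1) - u r \<le> - psi m c" by (simp add: algebra_simps)
    qed
    moreover have "((\<lambda>r. u (r + 1) - u r) \<longlongrightarrow> l - l) at_top" by (intro tendsto_intros sh l(1))
    ultimately have "l - l \<le> - psi m c" by (intro tendsto_upperbound) auto
    then show False using psi_pos[OF c(1), of m] by simp
  qed
  have wl: "(w \<longlongrightarrow> 0) at_top"
  proof (rule tendstoI)
    fix e :: real assume "0 < e"
    then have "0 < kin m e" using kin_pos[OF m1] by simp
    then have "\<forall>\<^sub>F r in at_top. kin m (w r) < kin m e" using order_tendstoD(2)[OF kl] k0 by simp
    then show "\<forall>\<^sub>F r in at_top. dist (w r) 0 < e"
    proof (rule eventually_mono)
      fix r assume "kin m (w r) < kin m e"
      from kin_less_imp[OF m1 this] show "dist (w r) 0 < e" using \<open>0 < e\<close> by (simp add: dist_real_def)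
    qed
  qed
  \<comment> \<open>otherwise \<open>w\<close> would change by a fixed amount on every interval of length one\<close>
  have f0: "f l = 0"
  proof (rule ccontr)
    assume "f l \<noteq> 0"
    define \<eta> where "\<eta> = \<bar>f l\<bar> / 2"
    have \<eta>0: "0 < \<eta>" using \<open>f l \<noteq> 0\<close> by (simp add: \<eta>_def)
    have "((\<lambda>r. (- ((real N - 1) * inverse r * w r) - f (u r)) + f l) \<longlongrightarrow> (- ((real N - 1) * 0 * 0) - f l) + f l) at_top"
      by (intro tendsto_intros wl fl tendsto_inverse_0_at_top filterlim_ident)
    then have "((\<lambda>r. (- ((real N - 1) / r * w r) - f (u r)) + f l) \<longlongrightarrow> 0) at_top" by (simp add: field_class.field_divide_inverse)
    from tendstoD[OF this \<eta>0] obtain R1 where R1: "\<And>r. R1 \<le> r \<Longrightarrow> \<bar>(- ((real N - 1) / r * w r) - f (u r)) + f l\<bar> < \<eta>"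
      by (auto simp: eventually_at_top_linorder dist_real_def)
    have "\<forall>\<^sub>F r in at_top. \<bar>(w (r + 1) - w r) + f l\<bar> \<le> \<eta>"
      unfolding eventually_at_top_linorder
    proof (intro exI allI impI)
      fix r assume r: "max R0 R1 \<le> r"
      have "\<bar>(w (r + 1) + f l * (r + 1)) - (w r + f l * r)\<bar> \<le> \<eta> * ((r + 1) - r)"
      proof (rule deriv_bound_imp_le[where g' = "\<lambda>x. (- ((real N - 1) / x * w x) - f (u x)) + f l"])
        fix x assume x: "r < x" "x < r + 1"
        then have x0: "0 < x" using r R0 by simp
        show "((\<lambda>x. w x + f l * x) has_real_derivative (- ((real N - 1) / x * w x) - f (u x)) + f l) (at x)"
          by (intro DERIV_add sol_dw[OF s x0]) (auto intro!: derivative_eq_intros)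
        show "\<bar>(- ((real N - 1) / x * w x) - f (u x)) + f l\<bar> \<le> \<eta>" using R1[of x] x r by auto
      qed (use r R0 sol_cont[OF s] in \<open>auto intro!: continuous_intros\<close>)
      then show "\<bar>(w (r + 1) - w r) + f l\<bar> \<le> \<eta>" by (simp add: algebra_simps)
    qed
    moreover have "((\<lambda>r. \<bar>(w (r + 1) - w r) + f l\<bar>) \<longlongrightarrow> \<bar>(0 - 0) + f l\<bar>) at_top" by (intro tendsto_intros sh wl)
    ultimately have "\<bar>(0 - 0) + f l\<bar> \<le> \<eta>" by (intro tendsto_upperbound) auto
    then show False using \<open>f l \<noteq> 0\<close> by (simp add: \<eta>_def)
  qed
  have "\<forall>\<^sub>F r in at_top. 0 \<le> en u w r" unfolding eventually_at_top_linorder using n by blast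
  then have "0 \<le> E" by (rule tendsto_lowerbound[OF E(1)]) simp
  moreover have "F l \<le> 0"
  proof (rule F_nonpos)
    show "bm \<le> l" by (rule ccontr) (use f0 f_neg[of l] in auto)
    show "l \<le> bp" by (rule ccontr) (use f0 f_pos[of l] in auto)
  qed
  ultimately have E0: "E = 0" "F l = 0" using k0 by (auto simp: k_def)
  obtain R1 where R1: "\<And>r. R1 \<le> r \<Longrightarrow> \<bar>w r\<bar> < 1"
    using tendstoD[OF wl, of 1] by (auto simp: eventually_at_top_linorder dist_real_def)
  have le: "r * en u w r \<le> (real N - 1) * (u r - l)" if r: "max R0 R1 \<le> r" for r
  proof -
    have r0: "0 < r" using r R0 by simp
    have up: "en u w r \<le> en u w t + (real N - 1) / r * (u r - u t)" if "r \<le> t" for t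
    proof -
      have "en u w r - en u w t \<le> (real N - 1) * 1 / r * (-1 * (u t - u r))"
      proof (rule loss_upper[OF s r0 that])
        fix x assume "r < x" "x < t"
        then show "0 \<le> -1 * w x \<and> \<bar>w x\<bar> \<le> 1" using R1[of x] w[of x] r by auto
      qed auto
      then show ?thesis by (simp add: algebra_simps)
    qed
    have "((\<lambda>t. en u w t + (real N - 1) / r * (u r - u t)) \<longlongrightarrow> E + (real N - 1) / r * (u r - l)) at_top"
      by (intro tendsto_intros E l)
    moreover have "\<forall>\<^sub>F t in at_top. en u w r \<le> en u w t + (real N - 1) / r * (u r - u t)"
      unfolding eventually_at_top_linorder using up by blast
    ultimately have "en u w r \<le> E + (real N - 1) / r * (u r - l)"
      by (rule tendsto_lowerbound) simp
    then show ?thesis using r0 E0 by (simp add: field_simps)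
  qed
  have "((\<lambda>r. r * en u w r) \<longlongrightarrow> 0) at_top"
  proof (rule tendsto_sandwich)
    show "\<forall>\<^sub>F r in at_top. 0 \<le> r * en u w r"
      unfolding eventually_at_top_linorder by (intro exI[of _ 0] allI impI mult_nonneg_nonneg n)
    show "\<forall>\<^sub>F r in at_top. r * en u w r \<le> (real N - 1) * (u r - l)" unfolding eventually_at_top_linorder using le by blast
    have "((\<lambda>r. (real N - 1) * (u r - l)) \<longlongrightarrow> (real N - 1) * (l - l)) at_top" by (intro tendsto_intros l)
    then show "((\<lambda>r. (real N - 1) * (u r - l)) \<longlongrightarrow> 0) at_top" by simp
  qed simp
  then show ?thesis using l(1) E(1) E0 f0 by blast
qed

lemma tail_mono_pos:
  assumes s: "sol u w" and R: "0 \<le> R" and n: "\<And>r. R \<le> r \<Longrightarrow> 0 < en u w r" and u: "\<And>r. R \<le> r \<Longrightarrow> 0 \<le> u r"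
  shows "\<exists>R0>0. (\<forall>r\<ge>R0. w r \<le> 0) \<or> (\<forall>r\<ge>R0. 0 \<le> w r)"
proof (cases "\<exists>x\<ge>R. w x \<le> 0")
  case True
  then obtain x where x: "x \<ge> R" "w x \<le> 0" by blast
  have "w r \<le> 0" if "x + 1 \<le> r" for r
    using descent[OF s, of x r] x R u n that by (smt (verit))
  then show ?thesis using x R by (intro exI[of _ "x + 1"]) auto
next
  case False
  then have "0 \<le> w r" if "R + 1 \<le> r" for r using that by (meson add_increasing2 le_add_same_cancel1 linear order_trans zero_le_one)
  then show ?thesis using R by (intro exI[of _ "R + 1"]) auto
qed

text \<open>After the last crossing, \<open>u\<close> has a constant sign and \<open>descent\<close> permits at most one change of
  direction. If the energy vanishes at some radius, the solution rests from then on.\<close>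

lemma tail_mono:
  assumes s: "sol u w" and n: "\<And>r. 0 \<le> r \<Longrightarrow> 0 \<le> en u w r"
    and fin: "finite {r. 0 < r \<and> u r = 0 \<and> w r \<noteq> 0}"
  shows "\<exists>R0>0. (\<forall>r\<ge>R0. w r \<le> 0) \<or> (\<forall>r\<ge>R0. 0 \<le> w r)"
proof (cases "\<exists>r\<ge>0. en u w r \<le> 0")
  case True
  then obtain r where r: "r \<ge> 0" "en u w r \<le> 0" by blast
  have "w x = 0" if "r + 1 \<le> x" for x
  proof -
    have "en u w r = en u w (x + 1)" using en_antimono[OF s, of r "x+1"] that r n[of "x+1"] by auto
    then show ?thesis using en_const_imp(2)[OF s r(1), of "x+1" x] that by auto
  qed
  then show ?thesis using r by (intro exI[of _ "r + 1"]) auto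
next
  case False
  then have p: "0 < en u w r" if "0 \<le> r" for r using that by fastforce
  have z: "w r \<noteq> 0" if "0 \<le> r" "u r = 0" for r using p[OF that(1)] that(2) F_0 by (auto simp: en_def)
  obtain R where R: "0 \<le> R" "\<And>r. R \<le> r \<Longrightarrow> u r \<noteq> 0"
  proof -
    obtain b where b: "\<And>r. r \<in> {r. 0 < r \<and> u r = 0 \<and> w r \<noteq> 0} \<Longrightarrow> r \<le> b"
      using bdd_above_finite[OF fin] unfolding bdd_above_def by blast
    have "u r \<noteq> 0" if "\<bar>b\<bar> + 1 \<le> r" for r using b[of r] z[of r] that by force
    then show ?thesis using that[of "\<bar>b\<bar> + 1"] by auto
  qed
  have "(\<forall>r\<ge>R. 0 \<le> u r) \<or> (\<forall>r\<ge>R. u r \<le> 0)"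
  proof (rule ccontr)
    assume "\<not> ?thesis"
    then obtain a b where ab: "R \<le> a" "u a < 0" "R \<le> b" "0 < u b" by (auto simp: not_le)
    have "\<exists>x\<ge>min a b. x \<le> max a b \<and> u x = 0"
    proof (cases "a \<le> b")
      case True
      then show ?thesis using IVT'[of u a 0 b] ab R sol_cont(1)[OF s] by (auto simp: min_def max_def)
    next
      case False
      then show ?thesis using IVT2'[of u a 0 b] ab R sol_cont(1)[OF s] by (auto simp: min_def max_def)
    qed
    then show False using R(2) ab by (metis min_def order_trans)
  qed
  then show ?thesis
  proof
    assume "\<forall>r\<ge>R. 0 \<le> u r"
    then show ?thesis using tail_mono_pos[OF s R(1) p] R(1) by force
  next
    assume a: "\<forall>r\<ge>R. u r \<le> 0"
    interpret R: shooting m N "\<lambda>s. - f (- s)" "\<lambda>s. F (- s)" Mf "- bp" "- bm" by (rule refl_shooting)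
    have "\<exists>R0>0. (\<forall>r\<ge>R0. - w r \<le> 0) \<or> (\<forall>r\<ge>R0. 0 \<le> - w r)"
      by (rule R.tail_mono_pos[OF refl_sol'[OF s] R(1)]) (use a p R(1) in \<open>auto simp: refl_en\<close>)
    then show ?thesis by auto
  qed
qed

lemma tail_limit_signed:
  assumes s: "sol u w" and n: "\<And>r. 0 \<le> r \<Longrightarrow> 0 \<le> en u w r"
    and R0: "R0 > 0" "(\<forall>r\<ge>R0. w r \<le> 0) \<or> (\<forall>r\<ge>R0. 0 \<le> w r)"
  shows "\<exists>l. (u \<longlongrightarrow> l) at_top \<and> (en u w \<longlongrightarrow> 0) at_top \<and> ((\<lambda>r. r * en u w r) \<longlongrightarrow> 0) at_top \<and> f l = 0 \<and> F l = 0"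
  using R0(2)
proof
  assume "\<forall>r\<ge>R0. w r \<le> 0"
  then show ?thesis using tail_limit_dec[OF s n R0(1)] by blast
next
  assume a: "\<forall>r\<ge>R0. 0 \<le> w r"
  interpret R: shooting m N "\<lambda>s. - f (- s)" "\<lambda>s. F (- s)" Mf "- bp" "- bm" by (rule refl_shooting)
  have e: "R.en (\<lambda>r. - u r) (\<lambda>r. - w r) = en u w" by (rule ext) (simp add: refl_en)
  obtain l where l: "((\<lambda>r. - u r) \<longlongrightarrow> l) at_top" "(en u w \<longlongrightarrow> 0) at_top" "((\<lambda>r. r * en u w r) \<longlongrightarrow> 0) at_top"
    "- f (- l) = 0" "F (- l) = 0"
    using R.tail_limit_dec[OF refl_sol'[OF s] _ R0(1)] a n unfolding e by auto
  have "(u \<longlongrightarrow> - l) at_top" using tendsto_minus[OF l(1)] by simp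
  then show ?thesis using l by auto
qed

theorem tail_limit:
  assumes s: "sol u w" and n: "\<And>r. 0 \<le> r \<Longrightarrow> 0 \<le> en u w r"
    and fin: "finite {r. 0 < r \<and> u r = 0 \<and> w r \<noteq> 0}"
  obtains l where "(u \<longlongrightarrow> l) at_top" "(en u w \<longlongrightarrow> 0) at_top" "((\<lambda>r. r * en u w r) \<longlongrightarrow> 0) at_top"
    "f l = 0" "l = 0 \<or> l = bm \<or> l = bp"
proof -
  obtain R0 where R0: "R0 > 0" "(\<forall>r\<ge>R0. w r \<le> 0) \<or> (\<forall>r\<ge>R0. 0 \<le> w r)" using tail_mono[OF assms] by blast
  obtain l where l: "(u \<longlongrightarrow> l) at_top" "(en u w \<longlongrightarrow> 0) at_top" "((\<lambda>r. r * en u w r) \<longlongrightarrow> 0) at_top" "f l = 0" "F l = 0"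
    using tail_limit_signed[OF s n R0] by blast
  have "l = 0 \<or> l = bm \<or> l = bp"
    using l(5) F_neg[of l] F_pos[of l] F_pos'[of l] by (metis less_irrefl linorder_neqE_linordered_idom)
  then show ?thesis using that l by blast
qed

end
section \<open>Energy loss in the well and levels close to its edge\<close>

text \<open>The speed \<open>|u'|\<close> in terms of the kinetic energy.\<close>

lemma psi_of_kin:
  assumes m: "1 < m" and "0 \<le> x" "0 \<le> e" "e \<le> kin m x"
  shows "(m / (m - 1) * e) powr (1 / m) \<le> psi m x"
proof -
  have "m / (m - 1) * e \<le> m / (m - 1) * kin m x" using assms by (intro mult_left_mono) auto
  also have "\<dots> = x powr (m / (m - 1))" using assms by (simp add: kin_def)
  finally have "(m / (m - 1) * e) powr (1 / m) \<le> (x powr (m / (m - 1))) powr (1 / m)"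
    using assms by (intro powr_mono2) auto
  also have "\<dots> = psi m x" using assms by (simp add: powr_powr psi_of_pos)
  finally show ?thesis .
qed

text \<open>Separation of variables: \<open>D powr ((m - 1) / m)\<close> has derivative at least \<open>(m - 1) / m * \<kappa> powr (1
  / m)\<close>. In the applications \<open>D\<close> is the distance from a level that is left with no or small
  speed, so \<open>D a = 0\<close> has to be admitted.\<close>

lemma speed_up:
  fixes D :: "real \<Rightarrow> real"
  assumes m: "1 < m" and ab: "a \<le> b" and c: "continuous_on {a..b} D" and Da: "0 \<le> D a"
    and d: "\<And>t. a < t \<Longrightarrow> t < b \<Longrightarrow> (D has_real_derivative D' t) (at t)"
    and g: "\<And>t. a < t \<Longrightarrow> t < b \<Longrightarrow> 0 < D t \<and> (\<kappa> * D t) powr (1 / m) \<le> D' t" and k: "0 \<le> \<kappa>"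
  shows "(m - 1) / m * \<kappa> powr (1 / m) * (b - a) \<le> D b powr ((m - 1) / m)"
proof (cases "a = b")
  case True then show ?thesis by simp
next
  case False
  then have ab': "a < b" using ab by simp
  have Db: "0 \<le> D b"
  proof (rule continuous_ge_on_closure[of "{a<..<b}" D b 0])
    show "continuous_on (closure {a<..<b}) D" using c ab' by simp
    show "b \<in> closure {a<..<b}" using ab' by simp
  qed (use g in \<open>auto intro: less_imp_le\<close>)
  have D0: "0 \<le> D t" if "a \<le> t" "t \<le> b" for t
    using g[of t] Da Db that by (cases "t = a"; cases "t = b") (auto intro: less_imp_le)
  have "(m - 1) / m * \<kappa> powr (1 / m) * b - (m - 1) / m * \<kappa> powr (1 / m) * a \<le> D b powr ((m - 1) / m) - D a powr ((m - 1) / m)"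
  proof (rule deriv_le_imp_le[where g = "\<lambda>t. (m - 1) / m * \<kappa> powr (1 / m) * t" and h = "\<lambda>t. D t powr ((m - 1) / m)"
     and g' = "\<lambda>_. (m - 1) / m * \<kappa> powr (1 / m)" and h' = "\<lambda>t. (m - 1) / m * D t powr ((m - 1) / m - 1) * D' t"])
    show "continuous_on {a..b} (\<lambda>t. D t powr ((m - 1) / m))"
      using D0 m by (intro continuous_on_powr' c continuous_intros) auto
    fix t assume t: "a < t" "t < b"
    show "((\<lambda>t. D t powr ((m - 1) / m)) has_real_derivative (m - 1) / m * D t powr ((m - 1) / m - 1) * D' t) (at t)"
      using g[OF t] d[OF t] by (auto intro!: derivative_eq_intros)
    have e: "(m - 1) / m - 1 = - (1 / m)" using m by (simp add: field_simps)
    have "\<kappa> powr (1 / m) = D t powr (- (1 / m)) * (\<kappa> * D t) powr (1 / m)"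
      using g[OF t] k by (simp add: powr_mult powr_minus field_simps)
    also have "\<dots> \<le> D t powr (- (1 / m)) * D' t" using g[OF t] by (intro mult_left_mono) auto
    finally show "(m - 1) / m * \<kappa> powr (1 / m) \<le> (m - 1) / m * D t powr ((m - 1) / m - 1) * D' t"
      unfolding e mult.assoc using m by (intro mult_left_mono) auto
  qed (use ab m in \<open>auto intro!: continuous_intros derivative_eq_intros\<close>)
  moreover have "0 \<le> D a powr ((m - 1) / m)" by simp
  ultimately show ?thesis unfolding right_diff_distrib by linarith
qed

context shooting begin

text \<open>In the well, \<open>(r + T) * en\<close> is nonincreasing by \<open>en_weighted\<close>. A traversal between \<open>bp / 3\<close> and
  \<open>2 * bp / 3\<close>, in either direction, or of the mirror image on the negative side, takes a bounded
  time \<open>T\<close> and costs energy of order \<open>1 / r\<close>. Therefore any such traversal, however late, bounds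
  the weighted energy at the earlier radius \<open>\<rho>\<close> from below.\<close>

definition zone :: "real \<Rightarrow> real \<Rightarrow> bool" where
  "zone T c \<longleftrightarrow> 0 \<le> T \<and> 0 < c \<and> (\<forall>u w \<rho> x y. sol u w \<and> 0 \<le> \<rho> \<and> \<rho> \<le> x \<and> \<rho> \<le> y \<and>
     (\<forall>r. \<rho> \<le> r \<and> r \<le> max x y \<longrightarrow> bm \<le> u r \<and> u r \<le> bp) \<and> 0 \<le> en u w (max x y) \<and>
     (u x \<le> bp / 3 \<and> 2 * bp / 3 \<le> u y \<or> bm / 3 \<le> u x \<and> u y \<le> 2 * bm / 3) \<longrightarrow>
     c \<le> (\<rho> + T) * en u w \<rho>)"

lemma pass_between:
  fixes g :: "real \<Rightarrow> real"
  assumes c: "continuous_on {l..max x y} g" and l: "l \<le> x" "l \<le> y" and ab: "a < b" and g: "g x \<le> a" "b \<le> g y"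
  shows "\<exists>s1 s2. l \<le> s1 \<and> s1 < s2 \<and> s2 \<le> max x y \<and> (\<forall>r. s1 \<le> r \<and> r \<le> s2 \<longrightarrow> a \<le> g r \<and> g r \<le> b) \<and>
     (g s1 = a \<and> g s2 = b \<or> g s1 = b \<and> g s2 = a)"
proof (cases "x \<le> y")
  case True
  have c1: "continuous_on {x..y} g" by (rule continuous_on_subset[OF c]) (use l in auto)
  obtain s2 where s2: "x < s2" "s2 \<le> y" "g s2 = b" "\<And>r. x \<le> r \<Longrightarrow> r < s2 \<Longrightarrow> g r < b"
    using first_up[OF c1 True, of b] g ab by auto
  have c2: "continuous_on {x..s2} g" by (rule continuous_on_subset[OF c1]) (use s2 in auto)
  obtain s1 where s1: "x \<le> s1" "s1 < s2" "g s1 = a" "\<And>r. s1 < r \<Longrightarrow> r \<le> s2 \<Longrightarrow> a < g r"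
    using last_up[OF c2, of a] s2 g ab by auto
  have "a \<le> g r \<and> g r \<le> b" if "s1 \<le> r" "r \<le> s2" for r
    using s1(4)[of r] s2(4)[of r] s1(1-3) s2(3) that ab by (cases "r = s1"; cases "r = s2") auto
  then show ?thesis using s1 s2 l True by (intro exI[of _ s1] exI[of _ s2]) auto
next
  case False
  then have yx: "y \<le> x" by simp
  have c1: "continuous_on {y..x} g" by (rule continuous_on_subset[OF c]) (use l in auto)
  obtain s2 where s2: "y < s2" "s2 \<le> x" "g s2 = a" "\<And>r. y \<le> r \<Longrightarrow> r < s2 \<Longrightarrow> a < g r"
    using first_down[OF c1 yx, of a] g ab by auto
  have c2: "continuous_on {y..s2} g" by (rule continuous_on_subset[OF c1]) (use s2 in auto)
  obtain s1 where s1: "y \<le> s1" "s1 < s2" "g s1 = b" "\<And>r. s1 < r \<Longrightarrow> r \<le> s2 \<Longrightarrow> g r < b"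
    using last_down[OF c2, of b] s2 g ab by auto
  have "a \<le> g r \<and> g r \<le> b" if "s1 \<le> r" "r \<le> s2" for r
    using s1(4)[of r] s2(4)[of r] s1(1-3) s2(3) that ab by (cases "r = s1"; cases "r = s2") auto
  then show ?thesis using s1 s2 l False by (intro exI[of _ s1] exI[of _ s2]) auto
qed

lemma sign_const:
  fixes g :: "real \<Rightarrow> real"
  assumes c: "continuous_on {a..b} g" and "a \<le> b" and n: "\<And>x. a \<le> x \<Longrightarrow> x \<le> b \<Longrightarrow> g x \<noteq> 0"
  shows "\<exists>\<sigma>. (\<sigma> = 1 \<or> \<sigma> = -1) \<and> (\<forall>x. a \<le> x \<and> x \<le> b \<longrightarrow> 0 \<le> \<sigma> * g x)"
proof (cases "0 < g a")
  case True
  have "0 \<le> g x" if "a \<le> x" "x \<le> b" for x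
  proof (rule ccontr)
    assume "\<not> 0 \<le> g x"
    then have "\<exists>y\<ge>a. y \<le> x \<and> g y = 0"
      using True that by (intro IVT2' continuous_on_subset[OF c]) auto
    then show False using n that by auto
  qed
  then show ?thesis by (intro exI[of _ 1]) auto
next
  case False
  have "g x \<le> 0" if "a \<le> x" "x \<le> b" for x
  proof (rule ccontr)
    assume "\<not> g x \<le> 0"
    then have "\<exists>y\<ge>a. y \<le> x \<and> g y = 0"
      using False that by (intro IVT' continuous_on_subset[OF c]) auto
    then show False using n that by auto
  qed
  then show ?thesis by (intro exI[of _ "-1"]) auto
qed

text \<open>Between the two levels the potential is at most a negative constant, so nonnegative energy forces
  \<open>|w| \<ge> k\<close>. This limits the time of the traversal, and by \<open>loss_lower\<close> it makes the loss at
  least \<open>(N - 1) k / r\<close> times the height.\<close>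

lemma zone_pos:
  "\<exists>T c. 0 \<le> T \<and> 0 < c \<and> (\<forall>u w \<rho> x y. sol u w \<and> 0 \<le> \<rho> \<and> \<rho> \<le> x \<and> \<rho> \<le> y \<and>
     (\<forall>r. \<rho> \<le> r \<and> r \<le> max x y \<longrightarrow> bm \<le> u r \<and> u r \<le> bp) \<and> 0 \<le> en u w (max x y) \<and>
     u x \<le> bp / 3 \<and> 2 * bp / 3 \<le> u y \<longrightarrow> c \<le> (\<rho> + T) * en u w \<rho>)"
proof -
  define a where "a = bp / 3"
  define b where "b = 2 * bp / 3"
  have ab: "0 < a" "a < b" "b < bp" using bp_pos by (auto simp: a_def b_def)
  obtain x0 where x0: "x0 \<in> {a..b}" "\<And>y. y \<in> {a..b} \<Longrightarrow> F y \<le> F x0"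
    using continuous_attains_sup[OF compact_Icc _ F_cont, of a b] ab by auto
  have "F x0 < 0" using x0(1) ab bm_neg by (intro F_neg) auto
  then obtain k where k: "0 < k" "kin m k < - F x0" using kin_small[OF m1, of "- F x0"] by auto
  have pk: "0 < psi m k" using k by (simp add: psi_pos)
  define T where "T = (b - a) / psi m k"
  define c where "c = (real N - 1) * k * (b - a)"
  have T0: "0 \<le> T" using pk ab by (simp add: T_def)
  have c0: "0 < c" using k ab N2 by (simp add: c_def)
  have main: "c \<le> (\<rho> + T) * en u w \<rho>"
    if s: "sol u w" and r: "0 \<le> \<rho>" "\<rho> \<le> x" "\<rho> \<le> y"
      and rng: "\<And>r. \<rho> \<le> r \<Longrightarrow> r \<le> max x y \<Longrightarrow> bm \<le> u r \<and> u r \<le> bp" and e: "0 \<le> en u w (max x y)"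
      and xy: "u x \<le> a" "b \<le> u y" for u w \<rho> x y
  proof -
    obtain s1 s2 where s12: "\<rho> \<le> s1" "s1 < s2" "s2 \<le> max x y" "\<And>r. s1 \<le> r \<Longrightarrow> r \<le> s2 \<Longrightarrow> a \<le> u r \<and> u r \<le> b"
      "u s1 = a \<and> u s2 = b \<or> u s1 = b \<and> u s2 = a"
      using pass_between[OF sol_cont(1)[OF s r(1)] r(2,3) ab(2) xy] by blast
    have e2: "0 \<le> en u w s2" using en_antimono[OF s, of s2 "max x y"] s12 r e by simp
    have kw: "k \<le> \<bar>w t\<bar>" if t: "s1 \<le> t" "t \<le> s2" for t
    proof -
      have "0 \<le> en u w t" using en_antimono[OF s, of t s2] t s12 r e2 by simp
      moreover have "F (u t) \<le> F x0" using s12(4)[OF t] x0(2) by simp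
      ultimately have "kin m k \<le> kin m (w t)" using k unfolding en_def by linarith
      from kin_le_imp[OF m1 this] show ?thesis using k by simp
    qed
    have s0: "0 \<le> s1" using s12 r by simp
    obtain \<sigma> :: real where sg: "\<sigma> = 1 \<or> \<sigma> = -1" "\<And>x. s1 \<le> x \<Longrightarrow> x \<le> s2 \<Longrightarrow> 0 \<le> \<sigma> * w x"
      using sign_const[OF sol_cont(2)[OF s s0] less_imp_le[OF s12(2)]] kw k by fastforce
    have pw: "psi m k \<le> \<sigma> * psi m (w t)" if t: "s1 \<le> t" "t \<le> s2" for t
    proof -
      have "\<sigma> * psi m (w t) = psi m \<bar>w t\<bar>" using sg(1) sg(2)[OF t] by (cases "0 \<le> w t") auto
      then show ?thesis using psi_mono[OF m1 kw[OF t]] by simp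
    qed
    have "psi m k * s2 - psi m k * s1 \<le> \<sigma> * u s2 - \<sigma> * u s1"
    proof (rule deriv_le_imp_le[where g = "\<lambda>t. psi m k * t" and h = "\<lambda>t. \<sigma> * u t" and g' = "\<lambda>_. psi m k" and h' = "\<lambda>t. \<sigma> * psi m (w t)"])
      show "continuous_on {s1..s2} (\<lambda>t. \<sigma> * u t)" by (intro continuous_intros sol_cont[OF s s0])
      fix t assume t: "s1 < t" "t < s2"
      then have "0 < t" using s0 by simp
      then show "((\<lambda>t. \<sigma> * u t) has_real_derivative \<sigma> * psi m (w t)) (at t)" by (intro DERIV_cmult sol_du[OF s])
      show "((\<lambda>t. psi m k * t) has_real_derivative psi m k) (at t)" using DERIV_cmult[OF DERIV_ident, of "psi m k"] by simp
      show "psi m k \<le> \<sigma> * psi m (w t)" using pw[of t] t by simp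
    qed (use s12(2) in \<open>auto intro!: continuous_intros\<close>)
    then have d1: "psi m k * (s2 - s1) \<le> \<sigma> * (u s2 - u s1)" by (simp add: algebra_simps)
    then have "0 < \<sigma> * (u s2 - u s1)" using pk s12(2) mult_pos_pos[of "psi m k" "s2 - s1"] by linarith
    then have d2: "\<sigma> * (u s2 - u s1) = b - a" using sg(1) s12(5) ab by auto
    have "s2 - s1 \<le> T" using d1 d2 pk by (simp add: T_def pos_le_divide_eq mult.commute)
    have "(real N - 1) * k / s2 * (\<sigma> * (u s2 - u s1)) \<le> en u w s1 - en u w s2"
      by (rule loss_lower[OF s s0 s12(2) sg(1)]) (use sg(2) kw k in auto)
    then have "c / s2 \<le> en u w s1" unfolding d2 using e2 by (simp add: c_def)
    then have "c \<le> s2 * en u w s1" using s12 s0 by (simp add: pos_divide_le_eq mult.commute)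
    also have "\<dots> \<le> (s1 + T) * en u w s1"
      using \<open>s2 - s1 \<le> T\<close> en_antimono[OF s, of s1 s2] s12 s0 e2 by (intro mult_right_mono) auto
    also have "\<dots> \<le> (\<rho> + T) * en u w \<rho>"
      by (rule en_weighted[OF s r(1) s12(1) T0]) (use rng s12 in \<open>auto intro!: F_nonpos\<close>)
    finally show ?thesis .
  qed
  show ?thesis
  proof (rule exI[of _ T], rule exI[of _ c], intro conjI allI impI T0 c0)
    fix u w \<rho> x y
    assume h: "sol u w \<and> 0 \<le> \<rho> \<and> \<rho> \<le> x \<and> \<rho> \<le> y \<and>
     (\<forall>r. \<rho> \<le> r \<and> r \<le> max x y \<longrightarrow> bm \<le> u r \<and> u r \<le> bp) \<and> 0 \<le> en u w (max x y) \<and>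
     u x \<le> bp / 3 \<and> 2 * bp / 3 \<le> u y"
    show "c \<le> (\<rho> + T) * en u w \<rho>"
      by (rule main[of u w \<rho> x y]) (use h in \<open>simp_all add: a_def b_def\<close>)
  qed
qed

lemma zone_exists: "\<exists>T c. zone T c"
proof -
  interpret R: shooting m N "\<lambda>s. - f (- s)" "\<lambda>s. F (- s)" Mf "- bp" "- bm" by (rule refl_shooting)
  obtain T1 c1 where 1: "0 \<le> T1" "0 < c1" "\<And>u w \<rho> x y. sol u w \<and> 0 \<le> \<rho> \<and> \<rho> \<le> x \<and> \<rho> \<le> y \<and>
     (\<forall>r. \<rho> \<le> r \<and> r \<le> max x y \<longrightarrow> bm \<le> u r \<and> u r \<le> bp) \<and> 0 \<le> en u w (max x y) \<and>
     u x \<le> bp / 3 \<and> 2 * bp / 3 \<le> u y \<Longrightarrow> c1 \<le> (\<rho> + T1) * en u w \<rho>" using zone_pos by blast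
  obtain T2 c2 where 2: "0 \<le> T2" "0 < c2" "\<And>u w \<rho> x y. R.sol u w \<and> 0 \<le> \<rho> \<and> \<rho> \<le> x \<and> \<rho> \<le> y \<and>
     (\<forall>r. \<rho> \<le> r \<and> r \<le> max x y \<longrightarrow> - bp \<le> u r \<and> u r \<le> - bm) \<and> 0 \<le> R.en u w (max x y) \<and>
     u x \<le> - bm / 3 \<and> 2 * - bm / 3 \<le> u y \<Longrightarrow> c2 \<le> (\<rho> + T2) * R.en u w \<rho>" using R.zone_pos by blast
  have "zone (max T1 T2) (min c1 c2)"
    unfolding zone_def
  proof (intro conjI allI impI)
    show "0 \<le> max T1 T2" "0 < min c1 c2" using 1 2 by auto
    fix u w and \<rho> x y :: real
    assume a: "sol u w \<and> 0 \<le> \<rho> \<and> \<rho> \<le> x \<and> \<rho> \<le> y \<and>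
     (\<forall>r. \<rho> \<le> r \<and> r \<le> max x y \<longrightarrow> bm \<le> u r \<and> u r \<le> bp) \<and> 0 \<le> en u w (max x y) \<and>
     (u x \<le> bp / 3 \<and> 2 * bp / 3 \<le> u y \<or> bm / 3 \<le> u x \<and> u y \<le> 2 * bm / 3)"
    have "\<rho> \<le> max x y" using a by auto
    then have "en u w (max x y) \<le> en u w \<rho>" using a by (intro en_antimono) auto
    then have e0: "0 \<le> en u w \<rho>" using a by linarith
    have "min c1 c2 \<le> (\<rho> + T1) * en u w \<rho> \<or> min c1 c2 \<le> (\<rho> + T2) * en u w \<rho>"
    proof (cases "u x \<le> bp / 3 \<and> 2 * bp / 3 \<le> u y")
      case True then show ?thesis using 1(3)[of u w \<rho> x y] a by auto
    next
      case False
      then have "c2 \<le> (\<rho> + T2) * R.en (\<lambda>r. - u r) (\<lambda>r. - w r) \<rho>"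
        using a refl_sol'[of u w] by (intro 2(3)[of _ _ _ x y]) (auto simp: refl_en)
      then show ?thesis by (auto simp: refl_en)
    qed
    moreover have "(\<rho> + T1) * en u w \<rho> \<le> (\<rho> + max T1 T2) * en u w \<rho>" "(\<rho> + T2) * en u w \<rho> \<le> (\<rho> + max T1 T2) * en u w \<rho>"
      using e0 by (auto intro!: mult_right_mono)
    ultimately show "min c1 c2 \<le> (\<rho> + max T1 T2) * en u w \<rho>" by linarith
  qed
  then show ?thesis by blast
qed

lemma zoneD:
  assumes "zone T c" "sol u w" "0 \<le> \<rho>" "\<rho> \<le> x" "\<rho> \<le> y"
    "\<And>r. \<rho> \<le> r \<Longrightarrow> r \<le> max x y \<Longrightarrow> bm \<le> u r \<and> u r \<le> bp" "0 \<le> en u w (max x y)"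
    "u x \<le> bp / 3 \<and> 2 * bp / 3 \<le> u y \<or> bm / 3 \<le> u x \<and> u y \<le> 2 * bm / 3"
  shows "c \<le> (\<rho> + T) * en u w \<rho>"
  using assms unfolding zone_def by blast

text \<open>The chord of \<open>F\<close> from \<open>bp\<close> to \<open>bp + y\<close> lies above the graph, as it would for a convex \<open>F\<close>.\<close>

definition good_level :: "real \<Rightarrow> bool" where
  "good_level y \<longleftrightarrow> 0 < y \<and> (\<forall>z. 0 \<le> z \<and> z \<le> y \<longrightarrow> F (bp + z) \<le> F (bp + y) / y * z)"

text \<open>As \<open>f bp = 0\<close>, the quotient \<open>F (bp + z) / z\<close> extends continuously by the value \<open>0\<close> to \<open>z = 0\<close>.
  Any point of \<open>[0, y1]\<close> where it is maximal is good.\<close>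

lemma good_level_exists:
  assumes fb: "f bp = 0" and y1: "0 < y1"
  shows "\<exists>y\<le>y1. good_level y"
proof -
  define G where "G z = (if z = 0 then 0 else F (bp + z) / z)" for z
  have "(F has_real_derivative 0) (at bp)" using F_deriv[of bp] fb by simp
  then have l: "((\<lambda>h. F (bp + h) / h) \<longlongrightarrow> 0) (at 0)" using F_bp by (simp add: DERIV_def)
  have "isCont G z" for z
  proof (cases "z = 0")
    case True
    have "\<forall>\<^sub>F h in at 0. F (bp + h) / h = G h" by (simp add: eventually_at_filter G_def)
    then have "(G \<longlongrightarrow> 0) (at 0)" using l by (rule Lim_transform_eventually[rotated])
    then show ?thesis using True by (simp add: isCont_def G_def)
  next
    case False
    have "isCont (\<lambda>z. F (bp + z) / z) z"
      using False isCont_o2[of z "\<lambda>z. bp + z" F] DERIV_isCont[OF F_deriv, of "bp + z"] by (intro continuous_intros) auto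
    moreover have "\<forall>\<^sub>F h in nhds z. G h = F (bp + h) / h"
      using eventually_nhds_in_open[of "- {0}" z] False by (auto elim!: eventually_mono simp: G_def)
    ultimately show ?thesis using isCont_cong by metis
  qed
  then have "continuous_on {0..y1} G" by (simp add: continuous_at_imp_continuous_on)
  from continuous_attains_sup[OF compact_Icc _ this] obtain y where y: "0 \<le> y" "y \<le> y1" "\<And>z. 0 \<le> z \<Longrightarrow> z \<le> y1 \<Longrightarrow> G z \<le> G y"
    using y1 by auto
  have "0 < G y1" using y1 F_pos[of "bp + y1"] by (simp add: G_def)
  then have "y \<noteq> 0" using y(3)[of y1] y1 by (auto simp: G_def)
  have "F (bp + z) \<le> F (bp + y) / y * z" if "0 \<le> z" "z \<le> y" for z
  proof (cases "z = 0")
    case True then show ?thesis using F_bp by simp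
  next
    case False
    then have "F (bp + z) / z \<le> F (bp + y) / y" using y(3)[of z] that y(2) \<open>y \<noteq> 0\<close> by (simp add: G_def)
    then show ?thesis using False that by (simp add: pos_divide_le_eq)
  qed
  then show ?thesis using y \<open>y \<noteq> 0\<close> by (auto simp: good_level_def)
qed

text \<open>Let \<open>q\<close> be the slope of the chord. If \<open>u\<close> comes to rest at the level \<open>bp + y\<close>, then before that
  the kinetic energy is at least \<open>F (bp + y) - F u \<ge> q (bp + y - u)\<close>. Backwards in time, the
  distance \<open>bp + y - u\<close> to the level therefore satisfies the differential inequality of
  \<open>speed_up\<close>, and since it is at most \<open>y\<close> as long as \<open>u \<ge> bp\<close>, that time is short.\<close>

lemma rising_time:
  assumes s: "sol u w" and g: "good_level y" and t: "0 \<le> t0" "t0 \<le> r" and ur: "u r = bp + y" "w r = 0"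
    and w: "\<And>x. t0 < x \<Longrightarrow> x < r \<Longrightarrow> 0 < w x" and u0: "bp \<le> u t0"
  shows "(r - t0) * F (bp + y) \<le> y * (m / (m - 1)) powr (1 - 1 / m) * F (bp + y) powr (1 - 1 / m)"
proof -
  define q where "q = F (bp + y) / y"
  define k where "k = m / (m - 1) * q"
  have y0: "0 < y" using g by (simp add: good_level_def)
  have F0: "0 < F (bp + y)" using y0 by (intro F_pos) simp
  have k0: "0 < k" using F0 y0 m1 by (simp add: k_def q_def)
  have D: "0 < bp + y - u x" "bp \<le> u x" if "t0 < x" "x < r" for x
  proof -
    have "u x < u r" by (rule u_inc[OF s]) (use that t w in auto)
    then show "0 < bp + y - u x" using ur by simp
    have "u t0 < u x" by (rule u_inc[OF s]) (use that t w in auto)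
    then show "bp \<le> u x" using u0 by simp
  qed
  have "(m - 1) / m * k powr (1 / m) * (- t0 - - r) \<le> (bp + y - u (- (- t0))) powr ((m - 1) / m)"
  proof (rule speed_up[OF m1, where D = "\<lambda>x. bp + y - u (- x)" and a = "- r" and b = "- t0" and D' = "\<lambda>x. psi m (w (- x))"])
    show "continuous_on {- r..- t0} (\<lambda>x. bp + y - u (- x))"
      by (intro continuous_intros continuous_on_compose2[OF sol_cont(1)[OF s t(1), of r]]) auto
    fix x assume x: "- r < x" "x < - t0"
    then have x': "t0 < - x" "- x < r" by auto
    have "((\<lambda>x. u (- x)) has_real_derivative psi m (w (- x)) * (-1)) (at x)"
      by (rule DERIV_chain2[OF sol_du[OF s]]) (use x' t in \<open>auto intro!: derivative_eq_intros\<close>)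
    then show "((\<lambda>x. bp + y - u (- x)) has_real_derivative psi m (w (- x))) (at x)"
      by (auto intro!: derivative_eq_intros)
    have "en u w r \<le> en u w (- x)" by (rule en_antimono[OF s]) (use x' t in auto)
    then have "F (bp + y) - F (u (- x)) \<le> kin m (w (- x))" using ur by (simp add: en_def)
    moreover have "F (u (- x)) \<le> q * (u (- x) - bp)"
    proof -
      have "F (bp + (u (- x) - bp)) \<le> F (bp + y) / y * (u (- x) - bp)"
        by (rule g[unfolded good_level_def, THEN conjunct2, rule_format]) (use D[OF x'] in simp)
      then show ?thesis by (simp add: q_def)
    qed
    moreover have "F (bp + y) = q * y" using y0 by (simp add: q_def)
    ultimately have "q * (bp + y - u (- x)) \<le> kin m (w (- x))" by (simp add: algebra_simps)
    from psi_of_kin[OF m1 _ _ this] have "(k * (bp + y - u (- x))) powr (1 / m) \<le> psi m (w (- x))"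
      using w[OF x'] D[OF x'] F0 y0 by (simp add: k_def q_def mult.assoc)
    then show "0 < bp + y - u (- x) \<and> (k * (bp + y - u (- x))) powr (1 / m) \<le> psi m (w (- x))" using D[OF x'] by simp
  qed (use t ur k0 in auto)
  moreover have "(bp + y - u (- (- t0))) powr ((m - 1) / m) \<le> y powr ((m - 1) / m)"
  proof (rule powr_mono2)
    show "0 \<le> bp + y - u (- (- t0))"
    proof (cases "t0 = r")
      case False
      then have "u t0 < u r" by (intro u_inc[OF s]) (use t w in auto)
      then show ?thesis using ur by simp
    qed (use ur in simp)
  qed (use m1 u0 in auto)
  ultimately have 1: "(m - 1) / m * k powr (1 / m) * (r - t0) \<le> y powr ((m - 1) / m)" by simp
  have e: "(m - 1) / m = 1 - 1 / m" using m1 by (simp add: field_simps)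
  have kk: "k powr (1 / m) = (m / (m - 1)) powr (1 / m) * F (bp + y) powr (1 / m) / y powr (1 / m)"
    using m1 F0 y0 by (simp add: k_def q_def powr_mult powr_divide)
  have "(m - 1) / m * ((m / (m - 1)) powr (1 / m) * F (bp + y) powr (1 / m)) * (r - t0) \<le> y powr (1 - 1 / m) * y powr (1 / m)"
    using 1 y0 unfolding kk e by (simp add: field_simps)
  also have "\<dots> = y" using y0 by (simp add: powr_add[symmetric])
  finally have 2: "(m - 1) / m * ((m / (m - 1)) powr (1 / m) * F (bp + y) powr (1 / m)) * (r - t0) \<le> y" .
  have m0: "0 < m / (m - 1)" using m1 by simp
  have "(m / (m - 1)) powr (1 - 1 / m) * F (bp + y) powr (1 - 1 / m) * ((m - 1) / m * ((m / (m - 1)) powr (1 / m) * F (bp + y) powr (1 / m)) * (r - t0))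
     = ((m / (m - 1)) powr (1 - 1 / m) * (m / (m - 1)) powr (1 / m)) * ((m - 1) / m) * (F (bp + y) powr (1 - 1 / m) * F (bp + y) powr (1 / m)) * (r - t0)"
    by simp
  also have "\<dots> = F (bp + y) * (r - t0)"
    using F0 m0 m1 unfolding powr_add[symmetric] by simp
  finally have 3: "(r - t0) * F (bp + y) = (m / (m - 1)) powr (1 - 1 / m) * F (bp + y) powr (1 - 1 / m) * ((m - 1) / m * ((m / (m - 1)) powr (1 / m) * F (bp + y) powr (1 / m)) * (r - t0))"
    by (simp add: mult.commute)
  have "(m / (m - 1)) powr (1 - 1 / m) * F (bp + y) powr (1 - 1 / m) * ((m - 1) / m * ((m / (m - 1)) powr (1 / m) * F (bp + y) powr (1 / m)) * (r - t0))
     \<le> (m / (m - 1)) powr (1 - 1 / m) * F (bp + y) powr (1 - 1 / m) * y"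
    by (rule mult_left_mono[OF 2]) simp
  then show ?thesis unfolding 3 by (simp add: mult.commute mult.left_commute)
qed

text \<open>Suppose that \<open>u\<close> passes the level \<open>bp + y\<close> at \<open>T\<close> but remains above \<open>bp\<close> up to \<open>3 T / 2\<close>. Such a
  slow motion means that \<open>|w|\<close> is at most of the order \<open>(y / T) powr (m - 1)\<close> up to \<open>5 T / 4\<close>. So
  at least half of the energy \<open>c / T\<close> is potential energy at level \<open>bp + y\<close>, and friction
  consumes at most half of what is gained along the chord of slope \<open>q \<ge> c / (2 T y)\<close>. By
  \<open>speed_up\<close> the distance from the level becomes larger than \<open>y\<close> before \<open>5 T / 4\<close>, if \<open>y\<close> is
  small.\<close>

lemma no_sticking:
  assumes c: "0 < c"
  shows "\<exists>y0>0. \<forall>y u w T. good_level y \<and> y < y0 \<and> sol u w \<and> 1 \<le> T \<and> w T \<le> 0 \<and> u T = bp + y \<and> T * en u w T = c \<and>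
     (\<forall>x. T \<le> x \<and> x \<le> 3 * T / 2 \<longrightarrow> bp \<le> u x) \<and> 0 < en u w (3 * T / 2) \<longrightarrow> False"
proof -
  define P where "P = real N - 1"
  define A1 where "A1 = (3 / 2) ^ (N - 1) * 4 powr (m - 1)"
  define A2 where "A2 = (m - 1) / m * A1 powr (m / (m - 1))"
  define A3 where "A3 = (m - 1) / (4 * m) * (m / (m - 1) * c / 4) powr (1 / m)"
  have P0: "0 < P" using N2 by (simp add: P_def)
  have A1: "0 < A1" by (simp add: A1_def)
  have A2: "0 < A2" using m1 A1 by (simp add: A2_def)
  have A3: "0 < A3" using m1 c by (simp add: A3_def)
  \<comment> \<open>the four bounds serve, in this order: \<open>y / T \<le> 1\<close>, small kinetic energy, small friction, and the
    final contradiction\<close>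
  define y0 where "y0 = min (min 1 (c / (2 * A2))) (min (c / (4 * (P * A1))) A3)"
  have y00: "0 < y0" using c A1 A2 A3 P0 by (simp add: y0_def)
  have False if g: "good_level y" and yy: "y < y0" and s: "sol u w" and T: "1 \<le> T" and wT: "w T \<le> 0" and uT: "u T = bp + y"
      and eT: "T * en u w T = c" and ub: "\<And>x. T \<le> x \<Longrightarrow> x \<le> 3 * T / 2 \<Longrightarrow> bp \<le> u x" and en: "0 < en u w (3 * T / 2)" for y u w T
  proof -
    have y: "0 < y" using g by (simp add: good_level_def)
    have y1: "y < 1" "y < c / (2 * A2)" "y < c / (4 * (P * A1))" "y < A3" using yy by (simp_all add: y0_def)
    have y2: "A2 * y \<le> c / 2" "P * A1 * y \<le> c / 4" using y1 A2 A1 P0 by (simp_all add: field_simps)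
    have T0: "0 < T" using T by simp
    have wn: "w x < 0" if "T < x" "x \<le> 3 * T / 2" for x
    proof (rule descent[OF s _ that(1) _ _ wT])
      show "0 < en u w x" using en_antimono[OF s, of x "3*T/2"] en that T0 by simp
      show "0 \<le> u t" if "T \<le> t" "t \<le> x" for t using ub[of t] that \<open>x \<le> 3 * T / 2\<close> bp_pos by simp
    qed (use T0 in auto)
    have ug: "bp < u x" if "T \<le> x" "x < 3 * T / 2" for x
    proof -
      have "u (3 * T / 2) < u x" by (rule u_dec[OF s]) (use that T0 wn in auto)
      then show ?thesis using ub[of "3*T/2"] T0 by simp
    qed
    have ul: "u x \<le> bp + y" if "T \<le> x" "x \<le> 3 * T / 2" for x
      using u_dec_le[OF s, of T x] that T0 wn uT by (simp add: less_imp_le)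
    obtain s0 where s0: "5 * T / 4 < s0" "s0 < 3 * T / 2" "u (3 * T / 2) - u (5 * T / 4) = (3 * T / 2 - 5 * T / 4) * psi m (w s0)"
      using MVT2[of "5*T/4" "3*T/2" u "\<lambda>x. psi m (w x)"] sol_du[OF s] T0 by force
    have "- (psi m (w s0)) * (T / 4) \<le> y" using s0(3) ub[of "3*T/2"] ul[of "5*T/4"] T0 by (simp add: field_simps)
    then have ps: "psi m (- w s0) \<le> 4 * y / T" using T0 by (simp add: field_simps)
    have ws0: "0 < - w s0" using wn[of s0] s0 T0 by simp
    have pws: "psi m (- w s0) = (- w s0) powr (1 / (m - 1))" by (rule psi_of_pos) (use ws0 in simp)
    \<comment> \<open>\<open>s0\<close> is a mean value point in \<open>[5 T / 4, 3 T / 2]\<close>, an interval of length \<open>T / 4\<close> in which \<open>u\<close> falls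
      by at most \<open>y\<close>\<close>
    have ws: "- w s0 \<le> (4 * y / T) powr (m - 1)"
    proof -
      have "- w s0 = psi m (- w s0) powr (m - 1)" unfolding pws using ws0 m1 by (simp add: powr_powr)
      also have "\<dots> \<le> (4 * y / T) powr (m - 1)" using ps psi_pos[OF ws0, of m] m1 by (intro powr_mono2) auto
      finally show ?thesis .
    qed
    \<comment> \<open>\<open>r ^ (N - 1) * |w|\<close> increases, so the bound at \<open>s0\<close> holds before it, up to a constant factor\<close>
    define om where "om = A1 * (y / T) powr (m - 1)"
    have om: "- w t \<le> om" if t: "T \<le> t" "t \<le> 5 * T / 4" for t
    proof -
      have t0: "0 < t" using t T0 by simp
      have "(0::real) - 0 \<le> - (s0 ^ (N - 1) * w s0) - - (t ^ (N - 1) * w t)"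
      proof (rule deriv_le_imp_le[where g = "\<lambda>_. 0" and h = "\<lambda>x. - (x ^ (N - 1) * w x)" and g' = "\<lambda>_. 0" and h' = "\<lambda>x. x ^ (N - 1) * f (u x)"])
        fix x assume x: "t < x" "x < s0"
        show "((\<lambda>x. - (x ^ (N - 1) * w x)) has_real_derivative x ^ (N - 1) * f (u x)) (at x)"
          using DERIV_minus[OF sol_dz[OF s, of x]] x t0 by simp
        show "0 \<le> x ^ (N - 1) * f (u x)" using f_pos[OF ug, of x] x t s0 t0 by simp
      qed (use t s0 sol_cont(2)[OF s less_imp_le[OF t0]] in \<open>auto intro!: continuous_intros\<close>)
      then have 1: "t ^ (N - 1) * - w t \<le> s0 ^ (N - 1) * - w s0" by simp
      have "s0 \<le> 3 / 2 * t" using s0 t by simp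
      then have "s0 ^ (N - 1) \<le> (3 / 2 * t) ^ (N - 1)" using s0 T0 by (intro power_mono) auto
      then have "s0 ^ (N - 1) * - w s0 \<le> (3 / 2 * t) ^ (N - 1) * - w s0" using ws0 by (intro mult_right_mono) auto
      then have "t ^ (N - 1) * - w t \<le> t ^ (N - 1) * ((3 / 2) ^ (N - 1) * - w s0)" using 1
        unfolding power_mult_distrib by (simp only: mult_ac)
      then have "- w t \<le> (3 / 2) ^ (N - 1) * - w s0" using t0 by (simp del: mult_minus_right)
      also have "\<dots> \<le> (3 / 2) ^ (N - 1) * (4 * y / T) powr (m - 1)" using ws by (intro mult_left_mono) auto
      also have "\<dots> = om" using y T0 by (simp add: om_def A1_def powr_mult powr_divide)
      finally show ?thesis .
    qed
    have om0: "0 < om" using A1 y T0 by (simp add: om_def)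
    have yT: "(y / T) powr m \<le> y / T"
      using y T0 T y1 powr_mono'[of 1 m "y / T"] m1 by (simp add: pos_divide_le_eq)
    have "kin m om = A2 * (y / T) powr m"
      using A1 y T0 m1 by (simp add: kin_def om_def A2_def powr_mult powr_powr)
    also have "\<dots> \<le> A2 * (y / T)" using yT A2 by (intro mult_left_mono) auto
    also have "\<dots> \<le> c / 2 / T" using divide_right_mono[OF y2(1), of T] T0 by simp
    finally have ko: "kin m om \<le> c / 2 / T" .
    define q where "q = F (bp + y) / y"
    have eT': "en u w T = c / T" using eT T0 by (simp add: field_simps)
    have "kin m (w T) \<le> kin m om" using om[of T] wT T0 om0 by (intro kin_mono m1) auto
    then have FT: "c / 2 / T \<le> F (bp + y)" using eT' ko uT unfolding en_def by (simp add: field_simps)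
    have Fq: "F (bp + y) = q * y" using y by (simp add: q_def)
    have q1: "c / 2 / T / y \<le> q" using divide_right_mono[OF FT, of y] y by (simp add: q_def)
    have q0: "0 < q" using FT c T0 y by (simp add: q_def) (meson divide_pos_pos less_le_trans zero_less_numeral mult_pos_pos)
    \<comment> \<open>friction consumes at most half of the potential energy set free along the chord\<close>
    have Po: "P * om / T \<le> q / 2"
    proof -
      have "y * (y / T) powr (m - 1) = T * ((y / T) powr 1 * (y / T) powr (m - 1))" using y T0 by simp
      also have "\<dots> = T * (y / T) powr m" by (simp only: powr_add[symmetric]) simp
      also have "\<dots> \<le> y" using yT T0 by (simp add: field_simps)
      finally have "P * A1 * (y * (y / T) powr (m - 1)) \<le> P * A1 * y" using P0 A1 by (intro mult_left_mono) auto
      then have "P * om * y \<le> c / 4" using y2(2) by (simp add: om_def mult_ac)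
      then have "P * om / T \<le> c / 4 / T / y" using y T0 by (simp add: field_simps)
      also have "\<dots> \<le> q / 2" using q1 by simp
      finally show ?thesis .
    qed
    have kd: "q / 2 * (bp + y - u t) \<le> kin m (w t)" if t: "T \<le> t" "t \<le> 5 * T / 4" for t
    proof -
      have "en u w T - en u w t \<le> (real N - 1) * om / T * (-1 * (u t - u T))"
      proof (rule loss_upper[OF s T0 t(1)])
        fix x assume x: "T < x" "x < t"
        then show "0 \<le> -1 * w x \<and> \<bar>w x\<bar> \<le> om" using wn[of x] om[of x] t T0 by auto
      qed simp
      also have "\<dots> = P * om / T * (bp + y - u t)" using uT by (simp add: P_def)
      also have "\<dots> \<le> q / 2 * (bp + y - u t)" using Po ul[of t] t T0 by (intro mult_right_mono) auto
      finally have 1: "en u w T - q / 2 * (bp + y - u t) \<le> en u w t" by simp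
      have "bp \<le> u t" "u t \<le> bp + y" using ub[of t] ul[of t] t T0 by auto
      then have "F (bp + (u t - bp)) \<le> F (bp + y) / y * (u t - bp)"
        by (intro g[unfolded good_level_def, THEN conjunct2, rule_format]) simp
      then have "F (u t) \<le> q * (u t - bp)" by (simp add: q_def)
      moreover have "q * y \<le> en u w T" using F_le_en[of u T w] uT Fq by simp
      ultimately have "q * y - q * (u t - bp) - q / 2 * (bp + y - u t) \<le> kin m (w t)" using 1 unfolding en_def[of u w t] by linarith
      moreover have "q * y - q * (u t - bp) - q / 2 * (bp + y - u t) = q / 2 * (bp + y - u t)" by (simp add: field_simps)
      ultimately show ?thesis by simp
    qed
    define k where "k = m / (m - 1) * (q / 2)"
    have k0: "0 < k" using q0 m1 by (simp add: k_def)
    have "(m - 1) / m * k powr (1 / m) * (5 * T / 4 - T) \<le> (bp + y - u (5 * T / 4)) powr ((m - 1) / m)"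
    proof (rule speed_up[OF m1, where D = "\<lambda>x. bp + y - u x" and D' = "\<lambda>x. psi m (- w x)"])
      show "continuous_on {T..5 * T / 4} (\<lambda>x. bp + y - u x)"
        by (intro continuous_intros sol_cont(1)[OF s]) (use T0 in auto)
      fix t assume t: "T < t" "t < 5 * T / 4"
      show "((\<lambda>x. bp + y - u x) has_real_derivative psi m (- w t)) (at t)"
        using sol_du[OF s, of t] t T0 by (auto intro!: derivative_eq_intros)
      have "u t < u T" by (rule u_dec[OF s]) (use t T0 wn in auto)
      then have D: "0 < bp + y - u t" using uT by simp
      have "(m / (m - 1) * (q / 2 * (bp + y - u t))) powr (1 / m) \<le> psi m (- w t)"
        by (rule psi_of_kin[OF m1]) (use kd[of t] t T0 wn[of t] q0 D in auto)
      then show "0 < bp + y - u t \<and> (k * (bp + y - u t)) powr (1 / m) \<le> psi m (- w t)"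
        using D by (simp add: k_def mult.assoc)
    qed (use T0 uT k0 in auto)
    also have "\<dots> \<le> y powr ((m - 1) / m)"
      using ub[of "5*T/4"] ul[of "5*T/4"] T0 m1 by (intro powr_mono2) auto
    finally have 1: "(m - 1) / (4 * m) * k powr (1 / m) * T \<le> y powr ((m - 1) / m)" by (simp add: field_simps)
    have "m / (m - 1) * c / 4 / (T * y) \<le> k"
    proof -
      have "m / (m - 1) * (c / 2 / T / y / 2) \<le> m / (m - 1) * (q / 2)" using q1 m1 by (intro mult_left_mono) auto
      then show ?thesis by (simp add: k_def mult_ac)
    qed
    then have "(m / (m - 1) * c / 4 / (T * y)) powr (1 / m) \<le> k powr (1 / m)"
      using m1 c T0 y by (intro powr_mono2) auto
    then have "(m - 1) / (4 * m) * (m / (m - 1) * c / 4 / (T * y)) powr (1 / m) * T \<le> (m - 1) / (4 * m) * k powr (1 / m) * T"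
      using m1 T0 by (intro mult_right_mono mult_left_mono) auto
    then have 2: "(m - 1) / (4 * m) * (m / (m - 1) * c / 4 / (T * y)) powr (1 / m) * T \<le> y powr ((m - 1) / m)" using 1 by simp
    have "(m / (m - 1) * c / 4 / (T * y)) powr (1 / m) = (m / (m - 1) * c / 4) powr (1 / m) / (T powr (1 / m) * y powr (1 / m))"
      using m1 c T0 y by (simp add: powr_divide powr_mult)
    then have "A3 * T / (T powr (1 / m) * y powr (1 / m)) \<le> y powr ((m - 1) / m)" using 2 by (simp add: A3_def mult_ac)
    then have "A3 * T \<le> y powr ((m - 1) / m) * (T powr (1 / m) * y powr (1 / m))"
      using T0 y by (simp add: pos_divide_le_eq)
    also have "\<dots> = T powr (1 / m) * (y powr ((m - 1) / m) * y powr (1 / m))" by simp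
    also have "y powr ((m - 1) / m) * y powr (1 / m) = y"
      using y m1 by (simp add: powr_add[symmetric] add_divide_distrib[symmetric])
    also have "T powr (1 / m) * y \<le> T powr 1 * y" using T m1 y by (intro mult_right_mono powr_mono) auto
    finally have "A3 \<le> y" using T0 by simp
    then show False using y1 by simp
  qed
  then show ?thesis using y00 by blast
qed

end
section \<open>Solutions do not linger at the edge of the well\<close>

text \<open>The hypothesis on sequences expresses that \<open>X\<close> is relatively open in \<open>[a0, b]\<close>; then the supremum
  of its complement does not belong to \<open>X\<close>.\<close>

lemma sup_of_complement:
  fixes X :: "real set"
  assumes ab: "a0 \<le> b" "b \<in> X" "a0 \<notin> X"
    and op: "\<And>x xn. x \<in> X \<Longrightarrow> a0 \<le> x \<Longrightarrow> x \<le> b \<Longrightarrow> (\<And>n. a0 \<le> xn n \<and> xn n \<le> b \<and> xn n \<notin> X) \<Longrightarrow> xn \<longlonglongrightarrow> x \<Longrightarrow> False"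
  obtains a where "a0 \<le> a" "a < b" "a \<notin> X" "\<And>x. a < x \<Longrightarrow> x \<le> b \<Longrightarrow> x \<in> X"
proof -
  define B where "B = {x. a0 \<le> x \<and> x \<le> b \<and> x \<notin> X}"
  have a0: "a0 \<in> B" using ab by (simp add: B_def)
  have bdd: "bdd_above B" by (auto simp: B_def intro!: bdd_aboveI[of _ b])
  define a where "a = Sup B"
  have a: "a0 \<le> a" "a \<le> b" unfolding a_def using a0 bdd by (auto intro!: cSup_upper cSup_least simp: B_def)
  have "\<exists>x\<in>B. a - 1 / real (Suc n) < x" for n
    using less_cSupD[of B "a - 1 / real (Suc n)"] a0 unfolding a_def by auto
  then obtain xs where xs: "\<And>n. xs n \<in> B" "\<And>n. a - 1 / real (Suc n) < xs n" by metis
  have xl: "xs \<longlonglongrightarrow> a"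
  proof (rule tendsto_sandwich[of "\<lambda>n. a - 1 / real (Suc n)" xs sequentially "\<lambda>_. a"])
    have "(\<lambda>n. a - 1 / real (Suc n)) \<longlonglongrightarrow> a - 0" by (intro tendsto_intros LIMSEQ_Suc[OF lim_1_over_n])
    then show "(\<lambda>n. a - 1 / real (Suc n)) \<longlonglongrightarrow> a" by simp
    show "\<forall>\<^sub>F n in sequentially. xs n \<le> a" using xs(1) bdd by (auto simp: a_def intro!: cSup_upper always_eventually)
  qed (use xs in \<open>auto intro!: always_eventually less_imp_le\<close>)
  have na: "a \<notin> X"
  proof
    assume "a \<in> X"
    then show False by (rule op[OF _ a _ xl]) (use xs(1) in \<open>auto simp: B_def\<close>)
  qed
  have "a \<noteq> b" using na ab by auto
  moreover have "x \<in> X" if "a < x" "x \<le> b" for x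
  proof (rule ccontr)
    assume "x \<notin> X"
    then have "x \<in> B" using that a by (simp add: B_def)
    then have "x \<le> a" unfolding a_def using bdd by (rule cSup_upper)
    then show False using that by simp
  qed
  ultimately show ?thesis using that a na by force
qed

context shooting begin

lemma seq_down:
  fixes a b :: real
  assumes "a < b"
  shows "a < a + (b - a) / real (Suc n)" "a + (b - a) / real (Suc n) \<le> b"
    "(\<lambda>n. a + (b - a) / real (Suc n)) \<longlonglongrightarrow> a"
proof -
  show "a < a + (b - a) / real (Suc n)" using assms by simp
  have "(b - a) / real (Suc n) \<le> (b - a) / 1" using assms by (intro divide_left_mono) auto
  then show "a + (b - a) / real (Suc n) \<le> b" by simp
  have "(\<lambda>n. a + (b - a) * (1 / real (Suc n))) \<longlonglongrightarrow> a + (b - a) * 0"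
    by (intro tendsto_intros LIMSEQ_Suc[OF lim_1_over_n])
  then show "(\<lambda>n. a + (b - a) / real (Suc n)) \<longlonglongrightarrow> a" by simp
qed

lemma isCont_nhds: "isCont g x \<Longrightarrow> (g \<longlongrightarrow> g x) (nhds x)" for g :: "real \<Rightarrow> real"
  by (simp add: isCont_def tendsto_at_iff_tendsto_nhds)

lemma en_luconv:
  assumes u: "luconv un u" "continuous_on {0..} u" and w: "luconv wn w" "continuous_on {0..} w"
    and X: "\<And>n. 0 \<le> X n" "X \<longlonglongrightarrow> r"
  shows "(\<lambda>n. en (un n) (wn n) (X n)) \<longlonglongrightarrow> en u w r"
proof -
  have "(\<lambda>n. un n (X n)) \<longlonglongrightarrow> u r" by (rule luconv_seq[OF u X])
  moreover have "(\<lambda>n. wn n (X n)) \<longlonglongrightarrow> w r" by (rule luconv_seq[OF w X])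
  ultimately show ?thesis unfolding en_def
    by (intro tendsto_add isCont_tendsto_compose[OF kin_cont[OF m1]] isCont_tendsto_compose[OF DERIV_isCont[OF F_deriv]])
qed

text \<open>As long as the energy of \<open>u\<close> is positive, uniqueness identifies the limit with \<open>u\<close>; later it may
  be a different solution.\<close>

lemma conv_unique:
  assumes s: "\<And>n. sol (un n) (wn n)" and a: "(\<lambda>n. un n 0) \<longlonglongrightarrow> u 0" and u: "sol u w"
    and R: "0 \<le> R" and en: "\<And>r. 0 \<le> r \<Longrightarrow> r < R \<Longrightarrow> 0 < en u w r"
  shows "\<exists>k v z. strict_mono (k :: nat \<Rightarrow> nat) \<and> luconv (\<lambda>n. un (k n)) v \<and> luconv (\<lambda>n. wn (k n)) z \<and> sol v z \<and> v 0 = u 0 \<and>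
    (\<forall>r. 0 \<le> r \<and> r \<le> R \<longrightarrow> v r = u r \<and> z r = w r)"
proof -
  obtain k v z where k: "strict_mono (k :: nat \<Rightarrow> nat)" "luconv (\<lambda>n. un (k n)) v"
     "luconv (\<lambda>n. wn (k n)) z" "sol v z" "v 0 = u 0" using sol_compact[OF s a] by blast
  have "u r = v r \<and> w r = z r" if "0 \<le> r" "r \<le> R" for r
    by (rule uniq[OF u k(4) k(5)[symmetric] R en that])
  then have "\<forall>r. 0 \<le> r \<and> r \<le> R \<longrightarrow> v r = u r \<and> z r = w r" by simp
  then show ?thesis using k by blast
qed

text \<open>Nonnegative energy passes to the limit, and solutions of nonnegative energy are determined by
  their initial value.\<close>

lemma conv_nonneg:
  assumes s: "\<And>n. sol (un n) (wn n)" and a: "(\<lambda>n. un n 0) \<longlonglongrightarrow> u 0" and u: "sol u w"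
    and n: "\<And>r. 0 \<le> r \<Longrightarrow> 0 \<le> en u w r" and p: "\<And>r. 0 \<le> r \<Longrightarrow> \<forall>\<^sub>F n in sequentially. 0 \<le> en (un n) (wn n) r"
  shows "\<exists>k. strict_mono (k :: nat \<Rightarrow> nat) \<and> luconv (\<lambda>n. un (k n)) u \<and> luconv (\<lambda>n. wn (k n)) w"
proof -
  obtain k v z where k: "strict_mono (k :: nat \<Rightarrow> nat)" "luconv (\<lambda>n. un (k n)) v"
     "luconv (\<lambda>n. wn (k n)) z" "sol v z" "v 0 = u 0" using sol_compact[OF s a] by blast
  have e: "0 \<le> en v z r" if "0 \<le> r" for r
  proof (rule tendsto_lowerbound)
    show "(\<lambda>n. en (un (k n)) (wn (k n)) r) \<longlonglongrightarrow> en v z r"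
      by (rule en_luconv[OF k(2) _ k(3)]) (use sol_cont0[OF k(4)] that in auto)
    show "\<forall>\<^sub>F n in sequentially. 0 \<le> en (un (k n)) (wn (k n)) r"
      using k(1) p[OF that] by (rule eventually_subseq)
  qed simp
  have eq: "u r = v r \<and> w r = z r" if "0 \<le> r" for r
    by (rule uniq_nonneg[OF u k(4) k(5)[symmetric] n e that])
  have "luconv (\<lambda>n. un (k n)) u" "luconv (\<lambda>n. wn (k n)) w"
    using k(2,3) eq unfolding luconv_def by (metis atLeastAtMost_iff)+
  then show ?thesis using k(1) by blast
qed

text \<open>Suppose that the solution from \<open>a\<close> tends to \<open>bp\<close>, while all solutions starting slightly above \<open>a\<close> have late zeros with positive energy. The
  contradiction comes from the quantity \<open>r * en\<close>. It is small for all of them at some large radius \<open>\<rho>\<close>, but when they finally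
  enter the well for good it is at least about \<open>c1\<close>, because they traverse the well. Fix a small good level \<open>bp + y\<close> and let \<open>Y y\<close> be the set of
  starting values for which \<open>u\<close> moves down through this level, between \<open>\<rho>\<close> and the first later zero, with \<open>r * en > c1 / 2\<close>.

  The set is open: at such a passage \<open>w\<close> does not vanish, since a maximum at this level would be reached so quickly (\<open>rising_time\<close>) that \<open>r * en\<close> would still be
  small. It is also closed, for in the limit case \<open>r * en = c1 / 2\<close> the bound for the traversal of the well
  implies that \<open>u\<close> stays above \<open>bp\<close> until \<open>3 r / 2\<close>, in contradiction to \<open>no_sticking\<close>. As it contains one starting value \<open>b\<close>, it contains all of \<open>(a, b]\<close>. But
  for starting values tending to \<open>a\<close> the radius of the passage stays bounded, and \<open>r * en\<close> tends to a value below \<open>c1 / 2\<close>.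

  The sign \<open>\<sigma>\<close> lets the lemma be applied to reflected solutions as well, for the exclusion of \<open>bm\<close>.\<close>

lemma no_lingering:
  fixes \<sigma> a :: real
  assumes fbp: "f bp = 0" and u0: "sol u0 w0" "u0 0 = \<sigma> * a" "\<And>r. 0 \<le> r \<Longrightarrow> 0 \<le> en u0 w0 r"
    and lim: "(u0 \<longlongrightarrow> bp) at_top" "((\<lambda>r. r * en u0 w0 r) \<longlongrightarrow> 0) at_top" "(en u0 w0 \<longlongrightarrow> 0) at_top"
    and X: "\<And>R. \<exists>\<delta>>0. \<forall>\<alpha> u w. a < \<alpha> \<and> \<alpha> < a + \<delta> \<and> sol u w \<and> u 0 = \<sigma> * \<alpha> \<longrightarrow> (\<exists>t>R. u t = 0 \<and> 0 < en u w t)"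
  shows False
proof -
  obtain T0 c1 where Z: "zone T0 c1" using zone_exists by blast
  have T0: "0 \<le> T0" and c1: "0 < c1" using Z by (auto simp: zone_def)
  define c2 where "c2 = c1 / 2"
  have c2: "0 < c2" using c1 by (simp add: c2_def)
  obtain ys where ys: "ys > 0" and stick: "\<And>y u w T. good_level y \<Longrightarrow> y < ys \<Longrightarrow> sol u w \<Longrightarrow> 1 \<le> T \<Longrightarrow> w T \<le> 0 \<Longrightarrow> u T = bp + y \<Longrightarrow>
     T * en u w T = c2 \<Longrightarrow> (\<And>x. T \<le> x \<Longrightarrow> x \<le> 3 * T / 2 \<Longrightarrow> bp \<le> u x) \<Longrightarrow> 0 < en u w (3 * T / 2) \<Longrightarrow> False"
    using no_sticking[OF c2] by blast
  have cu0: "continuous_on {0..} u0" "continuous_on {0..} w0" using sol_cont0[OF u0(1)] by auto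
  have "\<forall>\<^sub>F r in at_top. r * en u0 w0 r < c2 / 4" by (rule order_tendstoD(2)[OF lim(2)]) (use c2 in simp)
  moreover have "\<forall>\<^sub>F r in at_top. 2 * bp / 3 < u0 r" by (rule order_tendstoD(1)[OF lim(1)]) (use bp_pos in simp)
  ultimately have "\<forall>\<^sub>F r in at_top. r * en u0 w0 r < c2 / 4 \<and> 2 * bp / 3 < u0 r" by (rule eventually_conj)
  then obtain R1 where R1: "\<And>r. R1 \<le> r \<Longrightarrow> r * en u0 w0 r < c2 / 4 \<and> 2 * bp / 3 < u0 r"
    unfolding eventually_at_top_linorder by blast
  define \<rho> where "\<rho> = max R1 (max 1 (4 * T0))"
  have \<rho>: "1 \<le> \<rho>" "4 * T0 \<le> \<rho>" "R1 \<le> \<rho>" by (auto simp: \<rho>_def)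
  \<comment> \<open>the state at \<open>\<rho>\<close> of all solutions that start close enough to \<open>a\<close>\<close>
  define okr where "okr u w \<longleftrightarrow> \<rho> * en u w \<rho> < c2 / 4 \<and> 2 * bp / 3 < u \<rho> \<and> (\<exists>t>\<rho>. u t = 0 \<and> 0 < en u w t)" for u w
  have conv: "\<exists>k. strict_mono (k :: nat \<Rightarrow> nat) \<and> luconv (\<lambda>n. un (k n)) u0 \<and> luconv (\<lambda>n. wn (k n)) w0"
    if s: "\<And>n. sol (un n) (wn n)" "\<And>n. un n 0 = \<sigma> * \<alpha> n" "\<And>n. a < \<alpha> n" "\<alpha> \<longlonglongrightarrow> a" for un wn \<alpha>
  proof (rule conv_nonneg[OF s(1) _ u0(1,3)])
    show "(\<lambda>n. un n 0) \<longlonglongrightarrow> u0 0" unfolding s(2) u0(2) by (intro tendsto_intros s(4))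
    fix r :: real assume r: "0 \<le> r"
    obtain d where d: "d > 0" "\<And>\<alpha> u w. a < \<alpha> \<Longrightarrow> \<alpha> < a + d \<Longrightarrow> sol u w \<Longrightarrow> u 0 = \<sigma> * \<alpha> \<Longrightarrow> \<exists>t>r. u t = 0 \<and> 0 < en u w t"
      using X[of r] by blast
    have "\<forall>\<^sub>F n in sequentially. \<alpha> n < a + d" by (rule order_tendstoD(2)[OF s(4)]) (use d in simp)
    then show "\<forall>\<^sub>F n in sequentially. 0 \<le> en (un n) (wn n) r"
    proof (rule eventually_mono)
      fix n assume "\<alpha> n < a + d"
      then obtain t where t: "t > r" "0 < en (un n) (wn n) t" using d(2)[OF s(3) _ s(1) s(2)] by blast
      then show "0 \<le> en (un n) (wn n) r" using en_antimono[OF s(1), of r t n] r by simp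
    qed
  qed
  have "\<exists>\<delta>>0. \<forall>\<alpha> u w. a < \<alpha> \<and> \<alpha> < a + \<delta> \<and> sol u w \<and> u 0 = \<sigma> * \<alpha> \<longrightarrow> okr u w"
  proof (rule ccontr)
    assume neg: "\<not> ?thesis"
    obtain dX where dX: "dX > 0" "\<And>\<alpha> u w. a < \<alpha> \<Longrightarrow> \<alpha> < a + dX \<Longrightarrow> sol u w \<Longrightarrow> u 0 = \<sigma> * \<alpha> \<Longrightarrow> \<exists>t>\<rho>. u t = 0 \<and> 0 < en u w t"
      using X[of \<rho>] by blast
    define d where "d n = dX / real (Suc n)" for n
    have d0: "0 < d n" "d n \<le> dX" for n using dX by (auto simp: d_def field_simps)
    have "\<exists>\<alpha> p. a < \<alpha> \<and> \<alpha> < a + d n \<and> sol (fst p) (snd p) \<and> fst p 0 = \<sigma> * \<alpha> \<and> \<not> okr (fst p) (snd p)" for n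
      using neg d0(1)[of n] by (metis fst_conv snd_conv)
    then obtain al p where p: "\<And>n. a < al n" "\<And>n. al n < a + d n" "\<And>n. sol (fst (p n)) (snd (p n))"
      "\<And>n. fst (p n) 0 = \<sigma> * al n" "\<And>n. \<not> okr (fst (p n)) (snd (p n))" by metis
    have dl: "d \<longlonglongrightarrow> 0"
    proof -
      have "(\<lambda>n. dX * (1 / real (Suc n))) \<longlonglongrightarrow> dX * 0" by (intro tendsto_intros LIMSEQ_Suc[OF lim_1_over_n])
      then show ?thesis by (simp add: d_def[abs_def])
    qed
    have "al \<longlonglongrightarrow> a"
    proof (rule tendsto_sandwich[of "\<lambda>_. a" al sequentially "\<lambda>n. a + d n"])
      have "(\<lambda>n. a + d n) \<longlonglongrightarrow> a + 0" by (intro tendsto_intros dl)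
      then show "(\<lambda>n. a + d n) \<longlonglongrightarrow> a" by simp
    qed (use p in \<open>auto intro!: always_eventually less_imp_le\<close>)
    from conv[OF p(3,4,1) this] obtain k where k: "strict_mono (k :: nat \<Rightarrow> nat)"
      "luconv (\<lambda>n. fst (p (k n))) u0" "luconv (\<lambda>n. snd (p (k n))) w0" by blast
    have r0: "0 \<le> \<rho>" using \<rho> by simp
    have "(\<lambda>n. \<rho> * en (fst (p (k n))) (snd (p (k n))) \<rho>) \<longlonglongrightarrow> \<rho> * en u0 w0 \<rho>"
      by (intro tendsto_intros en_luconv[OF k(2) cu0(1) k(3) cu0(2)]) (use r0 in auto)
    then have "\<forall>\<^sub>F n in sequentially. \<rho> * en (fst (p (k n))) (snd (p (k n))) \<rho> < c2 / 4"
      by (rule order_tendstoD(2)) (use R1[OF \<rho>(3)] in simp)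
    moreover have "\<forall>\<^sub>F n in sequentially. 2 * bp / 3 < fst (p (k n)) \<rho>"
      by (rule order_tendstoD(1)[OF luconv_pt[OF k(2) cu0(1) r0]]) (use R1[OF \<rho>(3)] in simp)
    ultimately have "\<forall>\<^sub>F n in sequentially. okr (fst (p (k n))) (snd (p (k n)))"
    proof eventually_elim
      case (elim n)
      have "\<exists>t>\<rho>. fst (p (k n)) t = 0 \<and> 0 < en (fst (p (k n))) (snd (p (k n))) t"
        by (rule dX(2)[OF p(1) _ p(3,4)]) (use p(2)[of "k n"] d0(2)[of "k n"] in linarith)
      then show ?case using elim by (simp add: okr_def)
    qed
    then show False using p(5) by (auto dest: eventually_happens)
  qed
  then obtain \<delta> where \<delta>: "\<delta> > 0" "\<And>\<alpha> u w. a < \<alpha> \<Longrightarrow> \<alpha> < a + \<delta> \<Longrightarrow> sol u w \<Longrightarrow> u 0 = \<sigma> * \<alpha> \<Longrightarrow> okr u w" by blast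
  define b where "b = a + \<delta> / 2"
  have ab: "a < b" "b < a + \<delta>" using \<delta> by (auto simp: b_def)
  define ok where "ok \<alpha> u w \<longleftrightarrow> sol u w \<and> u 0 = \<sigma> * \<alpha>" for \<alpha> u w
  have ex_ok: "\<exists>u w. ok \<alpha> u w" for \<alpha> using sol_exists[of "\<sigma> * \<alpha>"] unfolding ok_def by blast
  \<comment> \<open>the first zero after \<open>\<rho>\<close>\<close>
  have zt: "\<exists>\<zeta>>\<rho>. u \<zeta> = 0 \<and> 0 < en u w \<zeta> \<and> (\<forall>r. \<rho> \<le> r \<and> r < \<zeta> \<longrightarrow> 0 < u r)"
    if "ok \<alpha> u w" "a < \<alpha>" "\<alpha> \<le> b" for \<alpha> u w
  proof -
    have s: "sol u w" and o: "okr u w" using that \<delta>(2)[of \<alpha> u w] ab by (auto simp: ok_def)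
    obtain t where t: "t > \<rho>" "u t = 0" "0 < en u w t" "0 < u \<rho>" using o bp_pos by (auto simp: okr_def)
    obtain z where z: "\<rho> < z" "z \<le> t" "u z = 0" "\<And>r. \<rho> \<le> r \<Longrightarrow> r < z \<Longrightarrow> 0 < u r"
      using first_down[OF sol_cont(1)[OF s, of \<rho> t], of 0] t \<rho> by auto
    then show ?thesis using en_antimono[OF s, of z t] t \<rho> by (intro exI[of _ z]) auto
  qed
  \<comment> \<open>a solution that stays in the well from \<open>\<tau>\<close> to a later zero traverses the zone\<close>
  have pass: "c1 \<le> (\<tau> + T0) * en u w \<tau>"
    if s: "sol u w" and t: "\<rho> \<le> \<tau>" "\<tau> \<le> \<zeta>" "2 * bp / 3 \<le> u \<tau>" "u \<zeta> = 0" "0 < en u w \<zeta>"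
      and r: "\<And>r. \<tau> \<le> r \<Longrightarrow> r \<le> \<zeta> \<Longrightarrow> 0 \<le> u r \<and> u r \<le> bp" for u w \<tau> \<zeta>
    by (rule zoneD[OF Z s, of \<tau> \<zeta> \<tau>]) (use t r \<rho> bm_neg bp_pos in \<open>fastforce+\<close>)
  define Y where "Y y = {\<alpha>. a < \<alpha> \<and> \<alpha> \<le> b \<and> (\<exists>u w r. ok \<alpha> u w \<and> \<rho> \<le> r \<and> u r = bp + y \<and> w r \<le> 0 \<and>
     c2 < r * en u w r \<and> (\<forall>x. \<rho> \<le> x \<and> x \<le> r \<longrightarrow> 0 < u x))}" for y
  have YI: "\<alpha> \<in> Y y" if "a < \<alpha>" "\<alpha> \<le> b" "ok \<alpha> u w" "\<rho> \<le> r" "u r = bp + y" "w r \<le> 0" "c2 < r * en u w r"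
    "\<And>x. \<rho> \<le> x \<Longrightarrow> x \<le> r \<Longrightarrow> 0 < u x" for \<alpha> y u w r
    unfolding Y_def using that by blast
  \<comment> \<open>the last passage of \<open>bp\<close> before the zero takes place with \<open>r * en\<close> well above \<open>c2\<close> and \<open>w < 0\<close>, and
    so does that of all slightly higher levels\<close>
  have "\<exists>yb>0. \<forall>y. 0 < y \<and> y < yb \<longrightarrow> b \<in> Y y"
  proof -
    obtain u w where uw: "ok b u w" using ex_ok by blast
    then have s: "sol u w" by (simp add: ok_def)
    have o: "okr u w" using uw \<delta>(2)[of b u w] ab by (auto simp: ok_def)
    obtain \<zeta> where z: "\<rho> < \<zeta>" "u \<zeta> = 0" "0 < en u w \<zeta>" "\<And>r. \<rho> \<le> r \<Longrightarrow> r < \<zeta> \<Longrightarrow> 0 < u r" using zt[OF uw ab(1)] by auto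
    have nn: "0 \<le> u r" if "\<rho> \<le> r" "r \<le> \<zeta>" for r using z(2) z(4)[of r] that by (cases "r = \<zeta>") auto
    have "\<exists>r0. \<rho> \<le> r0 \<and> r0 < \<zeta> \<and> bp < u r0"
    proof (rule ccontr)
      assume neg: "\<not> ?thesis"
      have "c1 \<le> (\<rho> + T0) * en u w \<rho>"
      proof (rule pass[OF s _ _ _ z(2,3)])
        fix r assume r: "\<rho> \<le> r" "r \<le> \<zeta>"
        have "u r \<le> bp" using neg r z(2) bp_pos by (cases "r = \<zeta>") (auto simp: not_less)
        then show "0 \<le> u r \<and> u r \<le> bp" using nn[OF r] by simp
      qed (use z(1) o in \<open>auto simp: okr_def\<close>)
      also have "\<dots> \<le> (2 * \<rho>) * en u w \<rho>"
        using \<rho> T0 en_antimono[OF s, of \<rho> \<zeta>] z by (intro mult_right_mono) auto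
      also have "\<dots> = 2 * (\<rho> * en u w \<rho>)" by simp
      also have "\<dots> < c2" using o c2 unfolding okr_def by linarith
      finally show False using c1 by (simp add: c2_def)
    qed
    then obtain r0 where r0: "\<rho> \<le> r0" "r0 < \<zeta>" "bp < u r0" by blast
    have r00: "0 \<le> r0" using r0 \<rho> by simp
    obtain \<tau> where t: "r0 \<le> \<tau>" "\<tau> < \<zeta>" "u \<tau> = bp" "\<And>r. \<tau> < r \<Longrightarrow> r \<le> \<zeta> \<Longrightarrow> u r < bp"
      using last_down[OF sol_cont(1)[OF s r00], of \<zeta> bp] r0 z bp_pos by auto
    have t0: "0 < \<tau>" using t r0 \<rho> by simp
    have et: "0 < en u w \<tau>" using en_antimono[OF s, of \<tau> \<zeta>] t t0 z by simp
    have "c1 \<le> (\<tau> + T0) * en u w \<tau>"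
    proof (rule pass[OF s _ _ _ z(2,3)])
      fix r assume r: "\<tau> \<le> r" "r \<le> \<zeta>"
      show "0 \<le> u r \<and> u r \<le> bp" using nn[of r] t(3) t(4)[of r] r t(1) r0 by (cases "r = \<tau>") auto
    qed (use t r0 bp_pos in auto)
    also have "\<dots> \<le> (5 / 4 * \<tau>) * en u w \<tau>" using \<rho> t r0 et by (intro mult_right_mono) auto
    finally have big: "c2 < \<tau> * en u w \<tau>" using c1 by (simp add: c2_def)
    have wt: "w \<tau> < 0"
    proof (rule ccontr)
      assume "\<not> w \<tau> < 0"
      moreover have "w \<tau> \<noteq> 0" using crit_outside[of w \<tau> u] et t(3) bm_neg bp_pos by auto
      ultimately have "0 < psi m (w \<tau>)" using psi_pos by simp
      from DERIV_pos_inc_right[OF sol_du[OF s t0] this] obtain d where d: "d > 0" "\<And>h. 0 < h \<Longrightarrow> h < d \<Longrightarrow> u \<tau> < u (\<tau> + h)" by blast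
      define h where "h = min (d / 2) (\<zeta> - \<tau>)"
      have "0 < h" "h < d" "\<tau> + h \<le> \<zeta>" using d t by (auto simp: h_def)
      then show False using d(2)[of h] t(3) t(4)[of "\<tau> + h"] by auto
    qed
    have "\<exists>d>0. \<forall>r. \<bar>r - \<tau>\<bar> < d \<longrightarrow> w r < 0 \<and> c2 < r * en u w r"
    proof -
      have iw: "isCont w \<tau>" using sol_dw[OF s t0] by (rule DERIV_isCont)
      have ie: "isCont (\<lambda>r. r * en u w r) \<tau>" using DERIV_isCont[OF en_deriv[OF s t0]] by (intro continuous_intros)
      have "\<forall>\<^sub>F r in nhds \<tau>. w r < 0"
        by (rule order_tendstoD(2)[OF isCont_nhds[OF iw] wt])
      moreover have "\<forall>\<^sub>F r in nhds \<tau>. c2 < r * en u w r"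
        using order_tendstoD(1)[OF isCont_nhds[OF ie], of c2] big by simp
      ultimately have "\<forall>\<^sub>F r in nhds \<tau>. w r < 0 \<and> c2 < r * en u w r" by (rule eventually_conj)
      then show ?thesis by (simp add: eventually_nhds_metric dist_real_def)
    qed
    then obtain d where d: "d > 0" "\<And>r. \<bar>r - \<tau>\<bar> < d \<Longrightarrow> w r < 0 \<and> c2 < r * en u w r" by blast
    have "r0 < \<tau>" using t r0 by (cases "r0 = \<tau>") auto
    define q where "q = max (\<tau> - d / 2) r0"
    have q: "r0 \<le> q" "q < \<tau>" "\<tau> - d < q" using d \<open>r0 < \<tau>\<close> by (auto simp: q_def)
    have uq: "bp < u q"
    proof -
      have "u \<tau> < u q" by (rule u_dec[OF s]) (use q r00 d(2) in \<open>auto simp: abs_less_iff\<close>)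
      then show ?thesis using t by simp
    qed
    have "b \<in> Y y" if y: "0 < y" "y < u q - bp" for y
    proof -
      have "\<exists>x\<ge>q. x \<le> \<tau> \<and> u x = bp + y"
        by (rule IVT2') (use y t q r00 sol_cont(1)[OF s] in auto)
      then obtain x where x: "q \<le> x" "x \<le> \<tau>" "u x = bp + y" by blast
      have "w x < 0 \<and> c2 < x * en u w x" by (rule d(2)) (use x q d in \<open>auto simp: abs_less_iff\<close>)
      moreover have "0 < u v" if "\<rho> \<le> v" "v \<le> x" for v using z(4)[of v] that x t by simp
      ultimately show ?thesis using ab uw x q r0 by (intro YI[of b u w x]) auto
    qed
    then show ?thesis using uq by (intro exI[of _ "u q - bp"]) auto
  qed
  then obtain yb where yb: "yb > 0" "\<And>y. 0 < y \<Longrightarrow> y < yb \<Longrightarrow> b \<in> Y y" by blast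
  \<comment> \<open>\<open>y\<close> is chosen small for \<open>no_sticking\<close>, for \<open>b \<in> Y y\<close>, and such that the rise to \<open>bp + y\<close> adds at most
    \<open>c2 / 4\<close> to \<open>r * en\<close>\<close>
  define Cr where "Cr = (m / (m - 1)) powr (1 - 1 / m) * (Mf + 1) powr (1 - 1 / m)"
  have Cr: "0 < Cr" using m1 Mf0 by (auto simp: Cr_def)
  obtain y where y: "y \<le> min (min (ys / 2) (yb / 2)) (min 1 (c2 / 4 / Cr))" "good_level y"
    using good_level_exists[OF fbp, of "min (min (ys / 2) (yb / 2)) (min 1 (c2 / 4 / Cr))"] ys yb Cr c2 by auto
  have y0: "0 < y" using y(2) by (simp add: good_level_def)
  have y1: "y < ys" "y < yb" "y \<le> 1" "y * Cr \<le> c2 / 4"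
    using y(1) ys yb Cr by (auto simp: pos_le_divide_eq)
  have Fy: "0 < F (bp + y)" "F (bp + y) \<le> Mf + 1"
  proof -
    show "0 < F (bp + y)" using y0 by (intro F_pos) simp
    have "\<bar>F (bp + y) - F bp\<bar> \<le> Mf * \<bar>bp + y - bp\<bar>" by (rule F_lip)
    also have "\<dots> \<le> Mf * 1" using y1 y0 Mf0 by (intro mult_left_mono) auto
    finally show "F (bp + y) \<le> Mf + 1" using F_bp by simp
  qed
  \<comment> \<open>If \<open>w r = 0\<close>, the solution has risen to the level. It was at \<open>bp\<close> or above with \<open>r * en < c2 / 4\<close> at
    some \<open>t0\<close>, since \<open>r * en\<close> does not increase in the well, and the rest of the rise is short.\<close>
  have top: "w r < 0"
    if o: "ok \<alpha> u w" "a < \<alpha>" "\<alpha> \<le> b" and r: "\<rho> \<le> r" "u r = bp + y" "w r \<le> 0" "c2 < r * en u w r"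
      and p: "\<And>x. \<rho> \<le> x \<Longrightarrow> x \<le> r \<Longrightarrow> 0 < u x" for \<alpha> u w r
  proof (rule ccontr)
    assume "\<not> w r < 0"
    then have wr: "w r = 0" using r by simp
    have s: "sol u w" and okk: "okr u w" using o \<delta>(2)[of \<alpha> u w] ab by (auto simp: ok_def)
    have rr: "0 \<le> \<rho>" "0 \<le> r" using \<rho> r by auto
    have er: "en u w r = F (bp + y)" using wr r by (simp add: en_def)
    have e\<rho>: "\<rho> * en u w \<rho> < c2 / 4" "2 * bp / 3 < u \<rho>" using okk by (auto simp: okr_def)
    have wp: "0 < w x" if "\<rho> \<le> x" "x < r" for x
    proof (rule ccontr)
      assume "\<not> 0 < w x"
      then have "w r < 0"
        by (intro descent[OF s _ that(2)]) (use that p rr er Fy in \<open>auto intro!: always_eventually less_imp_le\<close>)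
      then show False using wr by simp
    qed
    have "\<exists>t0. \<rho> \<le> t0 \<and> t0 \<le> r \<and> bp \<le> u t0 \<and> t0 * en u w t0 < c2 / 4"
    proof (cases "bp \<le> u \<rho>")
      case True then show ?thesis using e\<rho> r by auto
    next
      case False
      obtain t0 where t0: "\<rho> < t0" "t0 \<le> r" "u t0 = bp" "\<And>x. \<rho> \<le> x \<Longrightarrow> x < t0 \<Longrightarrow> u x < bp"
        using first_up[OF sol_cont(1)[OF s rr(1)] r(1), of bp] False r y0 by auto
      have "(t0 + 0) * en u w t0 \<le> (\<rho> + 0) * en u w \<rho>"
      proof (rule en_weighted[OF s rr(1)])
        fix x assume x: "\<rho> < x" "x < t0"
        then have "0 < u x" "u x < bp" using p[of x] t0(2) t0(4)[of x] by auto
        then show "F (u x) \<le> 0" using bm_neg by (intro F_nonpos) auto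
      qed (use t0 in auto)
      then show ?thesis using t0 e\<rho> by (intro exI[of _ t0]) auto
    qed
    then obtain t0 where t0: "\<rho> \<le> t0" "t0 \<le> r" "bp \<le> u t0" "t0 * en u w t0 < c2 / 4" by blast
    have "(r - t0) * F (bp + y) \<le> y * (m / (m - 1)) powr (1 - 1 / m) * F (bp + y) powr (1 - 1 / m)"
      by (rule rising_time[OF s y(2) _ t0(2) r(2) wr _ t0(3)]) (use t0 rr wp in auto)
    also have "\<dots> \<le> y * (m / (m - 1)) powr (1 - 1 / m) * (Mf + 1) powr (1 - 1 / m)"
      using Fy m1 y0 by (intro mult_left_mono powr_mono2) auto
    also have "\<dots> \<le> c2 / 4" using y1(4) by (simp add: Cr_def mult.assoc)
    finally have 1: "(r - t0) * F (bp + y) \<le> c2 / 4" .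
    have "t0 * F (bp + y) \<le> t0 * en u w t0"
      using en_antimono[OF s, of t0 r] t0 rr er by (intro mult_left_mono) auto
    then have "r * F (bp + y) \<le> c2 / 2" using 1 t0(4) by (simp add: algebra_simps)
    then show False using r(4) er c2 by simp
  qed
  \<comment> \<open>nearby solutions pass the level transversally as well\<close>
  have Yopen: False
    if A: "A \<in> Y y" and al: "\<And>n. a < al n" "\<And>n. al n \<le> b" "al \<longlonglongrightarrow> A" "\<And>n. al n \<notin> Y y" for A al
  proof -
    obtain u w r where A': "a < A" "A \<le> b" and o: "ok A u w" and r: "\<rho> \<le> r" "u r = bp + y" "w r \<le> 0" "c2 < r * en u w r"
      and p: "\<And>x. \<rho> \<le> x \<Longrightarrow> x \<le> r \<Longrightarrow> 0 < u x" using A unfolding Y_def by blast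
    have s: "sol u w" and okk: "okr u w" using o A' \<delta>(2)[of A u w] ab by (auto simp: ok_def)
    have wr: "w r < 0" by (rule top[OF o A' r p])
    obtain \<zeta> where z: "\<rho> < \<zeta>" "u \<zeta> = 0" "0 < en u w \<zeta>" "\<And>r. \<rho> \<le> r \<Longrightarrow> r < \<zeta> \<Longrightarrow> 0 < u r" using zt[OF o A'] by auto
    have r\<zeta>: "r < \<zeta>" using p[of \<zeta>] z by (cases "r < \<zeta>") auto
    have "r \<noteq> \<rho>" using okk r(4) c2 by (auto simp: okr_def)
    then have r\<rho>: "\<rho> < r" using r by simp
    have r0: "0 < r" using r\<rho> \<rho> by simp
    have "\<exists>d>0. \<forall>x. \<bar>x - r\<bar> < d \<longrightarrow> w x < 0 \<and> c2 < x * en u w x"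
    proof -
      have iw: "isCont w r" using sol_dw[OF s r0] by (rule DERIV_isCont)
      have ie: "isCont (\<lambda>r. r * en u w r) r" using DERIV_isCont[OF en_deriv[OF s r0]] by (intro continuous_intros)
      have "\<forall>\<^sub>F x in nhds r. w x < 0"
        by (rule order_tendstoD(2)[OF isCont_nhds[OF iw] wr])
      moreover have "\<forall>\<^sub>F x in nhds r. c2 < x * en u w x"
        using order_tendstoD(1)[OF isCont_nhds[OF ie], of c2] r(4) by simp
      ultimately have "\<forall>\<^sub>F x in nhds r. w x < 0 \<and> c2 < x * en u w x" by (rule eventually_conj)
      then show ?thesis by (simp add: eventually_nhds_metric dist_real_def)
    qed
    then obtain d where d: "d > 0" "\<And>x. \<bar>x - r\<bar> < d \<Longrightarrow> w x < 0 \<and> c2 < x * en u w x" by blast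
    define h where "h = min (d / 2) (min (r - \<rho>) ((\<zeta> - r) / 2))"
    have h: "0 < h" "h < d" "\<rho> \<le> r - h" "r + h < \<zeta>" using d r\<rho> r\<zeta> by (auto simp: h_def min_def field_simps)
    have up: "bp + y < u (r - h)"
    proof -
      have "u r < u (r - h)" by (rule u_dec[OF s]) (use h \<rho> d(2) in \<open>auto simp: abs_less_iff\<close>)
      then show ?thesis using r by simp
    qed
    have dn: "u (r + h) < bp + y"
    proof -
      have "u (r + h) < u r" by (rule u_dec[OF s]) (use h \<rho> r0 d(2) in \<open>auto simp: abs_less_iff\<close>)
      then show ?thesis using r by simp
    qed
    have "\<exists>p. ok (al n) (fst p) (snd p)" for n using ex_ok[of "al n"] by (metis fst_conv snd_conv)
    then obtain P where P: "\<And>n. ok (al n) (fst (P n)) (snd (P n))" by metis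
    define un where "un n = fst (P n)" for n
    define wn where "wn n = snd (P n)" for n
    have sn: "sol (un n) (wn n)" "un n 0 = \<sigma> * al n" "ok (al n) (un n) (wn n)" for n using P[of n] by (auto simp: ok_def un_def wn_def)
    have l0: "(\<lambda>n. un n 0) \<longlonglongrightarrow> u 0"
    proof -
      have u0A: "u 0 = \<sigma> * A" using o by (simp add: ok_def)
      show ?thesis unfolding sn(2) u0A by (intro tendsto_intros al(3))
    qed
    have ez: "0 < en u w x" if "0 \<le> x" "x < \<zeta>" for x using en_antimono[OF s, of x \<zeta>] that z(3) by simp
    obtain k v zz where k: "strict_mono (k :: nat \<Rightarrow> nat)" "luconv (\<lambda>n. un (k n)) v" "luconv (\<lambda>n. wn (k n)) zz"
      "sol v zz" and veq: "\<And>x. 0 \<le> x \<Longrightarrow> x \<le> \<zeta> \<Longrightarrow> v x = u x \<and> zz x = w x"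
      using conv_unique[OF sn(1) l0 s, of \<zeta>] z(1) \<rho> ez by auto
    have cv: "continuous_on {0..} v" "continuous_on {0..} zz" using sol_cont0[OF k(4)] by auto
    have e1: "\<forall>\<^sub>F n in sequentially. bp + y < un (k n) (r - h)"
      by (rule order_tendstoD(1)[OF luconv_pt[OF k(2) cv(1)]]) (use veq[of "r - h"] up h \<rho> in auto)
    have e2: "\<forall>\<^sub>F n in sequentially. un (k n) (r + h) < bp + y"
      by (rule order_tendstoD(2)[OF luconv_pt[OF k(2) cv(1)]]) (use veq[of "r + h"] dn h \<rho> r0 in auto)
    obtain xm where xm: "\<rho> \<le> xm" "xm \<le> r + h" "\<And>x. \<rho> \<le> x \<Longrightarrow> x \<le> r + h \<Longrightarrow> u xm \<le> u x"
      using continuous_attains_inf[OF compact_Icc _ sol_cont(1)[OF s, of \<rho> "r + h"]] \<rho> r\<rho> h by auto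
    have um: "0 < u xm" using z(4)[of xm] xm h by simp
    obtain n0 where n0: "\<And>n x. n0 \<le> n \<Longrightarrow> 0 \<le> x \<Longrightarrow> x \<le> r + h \<Longrightarrow> \<bar>un (k n) x - v x\<bar> < u xm"
      using k(2) um unfolding luconv_def by (metis atLeastAtMost_iff)
    have e3: "\<forall>\<^sub>F n in sequentially. \<forall>x. \<rho> \<le> x \<and> x \<le> r + h \<longrightarrow> 0 < un (k n) x"
      unfolding eventually_sequentially
    proof (intro exI allI impI)
      fix n x assume n: "n0 \<le> n" and x: "\<rho> \<le> x \<and> x \<le> r + h"
      have "\<bar>un (k n) x - v x\<bar> < u xm" by (rule n0[OF n]) (use x \<rho> in auto)
      moreover have "v x = u x" using veq[of x] x h \<rho> by simp
      moreover have "u xm \<le> u x" using xm(3) x by simp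
      ultimately show "0 < un (k n) x" by linarith
    qed
    from eventually_conj[OF e1 eventually_conj[OF e2 e3]] obtain n1 where
      n1: "\<And>n. n1 \<le> n \<Longrightarrow> bp + y < un (k n) (r - h) \<and> un (k n) (r + h) < bp + y \<and> (\<forall>x. \<rho> \<le> x \<and> x \<le> r + h \<longrightarrow> 0 < un (k n) x)"
      unfolding eventually_sequentially by blast
    have "\<exists>x. r - h \<le> x \<and> x \<le> r + h \<and> un (k n) x = bp + y" if "n1 \<le> n" for n
    proof -
      have "\<exists>x\<ge>r - h. x \<le> r + h \<and> un (k n) x = bp + y"
        by (rule IVT2') (use n1[OF that] h \<rho> sol_cont(1)[OF sn(1)] in auto)
      then show ?thesis by blast
    qed
    then have "\<forall>n. \<exists>x. r - h \<le> x \<and> x \<le> r + h \<and> un (k (n + n1)) x = bp + y" by simp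
    then obtain X where Xn: "\<And>n. r - h \<le> X n \<and> X n \<le> r + h \<and> un (k (n + n1)) (X n) = bp + y" by metis
    have "\<forall>n. X n \<in> {r - h..r + h}" using Xn by simp
    then obtain x0 j where x0: "x0 \<in> {r - h..r + h}" "strict_mono (j :: nat \<Rightarrow> nat)" "(X \<circ> j) \<longlonglongrightarrow> x0"
      using compact_Icc[of "r - h" "r + h"] unfolding compact_def by meson
    define kk where "kk n = j n + n1" for n
    have kk: "strict_mono kk" using x0(2) by (auto simp: kk_def strict_mono_def)
    have X0: "0 \<le> X (j n)" for n using Xn[of "j n"] h \<rho> by linarith
    have lw: "(\<lambda>n. wn (k (kk n)) (X (j n))) \<longlonglongrightarrow> zz x0"
      using luconv_seq[OF luconv_subseq[OF k(3) kk] cv(2) X0] x0(3) by (simp add: o_def)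
    have le: "(\<lambda>n. X (j n) * en (un (k (kk n))) (wn (k (kk n))) (X (j n))) \<longlonglongrightarrow> x0 * en v zz x0"
      using x0(3) by (intro tendsto_mult en_luconv[OF luconv_subseq[OF k(2) kk] cv(1) luconv_subseq[OF k(3) kk] cv(2) X0]) (auto simp: o_def)
    have x0b: "0 \<le> x0" "x0 \<le> \<zeta>" "\<bar>x0 - r\<bar> < d" using x0(1) h \<rho> by (auto simp: abs_less_iff)
    have v0: "v x0 = u x0" "zz x0 = w x0" using veq x0b by auto
    have "\<forall>\<^sub>F n in sequentially. wn (k (kk n)) (X (j n)) < 0"
      by (rule order_tendstoD(2)[OF lw]) (use d(2) x0b v0 in auto)
    moreover have "\<forall>\<^sub>F n in sequentially. c2 < X (j n) * en (un (k (kk n))) (wn (k (kk n))) (X (j n))"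
      by (rule order_tendstoD(1)[OF le]) (use d(2)[OF x0b(3)] v0 in \<open>simp add: en_def\<close>)
    ultimately have "\<forall>\<^sub>F n in sequentially. wn (k (kk n)) (X (j n)) < 0 \<and> c2 < X (j n) * en (un (k (kk n))) (wn (k (kk n))) (X (j n))"
      by (rule eventually_conj)
    then obtain n where n: "wn (k (kk n)) (X (j n)) < 0" "c2 < X (j n) * en (un (k (kk n))) (wn (k (kk n))) (X (j n))"
      using eventually_happens by (metis (no_types, lifting) sequentially_bot)
    have "al (k (kk n)) \<in> Y y"
    proof (rule YI[OF al(1,2) sn(3) _ _ _ n(2)])
      show "\<rho> \<le> X (j n)" using Xn[of "j n"] h by linarith
      show "un (k (kk n)) (X (j n)) = bp + y" using Xn[of "j n"] by (simp add: kk_def)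
      show "wn (k (kk n)) (X (j n)) \<le> 0" using n by simp
      fix x assume "\<rho> \<le> x" "x \<le> X (j n)"
      then show "0 < un (k (kk n)) x" using n1[of "kk n"] Xn[of "j n"] by (auto simp: kk_def)
    qed
    then show False using al(4) by blast
  qed
  \<comment> \<open>the passages of the approximating solutions stay before a fixed point beyond the first zero of the
    limit, so they accumulate\<close>
  have Yclosed: "A \<in> Y y"
    if A: "a < A" "A \<le> b" and al: "\<And>n. al n \<in> Y y" "al \<longlonglongrightarrow> A" for A al
  proof -
    have "\<exists>p. ok (al n) (fst p) (fst (snd p)) \<and> \<rho> \<le> snd (snd p) \<and> fst p (snd (snd p)) = bp + y \<and>
       fst (snd p) (snd (snd p)) \<le> 0 \<and> c2 < snd (snd p) * en (fst p) (fst (snd p)) (snd (snd p)) \<and>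
       (\<forall>x. \<rho> \<le> x \<and> x \<le> snd (snd p) \<longrightarrow> 0 < fst p x)" for n
    proof -
      obtain u w r where h: "ok (al n) u w" "\<rho> \<le> r" "u r = bp + y" "w r \<le> 0" "c2 < r * en u w r"
        "\<forall>x. \<rho> \<le> x \<and> x \<le> r \<longrightarrow> 0 < u x" using al(1)[of n] unfolding Y_def by blast
      show ?thesis by (rule exI[of _ "(u, w, r)"]) (use h in simp)
    qed
    then obtain P where P: "\<And>n. ok (al n) (fst (P n)) (fst (snd (P n))) \<and> \<rho> \<le> snd (snd (P n)) \<and> fst (P n) (snd (snd (P n))) = bp + y \<and>
       fst (snd (P n)) (snd (snd (P n))) \<le> 0 \<and> c2 < snd (snd (P n)) * en (fst (P n)) (fst (snd (P n))) (snd (snd (P n))) \<and>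
       (\<forall>x. \<rho> \<le> x \<and> x \<le> snd (snd (P n)) \<longrightarrow> 0 < fst (P n) x)" by metis
    define un where "un n = fst (P n)" for n
    define wn where "wn n = fst (snd (P n))" for n
    define rn where "rn n = snd (snd (P n))" for n
    have sn: "sol (un n) (wn n)" "un n 0 = \<sigma> * al n" "ok (al n) (un n) (wn n)" "\<rho> \<le> rn n" "un n (rn n) = bp + y" "wn n (rn n) \<le> 0"
      "c2 < rn n * en (un n) (wn n) (rn n)" "\<And>x. \<rho> \<le> x \<Longrightarrow> x \<le> rn n \<Longrightarrow> 0 < un n x" for n
      using P[of n] by (auto simp: ok_def un_def wn_def rn_def)
    have "(\<lambda>n. un n 0) \<longlonglongrightarrow> \<sigma> * A" unfolding sn(2) by (intro tendsto_intros al(2))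
    from sol_compact[OF sn(1) this] obtain k u w where k: "strict_mono (k :: nat \<Rightarrow> nat)" "luconv (\<lambda>n. un (k n)) u" "luconv (\<lambda>n. wn (k n)) w"
      "sol u w" "u 0 = \<sigma> * A" by blast
    have o: "ok A u w" using k by (simp add: ok_def)
    have s: "sol u w" by fact
    have cv: "continuous_on {0..} u" "continuous_on {0..} w" using sol_cont0[OF s] by auto
    obtain \<zeta> where z: "\<rho> < \<zeta>" "u \<zeta> = 0" "0 < en u w \<zeta>" "\<And>r. \<rho> \<le> r \<Longrightarrow> r < \<zeta> \<Longrightarrow> 0 < u r" using zt[OF o A] by auto
    have z0: "0 < \<zeta>" using z \<rho> by simp
    have nn: "0 \<le> u r" if "\<rho> \<le> r" "r \<le> \<zeta>" for r using z(2) z(4)[of r] that by (cases "r = \<zeta>") auto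
    have wz: "w \<zeta> < 0"
    proof (rule ccontr)
      assume "\<not> w \<zeta> < 0"
      moreover have "w \<zeta> \<noteq> 0" using crit_outside[of w \<zeta> u] z bm_neg bp_pos by auto
      ultimately have "0 < psi m (w \<zeta>)" using psi_pos by simp
      from DERIV_pos_inc_left[OF sol_du[OF s z0] this] obtain d where d: "d > 0" "\<And>h. 0 < h \<Longrightarrow> h < d \<Longrightarrow> u (\<zeta> - h) < u \<zeta>" by blast
      define h where "h = min (d / 2) (\<zeta> - \<rho>)"
      have "0 < h" "h < d" "\<rho> \<le> \<zeta> - h" using d z by (auto simp: h_def)
      then show False using d(2)[of h] z(2) nn[of "\<zeta> - h"] by auto
    qed
    from DERIV_neg_dec_right[OF sol_du[OF s z0] psi_neg[OF wz]]
    obtain d where d: "d > 0" "\<And>h. 0 < h \<Longrightarrow> h < d \<Longrightarrow> u (\<zeta> + h) < u \<zeta>" by blast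
    define z' where "z' = \<zeta> + d / 2"
    have z': "u z' < 0" "\<zeta> < z'" using d(1) d(2)[of "d/2"] z(2) by (auto simp: z'_def)
    have "\<forall>\<^sub>F n in sequentially. un (k n) z' < 0"
      by (rule order_tendstoD(2)[OF luconv_pt[OF k(2) cv(1)]]) (use z' z0 in auto)
    then obtain n1 where n1: "\<And>n. n1 \<le> n \<Longrightarrow> un (k n) z' < 0" unfolding eventually_sequentially by blast
    have rb: "rn (k n) \<le> z'" if "n1 \<le> n" for n
    proof (rule ccontr)
      assume "\<not> rn (k n) \<le> z'"
      then have "0 < un (k n) z'" using z' z by (intro sn(8)[of _ "k n"]) auto
      then show False using n1[OF that] by simp
    qed
    define X where "X n = rn (k (n + n1))" for n
    have "\<forall>n. X n \<in> {\<rho>..z'}" using rb sn(4) by (simp add: X_def)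
    then obtain r j where r: "r \<in> {\<rho>..z'}" "strict_mono (j :: nat \<Rightarrow> nat)" "(X \<circ> j) \<longlonglongrightarrow> r"
      using compact_Icc[of \<rho> z'] unfolding compact_def by meson
    define kk where "kk n = j n + n1" for n
    have kk: "strict_mono kk" using r(2) by (auto simp: kk_def strict_mono_def)
    have Xr: "X (j n) = rn (k (kk n))" for n by (simp add: X_def kk_def)
    have Xl: "(\<lambda>n. rn (k (kk n))) \<longlonglongrightarrow> r" using r(3) unfolding o_def Xr .
    have X0: "0 \<le> rn (k (kk n))" for n using sn(4)[of "k (kk n)"] \<rho> by linarith
    have lu: "(\<lambda>n. un (k (kk n)) (rn (k (kk n)))) \<longlonglongrightarrow> u r" by (rule luconv_seq[OF luconv_subseq[OF k(2) kk] cv(1) X0 Xl])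
    have lw: "(\<lambda>n. wn (k (kk n)) (rn (k (kk n)))) \<longlonglongrightarrow> w r" by (rule luconv_seq[OF luconv_subseq[OF k(3) kk] cv(2) X0 Xl])
    have le: "(\<lambda>n. rn (k (kk n)) * en (un (k (kk n))) (wn (k (kk n))) (rn (k (kk n)))) \<longlonglongrightarrow> r * en u w r"
      by (intro tendsto_mult Xl en_luconv[OF luconv_subseq[OF k(2) kk] cv(1) luconv_subseq[OF k(3) kk] cv(2) X0])
    have ur: "u r = bp + y" using lu unfolding sn(5) by (simp add: LIMSEQ_const_iff)
    have wr: "w r \<le> 0" by (rule tendsto_upperbound[OF lw]) (use sn(6) in auto)
    have er: "c2 \<le> r * en u w r" by (rule tendsto_lowerbound[OF le]) (use sn(7) in \<open>auto intro!: always_eventually less_imp_le\<close>)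
    have rr: "\<rho> \<le> r" using r by simp
    have pos: "0 \<le> u x" if x: "\<rho> \<le> x" "x < r" for x
    proof (rule tendsto_lowerbound[OF luconv_pt[OF luconv_subseq[OF k(2) kk] cv(1)]])
      show "0 \<le> x" using x \<rho> by simp
      have "\<forall>\<^sub>F n in sequentially. x < rn (k (kk n))" by (rule order_tendstoD(1)[OF Xl]) (use x in simp)
      then show "\<forall>\<^sub>F n in sequentially. 0 \<le> un (k (kk n)) x"
        by eventually_elim (use sn(8) x in \<open>auto intro!: less_imp_le\<close>)
    qed simp
    have r\<zeta>: "r < \<zeta>"
    proof (rule ccontr)
      assume "\<not> r < \<zeta>"
      moreover have "r \<noteq> \<zeta>" using ur z(2) y0 bp_pos by auto
      ultimately have rz: "\<zeta> < r" by simp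
      define h where "h = min (d / 2) ((r - \<zeta>) / 2)"
      have "0 < h" "h < d" "\<zeta> + h < r" using d rz by (auto simp: h_def min_def field_simps)
      then show False using d(2)[of h] z pos[of "\<zeta> + h"] by auto
    qed
    have pos': "0 < u x" if "\<rho> \<le> x" "x \<le> r" for x using z(4)[of x] that r\<zeta> by simp
    have r1: "1 \<le> r" "0 < r" using rr \<rho> by auto
    have epos: "0 < en u w x" if "0 \<le> x" "x \<le> \<zeta>" for x using en_antimono[OF s, of x \<zeta>] that z(3) by simp
    \<comment> \<open>Equality would give \<open>c1 \<le> (\<tau> + T0) c1 / (2 r)\<close>, where \<open>\<tau>\<close> is the next passage of \<open>bp\<close>. As \<open>T0 \<le> r /
      4\<close>, this means \<open>\<tau> \<ge> 3 r / 2\<close>.\<close>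
    have "c2 \<noteq> r * en u w r"
    proof
      assume eq: "c2 = r * en u w r"
      obtain \<tau> where t: "r < \<tau>" "\<tau> \<le> \<zeta>" "u \<tau> = bp" "\<And>x. r \<le> x \<Longrightarrow> x < \<tau> \<Longrightarrow> bp < u x"
        using first_down[OF sol_cont(1)[OF s less_imp_le[OF r1(2)]] less_imp_le[OF r\<zeta>], of bp] ur y0 z bp_pos by auto
      have wn': "w x < 0" if "r < x" "x \<le> \<zeta>" for x
        by (rule descent[OF s _ that(1) _ _ wr]) (use that r1 rr nn epos in auto)
      have "c1 \<le> (\<tau> + T0) * en u w \<tau>"
      proof (rule pass[OF s _ t(2) _ z(2,3)])
        fix x assume x: "\<tau> \<le> x" "x \<le> \<zeta>"
        have "u x \<le> u \<tau>" by (rule u_dec_le[OF s _ x(1)]) (use x t r1 wn' in \<open>auto intro!: less_imp_le\<close>)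
        then show "0 \<le> u x \<and> u x \<le> bp" using nn[of x] x t rr by simp
      qed (use t rr bp_pos in auto)
      also have "\<dots> \<le> (\<tau> + T0) * en u w r" using en_antimono[OF s, of r \<tau>] t r1 T0 by (intro mult_left_mono) auto
      also have "en u w r = c1 / (2 * r)" using eq r1 by (simp add: c2_def field_simps)
      finally have "c1 * (2 * r) \<le> c1 * (\<tau> + T0)" using r1 by (simp add: field_simps)
      then have "2 * r \<le> \<tau> + T0" using c1 by simp
      then have tt: "3 * r / 2 \<le> \<tau>" using \<rho> rr by linarith
      show False
      proof (rule stick[OF y(2) y1(1) s r1(1) wr ur eq[symmetric]])
        show "bp \<le> u x" if "r \<le> x" "x \<le> 3 * r / 2" for x
          using t(3) t(4)[of x] that tt by (cases "x = \<tau>") auto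
        show "0 < en u w (3 * r / 2)" using tt t r1 by (intro epos) auto
      qed
    qed
    then have "c2 < r * en u w r" using er by simp
    then show ?thesis by (rule YI[OF A o rr ur wr _ pos'])
  qed
  have all: "A \<in> Y y" if A: "a < A" "A \<le> b" for A
  proof (rule ccontr)
    assume nA: "A \<notin> Y y"
    obtain S where S: "A \<le> S" "S < b" "S \<notin> Y y" "\<And>x. S < x \<Longrightarrow> x \<le> b \<Longrightarrow> x \<in> Y y"
    proof (rule sup_of_complement[OF A(2) yb(2)[OF y0 y1(2)] nA])
      fix x xn assume x: "x \<in> Y y" and xn: "\<And>n. A \<le> xn n \<and> xn n \<le> b \<and> xn n \<notin> Y y" "xn \<longlonglongrightarrow> x"
      show False
      proof (rule Yopen[OF x _ _ xn(2)])
        fix n show "a < xn n" "xn n \<le> b" "xn n \<notin> Y y" using xn(1)[of n] A by auto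
      qed
    qed (use that in blast)
    define t where "t n = S + (b - S) / real (Suc n)" for n
    have tY: "t n \<in> Y y" for n using S(4) seq_down(1,2)[OF S(2)] by (simp add: t_def)
    have "t \<longlonglongrightarrow> S" using seq_down(3)[OF S(2)] by (simp add: t_def[abs_def])
    then have "S \<in> Y y" using Yclosed[of S t] tY S(1,2) A by simp
    then show False using S(3) by simp
  qed
  define al where "al n = a + (b - a) / real (Suc n)" for n
  have al: "a < al n" "al n \<le> b" for n using seq_down(1,2)[OF ab(1)] by (simp_all add: al_def)
  have all': "al \<longlonglongrightarrow> a" using seq_down(3)[OF ab(1)] by (simp add: al_def[abs_def])
  have "\<exists>p. ok (al n) (fst p) (fst (snd p)) \<and> \<rho> \<le> snd (snd p) \<and> fst p (snd (snd p)) = bp + y \<and>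
      c2 < snd (snd p) * en (fst p) (fst (snd p)) (snd (snd p))" for n
  proof -
    obtain u w r where h: "ok (al n) u w" "\<rho> \<le> r" "u r = bp + y" "c2 < r * en u w r"
      using all[OF al(1)[of n] al(2)[of n]] unfolding Y_def by blast
    show ?thesis by (rule exI[of _ "(u, w, r)"]) (use h in simp)
  qed
  then obtain P where P: "\<And>n. ok (al n) (fst (P n)) (fst (snd (P n))) \<and> \<rho> \<le> snd (snd (P n)) \<and> fst (P n) (snd (snd (P n))) = bp + y \<and>
      c2 < snd (snd (P n)) * en (fst (P n)) (fst (snd (P n))) (snd (snd (P n)))" by metis
  define un where "un n = fst (P n)" for n
  define wn where "wn n = fst (snd (P n))" for n
  define rn where "rn n = snd (snd (P n))" for n
  have sn: "sol (un n) (wn n)" "un n 0 = \<sigma> * al n" "\<rho> \<le> rn n" "un n (rn n) = bp + y" "c2 < rn n * en (un n) (wn n) (rn n)" for n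
    using P[of n] by (auto simp: ok_def un_def wn_def rn_def)
  obtain k where k: "strict_mono (k :: nat \<Rightarrow> nat)" "luconv (\<lambda>n. un (k n)) u0" "luconv (\<lambda>n. wn (k n)) w0"
    using conv[OF sn(1,2) al(1) all'] by blast
  \<comment> \<open>beyond \<open>q'\<close> the energy is too small to be at the level \<open>bp + y\<close>\<close>
  have "\<forall>\<^sub>F r in at_top. en u0 w0 r < F (bp + y)" by (rule order_tendstoD(2)[OF lim(3)]) (use Fy in simp)
  then obtain q where q: "\<And>r. q \<le> r \<Longrightarrow> en u0 w0 r < F (bp + y)" unfolding eventually_at_top_linorder by blast
  define q' where "q' = max q \<rho>"
  have q': "en u0 w0 q' < F (bp + y)" "\<rho> \<le> q'" "0 \<le> q'" using q \<rho> by (auto simp: q'_def)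
  have "(\<lambda>n. en (un (k n)) (wn (k n)) q') \<longlonglongrightarrow> en u0 w0 q'"
    by (rule en_luconv[OF k(2) cu0(1) k(3) cu0(2)]) (use q' in auto)
  then have "\<forall>\<^sub>F n in sequentially. en (un (k n)) (wn (k n)) q' < F (bp + y)" by (rule order_tendstoD(2)) (rule q')
  then obtain n1 where n1: "\<And>n. n1 \<le> n \<Longrightarrow> en (un (k n)) (wn (k n)) q' < F (bp + y)" unfolding eventually_sequentially by blast
  have rb: "rn (k n) \<le> q'" if "n1 \<le> n" for n
  proof (rule ccontr)
    assume "\<not> rn (k n) \<le> q'"
    then have "en (un (k n)) (wn (k n)) (rn (k n)) \<le> en (un (k n)) (wn (k n)) q'" using q' by (intro en_antimono[OF sn(1)]) auto
    moreover have "F (bp + y) \<le> en (un (k n)) (wn (k n)) (rn (k n))" using F_le_en[of "un (k n)" "rn (k n)" "wn (k n)"] sn(4) by simp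
    ultimately show False using n1[OF that] by simp
  qed
  define X where "X n = rn (k (n + n1))" for n
  have "\<forall>n. X n \<in> {\<rho>..q'}" using rb sn(3) by (simp add: X_def)
  then obtain r j where r: "r \<in> {\<rho>..q'}" "strict_mono (j :: nat \<Rightarrow> nat)" "(X \<circ> j) \<longlonglongrightarrow> r"
    using compact_Icc[of \<rho> q'] unfolding compact_def by meson
  define kk where "kk n = j n + n1" for n
  have kk: "strict_mono kk" using r(2) by (auto simp: kk_def strict_mono_def)
  have Xr: "X (j n) = rn (k (kk n))" for n by (simp add: X_def kk_def)
  have Xl: "(\<lambda>n. rn (k (kk n))) \<longlonglongrightarrow> r" using r(3) unfolding o_def Xr .
  have X0: "0 \<le> rn (k (kk n))" for n using sn(3)[of "k (kk n)"] \<rho> by linarith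
  have le: "(\<lambda>n. rn (k (kk n)) * en (un (k (kk n))) (wn (k (kk n))) (rn (k (kk n)))) \<longlonglongrightarrow> r * en u0 w0 r"
    by (intro tendsto_mult Xl en_luconv[OF luconv_subseq[OF k(2) kk] cu0(1) luconv_subseq[OF k(3) kk] cu0(2) X0])
  have "c2 \<le> r * en u0 w0 r" by (rule tendsto_lowerbound[OF le]) (use sn(5) in \<open>auto intro!: always_eventually less_imp_le\<close>)
  moreover have "r * en u0 w0 r < c2 / 4" using R1[of r] r \<rho> by auto
  ultimately show False using c2 by simp
qed

end
section \<open>Sign changes and their stability\<close>

text \<open>At a zero with \<open>w = 0\<close> a solution may be continued by \<open>0\<close>; such zeros do not count.\<close>

definition crossings :: "(real \<Rightarrow> real) \<Rightarrow> (real \<Rightarrow> real) \<Rightarrow> real set" where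
  "crossings u w = {r. 0 < r \<and> u r = 0 \<and> w r \<noteq> 0}"

definition crosses_at_least :: "nat \<Rightarrow> (real \<Rightarrow> real) \<Rightarrow> (real \<Rightarrow> real) \<Rightarrow> bool" where
  "crosses_at_least k u w \<longleftrightarrow> (\<exists>S\<subseteq>crossings u w. finite S \<and> card S = k)"

lemma not_crosses_at_least: assumes "\<not> crosses_at_least k u w" shows "finite (crossings u w)" "card (crossings u w) < k"
proof -
  show f: "finite (crossings u w)"
  proof (rule ccontr)
    assume "infinite (crossings u w)"
    then show False using infinite_arbitrarily_large[of "crossings u w" k] assms by (auto simp: crosses_at_least_def)
  qed
  show "card (crossings u w) < k"
  proof (rule ccontr)
    assume "\<not> card (crossings u w) < k"
    then have "k \<le> card (crossings u w)" by simp
    then show False using obtain_subset_with_card_n[of k "crossings u w"] assms unfolding crosses_at_least_def by metis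
  qed
qed

lemma crosses_at_least_enum:
  assumes "crosses_at_least k u w"
  shows "\<exists>t. (\<forall>i<k. t i \<in> crossings u w) \<and> (\<forall>i j. i < j \<and> j < k \<longrightarrow> t i < (t j :: real))"
proof -
  obtain S where S: "S \<subseteq> crossings u w" "finite S" "card S = k" using assms by (auto simp: crosses_at_least_def)
  let ?l = "sorted_list_of_set S"
  have l: "length ?l = k" "set ?l = S" "sorted_wrt (<) ?l" using S by auto
  show ?thesis
  proof (rule exI[of _ "\<lambda>i. ?l ! i"], intro conjI allI impI)
    fix i assume "i < k"
    then have "?l ! i \<in> set ?l" using l(1) by (intro nth_mem) simp
    then show "?l ! i \<in> crossings u w" using l(2) S(1) by blast
  next
    fix i j assume "i < j \<and> j < k"
    then show "?l ! i < ?l ! j" using sorted_wrt_nth_less[OF l(3), of i j] l(1) by simp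
  qed
qed

lemma function_subsequence:
  fixes t :: "nat \<Rightarrow> nat \<Rightarrow> real"
  assumes "\<And>n i. i < q \<Longrightarrow> \<bar>t n i\<bar> \<le> B"
  shows "\<exists>k. strict_mono (k :: nat \<Rightarrow> nat) \<and> (\<forall>i<q. \<exists>l. (\<lambda>n. t (k n) i) \<longlonglongrightarrow> l)"
proof -
  have c: "countable {..<q}" by simp
  have b: "norm (t n i) \<le> B" if "i \<in> {..<q}" for n i using assms that by simp
  have "\<exists>k. strict_mono (k :: nat \<Rightarrow> nat) \<and> (\<forall>i\<in>{..<q}. \<exists>l. (\<lambda>n. t (k n) i) \<longlonglongrightarrow> l)"
    by (rule function_convergent_subsequence[where f = t and M = B, OF c b]) blast+
  then show ?thesis by auto
qed

lemma deriv_truncate: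
  assumes "(g has_real_derivative 0) (at Z)" "g Z = 0"
  shows "((\<lambda>r. if r \<le> Z then g r else 0) has_real_derivative 0) (at (Z :: real))"
proof -
  have l: "((\<lambda>h. g (Z + h) / h) \<longlongrightarrow> 0) (at 0)" using assms by (simp add: DERIV_def)
  have "((\<lambda>h. (if Z + h \<le> Z then g (Z + h) else 0) / h) \<longlongrightarrow> 0) (at 0)"
    by (rule Lim_null_comparison[OF _ tendsto_rabs_zero[OF l]]) (auto simp: eventually_at_filter)
  then show ?thesis using assms by (simp add: DERIV_def)
qed

context shooting begin

lemma crossing_en: "r \<in> crossings u w \<Longrightarrow> 0 < en u w r"
  using kin_pos[OF m1] F_0 by (auto simp: crossings_def en_def)

lemma zero_crossing: "0 < r \<Longrightarrow> u r = 0 \<Longrightarrow> 0 < en u w r \<Longrightarrow> r \<in> crossings u w"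
  using F_0 by (auto simp: crossings_def en_def)

text \<open>A critical point between the zeros has positive energy.\<close>

lemma between_zeros:
  assumes s: "sol u w" and xy: "0 \<le> x" "x < y" "u x = 0" "u y = 0" and e: "0 < en u w y"
  shows "\<exists>z. x < z \<and> z < y \<and> (u z < bm \<or> bp < u z)"
proof -
  have "\<exists>z>x. z < y \<and> (u has_real_derivative 0) (at z)"
  proof (rule Rolle[OF xy(2)])
    fix z assume "x < z" "z < y"
    then have "0 < z" using xy by simp
    then show "u differentiable (at z)" using sol_du[OF s] unfolding real_differentiable_def by blast
  qed (use xy sol_cont(1)[OF s] in auto)
  then obtain z where z: "x < z" "z < y" "(u has_real_derivative 0) (at z)" by blast
  have "psi m (w z) = 0" using DERIV_unique[OF sol_du[OF s] z(3)] z xy by simp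
  then have "w z = 0" by simp
  moreover have "0 < en u w z" using en_antimono[OF s, of z y] z xy e by simp
  ultimately show ?thesis using crit_outside[of w z u] z by auto
qed

lemma excursions:
  fixes t :: "nat \<Rightarrow> real"
  assumes s: "sol u w" and t: "\<And>i. i < k \<Longrightarrow> t i \<in> crossings u w" "\<And>i j. i < j \<Longrightarrow> j < k \<Longrightarrow> t i < t j"
  shows "\<exists>e. \<forall>i. Suc i < k \<longrightarrow> t i < e i \<and> e i < t (Suc i) \<and> (u (e i) < bm \<or> bp < u (e i))"
proof (intro choice allI)
  fix i
  have tp: "0 < t i" "u (t i) = 0" "0 < en u w (t i)" if "i < k" for i
    using t(1)[OF that] crossing_en by (auto simp: crossings_def)
  show "\<exists>e. Suc i < k \<longrightarrow> t i < e \<and> e < t (Suc i) \<and> (u e < bm \<or> bp < u e)"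
  proof (cases "Suc i < k")
    case True
    then have "i < k" by simp
    then show ?thesis
      using between_zeros[OF s _ t(2)[of i "Suc i"] tp(2)[of i] tp(2)[OF True] tp(3)[OF True]] tp(1)[of i] True by auto
  qed simp
qed

text \<open>At a double zero, both derivatives agree with those of the zero solution, because \<open>f 0 = 0\<close>.\<close>

lemma sol_truncate:
  assumes s: "sol u w" and Z: "0 < Z" "u Z = 0" "w Z = 0"
  shows "sol (\<lambda>r. if r \<le> Z then u r else 0) (\<lambda>r. if r \<le> Z then w r else 0)"
proof -
  let ?u = "\<lambda>r. if r \<le> Z then u r else 0" and ?w = "\<lambda>r. if r \<le> Z then w r else 0"
  have c: "continuous_on {0..} (\<lambda>r. if r \<le> Z then g r else 0)" if "continuous_on {0..} g" "g Z = 0" for g :: "real \<Rightarrow> real"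
    by (rule continuous_on_cases_le) (use that in \<open>auto elim: continuous_on_subset intro!: continuous_intros\<close>)
  have d: "(?u has_real_derivative psi m (?w r)) (at r) \<and> (?w has_real_derivative (- ((real N - 1) / r * ?w r) - f (?u r))) (at r)"
    if r: "0 < r" for r
  proof -
    consider "r < Z" | "r = Z" | "Z < r" by linarith
    then show ?thesis
    proof cases
      case 1
      have "(?u has_real_derivative psi m (w r)) (at r)"
        by (rule has_field_derivative_transform_within_open[OF sol_du[OF s r], of "{..<Z}"]) (use 1 in auto)
      moreover have "(?w has_real_derivative (- ((real N - 1) / r * w r) - f (u r))) (at r)"
        by (rule has_field_derivative_transform_within_open[OF sol_dw[OF s r], of "{..<Z}"]) (use 1 in auto)
      ultimately show ?thesis using 1 by simp
    next
      case 2
      have "(?u has_real_derivative 0) (at Z)" by (rule deriv_truncate) (use sol_du[OF s Z(1)] Z in auto)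
      moreover have "(?w has_real_derivative 0) (at Z)" by (rule deriv_truncate) (use sol_dw[OF s Z(1)] Z f_0 in auto)
      ultimately show ?thesis using 2 Z f_0 by simp
    next
      case 3
      have "(?u has_real_derivative 0) (at r)"
        by (rule has_field_derivative_transform_within_open[OF DERIV_const, of "{Z<..}" _ 0]) (use 3 in auto)
      moreover have "(?w has_real_derivative 0) (at r)"
        by (rule has_field_derivative_transform_within_open[OF DERIV_const, of "{Z<..}" _ 0]) (use 3 in auto)
      ultimately show ?thesis using 3 f_0 by simp
    qed
  qed
  show ?thesis unfolding sol_def using c sol_cont0[OF s] Z d by auto
qed

text \<open>Each zero \<open>t n i\<close> is followed by a point \<open>e n i\<close> at which the solution is out of the interior of
  the well. These excursions keep the limits of the zeros apart. They also exclude that a limit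
  is a double zero, since there the energy would vanish and the solution would be at rest
  afterwards.\<close>

lemma limit_crossings:
  assumes s: "sol u w" "u 0 \<noteq> 0" and lu: "luconv un u" and lw: "luconv wn w" and b: "bn \<longlonglongrightarrow> b"
    and t: "\<And>n i. i < q \<Longrightarrow> 0 \<le> t n i \<and> t n i \<le> e n i \<and> e n i \<le> bn n \<and> un n (t n i) = 0 \<and>
      (un n (e n i) \<le> bm \<or> bp \<le> un n (e n i)) \<and> 0 \<le> en (un n) (wn n) (e n i)"
    and sep: "\<And>n i j. i < j \<Longrightarrow> j < q \<Longrightarrow> e n i \<le> t n j"
  shows "\<exists>S\<subseteq>crossings u w. finite S \<and> card S = q \<and> (\<forall>x\<in>S. x < b)"
proof -
  have cu: "continuous_on {0..} u" "continuous_on {0..} w" using sol_cont0[OF s(1)] by auto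
  obtain B where B: "\<And>n. \<bar>bn n\<bar> \<le> B"
    using convergent_imp_Bseq[OF convergentI[OF b]] unfolding Bseq_def by auto
  have bt: "\<bar>t n i\<bar> \<le> B" "\<bar>e n i\<bar> \<le> B" if "i < q" for n i
    using t[OF that, of n] B[of n] by (auto simp: abs_le_iff)
  obtain k1 where k1: "strict_mono (k1 :: nat \<Rightarrow> nat)" "\<And>i. i < q \<Longrightarrow> \<exists>l. (\<lambda>n. t (k1 n) i) \<longlonglongrightarrow> l"
    using function_subsequence[of q t B] bt by blast
  obtain k2 where k2: "strict_mono (k2 :: nat \<Rightarrow> nat)" "\<And>i. i < q \<Longrightarrow> \<exists>l. (\<lambda>n. e (k1 (k2 n)) i) \<longlonglongrightarrow> l"
    using function_subsequence[of q "\<lambda>n. e (k1 n)" B] bt by blast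
  define k where "k n = k1 (k2 n)" for n
  have k: "strict_mono k" using k1(1) k2(1) by (auto simp: k_def strict_mono_def)
  have "\<exists>l. (\<lambda>n. t (k n) i) \<longlonglongrightarrow> l" if i: "i < q" for i
  proof -
    obtain l where "(\<lambda>n. t (k1 n) i) \<longlonglongrightarrow> l" using k1(2)[OF i] by blast
    from LIMSEQ_subseq_LIMSEQ[OF this k2(1)] show ?thesis by (auto simp: k_def o_def)
  qed
  then obtain T where T: "\<And>i. i < q \<Longrightarrow> (\<lambda>n. t (k n) i) \<longlonglongrightarrow> T i" by metis
  obtain E where E: "\<And>i. i < q \<Longrightarrow> (\<lambda>n. e (k n) i) \<longlonglongrightarrow> E i" using k2(2) unfolding k_def by metis
  have uT: "u (T i) = 0" if i: "i < q" for i
  proof -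
    have "(\<lambda>n. un (k n) (t (k n) i)) \<longlonglongrightarrow> u (T i)"
      by (rule luconv_seq[OF luconv_subseq[OF lu k] cu(1) _ T[OF i]]) (use t[OF i] in auto)
    then show ?thesis using t[OF i] by (simp add: LIMSEQ_const_iff)
  qed
  have e0: "0 \<le> e n i" if i: "i < q" for n i using t[OF i, of n] by auto
  have uE: "u (E i) \<le> bm \<or> bp \<le> u (E i)" if i: "i < q" for i
  proof (rule ccontr)
    assume a: "\<not> ?thesis"
    have l: "(\<lambda>n. un (k n) (e (k n) i)) \<longlonglongrightarrow> u (E i)"
      by (rule luconv_seq[OF luconv_subseq[OF lu k] cu(1) e0[OF i] E[OF i]])
    have "\<forall>\<^sub>F n in sequentially. bm < un (k n) (e (k n) i)" by (rule order_tendstoD(1)[OF l]) (use a in auto)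
    moreover have "\<forall>\<^sub>F n in sequentially. un (k n) (e (k n) i) < bp" by (rule order_tendstoD(2)[OF l]) (use a in auto)
    ultimately have "\<forall>\<^sub>F n in sequentially. bm < un (k n) (e (k n) i) \<and> un (k n) (e (k n) i) < bp" by (rule eventually_conj)
    then obtain n where "bm < un (k n) (e (k n) i) \<and> un (k n) (e (k n) i) < bp"
      unfolding eventually_sequentially by blast
    then show False using t[OF i, of "k n"] by auto
  qed
  have eE: "0 \<le> en u w (E i)" if i: "i < q" for i
    by (rule tendsto_lowerbound[OF en_luconv[OF luconv_subseq[OF lu k] cu(1) luconv_subseq[OF lw k] cu(2) e0[OF i] E[OF i]]])
      (use t[OF i] in \<open>auto intro!: always_eventually\<close>)
  have T0: "0 \<le> T i" if i: "i < q" for i by (rule LIMSEQ_le_const[OF T[OF i]]) (use t[OF i] in auto)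
  have TE: "T i \<le> E i" if i: "i < q" for i by (rule LIMSEQ_le[OF T[OF i] E[OF i]]) (use t[OF i] in auto)
  have TE': "T i < E i" if i: "i < q" for i
  proof -
    have "u (E i) \<noteq> 0" using uE[OF i] bm_neg bp_pos by auto
    then show ?thesis using TE[OF i] uT[OF i] by (cases "T i = E i") auto
  qed
  have Eb: "E i \<le> b" if i: "i < q" for i
    by (rule LIMSEQ_le[OF E[OF i] LIMSEQ_subseq_LIMSEQ[OF b k]]) (use t[OF i] in auto)
  have ET: "E i \<le> T j" if "i < j" "j < q" for i j
    by (rule LIMSEQ_le[OF E T]) (use that sep in auto)
  have Tc: "T i \<in> crossings u w" if i: "i < q" for i
  proof -
    have "T i \<noteq> 0" using uT[OF i] s(2) by auto
    then have tp: "0 < T i" using T0[OF i] by simp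
    have "w (T i) \<noteq> 0"
    proof
      assume w0: "w (T i) = 0"
      then have "en u w (T i) = 0" using uT[OF i] F_0 by (simp add: en_def)
      then have "en u w (T i) = en u w (E i)" using eE[OF i] en_antimono[OF s(1) T0[OF i] TE[OF i]] by simp
      then have "u (E i) = u (T i)" by (intro en_const_imp(1)[OF s(1) T0[OF i] TE[OF i]]) (use TE[OF i] in auto)
      then show False using uE[OF i] uT[OF i] bm_neg bp_pos by auto
    qed
    then show ?thesis using tp uT[OF i] by (simp add: crossings_def)
  qed
  have lt: "T i < T j" if "i < j" "j < q" for i j using TE'[of i] ET[OF that] that by simp
  have inj: "inj_on T {..<q}"
  proof (rule inj_onI)
    fix i j assume "i \<in> {..<q}" "j \<in> {..<q}" "T i = T j"
    then show "i = j" using lt[of i j] lt[of j i] by (cases i j rule: linorder_cases) auto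
  qed
  show ?thesis
  proof (intro exI[of _ "T ` {..<q}"] conjI)
    show "card (T ` {..<q}) = q" using card_image[OF inj] by simp
    show "\<forall>x\<in>T ` {..<q}. x < b" using TE' Eb by fastforce
  qed (use Tc in auto)
qed

text \<open>Up to a point shortly after the last crossing the energy is positive, so nearby solutions
  converge there. Each crossing is a change of sign, which nearby solutions share, and their
  zeros are crossings because their energy is positive.\<close>

lemma crosses_at_least_open:
  assumes s: "sol u w" and nc: "crosses_at_least k u w" and sn: "\<And>n. sol (un n) (wn n)" and a: "(\<lambda>n. un n 0) \<longlonglongrightarrow> u 0"
    and k: "1 \<le> k"
  shows "\<exists>n. crosses_at_least k (un n) (wn n)"
proof -
  obtain S where S: "S \<subseteq> crossings u w" "finite S" "card S = k" using nc by (auto simp: crosses_at_least_def)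
  have S0: "S \<noteq> {}" using S k by auto
  define tm where "tm = Max S"
  have tm: "tm \<in> S" "\<And>t. t \<in> S \<Longrightarrow> t \<le> tm" using S S0 by (auto simp: tm_def)
  have tm0: "0 < tm" "0 < en u w tm" using tm(1) S(1) crossing_en by (auto simp: crossings_def)
  obtain d where d: "d > 0" "\<And>r. tm \<le> r \<Longrightarrow> r \<le> tm + d \<Longrightarrow> \<bar>en u w r - en u w tm\<bar> < en u w tm"
    using near_right[OF en_cont0[OF s] less_imp_le[OF tm0(1)] tm0(2)] by blast
  define R where "R = tm + d"
  have R: "tm < R" "0 < en u w R" "0 \<le> R" using d(1) d(2)[of R] tm0 by (auto simp: R_def abs_less_iff)
  have eR: "0 < en u w r" if "0 \<le> r" "r < R" for r using en_antimono[OF s, of r R] that R by simp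
  obtain kk v z where kk: "strict_mono (kk :: nat \<Rightarrow> nat)" "luconv (\<lambda>n. un (kk n)) v" "luconv (\<lambda>n. wn (kk n)) z" "sol v z"
    "\<And>r. 0 \<le> r \<Longrightarrow> r \<le> R \<Longrightarrow> v r = u r \<and> z r = w r"
    using conv_unique[OF sn a s R(3) eR] by blast
  have cv: "continuous_on {0..} v" "continuous_on {0..} z" using sol_cont0[OF kk(4)] by auto
  have sgn: "\<forall>\<^sub>F h in at_right 0. u (t - h) * u (t + h) < 0" if t: "t \<in> S" for t
  proof -
    have t': "0 < t" "u t = 0" "w t \<noteq> 0" using t S(1) by (auto simp: crossings_def)
    have "\<exists>d>0. \<forall>h. 0 < h \<and> h < d \<longrightarrow> u (t - h) * u (t + h) < 0"
    proof (cases "0 < w t")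
      case True
      obtain d1 where d1: "d1 > 0" "\<And>h. 0 < h \<Longrightarrow> h < d1 \<Longrightarrow> u t < u (t + h)"
        using DERIV_pos_inc_right[OF sol_du[OF s t'(1)] psi_pos[OF True]] by blast
      obtain d2 where d2: "d2 > 0" "\<And>h. 0 < h \<Longrightarrow> h < d2 \<Longrightarrow> u (t - h) < u t"
        using DERIV_pos_inc_left[OF sol_du[OF s t'(1)] psi_pos[OF True]] by blast
      show ?thesis using d1 d2 t'(2) by (intro exI[of _ "min d1 d2"]) (auto intro!: mult_neg_pos)
    next
      case False
      then have n: "w t < 0" using t' by simp
      obtain d1 where d1: "d1 > 0" "\<And>h. 0 < h \<Longrightarrow> h < d1 \<Longrightarrow> u (t + h) < u t"
        using DERIV_neg_dec_right[OF sol_du[OF s t'(1)] psi_neg[OF n]] by blast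
      obtain d2 where d2: "d2 > 0" "\<And>h. 0 < h \<Longrightarrow> h < d2 \<Longrightarrow> u t < u (t - h)"
        using DERIV_neg_dec_left[OF sol_du[OF s t'(1)] psi_neg[OF n]] by blast
      show ?thesis using d1 d2 t'(2) by (intro exI[of _ "min d1 d2"]) (auto intro!: mult_pos_neg)
    qed
    then obtain d where "d > 0" "\<And>h. 0 < h \<Longrightarrow> h < d \<Longrightarrow> u (t - h) * u (t + h) < 0" by blast
    then show ?thesis unfolding eventually_at_right_field by blast
  qed
  have small: "\<forall>\<^sub>F h in at_right 0. h < c" if "0 < c" for c :: real
    unfolding eventually_at_right_field using that by blast
  have e1: "\<forall>\<^sub>F h in at_right 0. \<forall>t\<in>S. u (t - h) * u (t + h) < 0"
    using S(2) sgn by (intro eventually_ball_finite) auto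
  have e2: "\<forall>\<^sub>F h in at_right 0. \<forall>t\<in>S. h < t"
    using S small by (intro eventually_ball_finite) (auto simp: crossings_def)
  have e3: "\<forall>\<^sub>F h in at_right 0. h < R - tm" using R by (intro small) simp
  have e4: "\<forall>\<^sub>F h in at_right 0. \<forall>p\<in>S \<times> S. fst p \<noteq> snd p \<longrightarrow> h < \<bar>fst p - snd p\<bar> / 2"
  proof (rule eventually_ball_finite)
    show "finite (S \<times> S)" using S by simp
    show "\<forall>p\<in>S \<times> S. \<forall>\<^sub>F h in at_right 0. fst p \<noteq> snd p \<longrightarrow> h < \<bar>fst p - snd p\<bar> / 2"
    proof
      fix p assume "p \<in> S \<times> S"
      show "\<forall>\<^sub>F h in at_right 0. fst p \<noteq> snd p \<longrightarrow> h < \<bar>fst p - snd p\<bar> / 2"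
      proof (cases "fst p = snd p")
        case False then show ?thesis using small[of "\<bar>fst p - snd p\<bar> / 2"] by simp
      qed simp
    qed
  qed
  have e5: "\<forall>\<^sub>F h in at_right (0::real). 0 < h" by (simp add: eventually_at_right_less)
  define Q where "Q h \<longleftrightarrow> (\<forall>t\<in>S. u (t - h) * u (t + h) < 0) \<and> (\<forall>t\<in>S. h < t) \<and> h < R - tm \<and>
      (\<forall>p\<in>S \<times> S. fst p \<noteq> snd p \<longrightarrow> h < \<bar>fst p - snd p\<bar> / 2) \<and> 0 < h" for h
  have "\<forall>\<^sub>F h in at_right 0. Q h" unfolding Q_def by (intro eventually_conj e1 e2 e3 e4 e5)
  then obtain d' where "0 < d'" "\<And>h. 0 < h \<Longrightarrow> h < d' \<Longrightarrow> Q h" unfolding eventually_at_right_field by blast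
  then have "Q (d' / 2)" by simp
  then obtain h where "Q h" by blast
  then have h: "\<And>t. t \<in> S \<Longrightarrow> u (t - h) * u (t + h) < 0" "\<And>t. t \<in> S \<Longrightarrow> h < t" "h < R - tm"
      "\<And>p. p \<in> S \<times> S \<Longrightarrow> fst p \<noteq> snd p \<Longrightarrow> h < \<bar>fst p - snd p\<bar> / 2" "0 < h"
    unfolding Q_def by blast+
  have f1: "\<forall>\<^sub>F n in sequentially. 0 < en (un (kk n)) (wn (kk n)) R"
  proof (rule order_tendstoD(1)[OF en_luconv[OF kk(2) cv(1) kk(3) cv(2)]])
    show "0 < en v z R" using kk(5)[of R] R by (simp add: en_def)
  qed (use R in auto)
  have f2: "\<forall>\<^sub>F n in sequentially. \<forall>t\<in>S. un (kk n) (t - h) * un (kk n) (t + h) < 0"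
  proof (rule eventually_ball_finite[OF S(2)], rule ballI)
    fix t assume t: "t \<in> S"
    have b: "0 \<le> t - h" "0 \<le> t + h" "t - h \<le> R" "t + h \<le> R" using h(2)[OF t] h(3,5) tm(2)[OF t] by auto
    have "(\<lambda>n. un (kk n) (t - h) * un (kk n) (t + h)) \<longlonglongrightarrow> v (t - h) * v (t + h)"
      by (intro tendsto_mult luconv_pt[OF kk(2) cv(1)] b)
    then show "\<forall>\<^sub>F n in sequentially. un (kk n) (t - h) * un (kk n) (t + h) < 0"
      by (rule order_tendstoD(2)) (use kk(5) b h(1)[OF t] in simp)
  qed
  obtain n where n: "0 < en (un (kk n)) (wn (kk n)) R" "\<And>t. t \<in> S \<Longrightarrow> un (kk n) (t - h) * un (kk n) (t + h) < 0"
    using eventually_conj[OF f1 f2] unfolding eventually_sequentially by blast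
  define U where "U = un (kk n)"
  define W where "W = wn (kk n)"
  have sU: "sol U W" using sn by (simp add: U_def W_def)
  have "\<exists>x. t - h \<le> x \<and> x \<le> t + h \<and> x \<noteq> t - h \<and> x \<noteq> t + h \<and> U x = 0" if t: "t \<in> S" for t
  proof -
    have neg: "U (t - h) * U (t + h) < 0" using n(2)[OF t] by (simp add: U_def)
    have c: "continuous_on {t - h..t + h} U" using h(2)[OF t] by (intro sol_cont[OF sU]) simp
    have "\<exists>x\<ge>t - h. x \<le> t + h \<and> U x = 0"
    proof (cases "U (t - h) < 0")
      case True
      then have "0 < U (t + h)" using neg by (simp add: mult_less_0_iff)
      then show ?thesis using IVT'[OF _ _ _ c, of 0] True h(5) by simp
    next
      case False
      then have "U (t + h) < 0" "0 < U (t - h)" using neg by (auto simp: mult_less_0_iff)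
      then show ?thesis using IVT2'[OF _ _ _ c, of 0] h(5) by simp
    qed
    then show ?thesis using neg by auto
  qed
  then obtain x where x: "\<And>t. t \<in> S \<Longrightarrow> t - h \<le> x t \<and> x t \<le> t + h \<and> x t \<noteq> t - h \<and> x t \<noteq> t + h \<and> U (x t) = 0" by metis
  have inj: "inj_on x S"
  proof (rule inj_onI, rule ccontr)
    fix s t assume st: "s \<in> S" "t \<in> S" "x s = x t" "s \<noteq> t"
    have "h < \<bar>s - t\<bar> / 2" using h(4)[of "(s, t)"] st by simp
    then show False using x[OF st(1)] x[OF st(2)] st(3) by (auto simp: abs_if split: if_splits)
  qed
  have "x ` S \<subseteq> crossings U W"
  proof
    fix y assume "y \<in> x ` S"
    then obtain t where t: "t \<in> S" "y = x t" by blast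
    have y: "0 < y" "y \<le> R" "U y = 0" using x[OF t(1)] h(2)[OF t(1)] h(3) tm(2)[OF t(1)] t(2) by auto
    have "0 < en U W y" using en_antimono[OF sU, of y R] y n(1) by (simp add: U_def W_def)
    then show "y \<in> crossings U W" using y by (intro zero_crossing) auto
  qed
  then have "crosses_at_least k U W" unfolding crosses_at_least_def using S card_image[OF inj] by (intro exI[of _ "x ` S"]) auto
  then show ?thesis unfolding U_def W_def by blast
qed

text \<open>Uniqueness may fail once the energy vanishes, but the crossings occur before. Continuous
  dependence along a constant sequence gives the claim.\<close>

lemma crosses_at_least_unique:
  assumes s: "sol u w" "sol v z" "u 0 = v 0" and k: "crosses_at_least k u w" "1 \<le> k"
  shows "crosses_at_least k v z"
proof -
  obtain n where "crosses_at_least k ((\<lambda>_. v) n) ((\<lambda>_. z) (n::nat))"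
    using crosses_at_least_open[OF s(1) k(1), of "\<lambda>_. v" "\<lambda>_. z"] s k by auto
  then show ?thesis by simp
qed

end
section \<open>Shooting\<close>

context shooting begin

text \<open>The \<open>k\<close>-th crossings accumulate at some \<open>Z\<close>, and the first \<open>k - 1\<close> crossings of the approximating
  solutions survive before \<open>Z\<close>. As the limit has fewer than \<open>k\<close> crossings, \<open>Z\<close> is a double zero,
  and the limit can be cut off there.\<close>

lemma bounded_crossings_limit:
  assumes s: "sol u w" "bp \<le> u 0" and nc: "\<not> crosses_at_least k u w" "1 \<le> k"
    and sn: "\<And>n. sol (un n) (wn n)" and lu: "luconv un u" "luconv wn w"
    and t: "\<And>n i. i < k \<Longrightarrow> t n i \<in> crossings (un n) (wn n) \<and> t n i \<le> R" "\<And>n i j. i < j \<Longrightarrow> j < k \<Longrightarrow> t n i < t n j"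
  shows "\<exists>v z. sol v z \<and> v 0 = u 0 \<and> (v \<longlongrightarrow> 0) at_top \<and> finite (crossings v z) \<and> card (crossings v z) = k - 1"
proof -
  have cu: "continuous_on {0..} u" "continuous_on {0..} w" using sol_cont0[OF s(1)] by auto
  have tp: "0 < t n i" "un n (t n i) = 0" "0 < en (un n) (wn n) (t n i)" if "i < k" for n i
    using t(1)[OF that, of n] crossing_en by (auto simp: crossings_def)
  have "\<forall>n. t n (k - 1) \<in> {0..R}" using t(1)[of "k - 1"] tp(1)[of "k - 1"] nc(2) by (auto intro: less_imp_le)
  then obtain Z j where Z: "Z \<in> {0..R}" "strict_mono (j :: nat \<Rightarrow> nat)" "((\<lambda>n. t n (k - 1)) \<circ> j) \<longlonglongrightarrow> Z"
    using compact_Icc[of 0 R] unfolding compact_def by meson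
  have lu': "luconv (\<lambda>n. un (j n)) u" "luconv (\<lambda>n. wn (j n)) w" using luconv_subseq[OF lu(1) Z(2)] luconv_subseq[OF lu(2) Z(2)] by auto
  have tl: "(\<lambda>n. t (j n) (k - 1)) \<longlonglongrightarrow> Z" using Z(3) by (simp add: o_def)
  have k1: "k - 1 < k" using nc by simp
  have "(\<lambda>n. un (j n) (t (j n) (k - 1))) \<longlonglongrightarrow> u Z" by (rule luconv_seq[OF lu'(1) cu(1) _ tl]) (use tp(1)[OF k1] in \<open>auto intro: less_imp_le\<close>)
  then have uZ: "u Z = 0" using tp(2)[OF k1] by (simp add: LIMSEQ_const_iff)
  then have Z0: "0 < Z" using s(2) bp_pos Z(1) by (cases "Z = 0") auto
  have "\<exists>e. \<forall>i. Suc i < k \<longrightarrow> t n i < e i \<and> e i < t n (Suc i) \<and> (un n (e i) < bm \<or> bp < un n (e i))" for n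
    by (rule excursions[OF sn]) (use t in auto)
  then obtain e where e: "\<And>n i. Suc i < k \<Longrightarrow> t n i < e n i \<and> e n i < t n (Suc i) \<and> (un n (e n i) < bm \<or> bp < un n (e n i))" by metis
  have "\<exists>S\<subseteq>crossings u w. finite S \<and> card S = k - 1 \<and> (\<forall>x\<in>S. x < Z)"
  proof (rule limit_crossings[OF s(1) _ lu' tl, where t = "\<lambda>n. t (j n)" and e = "\<lambda>n. e (j n)"])
    show "u 0 \<noteq> 0" using s(2) bp_pos by simp
    fix n i assume i: "i < k - 1"
    then have ik: "Suc i < k" "i < k" by auto
    have "t (j n) (Suc i) \<le> t (j n) (k - 1)" using t(2)[of "Suc i" "k - 1" "j n"] i by (cases "Suc i = k - 1") auto
    then have el: "e (j n) i \<le> t (j n) (k - 1)" using e[OF ik(1), of "j n"] by simp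
    moreover have "0 \<le> en (un (j n)) (wn (j n)) (e (j n) i)"
      using en_antimono[OF sn, of "e (j n) i" "t (j n) (k - 1)" "j n"] el tp(3)[OF k1, of "j n"] e[OF ik(1), of "j n"] tp(1)[OF ik(2), of "j n"] by simp
    ultimately show "0 \<le> t (j n) i \<and> t (j n) i \<le> e (j n) i \<and> e (j n) i \<le> t (j n) (k - 1) \<and> un (j n) (t (j n) i) = 0 \<and>
        (un (j n) (e (j n) i) \<le> bm \<or> bp \<le> un (j n) (e (j n) i)) \<and> 0 \<le> en (un (j n)) (wn (j n)) (e (j n) i)"
      using e[OF ik(1), of "j n"] tp(1,2)[OF ik(2), of "j n"] by auto
  next
    fix n i l assume il: "i < l" "l < k - 1"
    then have "l < k" by simp
    then have "t (j n) (Suc i) \<le> t (j n) l" using t(2)[of "Suc i" l "j n"] il by (cases "Suc i = l") auto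
    moreover have "Suc i < k" using il by simp
    ultimately show "e (j n) i \<le> t (j n) l" using e[of i "j n"] by simp
  qed
  then obtain S where S: "S \<subseteq> crossings u w" "finite S" "card S = k - 1" "\<And>x. x \<in> S \<Longrightarrow> x < Z" by blast
  have wZ: "w Z = 0"
  proof (rule ccontr)
    assume "w Z \<noteq> 0"
    then have "Z \<in> crossings u w" using Z0 uZ by (simp add: crossings_def)
    moreover have "Z \<notin> S" using S(4) by blast
    ultimately have "insert Z S \<subseteq> crossings u w \<and> finite (insert Z S) \<and> card (insert Z S) = k" using S nc(2) by auto
    then show False using nc(1) unfolding crosses_at_least_def by blast
  qed
  let ?v = "\<lambda>r. if r \<le> Z then u r else 0" and ?z = "\<lambda>r. if r \<le> Z then w r else 0"
  have "sol ?v ?z" by (rule sol_truncate[OF s(1) Z0 uZ wZ])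
  moreover have "?v 0 = u 0" using Z0 by simp
  moreover have "(?v \<longlongrightarrow> 0) at_top"
    by (rule tendsto_eventually) (auto simp: eventually_at_top_linorder intro!: exI[of _ "Z + 1"])
  moreover have sub: "crossings ?v ?z \<subseteq> crossings u w" "S \<subseteq> crossings ?v ?z"
    using S(1,4) by (auto simp: crossings_def split: if_splits) (force dest: S(4))+
  moreover have "finite (crossings ?v ?z)" using sub(1) not_crosses_at_least(1)[OF nc(1)] finite_subset by blast
  moreover have "card (crossings ?v ?z) = k - 1"
  proof -
    have "k - 1 \<le> card (crossings ?v ?z)" using card_mono[OF \<open>finite (crossings ?v ?z)\<close> sub(2)] S(3) by simp
    moreover have "card (crossings ?v ?z) \<le> card (crossings u w)" using card_mono[OF not_crosses_at_least(1)[OF nc(1)] sub(1)] .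
    ultimately show ?thesis using not_crosses_at_least(2)[OF nc(1)] by simp
  qed
  ultimately show ?thesis by blast
qed

text \<open>Choose \<open>\<rho>\<close> so late that the weighted energy of the limit is below the constant of \<open>zone\<close>.
  Approximating solutions then stay in the well after \<open>\<rho>\<close> as long as their energy is positive, so
  their excursions between crossings take place before \<open>\<rho>\<close>. Therefore at most the last of the \<open>k\<close>
  crossings can escape to infinity.\<close>

lemma decaying_limit:
  assumes s: "sol u w" "bp \<le> u 0" and nc: "\<not> crosses_at_least k u w" "1 \<le> k"
    and n: "\<And>r. 0 \<le> r \<Longrightarrow> 0 \<le> en u w r" and l: "(u \<longlongrightarrow> 0) at_top" "((\<lambda>r. r * en u w r) \<longlongrightarrow> 0) at_top" "(en u w \<longlongrightarrow> 0) at_top"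
    and sn: "\<And>n. sol (un n) (wn n)" and lu: "luconv un u" "luconv wn w" and nk: "\<And>n. crosses_at_least k (un n) (wn n)"
  shows "finite (crossings u w) \<and> card (crossings u w) = k - 1"
proof -
  have cu: "continuous_on {0..} u" "continuous_on {0..} w" using sol_cont0[OF s(1)] by auto
  obtain T0 c1 where Z: "zone T0 c1" using zone_exists by blast
  have T0: "0 \<le> T0" "0 < c1" using Z by (auto simp: zone_def)
  have "((\<lambda>r. r * en u w r + T0 * en u w r) \<longlongrightarrow> 0 + T0 * 0) at_top" by (intro tendsto_intros l)
  then have "((\<lambda>r. (r + T0) * en u w r) \<longlongrightarrow> 0) at_top" by (simp add: algebra_simps)
  then have e1: "\<forall>\<^sub>F r in at_top. (r + T0) * en u w r < c1" by (rule order_tendstoD(2)) (rule T0)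
  have e2: "\<forall>\<^sub>F r in at_top. u r < bp / 3" by (rule order_tendstoD(2)[OF l(1)]) (use bp_pos in simp)
  have e3: "\<forall>\<^sub>F r in at_top. bm / 3 < u r" by (rule order_tendstoD(1)[OF l(1)]) (use bm_neg in simp)
  from eventually_conj[OF e1 eventually_conj[OF e2 eventually_conj[OF e3 eventually_ge_at_top[of 1]]]]
  obtain \<rho> where \<rho>: "(\<rho> + T0) * en u w \<rho> < c1" "u \<rho> < bp / 3" "bm / 3 < u \<rho>" "1 \<le> \<rho>"
    unfolding eventually_at_top_linorder by blast
  have r0: "0 \<le> \<rho>" using \<rho> by simp
  have "(\<lambda>n. (\<rho> + T0) * en (un n) (wn n) \<rho>) \<longlonglongrightarrow> (\<rho> + T0) * en u w \<rho>"
    by (intro tendsto_intros en_luconv[OF lu(1) cu(1) lu(2) cu(2)]) (use r0 in auto)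
  from order_tendstoD(2)[OF this \<rho>(1)] have f1: "\<forall>\<^sub>F n in sequentially. (\<rho> + T0) * en (un n) (wn n) \<rho> < c1" .
  have f2: "\<forall>\<^sub>F n in sequentially. un n \<rho> < bp / 3" by (rule order_tendstoD(2)[OF luconv_pt[OF lu(1) cu(1) r0] \<rho>(2)])
  have f3: "\<forall>\<^sub>F n in sequentially. bm / 3 < un n \<rho>" by (rule order_tendstoD(1)[OF luconv_pt[OF lu(1) cu(1) r0] \<rho>(3)])
  from eventually_conj[OF f1 eventually_conj[OF f2 f3]] obtain n0 where
    n0: "\<And>n. n0 \<le> n \<Longrightarrow> (\<rho> + T0) * en (un n) (wn n) \<rho> < c1 \<and> un n \<rho> < bp / 3 \<and> bm / 3 < un n \<rho>"
    unfolding eventually_sequentially by blast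
  \<comment> \<open>a solution that leaves the well after \<open>\<rho>\<close> traverses the zone first\<close>
  have inside: "e \<le> \<rho>" if n: "n0 \<le> n" and e: "un n e < bm \<or> bp < un n e" "0 < en (un n) (wn n) e" for n e
  proof (rule ccontr)
    assume "\<not> e \<le> \<rho>"
    then have re: "\<rho> \<le> e" by simp
    let ?h = "\<lambda>r. min (bp - un n r) (un n r - bm)"
    have c: "continuous_on {\<rho>..e} ?h" by (intro continuous_intros sol_cont[OF sn r0])
    have h0: "0 < ?h \<rho>" using n0[OF n] bm_neg bp_pos by simp
    have h1: "?h e \<le> 0" using e(1) by auto
    obtain s where s: "\<rho> < s" "s \<le> e" "?h s = 0" "\<And>r. \<rho> \<le> r \<Longrightarrow> r < s \<Longrightarrow> 0 < ?h r"
      using first_down[OF c re h0 h1] by blast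
    have "c1 \<le> (\<rho> + T0) * en (un n) (wn n) \<rho>"
    proof (rule zoneD[OF Z sn r0, of \<rho> s])
      fix r assume r: "\<rho> \<le> r" "r \<le> max \<rho> s"
      show "bm \<le> un n r \<and> un n r \<le> bp" using s(3) s(4)[of r] r s(1) by (cases "r = s") (auto simp: min_def split: if_splits)
    next
      show "0 \<le> en (un n) (wn n) (max \<rho> s)" using en_antimono[OF sn, of s e n] s r0 e(2) by simp
      show "un n \<rho> \<le> bp / 3 \<and> 2 * bp / 3 \<le> un n s \<or> bm / 3 \<le> un n \<rho> \<and> un n s \<le> 2 * bm / 3"
        using s(3) n0[OF n] bm_neg bp_pos by (auto simp: min_def split: if_splits)
    qed (use s in auto)
    then show False using n0[OF n] by simp
  qed
  define U where "U n = un (n + n0)" for n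
  define W where "W n = wn (n + n0)" for n
  have sm: "strict_mono (\<lambda>n. n + n0)" by (simp add: strict_mono_def)
  have lU: "luconv U u" "luconv W w" using luconv_subseq[OF lu(1) sm] luconv_subseq[OF lu(2) sm] by (simp_all add: U_def[abs_def] W_def[abs_def])
  have sU: "sol (U n) (W n)" for n using sn by (simp add: U_def W_def)
  have "\<exists>t. (\<forall>i<k. t i \<in> crossings (U n) (W n)) \<and> (\<forall>i j. i < j \<and> j < k \<longrightarrow> t i < t j)" for n
    unfolding U_def W_def by (rule crosses_at_least_enum[OF nk])
  then obtain t where t: "\<And>n i. i < k \<Longrightarrow> t n i \<in> crossings (U n) (W n)" "\<And>n i j. i < j \<Longrightarrow> j < k \<Longrightarrow> t n i < t n j" by metis
  have tp: "0 < t n i" "U n (t n i) = 0" "0 < en (U n) (W n) (t n i)" if "i < k" for n i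
    using t(1)[OF that, of n] crossing_en by (auto simp: crossings_def)
  have "\<exists>e. \<forall>i. Suc i < k \<longrightarrow> t n i < e i \<and> e i < t n (Suc i) \<and> (U n (e i) < bm \<or> bp < U n (e i))" for n
    by (rule excursions[OF sU]) (use t in auto)
  then obtain e where e: "\<And>n i. Suc i < k \<Longrightarrow> t n i < e n i \<and> e n i < t n (Suc i) \<and> (U n (e n i) < bm \<or> bp < U n (e n i))" by metis
  have "\<exists>S\<subseteq>crossings u w. finite S \<and> card S = k - 1 \<and> (\<forall>x\<in>S. x < \<rho>)"
  proof (rule limit_crossings[OF s(1) _ lU tendsto_const, where t = t and e = e])
    show "u 0 \<noteq> 0" using s(2) bp_pos by simp
    fix n i assume i: "i < k - 1"
    then have ik: "Suc i < k" "i < k" by auto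
    have ei: "0 < en (U n) (W n) (e n i)"
      using en_antimono[OF sU, of "e n i" "t n (Suc i)" n] tp(3)[OF ik(1), of n] e[OF ik(1), of n] tp(1)[OF ik(2), of n] by simp
    have "e n i \<le> \<rho>" by (rule inside[of "n + n0"]) (use e[OF ik(1), of n] ei in \<open>auto simp: U_def W_def\<close>)
    then show "0 \<le> t n i \<and> t n i \<le> e n i \<and> e n i \<le> \<rho> \<and> U n (t n i) = 0 \<and>
        (U n (e n i) \<le> bm \<or> bp \<le> U n (e n i)) \<and> 0 \<le> en (U n) (W n) (e n i)"
      using e[OF ik(1), of n] tp(1,2)[OF ik(2), of n] ei by auto
  next
    fix n i l assume il: "i < l" "l < k - 1"
    then have "l < k" by simp
    then have "t n (Suc i) \<le> t n l" using t(2)[of "Suc i" l n] il by (cases "Suc i = l") auto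
    moreover have "Suc i < k" using il by simp
    ultimately show "e n i \<le> t n l" using e[of i n] by simp
  qed
  then obtain S where S: "S \<subseteq> crossings u w" "finite S" "card S = k - 1" by blast
  have "k - 1 \<le> card (crossings u w)" using card_mono[OF not_crosses_at_least(1)[OF nc(1)] S(1)] S(3) by simp
  then show ?thesis using not_crosses_at_least[OF nc(1)] by simp
qed

text \<open>The supremum \<open>a\<close> of the starting values with fewer than \<open>k\<close> crossings yields the bound state. The
  cases are whether or not solutions starting close enough to \<open>a\<close> have zeros of positive energy
  beyond every radius.\<close>

theorem shooting_bound_state:
  assumes A: "bp < A" "sol uA wA" "uA 0 = A" "crosses_at_least k uA wA" and k: "1 \<le> k"
  shows "\<exists>u w. sol u w \<and> bp \<le> u 0 \<and> u 0 \<le> A \<and> (u \<longlongrightarrow> 0) at_top \<and> finite (crossings u w) \<and> card (crossings u w) = k - 1"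
proof -
  define X where "X = {\<alpha>. \<exists>u w. sol u w \<and> u 0 = \<alpha> \<and> crosses_at_least k u w}"
  have XI: "crosses_at_least k u w" if "sol u w" "u 0 \<in> X" for u w
    using that crosses_at_least_unique[OF _ that(1) _ _ k] unfolding X_def by auto
  have AX: "A \<in> X" using A by (auto simp: X_def)
  have bX: "bp \<notin> X"
  proof
    assume "bp \<in> X"
    then obtain u w where uw: "sol u w" "u 0 = bp" "crosses_at_least k u w" by (auto simp: X_def)
    then obtain S where S: "S \<subseteq> crossings u w" "finite S" "card S = k" by (auto simp: crosses_at_least_def)
    then have "S \<noteq> {}" using k by auto
    then obtain r where r: "r \<in> crossings u w" using S by auto
    then have "en u w r \<le> en u w 0" by (intro en_antimono[OF uw(1)]) (auto simp: crossings_def)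
    then show False using crossing_en[OF r] en_0[OF uw(1)] uw(2) F_bp by simp
  qed
  obtain a where a: "bp \<le> a" "a < A" "a \<notin> X" "\<And>x. a < x \<Longrightarrow> x \<le> A \<Longrightarrow> x \<in> X"
  proof (rule sup_of_complement[OF less_imp_le[OF A(1)] AX bX])
    fix x xn assume x: "x \<in> X" and xn: "\<And>n. bp \<le> xn n \<and> xn n \<le> A \<and> xn n \<notin> X" "xn \<longlonglongrightarrow> x"
    obtain u w where uw: "sol u w" "u 0 = x" "crosses_at_least k u w" using x by (auto simp: X_def)
    have "\<exists>p. sol (fst p) (snd p) \<and> fst p 0 = xn n" for n by (rule sol_exists[of "xn n"]) (metis fst_conv snd_conv)
    then obtain p where p: "\<And>n. sol (fst (p n)) (snd (p n))" "\<And>n. fst (p n) 0 = xn n" by metis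
    have "\<exists>n. crosses_at_least k (fst (p n)) (snd (p n))"
      by (rule crosses_at_least_open[OF uw(1,3) p(1) _ k]) (use p(2) xn(2) uw(2) in simp)
    then obtain n where "crosses_at_least k (fst (p n)) (snd (p n))" by blast
    then have "xn n \<in> X" using p unfolding X_def by blast
    then show False using xn(1) by blast
  qed (use that in blast)
  define al where "al n = a + (A - a) / real (Suc n)" for n
  have al: "a < al n" "al n \<le> A" for n using seq_down(1,2)[OF a(2)] by (simp_all add: al_def)
  have all: "al \<longlonglongrightarrow> a" using seq_down(3)[OF a(2)] by (simp add: al_def[abs_def])
  have nca: "\<not> crosses_at_least k u w" if "sol u w" "u 0 = a" for u w using a(3) that by (auto simp: X_def)
  show ?thesis
  proof (cases "\<forall>R. \<exists>\<delta>>0. \<forall>\<alpha> u w. a < \<alpha> \<and> \<alpha> < a + \<delta> \<and> sol u w \<and> u 0 = \<alpha> \<longrightarrow> (\<exists>t>R. u t = 0 \<and> 0 < en u w t)")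
    case False
    then obtain R where R: "\<And>\<delta>. \<delta> > 0 \<Longrightarrow> \<exists>\<alpha> u w. a < \<alpha> \<and> \<alpha> < a + \<delta> \<and> sol u w \<and> u 0 = \<alpha> \<and> \<not> (\<exists>t>R. u t = 0 \<and> 0 < en u w t)" by blast
    have "\<exists>p. a < fst p 0 \<and> fst p 0 < al n \<and> sol (fst p) (snd p) \<and> \<not> (\<exists>t>R. fst p t = 0 \<and> 0 < en (fst p) (snd p) t)" for n
    proof -
      obtain \<alpha> u w where "a < \<alpha>" "\<alpha> < a + (al n - a)" "sol u w" "u 0 = \<alpha>" "\<not> (\<exists>t>R. u t = 0 \<and> 0 < en u w t)"
        using R[of "al n - a"] al(1)[of n] by auto
      then show ?thesis by (intro exI[of _ "(u, w)"]) auto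
    qed
    then obtain p where p: "\<And>n. a < fst (p n) 0" "\<And>n. fst (p n) 0 < al n" "\<And>n. sol (fst (p n)) (snd (p n))"
      "\<And>n. \<not> (\<exists>t>R. fst (p n) t = 0 \<and> 0 < en (fst (p n)) (snd (p n)) t)" by metis
    have "(\<lambda>n. fst (p n) 0) \<longlonglongrightarrow> a"
      by (rule tendsto_sandwich[OF _ _ tendsto_const all]) (use p in \<open>auto intro!: always_eventually less_imp_le\<close>)
    from sol_compact[OF p(3) this] obtain j u w where j: "strict_mono (j :: nat \<Rightarrow> nat)" "luconv (\<lambda>n. fst (p (j n))) u"
      "luconv (\<lambda>n. snd (p (j n))) w" "sol u w" "u 0 = a" by blast
    have nk: "crosses_at_least k (fst (p n)) (snd (p n))" for n
      by (rule XI[OF p(3)]) (use a(4)[of "fst (p n) 0"] p(1)[of n] p(2)[of n] al(2)[of n] in auto)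
    have "\<exists>t. (\<forall>i<k. t i \<in> crossings (fst (p (j n))) (snd (p (j n)))) \<and> (\<forall>i l. i < l \<and> l < k \<longrightarrow> t i < t l)" for n
      by (rule crosses_at_least_enum[OF nk])
    then obtain t where t: "\<And>n i. i < k \<Longrightarrow> t n i \<in> crossings (fst (p (j n))) (snd (p (j n)))" "\<And>n i l. i < l \<Longrightarrow> l < k \<Longrightarrow> t n i < t n l" by metis
    have tR: "t n i \<le> R" if "i < k" for n i
      using p(4)[of "j n"] t(1)[OF that, of n] crossing_en[OF t(1)[OF that, of n]] by (force simp: crossings_def)
    have "\<exists>v z. sol v z \<and> v 0 = u 0 \<and> (v \<longlongrightarrow> 0) at_top \<and> finite (crossings v z) \<and> card (crossings v z) = k - 1"
      by (rule bounded_crossings_limit[OF j(4) _ nca[OF j(4,5)] k p(3) j(2,3), where t = t and R = R]) (use j(5) a(1) t tR in auto)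
    then show ?thesis using j(5) a by (metis less_imp_le)
  next
    case True
    then have P: "\<And>R. \<exists>\<delta>>0. \<forall>\<alpha> u w. a < \<alpha> \<and> \<alpha> < a + \<delta> \<and> sol u w \<and> u 0 = \<alpha> \<longrightarrow> (\<exists>t>R. u t = 0 \<and> 0 < en u w t)" by blast
    have "\<exists>p. sol (fst p) (snd p) \<and> fst p 0 = al n" for n by (rule sol_exists[of "al n"]) (metis fst_conv snd_conv)
    then obtain p where p: "\<And>n. sol (fst (p n)) (snd (p n))" "\<And>n. fst (p n) 0 = al n" by metis
    have nk: "crosses_at_least k (fst (p n)) (snd (p n))" for n
      by (rule XI[OF p(1)]) (use a(4)[OF al(1,2)] p(2) in simp)
    have "(\<lambda>n. fst (p n) 0) \<longlonglongrightarrow> a" using all p(2) by simp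
    from sol_compact[OF p(1) this] obtain j u w where j: "strict_mono (j :: nat \<Rightarrow> nat)" "luconv (\<lambda>n. fst (p (j n))) u"
      "luconv (\<lambda>n. snd (p (j n))) w" "sol u w" "u 0 = a" by blast
    have cu: "continuous_on {0..} u" "continuous_on {0..} w" using sol_cont0[OF j(4)] by auto
    have n: "0 \<le> en u w r" if r: "0 \<le> r" for r
    proof (rule tendsto_lowerbound[OF en_luconv[OF j(2) cu(1) j(3) cu(2), of "\<lambda>_. r"]])
      obtain d where d: "d > 0" "\<And>\<alpha> u w. a < \<alpha> \<Longrightarrow> \<alpha> < a + d \<Longrightarrow> sol u w \<Longrightarrow> u 0 = \<alpha> \<Longrightarrow> \<exists>t>r. u t = 0 \<and> 0 < en u w t"
        using P[of r] by blast
      have "(\<lambda>n. al (j n)) \<longlonglongrightarrow> a" using LIMSEQ_subseq_LIMSEQ[OF all j(1)] by (simp add: o_def)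
      then have "\<forall>\<^sub>F n in sequentially. al (j n) < a + d" by (rule order_tendstoD(2)) (use d in simp)
      then show "\<forall>\<^sub>F n in sequentially. 0 \<le> en (fst (p (j n))) (snd (p (j n))) r"
      proof (rule eventually_mono)
        fix n assume "al (j n) < a + d"
        then obtain t where "t > r" "0 < en (fst (p (j n))) (snd (p (j n))) t" using d(2)[OF al(1) _ p(1,2)] by blast
        then show "0 \<le> en (fst (p (j n))) (snd (p (j n))) r" using en_antimono[OF p(1), of r t "j n"] r by simp
      qed
    qed (use r in auto)
    have fin: "finite {r. 0 < r \<and> u r = 0 \<and> w r \<noteq> 0}" using not_crosses_at_least(1)[OF nca[OF j(4,5)]] by (simp add: crossings_def)
    obtain l where l: "(u \<longlongrightarrow> l) at_top" "(en u w \<longlongrightarrow> 0) at_top" "((\<lambda>r. r * en u w r) \<longlongrightarrow> 0) at_top"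
      "f l = 0" "l = 0 \<or> l = bm \<or> l = bp"
      using tail_limit[OF j(4) n fin] by blast
    have "l \<noteq> bp"
    proof
      assume lb: "l = bp"
      show False
        by (rule no_lingering[of u w 1 a]) (use l lb j(4,5) n P in auto)
    qed
    moreover have "l \<noteq> bm"
    proof
      assume lb: "l = bm"
      interpret R: shooting m N "\<lambda>s. - f (- s)" "\<lambda>s. F (- s)" Mf "- bp" "- bm" by (rule refl_shooting)
      have e: "R.en (\<lambda>r. - u r) (\<lambda>r. - w r) = en u w" by (rule ext) (simp add: refl_en)
      show False
      proof (rule R.no_lingering[of "\<lambda>r. - u r" "\<lambda>r. - w r" "-1" a])
        show "- f (- (- bm)) = 0" using l lb by simp
        show "R.sol (\<lambda>r. - u r) (\<lambda>r. - w r)" by (rule refl_sol'[OF j(4)])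
        show "((\<lambda>r. - u r) \<longlongrightarrow> - bm) at_top" using l(1) lb by (intro tendsto_intros) simp
        fix R
        obtain d where d: "d > 0" "\<And>\<alpha> u w. a < \<alpha> \<Longrightarrow> \<alpha> < a + d \<Longrightarrow> sol u w \<Longrightarrow> u 0 = \<alpha> \<Longrightarrow> \<exists>t>R. u t = 0 \<and> 0 < en u w t"
          using P[of R] by blast
        have "\<exists>t>R. u t = 0 \<and> 0 < R.en u w t" if "a < \<alpha>" "\<alpha> < a + d" "R.sol u w" "u 0 = -1 * \<alpha>" for \<alpha> u w
          using d(2)[OF that(1,2), of "\<lambda>r. - u r" "\<lambda>r. - w r"] that(3,4) unfolding refl_sol refl_en by auto
        then show "\<exists>\<delta>>0. \<forall>\<alpha> u w. a < \<alpha> \<and> \<alpha> < a + \<delta> \<and> R.sol u w \<and> u 0 = -1 * \<alpha> \<longrightarrow> (\<exists>t>R. u t = 0 \<and> 0 < R.en u w t)"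
          using d(1) by blast
      qed (use l n j(5) in \<open>auto simp: e\<close>)
    qed
    ultimately have l0: "(u \<longlongrightarrow> 0) at_top" using l by auto
    have "finite (crossings u w) \<and> card (crossings u w) = k - 1"
      by (rule decaying_limit[OF j(4) _ nca[OF j(4,5)] k n l0 l(3,2) p(1) j(2,3) nk]) (use j(5) a in auto)
    then show ?thesis using j(4,5) l0 a by (metis less_imp_le)
  qed
qed

end
section \<open>Solutions with many sign changes\<close>

text \<open>The left-hand side bounds the energy that is lost while \<open>u\<close> rises to a level of at most \<open>B\<close> and
  falls again, at radii beyond \<open>r\<close> and with energy at most \<open>I\<close>, in a potential bounded below by
  \<open>- C\<close>.\<close>

definition loss_threshold :: "real \<Rightarrow> nat \<Rightarrow> real \<Rightarrow> real \<Rightarrow> real \<Rightarrow> real \<Rightarrow> bool" where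
  "loss_threshold m N B C c \<kappa> \<longleftrightarrow> (\<forall>r I. 0 < r \<and> c \<le> I \<and> \<kappa> \<le> r ^ N * I \<longrightarrow>
     2 * B * (real N - 1) / r * (m / (m - 1) * (I + C)) powr ((m - 1) / m) \<le> I / 4)"

lemma loss_threshold_mono: "loss_threshold m N B C c \<kappa> \<Longrightarrow> c \<le> c' \<Longrightarrow> \<kappa> \<le> \<kappa>' \<Longrightarrow> loss_threshold m N B C c' \<kappa>'"
  unfolding loss_threshold_def by (meson order_trans)

text \<open>For large \<open>I\<close> the left-hand side grows like \<open>I powr (1 - 1 / m) / r\<close>, so that \<open>r * I powr (1 /
  m)\<close> has to be large. Its \<open>N\<close>-th power is \<open>r ^ N * I * I powr (N / m - 1)\<close>, where \<open>N / m - 1 \<ge>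
  0\<close> and \<open>I \<ge> c\<close>.\<close>

lemma loss_threshold_exists:
  assumes m: "1 < m" "m \<le> real N" and B: "0 < B" "0 \<le> C" "0 < c"
  shows "\<exists>\<kappa>>0. loss_threshold m N B C c \<kappa>"
proof -
  have N: "1 < real N" "N > 0" using m by auto
  define p where "p = (m - 1) / m"
  define D where "D = 2 * B * (real N - 1) * (m / (m - 1) * (1 + C / c)) powr p"
  define e where "e = real N / m - 1"
  define \<kappa> where "\<kappa> = (4 * D) ^ N / c powr e"
  have p0: "0 < p" using m by (simp add: p_def)
  have D0: "0 < D"
  proof -
    have "0 < m / (m - 1) * (1 + C / c)" using m B by (intro mult_pos_pos add_pos_nonneg) auto
    then have "0 < (m / (m - 1) * (1 + C / c)) powr p" unfolding powr_gt_zero by (metis less_irrefl)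
    then show ?thesis unfolding D_def using B N by (intro mult_pos_pos) auto
  qed
  have e0: "0 \<le> e" using m by (simp add: e_def field_simps)
  have k0: "0 < \<kappa>" using D0 B by (simp add: \<kappa>_def)
  have "2 * B * (real N - 1) / r * (m / (m - 1) * (I + C)) powr ((m - 1) / m) \<le> I / 4"
    if r: "0 < r" and I: "c \<le> I" and k: "\<kappa> \<le> r ^ N * I" for r I
  proof -
    have I0: "0 < I" using I B by simp
    have "(4 * D) ^ N = \<kappa> * c powr e" using B by (simp add: \<kappa>_def)
    also have "\<dots> \<le> (r ^ N * I) * I powr e"
      using k I e0 B k0 r I0 by (intro mult_mono powr_mono2) auto
    also have "\<dots> = r ^ N * (I powr 1 * I powr e)" using I0 by simp
    also have "I powr 1 * I powr e = I powr (1 / m * real N)" unfolding powr_add[symmetric] by (simp add: e_def)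
    also have "\<dots> = (I powr (1 / m)) ^ N" using I0 powr_realpow[of "I powr (1 / m)" N] by (simp add: powr_powr)
    also have "r ^ N * \<dots> = (r * I powr (1 / m)) ^ N" by (simp add: power_mult_distrib)
    finally have "4 * D \<le> r * I powr (1 / m)"
      using r D0 N by (subst (asm) power_mono_iff) auto
    then have 1: "D / r \<le> I powr (1 / m) / 4" using r by (simp add: field_simps)
    have "I + C \<le> I * (1 + C / c)"
    proof -
      have "C = c * (C / c)" using B by simp
      also have "\<dots> \<le> I * (C / c)" using I B by (intro mult_right_mono) auto
      finally show ?thesis by (simp add: algebra_simps)
    qed
    then have "m / (m - 1) * (I + C) \<le> m / (m - 1) * (I * (1 + C / c))" using m by (intro mult_left_mono) auto
    then have "(m / (m - 1) * (I + C)) powr p \<le> (m / (m - 1) * (I * (1 + C / c))) powr p"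
      using m I0 B p0 by (intro powr_mono2) auto
    also have "\<dots> = (m / (m - 1) * (1 + C / c)) powr p * I powr p"
    proof -
      have "m / (m - 1) * (I * (1 + C / c)) = (m / (m - 1) * (1 + C / c)) * I" by simp
      moreover have "0 \<le> m / (m - 1) * (1 + C / c)" using m B by (intro mult_nonneg_nonneg) auto
      ultimately show ?thesis using I0 by (simp only: powr_mult less_imp_le)
    qed
    finally have "2 * B * (real N - 1) / r * (m / (m - 1) * (I + C)) powr p
       \<le> 2 * B * (real N - 1) / r * ((m / (m - 1) * (1 + C / c)) powr p * I powr p)"
      using B N r by (intro mult_left_mono) auto
    also have "\<dots> = D / r * I powr p" by (simp add: D_def)
    also have "\<dots> \<le> I powr (1 / m) / 4 * I powr p" using 1 by (intro mult_right_mono) auto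
    also have "\<dots> = I powr (1 / m + p) / 4" by (simp add: powr_add)
    also have "1 / m + p = 1" using m by (simp add: p_def field_simps)
    finally show ?thesis using I0 by (simp add: p_def)
  qed
  then show ?thesis using k0 unfolding loss_threshold_def by blast
qed

context radial begin

definition Q :: "real \<Rightarrow> real" where "Q s = m * real N * F s - (real N - m) * s * f s"

text \<open>In the derivative of this combination the kinetic terms cancel, and only \<open>Q u\<close> remains.\<close>

definition pohozaev :: "(real \<Rightarrow> real) \<Rightarrow> (real \<Rightarrow> real) \<Rightarrow> real \<Rightarrow> real" where
  "pohozaev u w r = m * (r ^ N * en u w r) + (real N - m) * (r ^ (N - 1) * w r * u r)"

lemma pohozaev_deriv:
  assumes s: "sol u w" and r: "0 < r"
  shows "(pohozaev u w has_real_derivative r ^ (N - 1) * Q (u r)) (at r)"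
proof -
  have N0: "N > 0" using N2 by simp
  let ?p = "w r * psi m (w r)"
  have rN: "r ^ N = r * r ^ (N - 1)" using N0 by (metis power_eq_if neq0_conv)
  have "(pohozaev u w has_real_derivative
     m * (real N * r ^ (N - 1) * en u w r + - ((real N - 1) / r * ?p) * r ^ N) +
     (real N - m) * (- (r ^ (N - 1) * f (u r)) * u r + psi m (w r) * (r ^ (N - 1) * w r))) (at r)"
    unfolding pohozaev_def
    by (intro DERIV_add DERIV_cmult DERIV_mult sol_dz[OF s r] sol_du[OF s r] en_deriv[OF s r])
      (use N0 in \<open>auto intro!: derivative_eq_intros\<close>)
  moreover have "m * (real N * r ^ (N - 1) * en u w r + - ((real N - 1) / r * ?p) * r ^ N) +
     (real N - m) * (- (r ^ (N - 1) * f (u r)) * u r + psi m (w r) * (r ^ (N - 1) * w r)) = r ^ (N - 1) * Q (u r)"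
  proof -
    define P where "P = r ^ (N - 1)"
    have k: "m * kin m (w r) = (m - 1) * ?p" using mult_psi[OF m1, of "w r"] m1 by (simp add: field_simps)
    have "m * (real N * P * en u w r + - ((real N - 1) / r * ?p) * r ^ N) +
     (real N - m) * (- (P * f (u r)) * u r + psi m (w r) * (P * w r)) =
      P * (real N * (m * kin m (w r)) + m * real N * F (u r) - m * (real N - 1) * ?p + (real N - m) * ?p - (real N - m) * u r * f (u r))"
      using r unfolding rN P_def[symmetric] en_def by (simp add: field_simps)
    also have "\<dots> = P * Q (u r)" unfolding k Q_def by (simp add: algebra_simps)
    finally show ?thesis unfolding P_def .
  qed
  ultimately show ?thesis by simp
qed

lemma pohozaev_cont: "sol u w \<Longrightarrow> 0 \<le> a \<Longrightarrow> continuous_on {a..b} (pohozaev u w)"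
  unfolding pohozaev_def by (intro continuous_intros en_cont sol_cont)

lemma pohozaev_growth:
  assumes s: "sol u w" and r: "0 \<le> r1" "r1 \<le> r2" and q: "\<And>x. r1 < x \<Longrightarrow> x < r2 \<Longrightarrow> q \<le> Q (u x)"
  shows "q / real N * (r2 ^ N - r1 ^ N) \<le> pohozaev u w r2 - pohozaev u w r1"
proof -
  have N0: "N > 0" using N2 by simp
  have "q / real N * r2 ^ N - q / real N * r1 ^ N \<le> pohozaev u w r2 - pohozaev u w r1"
  proof (rule deriv_le_imp_le[where g = "\<lambda>r. q / real N * r ^ N" and h = "pohozaev u w" and g' = "\<lambda>r. q * r ^ (N - 1)" and h' = "\<lambda>r. r ^ (N - 1) * Q (u r)"])
    fix x assume x: "r1 < x" "x < r2"
    show "((\<lambda>r. q / real N * r ^ N) has_real_derivative q * x ^ (N - 1)) (at x)"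
      using N0 by (auto intro!: derivative_eq_intros)
    show "(pohozaev u w has_real_derivative x ^ (N - 1) * Q (u x)) (at x)" using x r by (intro pohozaev_deriv[OF s]) simp
    show "q * x ^ (N - 1) \<le> x ^ (N - 1) * Q (u x)" using q[OF x] x r by (simp add: mult.commute mult_left_mono)
  qed (use r N0 pohozaev_cont[OF s] in \<open>auto intro!: continuous_intros\<close>)
  then show ?thesis by (simp add: algebra_simps)
qed

lemma u_inc_le:
  assumes s: "sol u w" and "0 \<le> a" "a \<le> b" and w: "\<And>x. a < x \<Longrightarrow> x < b \<Longrightarrow> 0 \<le> w x"
  shows "u a \<le> u b"
proof -
  have "(0::real) - 0 \<le> u b - u a"
    by (rule deriv_le_imp_le[where h = u and g = "\<lambda>_. 0" and h' = "\<lambda>x. psi m (w x)" and g' = "\<lambda>_. 0"])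
      (use assms sol_cont[OF s] sol_du[OF s] psi_nonneg in auto)
  then show ?thesis by simp
qed

end

context shooting begin

text \<open>Otherwise the solution would be monotone from some point on, and its energy would tend to \<open>0\<close>.\<close>

lemma must_vanish:
  assumes s: "sol u w" and R: "0 \<le> R" and e: "0 < e" "\<And>r. R \<le> r \<Longrightarrow> e \<le> en u w r" and u: "\<And>r. R \<le> r \<Longrightarrow> 0 \<le> u r"
  shows False
proof -
  have n: "e \<le> en u w r" if "0 \<le> r" for r
  proof (cases "R \<le> r")
    case False then show ?thesis using en_antimono[OF s that, of R] e(2)[of R] by simp
  qed (use e in simp)
  have p: "0 < en u w r" if "0 \<le> r" for r using n[OF that] e(1) by simp
  obtain R0 where R0: "R0 > 0" "(\<forall>r\<ge>R0. w r \<le> 0) \<or> (\<forall>r\<ge>R0. 0 \<le> w r)"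
  proof -
    have "0 < en u w r" if "R \<le> r" for r using p[of r] that R by simp
    from tail_mono_pos[OF s R this u] show ?thesis using that by blast
  qed
  have l: "(en u w \<longlongrightarrow> 0) at_top" using tail_limit_signed[OF s less_imp_le[OF p] R0] by blast
  have "\<forall>\<^sub>F r in at_top. e \<le> en u w r" unfolding eventually_at_top_linorder using n by blast
  then have "e \<le> 0" by (intro tendsto_lowerbound[OF l]) auto
  then show False using e by simp
qed

lemma unimodal:
  assumes s: "sol u w" and r: "0 \<le> r0" "r0 \<le> r" and u: "\<And>x. r0 \<le> x \<Longrightarrow> x \<le> r \<Longrightarrow> 0 \<le> u x" and e: "0 < en u w r"
  shows "\<exists>E. r0 \<le> E \<and> E \<le> r \<and> (\<forall>x. r0 < x \<and> x < E \<longrightarrow> 0 \<le> w x) \<and> (\<forall>x. E < x \<and> x \<le> r \<longrightarrow> w x \<le> 0)"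
proof -
  have desc: "w t < 0" if "r0 \<le> x" "x < t" "t \<le> r" "w x \<le> 0" for x t
  proof (rule descent[OF s _ that(2) _ _ that(4)])
    show "0 < en u w t" using en_antimono[OF s, of t r] that r e by simp
    show "0 \<le> u y" if "x \<le> y" "y \<le> t" for y using u[of y] that \<open>r0 \<le> x\<close> \<open>t \<le> r\<close> by simp
  qed (use that r in simp)
  show ?thesis
  proof (cases "w r0 \<le> 0")
    case True
    then show ?thesis using desc[of r0] r by (intro exI[of _ r0]) (auto intro: less_imp_le)
  next
    case False
    show ?thesis
    proof (cases "w r \<le> 0")
      case True
      obtain E where E: "r0 < E" "E \<le> r" "w E = 0" "\<And>x. r0 \<le> x \<Longrightarrow> x < E \<Longrightarrow> 0 < w x"
        using first_down[OF sol_cont(2)[OF s r(1)] r(2), of 0] False True by auto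
      then show ?thesis using desc[of E] by (intro exI[of _ E]) (auto intro: less_imp_le)
    next
      case False
      have "0 < w x" if "r0 < x" "x < r" for x using desc[of x r] that False by force
      then show ?thesis using r by (intro exI[of _ r]) (auto intro: less_imp_le)
    qed
  qed
qed

lemma quasiconcave:
  assumes s: "sol u w" and r: "0 \<le> p" "p \<le> x" "x \<le> q" and u: "\<And>x. p \<le> x \<Longrightarrow> x \<le> q \<Longrightarrow> 0 \<le> u x" and e: "0 < en u w q"
  shows "min (u p) (u q) \<le> u x"
proof -
  obtain E where E: "p \<le> E" "E \<le> q" "\<And>x. p < x \<Longrightarrow> x < E \<Longrightarrow> 0 \<le> w x" "\<And>x. E < x \<Longrightarrow> x \<le> q \<Longrightarrow> w x \<le> 0"
    using unimodal[OF s r(1) _ u e] r by auto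
  show ?thesis
  proof (cases "x \<le> E")
    case True
    have "u p \<le> u x" by (rule u_inc_le[OF s r(1,2)]) (use E True in auto)
    then show ?thesis by simp
  next
    case False
    have "u q \<le> u x" by (rule u_dec_le[OF s _ r(3)]) (use E False r in auto)
    then show ?thesis by simp
  qed
qed

text \<open>The energy bounds \<open>|w|\<close>, and by \<open>unimodal\<close> the arc consists of a rise and a fall, each of height
  at most \<open>b\<close>.\<close>

lemma zone_loss:
  assumes s: "sol u w" and r: "0 < r0" "r0 \<le> r" and u: "\<And>x. r0 \<le> x \<Longrightarrow> x \<le> r \<Longrightarrow> 0 \<le> u x \<and> u x \<le> b"
    and e: "0 < en u w r" and C: "\<And>s. - F s \<le> C" "b \<le> B"
    and z: "loss_threshold m N B C c \<kappa>" "c \<le> en u w r0" "\<kappa> \<le> r0 ^ N * en u w r0"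
  shows "3 / 4 * en u w r0 \<le> en u w r"
proof -
  define I where "I = en u w r0"
  define W where "W = (m / (m - 1) * (I + C)) powr ((m - 1) / m)"
  have I0: "0 < I" using en_antimono[OF s, of r0 r] r e by (simp add: I_def)
  have C0: "0 \<le> C" using C(1)[of 0] F_0 by simp
  have b0: "0 \<le> b" using u[of r0] r by simp
  have kW: "kin m W = I + C"
  proof -
    have "kin m W = (m - 1) / m * (m / (m - 1) * (I + C)) powr ((m - 1) / m * (m / (m - 1)))"
      by (simp add: kin_def W_def powr_powr)
    also have "(m - 1) / m * (m / (m - 1)) = 1" using m1 by simp
    also have "(m - 1) / m * (m / (m - 1) * (I + C)) powr 1 = I + C" using m1 I0 C0 by simp
    finally show ?thesis .
  qed
  have W0: "0 \<le> W" by (simp add: W_def)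
  have wW: "\<bar>w x\<bar> \<le> W" if "r0 \<le> x" "x \<le> r" for x
  proof -
    have "kin m (w x) \<le> I + C" using en_antimono[OF s, of r0 x] C(1)[of "u x"] that r unfolding I_def en_def[of u w x] by simp
    then have "kin m (w x) \<le> kin m W" using kW by simp
    from kin_le_imp[OF m1 this] show ?thesis using W0 by simp
  qed
  obtain E where E: "r0 \<le> E" "E \<le> r" "\<And>x. r0 < x \<Longrightarrow> x < E \<Longrightarrow> 0 \<le> w x" "\<And>x. E < x \<Longrightarrow> x \<le> r \<Longrightarrow> w x \<le> 0"
    using unimodal[OF s less_imp_le[OF r(1)] r(2) _ e] u by auto
  define q where "q = (real N - 1) * W / r0"
  have q0: "0 \<le> q" using N2 W0 r by (simp add: q_def)
  have "en u w r0 - en u w E \<le> (real N - 1) * W / r0 * (1 * (u E - u r0))"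
  proof (rule loss_upper[OF s r(1) E(1)])
    fix x assume x: "r0 < x" "x < E"
    then show "0 \<le> 1 * w x \<and> \<bar>w x\<bar> \<le> W" using E(2) E(3)[OF x] wW[of x] by simp
  qed simp
  also have "\<dots> \<le> q * b" unfolding q_def[symmetric] using u[of E] u[of r0] E r q0 by (intro mult_left_mono) auto
  finally have 1: "en u w r0 - en u w E \<le> q * b" .
  have "en u w E - en u w r \<le> (real N - 1) * W / E * (-1 * (u r - u E))"
  proof (rule loss_upper[OF s _ E(2)])
    fix x assume x: "E < x" "x < r"
    then show "0 \<le> -1 * w x \<and> \<bar>w x\<bar> \<le> W" using E(1) E(4)[of x] wW[of x] by simp
  qed (use E r in auto)
  also have "\<dots> \<le> q * b"
  proof (rule mult_mono)
    show "(real N - 1) * W / E \<le> q" unfolding q_def using E r N2 W0 by (intro divide_left_mono mult_nonneg_nonneg) auto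
    show "-1 * (u r - u E) \<le> b" using u[of E] u[of r] E r by simp
    show "0 \<le> -1 * (u r - u E)"
    proof -
      have "u r \<le> u E" by (rule u_dec_le[OF s _ E(2)]) (use E r in auto)
      then show ?thesis by simp
    qed
  qed (rule q0)
  finally have "en u w r0 - en u w r \<le> 2 * (q * b)" using 1 by simp
  also have "\<dots> \<le> 2 * (q * B)" using C(2) q0 by (simp add: mult_left_mono)
  also have "\<dots> = 2 * B * (real N - 1) / r0 * W" by (simp add: q_def)
  also have "\<dots> \<le> I / 4" using z r unfolding loss_threshold_def W_def I_def by blast
  finally show ?thesis by (simp add: I_def)
qed

text \<open>Below the level \<open>b\<close>, \<open>zone_loss\<close> applies. During an excursion above \<open>b\<close> the Pohozaev quantity
  increases, and its mixed term has the right sign at both ends, as \<open>w \<ge> 0\<close> on the way up and \<open>w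
  \<le> 0\<close> on the way down. So \<open>r ^ N * en\<close> does not decrease across the excursion, while the energy
  is at least \<open>F b \<ge> c\<close> when \<open>u\<close> returns. The factor \<open>3 / 4\<close> occurs at most twice.\<close>

lemma swing_bound:
  assumes s: "sol u w" and A: "\<And>r. 0 \<le> r \<Longrightarrow> u r \<le> A" and b: "bp < b" "b \<le> B"
    and Q: "\<And>s. b \<le> s \<Longrightarrow> s \<le> A \<Longrightarrow> 0 \<le> Q s" and cF: "b \<le> A \<Longrightarrow> c \<le> F b"
    and C: "\<And>s. - F s \<le> C" and c: "0 < c" and z: "loss_threshold m N B C c (\<kappa> / 2)" and \<kappa>: "0 < \<kappa>"
    and r0: "0 < r0" "0 \<le> u r0" "u r0 \<le> b" "c \<le> en u w r0" "\<kappa> \<le> r0 ^ N * en u w r0"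
    and r: "r0 \<le> r" "\<And>x. r0 < x \<Longrightarrow> x \<le> r \<Longrightarrow> 0 < u x" and e: "0 < en u w r"
  shows "c / 2 \<le> en u w r \<and> (u r \<le> b \<longrightarrow> \<kappa> / 2 \<le> r ^ N * en u w r)"
proof -
  have un: "0 \<le> u x" if "r0 \<le> x" "x \<le> r" for x using r(2)[of x] r0(2) that by (cases "x = r0") auto
  have ep: "0 < en u w x" if "r0 \<le> x" "x \<le> r" for x using en_antimono[OF s, of x r] that r0 e by simp
  have k2: "\<kappa> / 2 \<le> r0 ^ N * en u w r0" using r0 \<kappa> by simp
  show ?thesis
  proof (cases "\<exists>x. r0 \<le> x \<and> x \<le> r \<and> b < u x")
    case False
    have 1: "3 / 4 * en u w r0 \<le> en u w r"
      by (rule zone_loss[OF s r0(1) r(1) _ e C b(2) z r0(4) k2]) (use False un in force)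
    have "\<kappa> / 2 \<le> 3 / 4 * (r0 ^ N * en u w r0)" using r0(5) \<kappa> by simp
    also have "\<dots> \<le> r ^ N * en u w r"
    proof -
      have "r0 ^ N * (3 / 4 * en u w r0) \<le> r ^ N * en u w r"
        using 1 r0 r c by (intro mult_mono power_mono) auto
      then show ?thesis by simp
    qed
    finally show ?thesis using 1 r0(4) c by simp
  next
    case True
    then obtain x where x: "r0 \<le> x" "x \<le> r" "b < u x" by blast
    have bA: "b \<le> A" using A[of x] x r0 by simp
    have cont: "continuous_on {r0..x} u" "continuous_on {x..r} u" using sol_cont(1)[OF s] r0 x by auto
    have r0x: "r0 < x" using x r0 by (cases "r0 = x") auto
    obtain r1 where r1: "r0 \<le> r1" "r1 \<le> x" "u r1 = b" "\<And>t. r0 \<le> t \<Longrightarrow> t \<le> r1 \<Longrightarrow> u t \<le> b"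
    proof (cases "u r0 = b")
      case True then show ?thesis using that[of r0] x by force
    next
      case False
      then have "u r0 < b" using r0 by simp
      then obtain z where "r0 < z" "z \<le> x" "u z = b" "\<And>t. r0 \<le> t \<Longrightarrow> t < z \<Longrightarrow> u t < b"
        using first_up[OF cont(1) x(1), of b] x by auto
      then show ?thesis using that[of z] by (metis less_imp_le le_less)
    qed
    have r10: "0 < r1" using r1 r0 by simp
    have i1: "3 / 4 * en u w r0 \<le> en u w r1"
      by (rule zone_loss[OF s r0(1) r1(1) _ _ C b(2) z r0(4) k2]) (use r1 un x ep in auto)
    show ?thesis
    proof (cases "b < u r")
      case True
      have "F b < F (u r)" by (rule F_strict_mono) (use True b in auto)
      then have "c \<le> en u w r" using F_le_en[of u r w] cF[OF bA] by simp
      then show ?thesis using True c by simp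
    next
      case False
      obtain r2 where r2: "x \<le> r2" "r2 \<le> r" "u r2 = b" "\<And>t. r2 \<le> t \<Longrightarrow> t \<le> r \<Longrightarrow> u t \<le> b"
      proof (cases "u r = b")
        case True then show ?thesis using that[of r] x by force
      next
        case neq: False
        then have "u r < b" using False by simp
        then obtain z where "x \<le> z" "z < r" "u z = b" "\<And>t. z < t \<Longrightarrow> t \<le> r \<Longrightarrow> u t < b"
          using last_down[OF cont(2) x(2), of b] x by auto
        then show ?thesis using that[of z] by (metis less_imp_le le_less)
      qed
      have r12: "r1 \<le> r2" "0 < r2" using r1 r2 r10 by auto
      have ub: "b \<le> u t" if "r1 \<le> t" "t \<le> r2" for t
        using quasiconcave[OF s less_imp_le[OF r10] that _ ep[of r2]] un r1 r2 x that by (auto simp: min_def split: if_splits)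
      have w1: "0 \<le> w r1"
      proof (rule ccontr)
        assume "\<not> 0 \<le> w r1"
        then have "psi m (w r1) < 0" by (intro psi_neg) simp
        from DERIV_neg_dec_right[OF sol_du[OF s r10] this] obtain d where d: "d > 0" "\<And>h. 0 < h \<Longrightarrow> h < d \<Longrightarrow> u (r1 + h) < u r1" by blast
        have "r1 < r2" using r1 r2 x by (cases "r1 = r2") auto
        define h where "h = min (d / 2) (r2 - r1)"
        have "0 < h" "h < d" "r1 + h \<le> r2" using d \<open>r1 < r2\<close> by (auto simp: h_def)
        then show False using d(2)[of h] ub[of "r1 + h"] r1(3) by auto
      qed
      have w2: "w r2 \<le> 0"
      proof (rule ccontr)
        assume "\<not> w r2 \<le> 0"
        then have "0 < psi m (w r2)" by (intro psi_pos) simp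
        from DERIV_pos_inc_left[OF sol_du[OF s r12(2)] this] obtain d where d: "d > 0" "\<And>h. 0 < h \<Longrightarrow> h < d \<Longrightarrow> u (r2 - h) < u r2" by blast
        have "r1 < r2" using r1 r2 x by (cases "r1 = r2") auto
        define h where "h = min (d / 2) (r2 - r1)"
        have "0 < h" "h < d" "r1 \<le> r2 - h" using d \<open>r1 < r2\<close> by (auto simp: h_def)
        then show False using d(2)[of h] ub[of "r2 - h"] r2(3) by auto
      qed
      have b0: "0 < b" using b bp_pos by simp
      have "0 / real N * (r2 ^ N - r1 ^ N) \<le> pohozaev u w r2 - pohozaev u w r1"
        by (rule pohozaev_growth[OF s less_imp_le[OF r10] r12(1)]) (use ub A r10 in \<open>auto intro!: Q\<close>)
      then have "pohozaev u w r1 \<le> pohozaev u w r2" by simp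
      moreover have "m * (r1 ^ N * en u w r1) \<le> pohozaev u w r1"
        unfolding pohozaev_def using w1 r1(3) b0 r10 mN by simp
      moreover have "pohozaev u w r2 \<le> m * (r2 ^ N * en u w r2)"
      proof -
        have "r2 ^ (N - 1) * w r2 * u r2 \<le> 0" unfolding r2(3) using w2 b0 r12 by (intro mult_nonpos_nonneg mult_nonneg_nonpos) auto
        from mult_nonneg_nonpos[OF _ this, of "real N - m"] have "(real N - m) * (r2 ^ (N - 1) * w r2 * u r2) \<le> 0" using mN by simp
        then show ?thesis unfolding pohozaev_def by simp
      qed
      ultimately have "m * (r1 ^ N * en u w r1) \<le> m * (r2 ^ N * en u w r2)" by linarith
      then have i2: "r1 ^ N * en u w r1 \<le> r2 ^ N * en u w r2" using m1 by simp
      have "r0 ^ N * (3 / 4 * en u w r0) \<le> r1 ^ N * en u w r1"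
        using i1 r0 r1 c by (intro mult_mono power_mono) auto
      then have i3: "3 / 4 * \<kappa> \<le> r2 ^ N * en u w r2" using i2 r0(5) by simp
      have c2: "c \<le> en u w r2" using F_le_en[of u r2 w] r2(3) cF[OF bA] by simp
      have i4: "3 / 4 * en u w r2 \<le> en u w r"
        by (rule zone_loss[OF s r12(2) r2(2) _ e C b(2) z c2]) (use r2 un x r1 i3 \<kappa> in auto)
      have "r2 ^ N * (3 / 4 * en u w r2) \<le> r ^ N * en u w r"
        using i4 r2 r12 c2 c by (intro mult_mono power_mono) auto
      then have "\<kappa> / 2 \<le> r ^ N * en u w r" using i3 \<kappa> by simp
      then show ?thesis using i4 c2 c by simp
    qed
  qed
qed

text \<open>By \<open>swing_bound\<close> the energy stays away from \<open>0\<close> while \<open>u\<close> is positive, so \<open>must_vanish\<close> provides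
  a zero.\<close>

lemma swing:
  assumes s: "sol u w" and A: "\<And>r. 0 \<le> r \<Longrightarrow> u r \<le> A" and b: "bp < b" "b \<le> B"
    and Q: "\<And>s. b \<le> s \<Longrightarrow> s \<le> A \<Longrightarrow> 0 \<le> Q s" and cF: "b \<le> A \<Longrightarrow> c \<le> F b"
    and C: "\<And>s. - F s \<le> C" and c: "0 < c" and z: "loss_threshold m N B C c (\<kappa> / 2)" and \<kappa>: "0 < \<kappa>"
    and r0: "0 < r0" "0 \<le> u r0" "u r0 \<le> b" "c \<le> en u w r0" "\<kappa> \<le> r0 ^ N * en u w r0"
    and st: "0 < u r0 \<or> 0 < w r0"
  shows "\<exists>z>r0. u z = 0 \<and> w z < 0 \<and> c / 2 \<le> en u w z \<and> \<kappa> / 2 \<le> z ^ N * en u w z"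
proof -
  have sb: "c / 2 \<le> en u w r \<and> (u r \<le> b \<longrightarrow> \<kappa> / 2 \<le> r ^ N * en u w r)"
    if "r0 \<le> r" "\<And>x. r0 < x \<Longrightarrow> x \<le> r \<Longrightarrow> 0 < u x" "0 < en u w r" for r
    by (rule swing_bound[OF s _ b _ _ C c z \<kappa> r0]) (use A Q cF that in auto)
  have ge: "c / 2 \<le> g y" if "continuous_on {0..} g" "r0 < y" "\<And>x. r0 < x \<Longrightarrow> x < y \<Longrightarrow> c / 2 \<le> g x" for g :: "real \<Rightarrow> real" and y
  proof (rule continuous_ge_on_closure[of "{r0<..<y}" g y "c / 2"])
    show "continuous_on (closure {r0<..<y}) g" using that r0 by (auto elim!: continuous_on_subset)
    show "y \<in> closure {r0<..<y}" using that by simp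
  qed (use that in auto)
  have en0: "0 < en u w r" if r: "r0 < r" "\<And>x. r0 < x \<Longrightarrow> x < r \<Longrightarrow> 0 < u x" for r
  proof (rule ccontr)
    assume neg: "\<not> 0 < en u w r"
    have "0 < en u w r0" using r0(4) c by simp
    then obtain Z where Z: "r0 < Z" "Z \<le> r" "en u w Z = 0" "\<And>x. r0 \<le> x \<Longrightarrow> x < Z \<Longrightarrow> 0 < en u w x"
      using first_en_zero[OF s less_imp_le[OF r0(1)] less_imp_le[OF r(1)]] neg by (auto simp: not_less)
    have "c / 2 \<le> en u w Z"
    proof (rule ge[OF en_cont0[OF s] Z(1)])
      fix x assume x: "r0 < x" "x < Z"
      have ux: "0 < u t" if "r0 < t" "t \<le> x" for t by (rule r(2)) (use that x Z in auto)
      have "0 < en u w x" by (rule Z(4)) (use x in auto)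
      with sb[OF less_imp_le[OF x(1)] ux] show "c / 2 \<le> en u w x" by blast
    qed
    then show False using Z c by simp
  qed
  obtain r1 where r1: "r0 \<le> r1" "0 < u r1" "\<And>x. r0 < x \<Longrightarrow> x \<le> r1 \<Longrightarrow> 0 < u x"
  proof (cases "0 < u r0")
    case True then show ?thesis using that[of r0] by auto
  next
    case False
    then have u0: "u r0 = 0" "0 < w r0" using r0 st by auto
    from DERIV_pos_inc_right[OF sol_du[OF s r0(1)] psi_pos[OF u0(2)]] obtain d where d: "d > 0" "\<And>h. 0 < h \<Longrightarrow> h < d \<Longrightarrow> u r0 < u (r0 + h)" by blast
    have "0 < u x" if "r0 < x" "x \<le> r0 + d / 2" for x using d(2)[of "x - r0"] u0 that d(1) by auto
    then show ?thesis using that[of "r0 + d / 2"] d(1) by auto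
  qed
  have r10: "0 \<le> r1" using r1 r0 by simp
  have "\<exists>x\<ge>r1. u x \<le> 0"
  proof (rule ccontr)
    assume neg: "\<not> ?thesis"
    have up: "0 < u x" if "r0 < x" for x 
    proof (cases "x \<le> r1")
      case True then show ?thesis using r1(3) that by blast
    next
      case False then have "r1 \<le> x" by simp
      then have "\<not> u x \<le> 0" using neg by blast
      then show ?thesis by simp
    qed
    have eb: "c / 2 \<le> en u w x" if "r0 \<le> x" for x
    proof (cases "x = r0")
      case True then show ?thesis using r0(4) c by simp
    next
      case False
      then have x: "r0 < x" using that by simp
      have "0 < en u w x" by (rule en0[OF x up])
      with sb[OF less_imp_le[OF x] up] show ?thesis by blast
    qed
    show False
    proof (rule must_vanish[OF s less_imp_le[OF r0(1)] half_gt_zero[OF c] eb])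
      fix x assume "r0 \<le> x"
      then show "0 \<le> u x" using up[of x] r0(2) by (cases "x = r0") auto
    qed
  qed
  then obtain x where x: "r1 \<le> x" "u x \<le> 0" by blast
  obtain y where y: "r1 < y" "y \<le> x" "u y = 0" "\<And>t. r1 \<le> t \<Longrightarrow> t < y \<Longrightarrow> 0 < u t"
    using first_down[OF sol_cont(1)[OF s r10] x(1), of 0] r1 x by auto
  have y0: "r0 < y" "0 < y" using y r1 r0 by auto
  have up: "0 < u t" if "r0 < t" "t < y" for t using y(4)[of t] r1(3)[of t] that by (cases "t \<le> r1") auto
  have ey: "0 < en u w y" by (rule en0[OF y0(1) up])
  have c2: "c / 2 \<le> en u w y"
  proof (rule ge[OF en_cont0[OF s] y0(1)])
    fix x assume x: "r0 < x" "x < y"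
    have ux: "0 < u t" if "r0 < t" "t \<le> x" for t by (rule up) (use that x in auto)
    have "0 < en u w x" by (rule en0[OF x(1)]) (use ux in auto)
    with sb[OF less_imp_le[OF x(1)] ux] show "c / 2 \<le> en u w x" by blast
  qed
  have wy: "w y < 0"
  proof (rule ccontr)
    assume "\<not> w y < 0"
    moreover have "w y \<noteq> 0" using crit_outside[of w y u] ey y bm_neg bp_pos by auto
    ultimately have "0 < psi m (w y)" by (intro psi_pos) simp
    from DERIV_pos_inc_left[OF sol_du[OF s y0(2)] this] obtain d where d: "d > 0" "\<And>h. 0 < h \<Longrightarrow> h < d \<Longrightarrow> u (y - h) < u y" by blast
    define h where "h = min (d / 2) ((y - r0) / 2)"
    have "0 < h" "h < d" "r0 < y - h" using d y0 by (auto simp: h_def min_def field_simps)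
    then show False using d(2)[of h] up[of "y - h"] y(3) by auto
  qed
  have "\<kappa> / 2 \<le> y ^ N * en u w y"
  proof -
    have b0: "0 < b" using b bp_pos by simp
    have iu: "isCont u y" using DERIV_isCont[OF sol_du[OF s y0(2)]] .
    have "\<forall>\<^sub>F t in nhds y. u t < b" by (rule order_tendstoD(2)[OF isCont_nhds[OF iu]]) (use y(3) b0 in simp)
    then obtain d where d: "d > 0" "\<And>t. \<bar>t - y\<bar> < d \<Longrightarrow> u t < b" by (auto simp: eventually_nhds_metric dist_real_def)
    define q where "q = max r0 (y - d / 2)"
    have q: "r0 \<le> q" "q < y" "y - d < q" using d y0 by (auto simp: q_def)
    show ?thesis
    proof (rule continuous_ge_on_closure[of "{q<..<y}" "\<lambda>t. t ^ N * en u w t" y "\<kappa> / 2"])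
      show "continuous_on (closure {q<..<y}) (\<lambda>t. t ^ N * en u w t)"
        using q r0 by (intro continuous_intros continuous_on_subset[OF en_cont0[OF s]]) auto
      show "y \<in> closure {q<..<y}" using q by simp
      fix t assume t: "t \<in> {q<..<y}"
      have "u t \<le> b" using d(2)[of t] t q by (auto simp: abs_less_iff)
      moreover have "r0 < t" "t < y" using t q by auto
      moreover have ux: "0 < u x" if "r0 < x" "x \<le> t" for x by (rule up) (use that \<open>t < y\<close> in auto)
      moreover have "0 < en u w t" by (rule en0[OF \<open>r0 < t\<close>]) (use ux in auto)
      ultimately show "\<kappa> / 2 \<le> t ^ N * en u w t" using sb[of t] by auto
    qed
  qed
  then show ?thesis using y0 y(3) wy c2 by blast
qed

text \<open>Swings are alternately positive and negative, and each of them halves the available bounds at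
  worst.\<close>

lemma many_swings:
  assumes s: "sol u w" and A: "\<And>r. 0 \<le> r \<Longrightarrow> - A' \<le> u r \<and> u r \<le> A" and b: "bp < b" "b \<le> B" and b': "- bm < b'" "b' \<le> B"
    and Q: "\<And>s. b \<le> s \<Longrightarrow> s \<le> A \<Longrightarrow> 0 \<le> Q s" and Q': "\<And>s. b' \<le> s \<Longrightarrow> s \<le> A' \<Longrightarrow> 0 \<le> Q (- s)"
    and C: "\<And>s. - F s \<le> C"
  shows "0 < c \<Longrightarrow> 0 < \<kappa> \<Longrightarrow> (b \<le> A \<Longrightarrow> c \<le> F b) \<Longrightarrow> (b' \<le> A' \<Longrightarrow> c \<le> F (- b')) \<Longrightarrow>
    loss_threshold m N B C (c / 2 ^ j) (\<kappa> / 2 ^ (j + 1)) \<Longrightarrow> 0 < z \<Longrightarrow> u z = 0 \<Longrightarrow> w z \<noteq> 0 \<Longrightarrow> c \<le> en u w z \<Longrightarrow> \<kappa> \<le> z ^ N * en u w z \<Longrightarrow>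
    \<exists>S\<subseteq>crossings u w. finite S \<and> card S = j + 1 \<and> (\<forall>x\<in>S. z \<le> x)"
proof (induction j arbitrary: z c \<kappa>)
  case 0
  then show ?case by (intro exI[of _ "{z}"]) (auto simp: crossings_def)
next
  case (Suc j)
  interpret R: shooting m N "\<lambda>s. - f (- s)" "\<lambda>s. F (- s)" Mf "- bp" "- bm" by (rule refl_shooting)
  have z1: "loss_threshold m N B C c (\<kappa> / 2)"
  proof (rule loss_threshold_mono[OF Suc.prems(5)])
    have p: "(1::real) \<le> 2 ^ j" by simp
    show "c / 2 ^ Suc j \<le> c" using divide_left_mono[of 1 "2 ^ Suc j" c] p Suc.prems(1) by simp
    show "\<kappa> / 2 ^ (Suc j + 1) \<le> \<kappa> / 2" using divide_left_mono[of 2 "2 ^ (Suc j + 1)" \<kappa>] p Suc.prems(2) by simp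
  qed
  have "\<exists>y>z. u y = 0 \<and> w y \<noteq> 0 \<and> c / 2 \<le> en u w y \<and> \<kappa> / 2 \<le> y ^ N * en u w y"
  proof (cases "0 < w z")
    case True
    have "\<exists>y>z. u y = 0 \<and> w y < 0 \<and> c / 2 \<le> en u w y \<and> \<kappa> / 2 \<le> y ^ N * en u w y"
      by (rule swing[OF s _ b Q Suc.prems(3) C Suc.prems(1) z1 Suc.prems(2,6)]) (use A Suc.prems True b bp_pos in auto)
    then show ?thesis by force
  next
    case False
    have Qr: "R.Q s = Q (- s)" for s by (simp add: R.Q_def Q_def)
    have "\<exists>y>z. - u y = 0 \<and> - w y < 0 \<and> c / 2 \<le> R.en (\<lambda>r. - u r) (\<lambda>r. - w r) y \<and> \<kappa> / 2 \<le> y ^ N * R.en (\<lambda>r. - u r) (\<lambda>r. - w r) y"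
    proof (rule R.swing[OF refl_sol'[OF s] _ b'])
      show "loss_threshold m N B C c (\<kappa> / 2)" by (rule z1)
      show "- u r \<le> A'" if "0 \<le> r" for r using A[OF that] by simp
      show "- F (- s) \<le> C" for s by (rule C)
    qed (use Suc.prems False b' bm_neg Q' in \<open>auto simp: refl_en Qr\<close>)
    then show ?thesis by (auto simp: refl_en)
  qed
  then obtain y where y: "z < y" "u y = 0" "w y \<noteq> 0" "c / 2 \<le> en u w y" "\<kappa> / 2 \<le> y ^ N * en u w y" by blast
  have "\<exists>S\<subseteq>crossings u w. finite S \<and> card S = j + 1 \<and> (\<forall>x\<in>S. y \<le> x)"
    by (rule Suc.IH[of "c / 2" "\<kappa> / 2"]) (use Suc.prems y in \<open>auto intro: order_trans[of _ c] simp: mult.commute\<close>)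
  then obtain S where S: "S \<subseteq> crossings u w" "finite S" "card S = j + 1" "\<And>x. x \<in> S \<Longrightarrow> y \<le> x" by blast
  have "z \<notin> S" using S(4) y(1) by force
  then show ?case using S y Suc.prems by (intro exI[of _ "insert z S"]) (force simp: crossings_def)
qed

lemma reach_level:
  assumes s: "sol u w" and b: "bp < b" "b < u 0"
  shows "\<exists>r0>0. u r0 = b \<and> (\<forall>x. 0 \<le> x \<and> x < r0 \<longrightarrow> b < u x) \<and> (\<forall>x. 0 < x \<and> x \<le> r0 \<longrightarrow> w x < 0) \<and> F b \<le> en u w r0"
proof -
  have Fb: "0 < F b" by (rule F_pos[OF b(1)])
  have "\<exists>x\<ge>0. u x \<le> b"
  proof (rule ccontr)
    assume neg: "\<not> ?thesis"
    show False
    proof (rule must_vanish[OF s order_refl Fb])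
      fix r :: real assume "0 \<le> r"
      then have "b < u r" using neg by force
      then show "F b \<le> en u w r" using F_le_en[of u r w] F_strict_mono[of b "u r"] b by simp
      show "0 \<le> u r" using \<open>b < u r\<close> b bp_pos by simp
    qed
  qed
  then obtain x where x: "0 \<le> x" "u x \<le> b" by blast
  obtain r0 where r0: "0 < r0" "r0 \<le> x" "u r0 = b" "\<And>t. 0 \<le> t \<Longrightarrow> t < r0 \<Longrightarrow> b < u t"
    using first_down[OF sol_cont(1)[OF s order_refl] x(1), of b] x b by auto
  have e: "F b \<le> en u w r0" using F_le_en[of u r0 w] r0 by simp
  have "w t < 0" if t: "0 < t" "t \<le> r0" for t
  proof (rule descent[OF s order_refl t(1)])
    show "0 < en u w t" using en_antimono[OF s, of t r0] t e Fb by simp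
    show "w 0 \<le> 0" using sol_cont0[OF s] by simp
    show "0 \<le> u y" if "0 \<le> y" "y \<le> t" for y using r0(3) r0(4)[of y] that t b bp_pos by (cases "y = r0") auto
  qed
  then show ?thesis using r0 e by blast
qed

text \<open>While \<open>u\<close> falls from \<open>A\<close> to \<open>\<theta> A\<close>, the bound \<open>|w| \<le> fm * r\<close> limits its speed; therefore the
  radius \<open>rt\<close> at the end satisfies \<open>rt powr m \<ge> ((1 - \<theta>) A) powr (m - 1) / fm\<close>. The Pohozaev
  quantity has increased by at least \<open>q / N * rt ^ N\<close> by then, and it does not decrease until \<open>u\<close>
  reaches \<open>b\<close>, where its mixed term is negative.\<close>

lemma start_infinite:
  assumes s: "sol u w" "u 0 = A" and b: "bp < b" "b \<le> \<theta> * A" and \<theta>: "0 < \<theta>" "\<theta> < 1"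
    and fm: "\<And>s. \<theta> * A \<le> s \<Longrightarrow> s \<le> A \<Longrightarrow> f s \<le> fm" "0 < fm"
    and Q: "\<And>s. \<theta> * A \<le> s \<Longrightarrow> s \<le> A \<Longrightarrow> q \<le> Q s" "0 \<le> q" "\<And>s. b \<le> s \<Longrightarrow> s \<le> A \<Longrightarrow> 0 \<le> Q s"
  shows "\<exists>r0>0. u r0 = b \<and> F b \<le> en u w r0 \<and> q * (((1 - \<theta>) * A) powr (m - 1) / fm) powr (real N / m) \<le> real N * m * (r0 ^ N * en u w r0)"
proof -
  have N0: "N > 0" using N2 by simp
  have tA: "0 < \<theta> * A" using b bp_pos by simp
  then have A0: "0 < A" using \<theta> by (simp add: zero_less_mult_iff)
  have tAA: "\<theta> * A < A" using \<theta> A0 by simp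
  obtain r0 where r0: "0 < r0" "u r0 = b" "\<And>x. 0 \<le> x \<Longrightarrow> x < r0 \<Longrightarrow> b < u x" "\<And>x. 0 < x \<Longrightarrow> x \<le> r0 \<Longrightarrow> w x < 0" "F b \<le> en u w r0"
    using reach_level[OF s(1) b(1)] b tAA s(2) by auto
  have uA: "u x \<le> A" if "0 \<le> x" "x \<le> r0" for x
    using u_dec_le[OF s(1) order_refl that(1)] r0(4) that s(2) by (simp add: less_imp_le)
  obtain rt where rt: "0 < rt" "rt \<le> r0" "u rt = \<theta> * A" "\<And>x. 0 \<le> x \<Longrightarrow> x < rt \<Longrightarrow> \<theta> * A < u x"
    using first_down[OF sol_cont(1)[OF s(1) order_refl, of r0] less_imp_le[OF r0(1)], of "\<theta> * A"] s(2) tAA r0(2) b by auto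
  have ut: "\<theta> * A \<le> u x" if "0 \<le> x" "x \<le> rt" for x using rt(3) rt(4)[of x] that by (cases "x = rt") auto
  have wl: "- w x \<le> fm * rt" if x: "0 < x" "x < rt" for x
  proof -
    have "- w x \<le> fm * (x - 0)"
    proof (rule w_linear(2)[OF s(1) order_refl _ _ _ order_refl])
      fix t assume t: "0 \<le> t" "t \<le> x"
      then have "\<theta> * A < u t" using rt(4)[of t] x by simp
      then have "bp < u t" "\<theta> * A \<le> u t" using b by linarith+
      then show "0 \<le> f (u t) \<and> f (u t) \<le> fm" using fm(1)[of "u t"] f_pos[of "u t"] uA[of t] t x rt b by simp
    qed (use x sol_cont0[OF s(1)] in auto)
    also have "\<dots> \<le> fm * rt" using x fm by (intro mult_left_mono) auto
    finally show ?thesis .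
  qed
  have "\<bar>u rt - u 0\<bar> \<le> psi m (fm * rt) * (rt - 0)"
  proof (rule deriv_bound_imp_le[where g' = "\<lambda>x. psi m (w x)"])
    fix x assume x: "0 < x" "x < rt"
    show "(u has_real_derivative psi m (w x)) (at x)" by (rule sol_du[OF s(1) x(1)])
    have "\<bar>w x\<bar> \<le> fm * rt" using wl[OF x] r0(4)[of x] x rt by simp
    then show "\<bar>psi m (w x)\<bar> \<le> psi m (fm * rt)" unfolding abs_psi by (intro psi_mono m1)
  qed (use rt sol_cont[OF s(1)] in auto)
  then have "(1 - \<theta>) * A \<le> psi m (fm * rt) * rt" using rt(3) s(2) tAA by (simp add: algebra_simps)
  also have "\<dots> = (fm * rt) powr (1 / (m - 1)) * rt" using fm rt by (simp add: psi_of_pos)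
  finally have "((1 - \<theta>) * A) powr (m - 1) \<le> ((fm * rt) powr (1 / (m - 1)) * rt) powr (m - 1)"
    using \<theta> A0 m1 by (intro powr_mono2) auto
  also have "\<dots> = fm * rt * rt powr (m - 1)" using fm rt m1 by (simp add: powr_mult powr_powr)
  also have "\<dots> = fm * (rt powr 1 * rt powr (m - 1))" using rt by simp
  also have "rt powr 1 * rt powr (m - 1) = rt powr m" unfolding powr_add[symmetric] by simp
  finally have "((1 - \<theta>) * A) powr (m - 1) / fm \<le> rt powr m" using fm by (simp add: pos_divide_le_eq mult.commute)
  then have "(((1 - \<theta>) * A) powr (m - 1) / fm) powr (real N / m) \<le> (rt powr m) powr (real N / m)"
    using fm m1 by (intro powr_mono2) auto
  also have "\<dots> = rt ^ N" using rt m1 by (simp add: powr_powr powr_realpow)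
  finally have 1: "(((1 - \<theta>) * A) powr (m - 1) / fm) powr (real N / m) \<le> rt ^ N" .
  have "q / real N * (rt ^ N - 0 ^ N) \<le> pohozaev u w rt - pohozaev u w 0"
  proof (rule pohozaev_growth[OF s(1) order_refl less_imp_le[OF rt(1)]])
    fix x assume "0 < x" "x < rt"
    then show "q \<le> Q (u x)" using ut[of x] uA[of x] rt by (intro Q) auto
  qed
  moreover have "pohozaev u w 0 = 0" using N0 N2 by (simp add: pohozaev_def power_0_left sol_cont0[OF s(1)])
  ultimately have 2: "q / real N * rt ^ N \<le> pohozaev u w rt" using N0 by (simp add: power_0_left)
  have "0 / real N * (r0 ^ N - rt ^ N) \<le> pohozaev u w r0 - pohozaev u w rt"
  proof (rule pohozaev_growth[OF s(1) less_imp_le[OF rt(1)] rt(2)])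
    fix x assume "rt < x" "x < r0"
    then show "0 \<le> Q (u x)" using r0(3)[of x] uA[of x] rt by (intro Q) auto
  qed
  then have 3: "pohozaev u w rt \<le> pohozaev u w r0" by simp
  have "r0 ^ (N - 1) * w r0 * u r0 \<le> 0"
    using r0(1,2) r0(4)[of r0] b bp_pos by (intro mult_nonpos_nonneg mult_nonneg_nonpos) auto
  from mult_nonneg_nonpos[OF _ this, of "real N - m"] have "(real N - m) * (r0 ^ (N - 1) * w r0 * u r0) \<le> 0" using mN by simp
  then have "pohozaev u w r0 \<le> m * (r0 ^ N * en u w r0)" unfolding pohozaev_def by simp
  then have "q / real N * rt ^ N \<le> m * (r0 ^ N * en u w r0)" using 2 3 by simp
  then have "q * rt ^ N \<le> real N * m * (r0 ^ N * en u w r0)" using N0 by (simp add: field_simps)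
  moreover have "q * (((1 - \<theta>) * A) powr (m - 1) / fm) powr (real N / m) \<le> q * rt ^ N" using 1 Q(2) by (intro mult_left_mono) auto
  ultimately have "q * (((1 - \<theta>) * A) powr (m - 1) / fm) powr (real N / m) \<le> real N * m * (r0 ^ N * en u w r0)" by simp
  then show ?thesis using r0 by blast
qed

text \<open>Before the radius \<open>R\<close>, \<open>|u'|\<close> is at most \<open>(L0 R) powr (1 / (m - 1))\<close> times the distance \<open>g - u\<close>.
  By Gronwall's inequality this distance grows at most exponentially, so \<open>u\<close> is still above \<open>b\<close>
  at \<open>R\<close> if it starts close to \<open>g\<close>.\<close>

lemma start_finite:
  assumes s: "sol u w" "u 0 = A" and b: "bp < b" "b < A" and g: "A < g" and L0: "0 < L0" and R: "0 < R"
    and fL: "\<And>s. b \<le> s \<Longrightarrow> s \<le> A \<Longrightarrow> f s \<le> L0 * (g - s) powr (m - 1)"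
    and cl: "(g - A) * exp ((L0 * R) powr (1 / (m - 1)) * R) < g - b"
  shows "\<exists>r0>R. u r0 = b \<and> F b \<le> en u w r0"
proof -
  obtain r0 where r0: "0 < r0" "u r0 = b" "\<And>x. 0 \<le> x \<Longrightarrow> x < r0 \<Longrightarrow> b < u x" "\<And>x. 0 < x \<Longrightarrow> x \<le> r0 \<Longrightarrow> w x < 0" "F b \<le> en u w r0"
    using reach_level[OF s(1) b(1)] b s(2) by auto
  have "R < r0"
  proof (rule ccontr)
    assume "\<not> R < r0"
    then have r0R: "r0 \<le> R" by simp
    define K where "K = (L0 * R) powr (1 / (m - 1))"
    have K0: "0 \<le> K" by (simp add: K_def)
    have mono: "u y \<le> u x" if "0 \<le> x" "x \<le> y" "y \<le> r0" for x y
      by (rule u_dec_le[OF s(1) that(1,2)]) (use r0(4) that in \<open>auto intro!: less_imp_le\<close>)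
    have up: "b \<le> u x" "u x \<le> A" if "0 \<le> x" "x \<le> r0" for x using mono[of x r0] mono[of 0 x] that r0 s by auto
    have pw: "psi m (- w x) \<le> K * (g - u x)" if x: "0 < x" "x < r0" for x
    proof -
      have gx: "0 < g - u x" using up(2)[of x] x g by simp
      have "- w x \<le> L0 * (g - u x) powr (m - 1) * (x - 0)"
      proof (rule w_linear(2)[OF s(1) order_refl _ _ _ order_refl])
        fix t assume t: "0 \<le> t" "t \<le> x"
        have "f (u t) \<le> L0 * (g - u t) powr (m - 1)" using up[of t] t x by (intro fL) auto
        also have "\<dots> \<le> L0 * (g - u x) powr (m - 1)"
          using mono[of t x] t x L0 up(2)[of t] g m1 by (intro mult_left_mono powr_mono2) auto
        finally show "0 \<le> f (u t) \<and> f (u t) \<le> L0 * (g - u x) powr (m - 1)" using f_pos[of "u t"] up(1)[of t] t x b by simp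
      qed (use x sol_cont0[OF s(1)] in auto)
      also have "\<dots> \<le> L0 * (g - u x) powr (m - 1) * R" using x r0R L0 by (intro mult_left_mono) auto
      finally have "psi m (- w x) \<le> psi m (L0 * (g - u x) powr (m - 1) * R)" by (intro psi_mono m1)
      also have "\<dots> = (L0 * R * (g - u x) powr (m - 1)) powr (1 / (m - 1))" using L0 R by (simp add: psi_of_pos mult_ac)
      also have "\<dots> = K * (g - u x)" using L0 R gx m1 by (simp add: powr_mult powr_powr K_def)
      finally show ?thesis .
    qed
    have "(g - u r0) * exp (- K * r0) - (g - u 0) * exp (- K * 0) \<le> 0 - 0"
    proof (rule deriv_le_imp_le[where g = "\<lambda>x. (g - u x) * exp (- K * x)" and h = "\<lambda>_. 0" and h' = "\<lambda>_. 0"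
        and g' = "\<lambda>x. (psi m (- w x) - K * (g - u x)) * exp (- K * x)"])
      show "continuous_on {0..r0} (\<lambda>x. (g - u x) * exp (- K * x))" by (intro continuous_intros sol_cont[OF s(1)]) simp
      fix x assume x: "0 < x" "x < r0"
      show "((\<lambda>x. (g - u x) * exp (- K * x)) has_real_derivative (psi m (- w x) - K * (g - u x)) * exp (- K * x)) (at x)"
        using sol_du[OF s(1) x(1)] by (auto intro!: derivative_eq_intros simp: algebra_simps)
      show "(psi m (- w x) - K * (g - u x)) * exp (- K * x) \<le> 0" using pw[OF x] by (simp add: mult_nonpos_nonneg)
    qed (use r0 in auto)
    then have "(g - b) * exp (- K * r0) \<le> g - A" using r0 s by simp
    then have "(g - b) * exp (- K * r0) * exp (K * r0) \<le> (g - A) * exp (K * r0)" by (intro mult_right_mono) auto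
    then have "g - b \<le> (g - A) * exp (K * r0)" by (simp add: mult.assoc exp_add[symmetric])
    also have "\<dots> \<le> (g - A) * exp (K * R)" using r0R K0 g by (intro mult_left_mono) (auto intro: mult_left_mono)
    finally show False using cl by (simp add: K_def)
  qed
  then show ?thesis using r0 by blast
qed

end
section \<open>From the truncated system to the original equation\<close>

lemma primitive_deriv:
  assumes "continuous_on UNIV f" shows "(primitive f has_real_derivative f s) (at s)"
proof -
  define a where "a = - \<bar>s\<bar> - 1"
  define b where "b = \<bar>s\<bar> + 1"
  have ab: "a \<le> 0" "0 \<le> b" "a < s" "s < b" by (auto simp: a_def b_def)
  have "((\<lambda>u. LBINT y=(0::real)..u. f y) has_vector_derivative f s) (at s within {a..b})"
    by (rule interval_integral_FTC2) (use ab assms in \<open>auto elim: continuous_on_subset\<close>)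
  then have "(primitive f has_vector_derivative f s) (at s within {a..b})"
    unfolding primitive_def[abs_def] by simp
  then show ?thesis
    using ab by (simp add: at_within_Icc_at has_real_derivative_iff_has_vector_derivative)
qed

lemma primitive_0 [simp]: "primitive f 0 = 0"
  by (simp add: primitive_def)

lemma primitive_cong_on:
  assumes f: "continuous_on UNIV f" "continuous_on UNIV g" and 0: "B \<le> 0" "0 \<le> A"
    and e: "\<And>s. B \<le> s \<Longrightarrow> s \<le> A \<Longrightarrow> f s = g s" and s: "B \<le> s" "s \<le> A"
  shows "primitive f s = primitive g s"
proof -
  have c: "continuous_on S (\<lambda>s. primitive f s - primitive g s)" for S
    by (intro continuous_at_imp_continuous_on ballI continuous_intros DERIV_isCont[OF primitive_deriv] f)
  have d: "((\<lambda>s. primitive f s - primitive g s) has_real_derivative f x - g x) (at x)" for x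
    by (intro DERIV_diff primitive_deriv f)
  have "\<bar>(primitive f y - primitive g y) - (primitive f x - primitive g x)\<bar> \<le> 0 * (y - x)"
    if "x \<le> y" "B \<le> x" "y \<le> A" for x y
    by (rule deriv_bound_imp_le[OF that(1) c d]) (use e that in auto)
  from this[of 0 s] this[of s 0] show ?thesis using s 0 by (cases "0 \<le> s") auto
qed

definition clamp :: "real \<Rightarrow> real \<Rightarrow> real \<Rightarrow> real" where "clamp B A s = max B (min A s)"

lemma clamp_id: "B \<le> s \<Longrightarrow> s \<le> A \<Longrightarrow> clamp B A s = s" by (simp add: clamp_def)
lemma clamp_range: "B \<le> A \<Longrightarrow> B \<le> clamp B A s \<and> clamp B A s \<le> A" by (auto simp: clamp_def)
lemma clamp_lip: "\<bar>clamp B A x - clamp B A y\<bar> \<le> \<bar>x - y\<bar>" by (auto simp: clamp_def min_def max_def)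

lemma deriv_at_zero:
  fixes u g :: "real \<Rightarrow> real"
  assumes u: "continuous_on {0..} u" and g: "continuous_on {0..} g"
    and d: "\<And>r. 0 < r \<Longrightarrow> (u has_real_derivative g r) (at r)"
  shows "(u has_real_derivative g 0) (at 0 within {0..})"
proof -
  have i: "u r = u 0 + integral {0..r} g" if "0 \<le> r" for r
  proof -
    have "(g has_integral (u r - u 0)) {0..r}"
      by (rule fundamental_theorem_of_calculus_interior[OF that])
        (use u d in \<open>auto elim: continuous_on_subset simp: has_real_derivative_iff_has_vector_derivative\<close>)
    then show ?thesis by (simp add: integral_unique)
  qed
  have "((\<lambda>x. integral {0..x} g) has_real_derivative g 0) (at 0 within {0..1})"
    by (rule integral_has_real_derivative) (use g in \<open>auto elim: continuous_on_subset\<close>)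
  then have "((\<lambda>x. u 0 + integral {0..x} g) has_real_derivative g 0) (at 0 within {0..1})"
    by (auto intro!: derivative_eq_intros)
  then have "(u has_real_derivative g 0) (at 0 within {0..1})"
    by (rule has_field_derivative_transform_within[OF _ zero_less_one]) (auto intro!: i[symmetric])
  moreover have "at (0::real) within {0..1} = at 0 within {0..}"
    by (rule at_within_nhd[of _ "{..<1}"]) auto
  ultimately show ?thesis by simp
qed

context radial begin

text \<open>At \<open>r = 0\<close> the derivatives extend continuously, because \<open>w r / r\<close> tends to \<open>- f (u 0) / N\<close>.\<close>

lemma sol_C1:
  assumes s: "sol u w"
  shows "C1_halfline u (\<lambda>r. psi m (w r))"
    and "\<exists>w'. C1_halfline w w' \<and> (\<forall>r>0. w' r + (real N - 1) / r * w r + f (u r) = 0)"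
proof -
  have cu: "continuous_on {0..} u" "continuous_on {0..} w" using sol_cont0[OF s] by auto
  have C: "C1_halfline v g" if "continuous_on {0..} v" "continuous_on {0..} g"
    "\<And>r. 0 < r \<Longrightarrow> (v has_real_derivative g r) (at r)" for v g
    unfolding C1_halfline_def
  proof (intro conjI allI impI that(2))
    fix r :: real assume "0 \<le> r"
    then show "(v has_real_derivative g r) (at r within {0..})"
      using deriv_at_zero[OF that] that(3)[of r] has_field_derivative_at_within by (cases "r = 0") auto
  qed
  have "continuous_on {0..} (\<lambda>r. psi m (w r))" by (rule continuous_on_compose2[OF psi_cont_on[OF m1] cu(2)]) auto
  then show "C1_halfline u (\<lambda>r. psi m (w r))" by (intro C cu(1) sol_du[OF s])
  have N0: "0 < real N" "N > 0" using N2 by auto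
  define w' where "w' r = (if r = 0 then - f (u 0) / real N else - ((real N - 1) / r * w r) - f (u r))" for r
  have cfu: "continuous_on {0..} (\<lambda>r. f (u r))" by (rule continuous_on_compose2[OF f_cont cu(1)]) auto
  have wl: "((\<lambda>r. w r / r) \<longlongrightarrow> - f (u 0) / real N) (at 0 within {0..})"
  proof (rule tendstoI)
    fix e :: real assume e: "0 < e"
    obtain d where d: "d > 0" "\<And>r. 0 \<le> r \<Longrightarrow> r \<le> 0 + d \<Longrightarrow> \<bar>f (u r) - f (u 0)\<bar> < e / 2"
      using near_right[OF cfu order_refl half_gt_zero[OF e]] by blast
    have "\<bar>w r / r - - f (u 0) / real N\<bar> \<le> e / 2" if r: "0 < r" "r \<le> d" for r
    proof -
      have "\<bar>(r ^ (N - 1) * w r + f (u 0) / real N * r ^ N) - (0 ^ (N - 1) * w 0 + f (u 0) / real N * 0 ^ N)\<bar> \<le> (r ^ (N - 1) * (e / 2)) * (r - 0)"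
      proof (rule deriv_bound_imp_le[where g = "\<lambda>r. r ^ (N - 1) * w r + f (u 0) / real N * r ^ N" and g' = "\<lambda>x. - (x ^ (N - 1) * f (u x)) + f (u 0) * x ^ (N - 1)"])
        show "continuous_on {0..r} (\<lambda>r. r ^ (N - 1) * w r + f (u 0) / real N * r ^ N)"
          by (intro continuous_intros sol_cont[OF s]) simp
        fix x assume x: "0 < x" "x < r"
        show "((\<lambda>r. r ^ (N - 1) * w r + f (u 0) / real N * r ^ N) has_real_derivative - (x ^ (N - 1) * f (u x)) + f (u 0) * x ^ (N - 1)) (at x)"
          by (rule DERIV_add[OF sol_dz[OF s x(1)]]) (use N0 in \<open>auto intro!: derivative_eq_intros\<close>)
        have "- (x ^ (N - 1) * f (u x)) + f (u 0) * x ^ (N - 1) = x ^ (N - 1) * (f (u 0) - f (u x))" by (simp add: algebra_simps)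
        then have "\<bar>- (x ^ (N - 1) * f (u x)) + f (u 0) * x ^ (N - 1)\<bar> = x ^ (N - 1) * \<bar>f (u x) - f (u 0)\<bar>"
          using x by (simp add: abs_mult abs_minus_commute)
        also have "\<dots> \<le> r ^ (N - 1) * (e / 2)" using x r d(2)[of x] by (intro mult_mono power_mono) auto
        finally show "\<bar>- (x ^ (N - 1) * f (u x)) + f (u 0) * x ^ (N - 1)\<bar> \<le> r ^ (N - 1) * (e / 2)" .
      qed (use r in simp)
      then have 1: "\<bar>r ^ (N - 1) * w r + f (u 0) / real N * r ^ N\<bar> \<le> r ^ (N - 1) * (e / 2) * r"
        using N0 N2 by (simp add: power_0_left sol_cont0[OF s])
      have rN: "r ^ N = r * r ^ (N - 1)" using N0 by (metis power_eq_if neq0_conv)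
      have "r ^ (N - 1) * w r + f (u 0) / real N * r ^ N = (r * r ^ (N - 1)) * (w r / r - - f (u 0) / real N)"
        unfolding rN using r by (simp add: field_simps)
      then have "(r * r ^ (N - 1)) * \<bar>w r / r - - f (u 0) / real N\<bar> \<le> (r * r ^ (N - 1)) * (e / 2)"
        using 1 r by (simp add: abs_mult mult_ac)
      then show ?thesis using r by simp
    qed
    then show "\<forall>\<^sub>F r in at 0 within {0..}. dist (w r / r) (- f (u 0) / real N) < e"
      unfolding eventually_at
    proof (intro exI[of _ d] conjI ballI impI d(1))
      fix x :: real assume "x \<in> {0..}" "x \<noteq> 0 \<and> dist x 0 < d"
      then have "0 < x" "x \<le> d" by (auto simp: dist_real_def)
      with \<open>\<And>r. 0 < r \<Longrightarrow> r \<le> d \<Longrightarrow> \<bar>w r / r - - f (u 0) / real N\<bar> \<le> e / 2\<close>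
      have "\<bar>w x / x - - f (u 0) / real N\<bar> \<le> e / 2" by blast
      then show "dist (w x / x) (- f (u 0) / real N) < e" unfolding dist_real_def using e by linarith
    qed
  qed
  have "continuous_on {0..} w'"
    unfolding continuous_on_eq_continuous_within
  proof
    fix x :: real assume "x \<in> {0..}"
    then consider "x = 0" | "0 < x" by force
    then show "continuous (at x within {0..}) w'"
    proof cases
      case 1
      have "((\<lambda>r. f (u r)) \<longlongrightarrow> f (u 0)) (at 0 within {0..})" using cfu by (auto simp: continuous_on_def)
      then have "((\<lambda>r. - ((real N - 1) * (w r / r)) - f (u r)) \<longlongrightarrow> - ((real N - 1) * (- f (u 0) / real N)) - f (u 0)) (at 0 within {0..})"
        by (intro tendsto_intros wl)
      moreover have "- ((real N - 1) * (- f (u 0) / real N)) - f (u 0) = w' 0" using N0 by (simp add: w'_def field_simps)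
      moreover have "\<forall>\<^sub>F r in at 0 within {0..}. - ((real N - 1) * (w r / r)) - f (u r) = w' r"
        by (simp add: eventually_at_filter w'_def)
      ultimately have "(w' \<longlongrightarrow> w' 0) (at 0 within {0..})" using Lim_transform_eventually by force
      then show ?thesis using 1 by (simp add: continuous_within)
    next
      case 2
      have "isCont w x" "isCont u x" using DERIV_isCont sol_du[OF s 2] sol_dw[OF s 2] by blast+
      moreover have "isCont f (u x)" using f_cont by (simp add: continuous_on_eq_continuous_at)
      ultimately have "isCont (\<lambda>r. - ((real N - 1) / r * w r) - f (u r)) x"
        using 2 isCont_o2[of x u f] by (intro continuous_intros) auto
      moreover have "\<forall>\<^sub>F r in nhds x. w' r = - ((real N - 1) / r * w r) - f (u r)"
      proof -
        have "\<forall>\<^sub>F r in nhds x. r \<in> {0<..}" using 2 by (intro eventually_nhds_in_open) auto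
        then show ?thesis by (rule eventually_mono) (simp add: w'_def)
      qed
      ultimately have "isCont w' x" using isCont_cong by metis
      then show ?thesis by (rule continuous_at_imp_continuous_at_within)
    qed
  qed
  then have "C1_halfline w w'" by (intro C cu(2)) (use sol_dw[OF s] in \<open>auto simp: w'_def\<close>)
  moreover have "\<forall>r>0. w' r + (real N - 1) / r * w r + f (u r) = 0" by (auto simp: w'_def)
  ultimately show "\<exists>w'. C1_halfline w w' \<and> (\<forall>r>0. w' r + (real N - 1) / r * w r + f (u r) = 0)" by blast
qed

end

context shooting begin

text \<open>The potential energy never exceeds the initial energy \<open>F (u 0) \<le> F A\<close>.\<close>

lemma range_bound:
  assumes s: "sol u w" and A: "bp < A" "B < bm" "F B = F A" and u0: "bp \<le> u 0" "u 0 \<le> A" and r: "0 \<le> r"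
  shows "B \<le> u r \<and> u r \<le> A"
proof -
  have "F (u 0) \<le> F A" using F_strict_mono[of "u 0" A] u0 by (cases "u 0 = A") auto
  then have le: "F (u r) \<le> F A" using F_le_en[of u r w] en_antimono[OF s order_refl r] en_0[OF s] by simp
  have "u r \<le> A" using le F_strict_mono[of A "u r"] A by (meson less_imp_le not_le)
  moreover have "B \<le> u r" using le F_strict_anti[of "u r" B] A by (metis less_imp_le not_le)
  ultimately show ?thesis by simp
qed

end

lemma bound_state_of_sol:
  assumes sh: "shooting m N g G Mf bm bp" and s: "radial.sol m N g u w" and e: "\<And>r. 0 \<le> r \<Longrightarrow> g (u r) = f (u r)"
    and u0: "bp \<le> u 0" and l: "(u \<longlongrightarrow> 0) at_top"
  shows "bound_state m N f u (\<lambda>r. psi m (w r))"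
proof -
  interpret shooting m N g G Mf bm bp by (rule sh)
  have p: "(\<lambda>r. phi m (psi m (w r))) = w" using phi_psi[OF m1] by simp
  obtain w' where w': "C1_halfline w w'" "\<And>r. 0 < r \<Longrightarrow> w' r + (real N - 1) / r * w r + g (u r) = 0"
    using sol_C1(2)[OF s] by blast
  have "radial_solution m N f u (\<lambda>r. psi m (w r))"
    unfolding radial_solution_def p phi_psi[OF m1] using sol_C1(1)[OF s] w' e by (auto intro!: exI[of _ w'])
  moreover have "\<not> (\<exists>c. \<forall>r\<ge>0. u r = c)"
  proof
    assume "\<exists>c. \<forall>r\<ge>0. u r = c"
    then have c: "\<And>r. 0 \<le> r \<Longrightarrow> u r = u 0" by (metis order_refl)
    have "\<forall>\<^sub>F r in at_top. u r = u 0" unfolding eventually_at_top_linorder using c by blast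
    then have "(u \<longlongrightarrow> u 0) at_top" by (rule tendsto_eventually)
    then have "u 0 = 0" using l by (intro tendsto_unique[OF _ _ l]) auto
    then show False using u0 bp_pos by simp
  qed
  ultimately show ?thesis unfolding bound_state_def using l sol_cont0(3)[OF s] by simp
qed

text \<open>Outside \<open>[B, A]\<close> the frozen \<open>f\<close> is a constant different from \<open>0\<close>, so that its primitive grows
  linearly there and is coercive.\<close>

lemma truncation_shooting:
  assumes m: "1 < m" "m \<le> real N" and f: "continuous_on UNIV f"
    and sg: "bm < 0" "0 < bp" and Fneg: "\<And>s. bm < s \<Longrightarrow> s < bp \<Longrightarrow> s \<noteq> 0 \<Longrightarrow> primitive f s < 0"
    and Fz: "primitive f bm = 0" "primitive f bp = 0"
    and AB: "bp < A" "B < bm" "\<And>s. bp < s \<Longrightarrow> s \<le> A \<Longrightarrow> 0 < f s" "\<And>s. B \<le> s \<Longrightarrow> s < bm \<Longrightarrow> f s < 0"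
    and lip: "\<And>s. B \<le> s \<Longrightarrow> s \<le> A \<Longrightarrow> s \<noteq> 0 \<Longrightarrow> \<exists>e>0. \<exists>\<Lambda>. \<forall>x y. B \<le> x \<and> x \<le> A \<and> B \<le> y \<and> y \<le> A \<and> \<bar>x - s\<bar> < e \<and> \<bar>y - s\<bar> < e \<longrightarrow> \<bar>f x - f y\<bar> \<le> \<Lambda> * \<bar>x - y\<bar>"
  shows "\<exists>Mf. shooting m N (\<lambda>s. f (clamp B A s)) (primitive (\<lambda>s. f (clamp B A s))) Mf bm bp"
proof -
  let ?f = "\<lambda>s. f (clamp B A s)"
  have cc: "continuous_on UNIV (clamp B A)" unfolding clamp_def[abs_def] by (intro continuous_intros)
  have cf: "continuous_on UNIV ?f" by (rule continuous_on_compose2[OF f cc]) auto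
  have BA: "B \<le> A" using AB sg by simp
  have eq: "primitive ?f s = primitive f s" if "B \<le> s" "s \<le> A" for s
    by (rule primitive_cong_on[OF cf f _ _ _ that]) (use AB sg in \<open>auto simp: clamp_id\<close>)
  have "compact (f ` {B..A})" by (intro compact_continuous_image continuous_on_subset[OF f]) auto
  then obtain M where M: "\<And>y. y \<in> f ` {B..A} \<Longrightarrow> norm y \<le> M" using compact_imp_bounded bounded_iff by metis
  have fp: "0 < ?f s" if "bp < s" for s using AB that sg by (auto simp: clamp_def min_def max_def intro!: AB(3))
  have fn: "?f s < 0" if "s < bm" for s using AB that sg by (auto simp: clamp_def min_def max_def intro!: AB(4))
  have "shooting m N ?f (primitive ?f) M bm bp"
  proof
    show "1 < m" "m \<le> real N" "continuous_on UNIV ?f" "bm < 0" "0 < bp" by fact+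
    show "\<bar>?f s\<bar> \<le> M" for s using M[of "?f s"] clamp_range[OF BA, of s] by auto
    show "(primitive ?f has_real_derivative ?f s) (at s)" for s by (rule primitive_deriv[OF cf])
    show "primitive ?f 0 = 0" by simp
    show "primitive ?f bm = 0" "primitive ?f bp = 0" using eq[of bm] eq[of bp] Fz AB sg by auto
    show "primitive ?f s < 0" if "bm < s" "s < bp" "s \<noteq> 0" for s using Fneg[OF that] eq[of s] that AB by simp
    show "0 < ?f s" if "bp < s" for s by (rule fp[OF that])
    show "?f s < 0" if "s < bm" for s by (rule fn[OF that])
    show "\<exists>e>0. \<exists>\<Lambda>. \<forall>x y. \<bar>x - s\<bar> < e \<longrightarrow> \<bar>y - s\<bar> < e \<longrightarrow> \<bar>?f x - ?f y\<bar> \<le> \<Lambda> * \<bar>x - y\<bar>" if s: "s < bm \<or> bp < s" for s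
    proof -
      let ?s = "clamp B A s"
      have "?s \<noteq> 0" using s AB sg by (auto simp: clamp_def min_def max_def)
      then obtain e \<Lambda> where e: "e > 0" "\<And>x y. B \<le> x \<Longrightarrow> x \<le> A \<Longrightarrow> B \<le> y \<Longrightarrow> y \<le> A \<Longrightarrow> \<bar>x - ?s\<bar> < e \<Longrightarrow> \<bar>y - ?s\<bar> < e \<Longrightarrow> \<bar>f x - f y\<bar> \<le> \<Lambda> * \<bar>x - y\<bar>"
        using lip[of ?s] clamp_range[OF BA, of s] by blast
      have "\<bar>?f x - ?f y\<bar> \<le> \<bar>\<Lambda>\<bar> * \<bar>x - y\<bar>" if "\<bar>x - s\<bar> < e" "\<bar>y - s\<bar> < e" for x y
      proof -
        have "\<bar>?f x - ?f y\<bar> \<le> \<Lambda> * \<bar>clamp B A x - clamp B A y\<bar>"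
          by (rule e(2)) (use clamp_range[OF BA] clamp_lip[of B A x s] clamp_lip[of B A y s] that in auto)
        also have "\<dots> \<le> \<bar>\<Lambda>\<bar> * \<bar>x - y\<bar>" using clamp_lip[of B A x y] by (intro mult_mono) auto
        finally show ?thesis .
      qed
      then show ?thesis using e(1) by blast
    qed
    show "\<exists>x>bp. c < primitive ?f x" for c
    proof -
      have fA: "0 < f A" using AB by simp
      define x where "x = A + (\<bar>c - primitive ?f A\<bar> + 1) / f A"
      have x: "A < x" using fA by (auto simp: x_def intro!: divide_pos_pos add_nonneg_pos)
      have "f A * x - f A * A \<le> primitive ?f x - primitive ?f A"
      proof (rule deriv_le_imp_le[where g = "\<lambda>x. f A * x" and h = "primitive ?f" and g' = "\<lambda>_. f A" and h' = ?f])
        show "continuous_on {A..x} (primitive ?f)"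
          by (intro continuous_at_imp_continuous_on ballI DERIV_isCont[OF primitive_deriv[OF cf]])
        show "(primitive ?f has_real_derivative ?f y) (at y)" for y by (rule primitive_deriv[OF cf])
        show "f A \<le> ?f y" if "A < y" for y using that BA by (simp add: clamp_def)
        show "((\<lambda>x. f A * x) has_real_derivative f A) (at y)" for y using DERIV_cmult[OF DERIV_ident, of "f A"] by simp
      qed (use x in \<open>auto intro!: continuous_intros\<close>)
      moreover have "f A * x - f A * A = \<bar>c - primitive ?f A\<bar> + 1" using fA by (simp add: x_def field_simps)
      ultimately show ?thesis using x AB by (intro exI[of _ x]) auto
    qed
    show "\<exists>x<bm. c < primitive ?f x" for c
    proof -
      have fB: "f B < 0" using AB by simp
      define x where "x = B + (\<bar>c - primitive ?f B\<bar> + 1) / f B"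
      have x: "x < B" using fB by (auto simp: x_def intro!: divide_pos_neg add_nonneg_pos)
      have "primitive ?f B - primitive ?f x \<le> f B * B - f B * x"
      proof (rule deriv_le_imp_le[where h = "\<lambda>x. f B * x" and g = "primitive ?f" and h' = "\<lambda>_. f B" and g' = ?f])
        show "continuous_on {x..B} (primitive ?f)"
          by (intro continuous_at_imp_continuous_on ballI DERIV_isCont[OF primitive_deriv[OF cf]])
        show "(primitive ?f has_real_derivative ?f y) (at y)" for y by (rule primitive_deriv[OF cf])
        show "?f y \<le> f B" if "y < B" for y using that BA by (simp add: clamp_def)
        show "((\<lambda>x. f B * x) has_real_derivative f B) (at y)" for y using DERIV_cmult[OF DERIV_ident, of "f B"] by simp
      qed (use x in \<open>auto intro!: continuous_intros\<close>)
      moreover have "f B * B - f B * x = - (\<bar>c - primitive ?f B\<bar> + 1)" using fB by (simp add: x_def field_simps)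
      ultimately show ?thesis using x AB by (intro exI[of _ x]) auto
    qed
  qed
  then show ?thesis by blast
qed

section \<open>Existence of bound states\<close>

lemma truncation_eq:
  assumes sh: "shooting m N (\<lambda>s. f (clamp B A s)) (primitive (\<lambda>s. f (clamp B A s))) Mf bm bp"
    and f: "continuous_on UNIV f" and AB: "B < bm" "bp < A" and s: "B \<le> s" "s \<le> A"
  shows "primitive (\<lambda>s. f (clamp B A s)) s = primitive f s"
    and "radial.Q m N (\<lambda>s. f (clamp B A s)) (primitive (\<lambda>s. f (clamp B A s))) s = Qfun m N f s"
proof -
  interpret shooting m N "\<lambda>s. f (clamp B A s)" "primitive (\<lambda>s. f (clamp B A s))" Mf bm bp by (rule sh)
  show "primitive (\<lambda>s. f (clamp B A s)) s = primitive f s"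
    by (rule primitive_cong_on[OF f_cont f _ _ _ s]) (use AB bm_neg bp_pos in \<open>auto simp: clamp_id\<close>)
  then show "Q s = Qfun m N f s" using s by (simp add: Q_def Qfun_def clamp_id)
qed

text \<open>The solution from \<open>A\<close> reaches a level in \<open>(0, b]\<close> with energy at least \<open>c\<close> and weighted energy at
  least \<open>\<kappa>\<close>. All cut-offs \<open>B\<close> on the left are considered at once, since \<open>B\<close> is chosen after \<open>A\<close>.\<close>

definition good_start :: "real \<Rightarrow> nat \<Rightarrow> (real \<Rightarrow> real) \<Rightarrow> real \<Rightarrow> real \<Rightarrow> real \<Rightarrow> real \<Rightarrow> real \<Rightarrow> real \<Rightarrow> bool" where
  "good_start m N f bm bp b c \<kappa> A \<longleftrightarrow> (\<forall>B Mf u w. B < bm \<and>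
     shooting m N (\<lambda>s. f (clamp B A s)) (primitive (\<lambda>s. f (clamp B A s))) Mf bm bp \<and>
     radial.sol m N (\<lambda>s. f (clamp B A s)) u w \<and> u 0 = A \<longrightarrow>
     (\<exists>r>0. 0 < u r \<and> u r \<le> b \<and> c \<le> radial.en m (primitive (\<lambda>s. f (clamp B A s))) u w r \<and>
        \<kappa> \<le> r ^ N * radial.en m (primitive (\<lambda>s. f (clamp B A s))) u w r))"

text \<open>Let \<open>f\<close> attain its largest value on \<open>[\<theta> A, A]\<close> at \<open>s1\<close>. The growth condition for this \<open>s1\<close> bounds
  \<open>Q\<close> from below on the whole interval, in the form that \<open>start_infinite\<close> requires.\<close>

lemma good_start_infinite:
  assumes m: "1 < m" "m \<le> real N" and f: "continuous_on UNIV f" and bp: "0 < bp" and fp: "\<And>s. bp < s \<Longrightarrow> 0 < f s"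
    and b: "bp < b" "\<And>s. b \<le> s \<Longrightarrow> 0 \<le> Qfun m N f s" and \<theta>: "0 < \<theta>" "\<theta> < 1"
    and lim: "((\<lambda>s. Q_inf m N f {\<theta> * s..s} s) \<longlongrightarrow> \<infinity>) at_top" and k: "0 < \<kappa>"
  shows "\<exists>A>b. good_start m N f bm bp b (primitive f b) \<kappa> A"
proof -
  have N0: "0 < real N" using m by simp
  define D where "D = ((1 - \<theta>) powr (m - 1)) powr (real N / m)"
  have D0: "0 < D" using \<theta> by (simp add: D_def)
  define \<Lambda> where "\<Lambda> = real N * m * \<kappa> / D"
  have \<Lambda>0: "0 < \<Lambda>" using N0 m k D0 by (simp add: \<Lambda>_def)
  have "\<forall>\<^sub>F s in at_top. ereal \<Lambda> < Q_inf m N f {\<theta> * s..s} s" by (rule order_tendstoD(1)[OF lim]) simp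
  from eventually_conj[OF this eventually_ge_at_top[of "b / \<theta>"]]
  obtain A where A: "ereal \<Lambda> < Q_inf m N f {\<theta> * A..A} A" "b / \<theta> \<le> A" unfolding eventually_at_top_linorder by blast
  have bA: "b \<le> \<theta> * A" using A(2) \<theta> by (simp add: field_simps)
  have tA: "0 < \<theta> * A" using bA b bp by simp
  then have A0: "0 < A" using \<theta> by (simp add: zero_less_mult_iff)
  have tAA: "\<theta> * A < A" using \<theta> A0 by simp
  have low: "\<Lambda> < Qfun m N f s2 * (phi m A / f s1) powr (real N / m)" if "s1 \<in> {\<theta> * A..A}" "s2 \<in> {\<theta> * A..A}" for s1 s2
  proof -
    have "Q_inf m N f {\<theta> * A..A} A \<le> (INF s2\<in>{\<theta> * A..A}. ereal (Qfun m N f s2 * (phi m A / f s1) powr (real N / m)))"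
      unfolding Q_inf_def using that(1) by (rule INF_lower)
    also have "\<dots> \<le> ereal (Qfun m N f s2 * (phi m A / f s1) powr (real N / m))" using that(2) by (rule INF_lower)
    finally have "Q_inf m N f {\<theta> * A..A} A \<le> ereal (Qfun m N f s2 * (phi m A / f s1) powr (real N / m))" .
    with A(1) have "ereal \<Lambda> < ereal (Qfun m N f s2 * (phi m A / f s1) powr (real N / m))" by (rule less_le_trans)
    then show ?thesis by simp
  qed
  obtain s1 where s1: "s1 \<in> {\<theta> * A..A}" "\<And>s. s \<in> {\<theta> * A..A} \<Longrightarrow> f s \<le> f s1"
    using continuous_attains_sup[OF compact_Icc _ continuous_on_subset[OF f], of "\<theta> * A" A] tAA by auto
  have f1: "0 < f s1" using fp[of s1] s1 bA b by auto
  have pA: "phi m A = A powr (m - 1)" using A0 powr_mult_base[of A "m - 2"] by (simp add: phi_def mult.commute)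
  define P where "P = (A powr (m - 1) / f s1) powr (real N / m)"
  have P0: "0 < P" using A0 f1 by (simp add: P_def)
  define q where "q = \<Lambda> / P"
  have q0: "0 \<le> q" using \<Lambda>0 P0 by (simp add: q_def)
  have qQ: "q \<le> Qfun m N f s" if "\<theta> * A \<le> s" "s \<le> A" for s
  proof -
    have "\<Lambda> < Qfun m N f s * P" using low[OF s1(1), of s] that by (simp add: P_def pA)
    then show ?thesis using P0 by (simp add: q_def pos_divide_le_eq)
  qed
  have "good_start m N f bm bp b (primitive f b) \<kappa> A"
    unfolding good_start_def
  proof (intro allI impI)
    fix B Mf u w
    let ?f = "\<lambda>s. f (clamp B A s)"
    assume h: "B < bm \<and> shooting m N ?f (primitive ?f) Mf bm bp \<and> radial.sol m N ?f u w \<and> u 0 = A"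
    then interpret S: shooting m N ?f "primitive ?f" Mf bm bp by simp
    have B: "B < bm" "S.sol u w" "u 0 = A" using h by auto
    have bpA: "bp < A" using b bA tAA by simp
    have in': "B \<le> s" if "b \<le> s" for s using that b B(1) S.bm_neg S.bp_pos by simp
    have eqQ: "S.Q s = Qfun m N f s" if "b \<le> s" "s \<le> A" for s
      by (rule truncation_eq(2)[OF S.shooting_axioms f B(1) bpA in'[OF that(1)] that(2)])
    have eqF: "primitive ?f b = primitive f b"
      by (rule truncation_eq(1)[OF S.shooting_axioms f B(1) bpA in'[OF order_refl]]) (use bA tAA in simp)
    have "\<exists>r0>0. u r0 = b \<and> primitive ?f b \<le> S.en u w r0 \<and>
       q * (((1 - \<theta>) * A) powr (m - 1) / f s1) powr (real N / m) \<le> real N * m * (r0 ^ N * S.en u w r0)"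
    proof (rule S.start_infinite[OF B(2,3) b(1) bA \<theta> _ f1 _ q0])
      show "?f s \<le> f s1" if "\<theta> * A \<le> s" "s \<le> A" for s using s1(2)[of s] in'[of s] that bA by (simp add: clamp_id)
      show "q \<le> S.Q s" if "\<theta> * A \<le> s" "s \<le> A" for s using qQ[OF that] eqQ[of s] that bA by simp
      show "0 \<le> S.Q s" if "b \<le> s" "s \<le> A" for s using b(2)[OF that(1)] eqQ[OF that] by simp
    qed
    then obtain r0 where r0: "r0 > 0" "u r0 = b" "primitive f b \<le> S.en u w r0"
      "q * (((1 - \<theta>) * A) powr (m - 1) / f s1) powr (real N / m) \<le> real N * m * (r0 ^ N * S.en u w r0)"
      unfolding eqF by blast
    have "(((1 - \<theta>) * A) powr (m - 1) / f s1) powr (real N / m) = D * P"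
      using \<theta> A0 f1 by (simp add: D_def P_def powr_mult powr_divide)
    then have "\<Lambda> * D \<le> real N * m * (r0 ^ N * S.en u w r0)" using r0(4) P0 by (simp add: q_def mult.commute)
    then have "real N * m * \<kappa> \<le> real N * m * (r0 ^ N * S.en u w r0)" using D0 by (simp add: \<Lambda>_def)
    then have "\<kappa> \<le> r0 ^ N * S.en u w r0" using N0 m by simp
    then show "\<exists>r>0. 0 < u r \<and> u r \<le> b \<and> primitive f b \<le> S.en u w r \<and> \<kappa> \<le> r ^ N * S.en u w r"
      using r0 b bp by (intro exI[of _ r0]) auto
  qed
  then show ?thesis using bA tAA by (intro exI[of _ A]) auto
qed

text \<open>If \<open>u\<close> reaches \<open>b\<close> only after the radius \<open>R \<ge> 1\<close>, then the weighted energy is at least \<open>R * F b\<close>.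
  The level of the conclusion is \<open>g\<close> and not \<open>b\<close>: as \<open>A < g\<close>, conditions on \<open>Q\<close> in the range \<open>g \<le>
  s \<le> A\<close> are void.\<close>

lemma good_start_finite:
  assumes m: "1 < m" "m \<le> real N" and f: "continuous_on UNIV f" and bp: "0 < bp"
    and b: "bp < b" "b < g" "0 < primitive f b" and L0: "0 < L0"
    and fL: "\<And>s. b \<le> s \<Longrightarrow> s < g \<Longrightarrow> f s \<le> L0 * (g - s) powr (m - 1)" and k: "0 < \<kappa>"
  shows "\<exists>A>b. A < g \<and> good_start m N f bm bp g (primitive f b) \<kappa> A"
proof -
  \<comment> \<open>\<open>R \<ge> 1\<close> gives \<open>R \<le> r0 ^ N\<close> from \<open>R < r0\<close>\<close>
  define R where "R = max 1 (\<kappa> / primitive f b)"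
  define e where "e = exp ((L0 * R) powr (1 / (m - 1)) * R)"
  have R: "1 \<le> R" "\<kappa> \<le> R * primitive f b" using b by (auto simp: R_def max_def field_simps)
  have e1: "1 \<le> e" using R by (simp add: e_def)
  define A where "A = g - (g - b) / (2 * e)"
  have "(g - b) / (2 * e) < (g - b) / 1" using b e1 by (intro divide_strict_left_mono) auto
  then have A: "b < A" "A < g" using b e1 by (auto simp: A_def)
  have Ae: "(g - A) * e < g - b" using b e1 by (simp add: A_def)
  have "good_start m N f bm bp g (primitive f b) \<kappa> A"
    unfolding good_start_def
  proof (intro allI impI)
    fix B Mf u w
    let ?f = "\<lambda>s. f (clamp B A s)"
    assume h: "B < bm \<and> shooting m N ?f (primitive ?f) Mf bm bp \<and> radial.sol m N ?f u w \<and> u 0 = A"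
    then interpret S: shooting m N ?f "primitive ?f" Mf bm bp by simp
    have B: "B < bm" "S.sol u w" "u 0 = A" using h by auto
    have in': "B \<le> s" if "b \<le> s" for s using that b B(1) S.bm_neg S.bp_pos by simp
    have eqF: "primitive ?f b = primitive f b"
      by (rule truncation_eq(1)[OF S.shooting_axioms f B(1) _ in'[OF order_refl]]) (use A b in auto)
    have "\<exists>r0>R. u r0 = b \<and> primitive ?f b \<le> S.en u w r0"
    proof (rule S.start_finite[OF B(2,3) b(1) A L0])
      show "0 < R" using R by simp
      show "?f s \<le> L0 * (g - s) powr (m - 1)" if "b \<le> s" "s \<le> A" for s
        using fL[of s] in'[of s] that A by (simp add: clamp_id)
      show "(g - A) * exp ((L0 * R) powr (1 / (m - 1)) * R) < g - b" using Ae by (simp add: e_def)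
    qed
    then obtain r0 where r0: "r0 > R" "u r0 = b" "primitive f b \<le> S.en u w r0" unfolding eqF by blast
    have "R \<le> r0 ^ N"
    proof -
      have "r0 ^ 1 \<le> r0 ^ N" using r0 R m by (intro power_increasing) auto
      then show ?thesis using r0 by simp
    qed
    then have "R * primitive f b \<le> r0 ^ N * S.en u w r0" using r0 R b by (intro mult_mono) auto
    then have "\<kappa> \<le> r0 ^ N * S.en u w r0" using R by simp
    then show "\<exists>r>0. 0 < u r \<and> u r \<le> g \<and> primitive f b \<le> S.en u w r \<and> \<kappa> \<le> r ^ N * S.en u w r"
      using r0 b bp R by (intro exI[of _ r0]) auto
  qed
  then show ?thesis using A by blast
qed

theorem theorem1p1:
  fixes m :: real and N :: nat and f :: "real \<Rightarrow> real"
    and \<beta>m \<beta>p :: real and \<gamma>m \<gamma>p L :: ereal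
  assumes m: "1 < m" and N: "m \<le> real N"
    and f_cont: "continuous_on UNIV f"
    and h1_sign: "\<beta>m < 0" "0 < \<beta>p"
    and h1_neg: "\<And>s. \<beta>m < s \<Longrightarrow> s < \<beta>p \<Longrightarrow> s \<noteq> 0 \<Longrightarrow> primitive f s < 0"
    and h1_zero: "primitive f \<beta>m = 0" "primitive f \<beta>p = 0"
    and h1_gamma: "is_gamma_minus f \<beta>m \<gamma>m" "is_gamma_plus f \<beta>p \<gamma>p"
    and h1_fpos: "\<And>s. \<beta>p < s \<Longrightarrow> ereal s < \<gamma>p \<Longrightarrow> 0 < f s"
    and h1_fneg: "\<And>s. \<gamma>m < ereal s \<Longrightarrow> s < \<beta>m \<Longrightarrow> f s < 0"
    and h2_minus: "((\<lambda>s. ereal (primitive f (real_of_ereal s))) \<longlongrightarrow> L) (at_right \<gamma>m)"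
    and h2_plus: "((\<lambda>s. ereal (primitive f (real_of_ereal s))) \<longlongrightarrow> L) (at_left \<gamma>p)"
    and h3: "local_lipschitz (UNIV :: real set)
               {s. \<gamma>m < ereal s \<and> ereal s < \<gamma>p \<and> s \<noteq> 0} (\<lambda>_. f)"
    and h4: "\<gamma>p = \<infinity> \<Longrightarrow>
               (\<exists>b>\<beta>p. \<forall>s\<ge>b. 0 \<le> Qfun m N f s) \<and>
               (\<exists>\<theta>. 0 < \<theta> \<and> \<theta> < 1 \<and> ((\<lambda>s. Q_inf m N f {\<theta> * s..s} s) \<longlongrightarrow> \<infinity>) at_top)"
    and h5: "\<gamma>m = -\<infinity> \<Longrightarrow>
               (\<exists>b. -b < \<beta>m \<and> (\<forall>s\<le>-b. 0 \<le> Qfun m N f s)) \<and>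
               (\<exists>\<theta>. 0 < \<theta> \<and> \<theta> < 1 \<and> ((\<lambda>s. Q_inf m N f {s..\<theta> * s} s) \<longlongrightarrow> \<infinity>) at_bot)"
    and h6: "\<And>g. \<gamma>p = ereal g \<Longrightarrow>
               \<exists>L0>0. \<exists>b>\<beta>p. b < g \<and> (\<forall>s. b \<le> s \<and> s < g \<longrightarrow> f s \<le> L0 * (g - s) powr (m - 1))"
    and h7: "\<And>g. \<gamma>m = ereal g \<Longrightarrow>
               \<exists>L0>0. \<exists>b>-\<beta>m. g < -b \<and> (\<forall>s. g < s \<and> s \<le> -b \<longrightarrow> - f s \<le> L0 * (s - g) powr (m - 1))"
  shows "\<forall>k::nat. 1 \<le> k \<longrightarrow>
           (\<exists>u u'. bound_state m N f u u' \<and>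
                   finite (sign_changes u u') \<and> card (sign_changes u u') = k)"
proof (intro allI impI)
  fix K :: nat assume "1 \<le> K"
  let ?F = "primitive f"
  have Fd: "(?F has_real_derivative f s) (at s)" for s by (rule primitive_deriv[OF f_cont])
  have Fc: "continuous_on S ?F" for S by (intro continuous_at_imp_continuous_on ballI DERIV_isCont[OF Fd])
  have bgp: "ereal \<beta>p < \<gamma>p" using h1_gamma(2) by (auto simp: is_gamma_plus_def)
  have bgm: "\<gamma>m < ereal \<beta>m" using h1_gamma(1) by (auto simp: is_gamma_minus_def)
  have Fmono: "?F s < ?F t" if "\<beta>p \<le> s" "s < t" "ereal t \<le> \<gamma>p" for s t
  proof (rule DERIV_pos_imp_increasing_open[of s t ?F])
    fix x assume x: "s < x" "x < t"
    have "ereal x < ereal t" using x by simp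
    then have "ereal x < \<gamma>p" using that(3) by (rule less_le_trans)
    then have "0 < f x" using h1_fpos[of x] x that by simp
    then show "\<exists>y. (?F has_real_derivative y) (at x) \<and> 0 < y" using Fd by blast
  qed (use that Fc in auto)
  have Fanti: "?F t < ?F s" if "s < t" "t \<le> \<beta>m" "\<gamma>m \<le> ereal s" for s t
  proof (rule DERIV_neg_imp_decreasing_open[of s t ?F])
    fix x assume x: "s < x" "x < t"
    have "ereal s < ereal x" using x by simp
    with that(3) have "\<gamma>m < ereal x" by (rule le_less_trans)
    then have "f x < 0" using h1_fneg[of x] x that by simp
    then show "\<exists>y. (?F has_real_derivative y) (at x) \<and> y < 0" using Fd by blast
  qed (use that Fc in auto)
  \<comment> \<open>\<open>F\<close> increases strictly to its limit on the right, and it exceeds every smaller value on the left\<close>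
  have FL: "ereal (?F s) < L" if s: "\<beta>p < s" "ereal s < \<gamma>p" for s
  proof -
    obtain t where t: "s < t" "ereal t < \<gamma>p" using ereal_dense2[OF s(2)] by auto
    have "ereal (?F t) \<le> L"
    proof (rule ccontr)
      assume "\<not> ereal (?F t) \<le> L"
      then have "L < ereal (?F t)" by simp
      have "\<forall>\<^sub>F y in at_left \<gamma>p. ereal (?F (real_of_ereal y)) < ereal (?F t)"
        by (rule order_tendstoD(2)[OF h2_plus \<open>L < ereal (?F t)\<close>])
      then have "\<exists>b<\<gamma>p. \<forall>y>b. y < \<gamma>p \<longrightarrow> ereal (?F (real_of_ereal y)) < ereal (?F t)"
        by (simp only: eventually_at_left[OF s(2)])
      then obtain b where b: "b < \<gamma>p" "\<And>y. b < y \<Longrightarrow> y < \<gamma>p \<Longrightarrow> ereal (?F (real_of_ereal y)) < ereal (?F t)"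
        by auto
      have "max b (ereal t) < \<gamma>p" using b t by simp
      then obtain y where y: "max b (ereal t) < ereal y" "ereal y < \<gamma>p" using ereal_dense2 by blast
      then have "?F y < ?F t" using b(2)[of "ereal y"] by simp
      moreover have "?F t < ?F y" by (rule Fmono) (use y t s in auto)
      ultimately show False by simp
    qed
    have "?F s < ?F t" by (rule Fmono) (use s t in auto)
    then have "ereal (?F s) < ereal (?F t)" by simp
    from this \<open>ereal (?F t) \<le> L\<close> show ?thesis by (rule less_le_trans)
  qed
  have Fdense: "\<exists>s. \<gamma>m < ereal s \<and> s < \<beta>m \<and> x < ?F s" if x: "ereal x < L" for x
  proof -
    have "\<forall>\<^sub>F y in at_right \<gamma>m. ereal x < ereal (?F (real_of_ereal y))"
      by (rule order_tendstoD(1)[OF h2_minus x])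
    then have "\<exists>b>\<gamma>m. \<forall>y>\<gamma>m. y < b \<longrightarrow> ereal x < ereal (?F (real_of_ereal y))"
      by (simp only: eventually_at_right[OF bgm])
    then obtain b where b: "\<gamma>m < b" "\<And>y. \<gamma>m < y \<Longrightarrow> y < b \<Longrightarrow> ereal x < ereal (?F (real_of_ereal y))"
      by auto
    have "\<gamma>m < min b (ereal \<beta>m)" using b bgm by simp
    then obtain y where "\<gamma>m < ereal y" "ereal y < min b (ereal \<beta>m)" using ereal_dense2 by blast
    then show ?thesis using b(2)[of "ereal y"] by (intro exI[of _ y]) auto
  qed
  \<comment> \<open>For infinite \<open>\<gamma>p\<close>, \<open>Q\<close> is nonnegative above \<open>b\<close>. For finite \<open>\<gamma>p\<close>, \<open>b\<close> is \<open>\<gamma>p\<close> itself, which exceeds every admissible \<open>A\<close>.\<close>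
  have "\<exists>b c. \<beta>p < b \<and> 0 < c \<and> (\<forall>A. ereal A < \<gamma>p \<longrightarrow> (\<forall>s. b \<le> s \<and> s \<le> A \<longrightarrow> 0 \<le> Qfun m N f s) \<and> (b \<le> A \<longrightarrow> c \<le> ?F b)) \<and>
     (\<forall>\<kappa>>0. \<exists>A>\<beta>p. ereal A < \<gamma>p \<and> good_start m N f \<beta>m \<beta>p b c \<kappa> A)"
  proof (cases "\<gamma>p = \<infinity>")
    case True
    obtain b where b: "b > \<beta>p" "\<And>s. b \<le> s \<Longrightarrow> 0 \<le> Qfun m N f s" using h4[OF True] by blast
    obtain \<theta> where \<theta>: "0 < \<theta>" "\<theta> < 1" "((\<lambda>s. Q_inf m N f {\<theta> * s..s} s) \<longlongrightarrow> \<infinity>) at_top" using h4[OF True] by blast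
    have Fb: "0 < ?F b" using Fmono[of \<beta>p b] b h1_zero True by simp
    have fp: "0 < f s" if "\<beta>p < s" for s using h1_fpos[OF that] True by simp
    have "\<exists>A>\<beta>p. ereal A < \<gamma>p \<and> good_start m N f \<beta>m \<beta>p b (?F b) \<kappa> A" if \<kappa>: "0 < \<kappa>" for \<kappa>
    proof -
      obtain A where "A > b" "good_start m N f \<beta>m \<beta>p b (?F b) \<kappa> A"
        using good_start_infinite[OF m N f_cont h1_sign(2) fp b \<theta> \<kappa>] by blast
      then show ?thesis using b(1) True by (intro exI[of _ A]) simp
    qed
    then show ?thesis using b Fb by blast
  next
    case False
    then obtain g where g: "\<gamma>p = ereal g" "\<beta>p < g" using h1_gamma(2) by (auto simp: is_gamma_plus_def)
    obtain L0 b where b: "L0 > 0" "b > \<beta>p" "b < g" "\<And>s. b \<le> s \<Longrightarrow> s < g \<Longrightarrow> f s \<le> L0 * (g - s) powr (m - 1)"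
      using h6[OF g(1)] by blast
    have Fb: "0 < ?F b" using Fmono[of \<beta>p b] b h1_zero g by simp
    have "\<exists>A>\<beta>p. ereal A < \<gamma>p \<and> good_start m N f \<beta>m \<beta>p g (?F b) \<kappa> A" if \<kappa>: "0 < \<kappa>" for \<kappa>
    proof -
      obtain A where "A > b" "A < g" "good_start m N f \<beta>m \<beta>p g (?F b) \<kappa> A"
        using good_start_finite[OF m N f_cont h1_sign(2) b(2,3) Fb b(1,4) \<kappa>] by blast
      then show ?thesis using b(2) g(1) by (intro exI[of _ A]) simp
    qed
    then show ?thesis using g b Fb by (intro exI[of _ g] exI[of _ "?F b"]) auto
  qed
  then obtain b c1 where b: "\<beta>p < b" "0 < c1"
    and bQ: "\<And>A s. ereal A < \<gamma>p \<Longrightarrow> b \<le> s \<Longrightarrow> s \<le> A \<Longrightarrow> 0 \<le> Qfun m N f s"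
    and bF: "\<And>A. ereal A < \<gamma>p \<Longrightarrow> b \<le> A \<Longrightarrow> c1 \<le> ?F b"
    and bst: "\<And>\<kappa>. 0 < \<kappa> \<Longrightarrow> \<exists>A>\<beta>p. ereal A < \<gamma>p \<and> good_start m N f \<beta>m \<beta>p b c1 \<kappa> A" by blast
  \<comment> \<open>the analogous level \<open>- b'\<close> on the left\<close>
  have "\<exists>b' c. - \<beta>m < b' \<and> 0 < c \<and> (\<forall>B. \<gamma>m < ereal B \<longrightarrow> (\<forall>s. b' \<le> s \<and> s \<le> - B \<longrightarrow> 0 \<le> Qfun m N f (- s)) \<and> (b' \<le> - B \<longrightarrow> c \<le> ?F (- b')))"
  proof (cases "\<gamma>m = -\<infinity>")
    case True
    obtain b' where b': "- b' < \<beta>m" "\<And>s. s \<le> - b' \<Longrightarrow> 0 \<le> Qfun m N f s" using h5[OF True] by blast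
    have "0 < ?F (- b')" using Fanti[of "- b'" \<beta>m] b' h1_zero True by simp
    then show ?thesis using b' by (intro exI[of _ b'] exI[of _ "?F (- b')"]) auto
  next
    case False
    then obtain g where g: "\<gamma>m = ereal g" "g < \<beta>m" using h1_gamma(1) by (auto simp: is_gamma_minus_def)
    then show ?thesis by (intro exI[of _ "- g"] exI[of _ 1]) auto
  qed
  then obtain b' c2 where b': "- \<beta>m < b'" "0 < c2"
    and bQ': "\<And>B s. \<gamma>m < ereal B \<Longrightarrow> b' \<le> s \<Longrightarrow> s \<le> - B \<Longrightarrow> 0 \<le> Qfun m N f (- s)"
    and bF': "\<And>B. \<gamma>m < ereal B \<Longrightarrow> b' \<le> - B \<Longrightarrow> c2 \<le> ?F (- b')" by blast
  define c where "c = min c1 c2"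
  have c: "0 < c" "c \<le> c1" "c \<le> c2" using b b' by (auto simp: c_def)
  obtain x0 where x0: "x0 \<in> {\<beta>m..\<beta>p}" "\<And>y. y \<in> {\<beta>m..\<beta>p} \<Longrightarrow> ?F x0 \<le> ?F y"
    using continuous_attains_inf[OF compact_Icc _ Fc, of \<beta>m \<beta>p] h1_sign by auto
  define C where "C = - ?F x0"
  have C0: "0 \<le> C" using x0(2)[of 0] h1_sign by (simp add: C_def)
  define BB where "BB = max b b'"
  have BB: "b \<le> BB" "b' \<le> BB" "0 < BB" using b h1_sign by (auto simp: BB_def)
  obtain \<kappa>0 where \<kappa>0: "\<kappa>0 > 0" "loss_threshold m N BB C (c / 2 / 2 ^ K) \<kappa>0"
    using loss_threshold_exists[OF m N BB(3) C0, of "c / 2 / 2 ^ K"] c by auto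
  \<comment> \<open>the first swing and the \<open>K\<close> swings after it halve the weighted energy each, and the threshold is
    applied to half of it once more\<close>
  define \<kappa> where "\<kappa> = \<kappa>0 * 2 ^ (K + 2)"
  have \<kappa>: "0 < \<kappa>" "\<kappa> / 2 / 2 ^ (K + 1) = \<kappa>0" using \<kappa>0 by (auto simp: \<kappa>_def)
  obtain A where A: "A > \<beta>p" "ereal A < \<gamma>p" "good_start m N f \<beta>m \<beta>p b c1 \<kappa> A" using bst[OF \<kappa>(1)] by blast
  have FA: "0 < ?F A" using Fmono[of \<beta>p A] A h1_zero by simp
  \<comment> \<open>the common limit of \<open>F\<close> at both ends makes it possible to match the values of \<open>F\<close>\<close>
  obtain B where B: "\<gamma>m < ereal B" "B < \<beta>m" "?F B = ?F A"
  proof -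
    obtain s where s: "\<gamma>m < ereal s" "s < \<beta>m" "?F A < ?F s" using Fdense[OF FL[OF A(1,2)]] by blast
    have "\<exists>x\<ge>s. x \<le> \<beta>m \<and> ?F x = ?F A" by (rule IVT2') (use s FA h1_zero Fc in auto)
    then obtain x where x: "s \<le> x" "x \<le> \<beta>m" "?F x = ?F A" by blast
    have "x \<noteq> \<beta>m" using x FA h1_zero by auto
    moreover have "\<gamma>m < ereal x" by (rule less_le_trans[OF s(1)]) (use x in simp)
    ultimately show ?thesis using that x by auto
  qed
  let ?f = "\<lambda>s. f (clamp B A s)"
  have "\<exists>Mf. shooting m N ?f (primitive ?f) Mf \<beta>m \<beta>p"
  proof (rule truncation_shooting[OF m N f_cont h1_sign h1_neg h1_zero A(1) B(2)])
    show "0 < f s" if "\<beta>p < s" "s \<le> A" for s by (rule h1_fpos[OF that(1) le_less_trans[OF _ A(2)]]) (use that in simp)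
    show "f s < 0" if "B \<le> s" "s < \<beta>m" for s by (rule h1_fneg[OF less_le_trans[OF B(1)] that(2)]) (use that in simp)
    fix s assume s: "B \<le> s" "s \<le> A" "s \<noteq> 0"
    have in': "\<gamma>m < ereal x \<and> ereal x < \<gamma>p" if "B \<le> x" "x \<le> A" for x
    proof
      show "\<gamma>m < ereal x" by (rule less_le_trans[OF B(1)]) (use that in simp)
      show "ereal x < \<gamma>p" by (rule le_less_trans[OF _ A(2)]) (use that in simp)
    qed
    let ?X = "{s. \<gamma>m < ereal s \<and> ereal s < \<gamma>p \<and> s \<noteq> 0}"
    have sX: "s \<in> ?X" using in'[OF s(1,2)] s(3) by simp
    have "\<exists>u>0. \<exists>L. \<forall>t\<in>cball (0::real) u \<inter> UNIV. L-lipschitz_on (cball s u \<inter> ?X) f"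
      by (rule h3[unfolded local_lipschitz_def, THEN bspec, OF sX, THEN bspec, OF UNIV_I])
    then obtain u L where u: "u > 0" "\<forall>t\<in>cball (0::real) u \<inter> UNIV. L-lipschitz_on (cball s u \<inter> ?X) f" by blast
    have lp: "L-lipschitz_on (cball s u \<inter> ?X) f" by (rule bspec[OF u(2), of 0]) (use u(1) in simp)
    have "\<bar>f x - f y\<bar> \<le> L * \<bar>x - y\<bar>" if "B \<le> x" "x \<le> A" "B \<le> y" "y \<le> A" "\<bar>x - s\<bar> < min u \<bar>s\<bar>" "\<bar>y - s\<bar> < min u \<bar>s\<bar>" for x y
    proof -
      have "x \<in> cball s u \<inter> ?X" using in'[OF that(1,2)] that by (auto simp: dist_real_def)
      moreover have "y \<in> cball s u \<inter> ?X" using in'[OF that(3,4)] that by (auto simp: dist_real_def)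
      ultimately show ?thesis using lipschitz_onD[OF lp] by (simp add: dist_real_def)
    qed
    moreover have "0 < min u \<bar>s\<bar>" using u s by simp
    ultimately show "\<exists>e>0. \<exists>\<Lambda>. \<forall>x y. B \<le> x \<and> x \<le> A \<and> B \<le> y \<and> y \<le> A \<and> \<bar>x - s\<bar> < e \<and> \<bar>y - s\<bar> < e \<longrightarrow> \<bar>f x - f y\<bar> \<le> \<Lambda> * \<bar>x - y\<bar>"
      by blast
  qed
  then obtain Mf where sh: "shooting m N ?f (primitive ?f) Mf \<beta>m \<beta>p" by blast
  interpret S: shooting m N ?f "primitive ?f" Mf \<beta>m \<beta>p by (rule sh)
  have eqF: "primitive ?f s = ?F s" if "B \<le> s" "s \<le> A" for s by (rule truncation_eq(1)[OF sh f_cont B(2) A(1) that])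
  have eqQ: "S.Q s = Qfun m N f s" if "B \<le> s" "s \<le> A" for s by (rule truncation_eq(2)[OF sh f_cont B(2) A(1) that])
  have BA: "B < 0" "0 < A" using B A h1_sign by auto
  have FBA: "primitive ?f B = primitive ?f A" using eqF[of B] eqF[of A] B BA by simp
  have Cb: "- primitive ?f s \<le> C" for s
  proof (cases "\<beta>m \<le> s \<and> s \<le> \<beta>p")
    case True then show ?thesis using eqF[of s] x0(2)[of s] A B by (simp add: C_def)
  next
    case False then show ?thesis using S.F_pos[of s] S.F_pos'[of s] C0 by force
  qed
  obtain u w where uw: "S.sol u w" "u 0 = A" using S.sol_exists[of A] by blast
  have rng: "B \<le> v r \<and> v r \<le> A" if "S.sol v z" "\<beta>p \<le> v 0" "v 0 \<le> A" "0 \<le> r" for v z r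
    by (rule S.range_bound[OF that(1) A(1) B(2) FBA that(2-4)])
  have ru: "B \<le> u r \<and> u r \<le> A" if "0 \<le> r" for r by (rule rng[OF uw(1)]) (use uw A that in auto)
  have Qp: "0 \<le> S.Q s" if "b \<le> s" "s \<le> A" for s using bQ[OF A(2) that] eqQ[of s] that b BA h1_sign by simp
  have Qm: "0 \<le> S.Q (- s)" if "b' \<le> s" "s \<le> - B" for s using bQ'[OF B(1) that] eqQ[of "- s"] that b' BA h1_sign by simp
  have Fp: "c \<le> primitive ?f b" if "b \<le> A" using bF[OF A(2) that] eqF[of b] that b BA h1_sign c by simp
  have Fm: "c \<le> primitive ?f (- b')" if "b' \<le> - B" using bF'[OF B(1) that] eqF[of "- b'"] that b' BA h1_sign c by simp
  obtain r0 where r0: "0 < r0" "0 < u r0" "u r0 \<le> b" "c1 \<le> S.en u w r0" "\<kappa> \<le> r0 ^ N * S.en u w r0"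
    using A(3)[unfolded good_start_def, rule_format, of B Mf u w] B(2) sh uw by blast
  have p2: "(1::real) \<le> 2 ^ K" by simp
  have z1: "loss_threshold m N BB C c (\<kappa> / 2)"
  proof (rule loss_threshold_mono[OF \<kappa>0(2)])
    show "c / 2 / 2 ^ K \<le> c" using divide_left_mono[of 1 "2 * 2 ^ K" c] p2 c by simp
    have "\<kappa>0 * 1 \<le> \<kappa>0 * (2 * 2 ^ K)" using p2 \<kappa>0(1) by (intro mult_left_mono) linarith+
    then show "\<kappa>0 \<le> \<kappa> / 2" by (simp add: \<kappa>_def mult.commute)
  qed
  have "\<exists>z>r0. u z = 0 \<and> w z < 0 \<and> c / 2 \<le> S.en u w z \<and> \<kappa> / 2 \<le> z ^ N * S.en u w z"
    by (rule S.swing[OF uw(1) _ b(1) BB(1) Qp Fp Cb c(1) z1 \<kappa>(1) r0(1) _ r0(3) _ r0(5)]) (use ru r0 c in auto)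
  then obtain z where z: "z > r0" "u z = 0" "w z < 0" "c / 2 \<le> S.en u w z" "\<kappa> / 2 \<le> z ^ N * S.en u w z" by blast
  have "\<exists>S\<subseteq>crossings u w. finite S \<and> card S = K + 1 \<and> (\<forall>x\<in>S. z \<le> x)"
  proof (rule S.many_swings[OF uw(1) _ b(1) BB(1) b'(1) BB(2) Qp Qm Cb, where c = "c / 2" and \<kappa> = "\<kappa> / 2" and A' = "- B"])
    show "loss_threshold m N BB C (c / 2 / 2 ^ K) (\<kappa> / 2 / 2 ^ (K + 1))" using \<kappa>0(2) \<kappa>(2) by simp
    show "c / 2 \<le> primitive ?f b" if "b \<le> A" using Fp[OF that] c by simp
    show "c / 2 \<le> primitive ?f (- b')" if "b' \<le> - B" using Fm[OF that] c by simp
    show "- (- B) \<le> u r \<and> u r \<le> A" if "0 \<le> r" for r using ru[OF that] by simp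
  qed (use c \<kappa> z r0 in auto)
  then have nc: "crosses_at_least (K + 1) u w" unfolding crosses_at_least_def by blast
  obtain v y where v: "S.sol v y" "\<beta>p \<le> v 0" "v 0 \<le> A" "(v \<longlongrightarrow> 0) at_top" "finite (crossings v y)" "card (crossings v y) = K"
    using S.shooting_bound_state[OF A(1) uw nc] by auto
  have "bound_state m N f v (\<lambda>r. psi m (y r))"
    by (rule bound_state_of_sol[OF sh v(1) _ v(2,4)]) (use rng[OF v(1-3)] in \<open>simp add: clamp_id\<close>)
  moreover have "sign_changes v (\<lambda>r. psi m (y r)) = crossings v y" by (simp add: sign_changes_def crossings_def)
  ultimately show "\<exists>u u'. bound_state m N f u u' \<and> finite (sign_changes u u') \<and> card (sign_changes u u') = K"
    using v(5,6) by (intro exI[of _ v] exI[of _ "\<lambda>r. psi m (y r)"]) simp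
qed

end
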